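(* Let $(X,d)$ be a complete metric space, $\Omega\subset\mathbb{R}^n$ ($n\ge2$) a bounded Lipschitz domain, and $(u_m)\subset W^{1,p}(\Omega,X)$ a bounded sequence for some $p>1$. Then, after possibly passing to a subsequence, there exist a complete metric space $Z$, isometric embeddings $\varphi_m\colon X\hookrightarrow Z$ ($m\in\mathbb{N}$) and $v\in W^{1,p}(\Omega,Z)$ such that $\varphi_m\circ u_m$ converges to $v$ in $L^q(\Omega,Z)$ for every $1\le q<p^*$.
   Context: Sobolev maps. Let $\Omega\subset\mathbb{R}^n$, $n\ge2$, be a bounded domain, $p>1$, $(X,d)$ a complete metric space. $L^p(\Omega,X)$ is the set of measurable, essentially separably valued maps $u\colon\Omega\to X$ such that for some (thus every) $x\in X$ the function $u_x(z)=d(x,u(z))$ lies in $L^p(\Omega)$ (and analogously for $L^q(\Omega,X)$ with other exponents $q\ge 1$). $u\in L^p(\Omega,X)$ belongs to $W^{1,p}(\Omega,X)$ if there is $g\in L^p(\Omega)$ such that for every $x\in X$, $u_x\in W^{1,p}(\Omega)$ and $|\nabla u_x|\le g$ almost everywhere. The Reshetnyak $p$-energy $E_+^p(u)$ is the infimum of $\|g\|_{L^p(\Omega)}^p$ over all such $g$. A sequence $(u_m)\subset W^{1,p}(\Omega,X)$ is bounded if $\sup_{m}\left[\int_\Omega d(x_0,u_m(z))^p\,dz+E_+^p(u_m)\right]<\infty$ for some (and thus every) $x_0\in X$. A bounded Lipschitz domain is a bounded domain $\Omega\subset\mathbb{R}^n$ such that for each $x\in\partial\Omega$ there are an open neighborhood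 $U\subset\mathbb{R}^n$ of $x$, an open $V\subset\mathbb{R}^{n-1}$, and a biLipschitz homeomorphism $\varphi\colon V\times(-1,1)\to U$ with $\varphi(V\times(-1,0))=U\cap\Omega$ and $\varphi(V\times\{0\})=U\cap\partial\Omega$. The Sobolev conjugate is $p^*=\frac{np}{n-p}$ if $p<n$ and $p^*=\infty$ otherwise. Convergence $f_m\to v$ in $L^q(\Omega,Z)$ means $\int_\Omega d_Z(f_m(z),v(z))^q\,dz\to0$, where $d_Z$ is the metric of $Z$. *)

theory Defs
  imports "HOL-Analysis.Analysis"
begin

definition partial_deriv :: "'n::finite \<Rightarrow> (real^'n \<Rightarrow> real) \<Rightarrow> real^'n \<Rightarrow> real" where
  "partial_deriv i f z = frechet_derivative f (at z) (axis i 1)"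

primrec C_k :: "nat \<Rightarrow> (real^'n::finite \<Rightarrow> real) \<Rightarrow> bool" where
  "C_k 0 f \<longleftrightarrow> continuous_on UNIV f"
| "C_k (Suc k) f \<longleftrightarrow> f differentiable_on UNIV \<and> (\<forall>i. C_k k (partial_deriv i f))"

definition test_functions :: "(real^'n::finite) set \<Rightarrow> (real^'n \<Rightarrow> real) set" where
  "test_functions \<Omega> = {\<eta>. (\<forall>k. C_k k \<eta>) \<and> compact (closure {z. \<eta> z \<noteq> 0}) \<and>
     closure {z. \<eta> z \<noteq> 0} \<subseteq> \<Omega>}"

(* Functions on \<Omega> are total functions of which only the values on \<Omega> matter. *)
definition Lp_space ::
  "real \<Rightarrow> (real^'n::finite) set \<Rightarrow> (real^'n \<Rightarrow> 'b::euclidean_space) set" where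
  "Lp_space p \<Omega> = {f. f \<in> borel_measurable (lebesgue_on \<Omega>) \<and>
     integrable (lebesgue_on \<Omega>) (\<lambda>z. norm (f z) powr p)}"

(* G is a weak gradient of f on \<Omega>; weak gradients are unique almost everywhere.  Local
   integrability makes every integral below a genuine one, since Bochner integrals of
   non-integrable functions are 0 by convention. *)
definition weak_gradient ::
  "(real^'n::finite) set \<Rightarrow> (real^'n \<Rightarrow> real) \<Rightarrow> (real^'n \<Rightarrow> real^'n) \<Rightarrow> bool" where
  "weak_gradient \<Omega> f G \<longleftrightarrow>
     (\<forall>K. compact K \<and> K \<subseteq> \<Omega> \<longrightarrow> f absolutely_integrable_on K \<and> G absolutely_integrable_on K) \<and>
     (\<forall>\<eta>\<in>test_functions \<Omega>. \<forall>i.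
        (LINT z|lebesgue_on \<Omega>. f z * partial_deriv i \<eta> z) =
        - (LINT z|lebesgue_on \<Omega>. G z $ i * \<eta> z))"

definition W1p :: "real \<Rightarrow> (real^'n::finite) set \<Rightarrow> (real^'n \<Rightarrow> real) set" where
  "W1p p \<Omega> = {f. f \<in> Lp_space p \<Omega> \<and> (\<exists>G. weak_gradient \<Omega> f G \<and> G \<in> Lp_space p \<Omega>)}"

definition Lp_maps :: "real \<Rightarrow> (real^'n::finite) set \<Rightarrow> 'x metric \<Rightarrow> (real^'n \<Rightarrow> 'x) set" where
  "Lp_maps p \<Omega> X = {u.
     u \<in> lebesgue_on \<Omega> \<rightarrow>\<^sub>M sigma (mspace X) {U. openin (mtopology_of X) U} \<and>
     (\<exists>N\<in>null_sets (lebesgue_on \<Omega>). separable_space (subtopology (mtopology_of X) (u ` (\<Omega> - N)))) \<and>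
     (\<exists>x\<in>mspace X. (\<lambda>z. mdist X x (u z)) \<in> Lp_space p \<Omega>)}"

definition gradient_bounds ::
  "real \<Rightarrow> (real^'n::finite) set \<Rightarrow> 'x metric \<Rightarrow> (real^'n \<Rightarrow> 'x) \<Rightarrow> (real^'n \<Rightarrow> real) set" where
  "gradient_bounds p \<Omega> X u = {g. g \<in> Lp_space p \<Omega> \<and>
     (\<forall>x\<in>mspace X. (\<lambda>z. mdist X x (u z)) \<in> W1p p \<Omega> \<and>
        (\<exists>G. weak_gradient \<Omega> (\<lambda>z. mdist X x (u z)) G \<and>
             (AE z in lebesgue_on \<Omega>. norm (G z) \<le> g z)))}"

definition W1p_maps :: "real \<Rightarrow> (real^'n::finite) set \<Rightarrow> 'x metric \<Rightarrow> (real^'n \<Rightarrow> 'x) set" where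
  "W1p_maps p \<Omega> X = {u. u \<in> Lp_maps p \<Omega> X \<and> gradient_bounds p \<Omega> X u \<noteq> {}}"

definition reshetnyak_energy ::
  "real \<Rightarrow> (real^'n::finite) set \<Rightarrow> 'x metric \<Rightarrow> (real^'n \<Rightarrow> 'x) \<Rightarrow> real" where
  "reshetnyak_energy p \<Omega> X u =
     (INF g\<in>gradient_bounds p \<Omega> X u. LINT z|lebesgue_on \<Omega>. \<bar>g z\<bar> powr p)"

definition bounded_W1p_seq ::
  "real \<Rightarrow> (real^'n::finite) set \<Rightarrow> 'x metric \<Rightarrow> (nat \<Rightarrow> real^'n \<Rightarrow> 'x) \<Rightarrow> bool" where
  "bounded_W1p_seq p \<Omega> X u \<longleftrightarrow> (\<forall>m. u m \<in> W1p_maps p \<Omega> X) \<and>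
     (\<exists>x\<^sub>0\<in>mspace X. bdd_above (range (\<lambda>m.
        (LINT z|lebesgue_on \<Omega>. mdist X x\<^sub>0 (u m z) powr p) + reshetnyak_energy p \<Omega> X (u m))))"

(* The index type 'm of the chart domains is to satisfy CARD('n) = CARD('m) + 1, so that
   real^'m is R^(n-1). *)
definition bounded_lipschitz_domain :: "'m::finite itself \<Rightarrow> (real^'n::finite) set \<Rightarrow> bool" where
  "bounded_lipschitz_domain (_ :: 'm itself) \<Omega> \<longleftrightarrow>
     open \<Omega> \<and> connected \<Omega> \<and> \<Omega> \<noteq> {} \<and> bounded \<Omega> \<and>
     (\<forall>x\<in>frontier \<Omega>. \<exists>U (V :: (real^'m) set) \<phi> \<psi> L.
        open U \<and> x \<in> U \<and> open V \<and>
        homeomorphism (V \<times> {-1<..<1::real}) U \<phi> \<psi> \<and>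
        L-lipschitz_on (V \<times> {-1<..<1}) \<phi> \<and> L-lipschitz_on U \<psi> \<and>
        \<phi> ` (V \<times> {-1<..<0}) = U \<inter> \<Omega> \<and>
        \<phi> ` (V \<times> {0}) = U \<inter> frontier \<Omega>)"

definition sobolev_conjugate :: "nat \<Rightarrow> real \<Rightarrow> ereal" where
  "sobolev_conjugate n p = (if p < real n then ereal (real n * p / (real n - p)) else \<infinity>)"

definition isometric_embedding :: "'x metric \<Rightarrow> 'z metric \<Rightarrow> ('x \<Rightarrow> 'z) \<Rightarrow> bool" where
  "isometric_embedding X Z \<phi> \<longleftrightarrow> \<phi> \<in> mspace X \<rightarrow> mspace Z \<and>
     (\<forall>x\<in>mspace X. \<forall>y\<in>mspace X. mdist Z (\<phi> x) (\<phi> y) = mdist X x y)"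

definition converges_in_Lq ::
  "real \<Rightarrow> (real^'n::finite) set \<Rightarrow> 'z metric \<Rightarrow> (nat \<Rightarrow> real^'n \<Rightarrow> 'z) \<Rightarrow> (real^'n \<Rightarrow> 'z) \<Rightarrow> bool"
  where
  "converges_in_Lq q \<Omega> Z f v \<longleftrightarrow> (\<forall>m. f m \<in> Lp_maps q \<Omega> Z) \<and> v \<in> Lp_maps q \<Omega> Z \<and>
     (\<lambda>m. \<integral>\<^sup>+z. ennreal (mdist Z (f m z) (v z) powr q) \<partial>lebesgue_on \<Omega>) \<longlonglongrightarrow> 0"

(* HOL cannot quantify existentially over types, so a metric space Z receiving isometric
   embeddings \<phi>_m of X (m in N) is given as a metric on a subset of the following type.
   If the \<phi>_m o u_m converge to v in L^q, then v takes almost all its values in the closure of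
   the union of the \<phi>_m(X), and Z may be replaced by that closure.  The map sending z to the
   function (m, x) |-> d_Z(z, \<phi>_m(x)) is injective there, so this type is always large enough. *)
type_synonym 'x target = "nat \<times> 'x \<Rightarrow> real"

end

theory Submission
 imports Defs "HOL-Library.Diagonal_Subsequence"
begin

text \<open>
 A bounded sequence \<open>u\<^sub>m\<close> in \<open>W\<^sup>1\<^sup>,\<^sup>p(\<Omega>, X)\<close> need not have a convergent subsequence, because \<open>X\<close> need not be
 locally compact; but the distance functions \<open>(z, w) \<mapsto> d(u\<^sub>m(z), u\<^sub>m(w))\<close> form a compact family, and a limit of
 these distances is all that is needed to build a space in which copies of \<open>X\<close> are glued together.

 The gradient bound enters only through \<open>segment_bound\<close>: for almost all \<open>z\<close>, the distance between
 \<open>u(z)\<close> and \<open>u(z + \<xi>)\<close> is at most the integral of \<open>g\<close> along the segment. Mollification shows that this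
 follows from a weak gradient (\<open>weak_gradient_imp_segment_bound\<close>), and difference quotients show that it
 gives one back (\<open>segment_bound_imp_weak_gradient\<close>). In this form the bound survives isometric
 embeddings and almost everywhere limits (\<open>segment_bound_limit\<close>).

 \<^bold>\<open>Compactness.\<close> The segment bound is a Poincare inequality on small cubes, so that up to a set of small
 measure \<open>u\<^sub>m\<close> is close to its values at finitely many centres. The mutual distances of these finitely
 many values are bounded, so a diagonal subsequence makes them converge for every scale. Hence
 consecutive maps of a subsequence have almost the same distances on a set \<open>G\<^sub>j\<close> whose complement has
 measure of order \<open>2\<^sup>-\<^sup>j\<close> (\<open>subsequence_almost_isometric\<close>).

 \<^bold>\<open>Gluing.\<close> Two copies of \<open>X\<close> with almost equal distances along \<open>G\<^sub>j\<close> embed into a common space in which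
 the corresponding points are close. Doing this for all \<open>j\<close> at once (\<open>glue_chain_of_copies\<close>) gives \<open>Z\<close>
 and \<open>\<phi>\<^sub>j\<close>, and by Borel-Cantelli \<open>\<phi>\<^sub>j(u\<^sub>j(z))\<close> is a Cauchy sequence for almost every \<open>z\<close>; its limit is
 \<open>v\<close>.

 \<^bold>\<open>Higher integrability.\<close> Almost everywhere convergence turns into convergence in \<open>L\<^sup>q\<close> as soon as
 a slightly higher power is bounded. This is a subcritical Sobolev inequality for the real functions
 \<open>d(x\<^sub>0, u\<^sub>m)\<close>. In a convex set it follows by averaging the segment bound over all endpoints
 (\<open>Sobolev_bound_of_segment_bound\<close>); bi-Lipschitz charts carry it to the boundary of \<open>\<Omega>\<close>, and a finite
 cover gives it on all of \<open>\<Omega>\<close> (\<open>Sobolev_inequality_Lipschitz_domain\<close>).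
\<close>

abbreviation lebesgue_nn_integral :: "('a::euclidean_space => ennreal) => ennreal" (binder "\<integral>\<^sub>+" 10)
 where "lebesgue_nn_integral f \<equiv> nn_integral lborel f"

text \<open>The mean of \<open>g\<close> over the segment from \<open>z\<close> to \<open>z + \<xi>\<close>, so that its product with
 \<open>norm \<xi>\<close> is the line integral of \<open>g\<close> along that segment.\<close>
abbreviation segment_integral :: "('a::euclidean_space => real) => 'a => 'a => ennreal" where
 "segment_integral g z \<xi> \<equiv> (\<integral>\<^sub>+t. ennreal (g (z + t *\<^sub>R \<xi>)) * indicator {0..1} t)"

section \<open>Integral inequalities\<close>

lemma powr_split_bound:
 fixes x s q :: real
 assumes "x \<ge> 0" "s > 0" "q \<ge> 1"
 shows "x \<le> s + s powr (1 - q) * x powr q"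
proof (cases "x \<le> s")
 case True
 then show ?thesis by (simp add: add_increasing2)
next
 case False
 then have xs: "s < x" "x > 0" using assms by auto
 have "x powr (1 - q) \<le> s powr (1 - q)"
  using xs assms by (intro powr_mono2') auto
 then have "x powr (1 - q) * x powr q \<le> s powr (1 - q) * x powr q"
  by (intro mult_right_mono) auto
 moreover have "x powr (1 - q) * x powr q = x"
  using xs by (simp flip: powr_add)
 ultimately show ?thesis using assms by simp
qed

text \<open>Integrate \<open>x \<le> s + s\<^sup>1\<^sup>-\<^sup>q x\<^sup>q\<close> and choose \<open>s = (I /
 A)\<^sup>1\<^sup>/\<^sup>q\<close>; this elementary form of Hoelder's inequality costs the factor 2.\<close>
lemma nn_integral_Holder_bound:
 fixes h :: "'a => real"
 assumes [measurable]: "h \<in> borel_measurable M" and h: "\<And>x. h x \<ge> 0"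
  and A: "emeasure M (space M) \<le> ennreal A" "A > 0"
  and q: "q \<ge> 1"
  and I: "(\<integral>\<^sup>+x. ennreal (h x powr q) \<partial>M) \<le> ennreal I" "I \<ge> 0"
 shows "(\<integral>\<^sup>+x. ennreal (h x) \<partial>M) \<le> ennreal (2 * A powr (1 - 1/q) * I powr (1/q))"
proof (cases "I = 0")
 case True
 then have "(\<integral>\<^sup>+x. ennreal (h x powr q) \<partial>M) = 0"
  using I by simp
 then have "AE x in M. ennreal (h x powr q) = 0"
  by (subst (asm) nn_integral_0_iff_AE) auto
 then have "AE x in M. ennreal (h x) = 0"
 proof eventually_elim
  case (elim x)
  then have "h x powr q \<le> 0" by simp
  then have "h x powr q = 0" by (metis order_antisym powr_ge_zero)
  then show ?case by simp
 qed
 then have "(\<integral>\<^sup>+x. ennreal (h x) \<partial>M) = 0"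
  by (subst nn_integral_0_iff_AE) auto
 then show ?thesis by simp
next
 case False
 then have "I > 0" using I by simp
 define s where "s = (I / A) powr (1/q)"
 have s: "s > 0" using \<open>I > 0\<close> A by (simp add: s_def)
 have "(\<integral>\<^sup>+x. ennreal (h x) \<partial>M) \<le> (\<integral>\<^sup>+x. ennreal s + ennreal (s powr (1 - q)) * ennreal (h x powr q) \<partial>M)"
 proof (intro nn_integral_mono)
  fix x
  show "ennreal (h x) \<le> ennreal s + ennreal (s powr (1 - q)) * ennreal (h x powr q)"
   using powr_split_bound[OF h s q, of x] s
   by (simp flip: ennreal_mult ennreal_plus)
 qed
 also have "\<dots> = ennreal s * emeasure M (space M) + ennreal (s powr (1 - q)) * (\<integral>\<^sup>+x. ennreal (h x powr q) \<partial>M)"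
  by (subst nn_integral_add) (auto simp: nn_integral_cmult)
 also have "\<dots> \<le> ennreal s * ennreal A + ennreal (s powr (1 - q)) * ennreal I"
  using A I by (intro add_mono mult_left_mono) auto
 also have "\<dots> = ennreal (s * A + s powr (1 - q) * I)"
  using s A I by (simp flip: ennreal_mult ennreal_plus)
 also have "s * A = A powr (1 - 1/q) * I powr (1/q)"
  using A \<open>I > 0\<close> by (simp add: s_def powr_divide powr_diff)
 also have "s powr (1 - q) * I = A powr (1 - 1/q) * I powr (1/q)"
 proof -
  have "s powr (1 - q) = I powr (1/q - 1) / A powr (1/q - 1)"
   using A \<open>I > 0\<close> q by (simp add: s_def powr_powr powr_divide field_simps)
  also have "\<dots> = I powr (1/q) / I * A powr (1 - 1/q)"
   using A \<open>I > 0\<close> by (simp add: powr_diff)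
  finally show ?thesis using \<open>I > 0\<close> by simp
 qed
 finally show ?thesis by (simp add: algebra_simps)
qed

lemma nn_integral_Jensen_bound:
 fixes h :: "'a => real"
 assumes [measurable]: "h \<in> borel_measurable M" and h: "\<And>x. h x \<ge> 0"
  and A: "emeasure M (space M) \<le> ennreal A" "A > 0"
  and q: "q \<ge> 1"
 shows "ennreal (enn2real (\<integral>\<^sup>+x. ennreal (h x) \<partial>M) powr q)
     \<le> ennreal (2 powr q * A powr (q - 1)) * (\<integral>\<^sup>+x. ennreal (h x powr q) \<partial>M)"
proof (cases "(\<integral>\<^sup>+x. ennreal (h x powr q) \<partial>M) = \<infinity>")
 case True
 have "0 < ennreal (2 powr q * A powr (q - 1))" using A by simp
 then show ?thesis using True
  by (metis ennreal_mult_top infinity_ennreal_def not_gr_zero top_greatest)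
next
 case False
 then obtain I where I: "(\<integral>\<^sup>+x. ennreal (h x powr q) \<partial>M) = ennreal I" "I \<ge> 0"
  by (metis ennreal_cases infinity_ennreal_def)
 have "(\<integral>\<^sup>+x. ennreal (h x) \<partial>M) \<le> ennreal (2 * A powr (1 - 1/q) * I powr (1/q))"
  using nn_integral_Holder_bound[OF assms, of I] I by simp
 then have "enn2real (\<integral>\<^sup>+x. ennreal (h x) \<partial>M) \<le> 2 * A powr (1 - 1/q) * I powr (1/q)"
  by (intro enn2real_leI) auto
 then have "enn2real (\<integral>\<^sup>+x. ennreal (h x) \<partial>M) powr q \<le> (2 * A powr (1 - 1/q) * I powr (1/q)) powr q"
  using q by (intro powr_mono2) auto
 also have "\<dots> = 2 powr q * A powr (q - 1) * I"
 proof -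
  have "(1 - 1/q) * q = q - 1" using q by (simp add: field_simps)
  then show ?thesis using A I q by (simp add: powr_mult powr_powr)
 qed
 finally show ?thesis using I A by (simp flip: ennreal_mult)
qed

text \<open>Truncate at \<open>K\<close>: the truncated part tends to 0 by dominated convergence, and the rest
 is at most \<open>K\<^sup>q\<^sup>-\<^sup>q\<^sup>' C\<close> by the bound on the higher power.\<close>
lemma AE_tendsto_bounded_imp_Lq_tendsto:
 fixes e :: "nat => 'a => real"
 assumes fin: "finite_measure M" and [measurable]: "\<And>m. e m \<in> borel_measurable M"
  and nonneg: "\<And>m x. e m x \<ge> 0" and ae: "AE x in M. (\<lambda>m. e m x) \<longlonglongrightarrow> 0"
  and q: "0 < q" "q < q'"
  and bound: "\<And>m. (\<integral>\<^sup>+x. ennreal (e m x powr q') \<partial>M) \<le> ennreal C"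
 shows "(\<lambda>m. \<integral>\<^sup>+x. ennreal (e m x powr q) \<partial>M) \<longlonglongrightarrow> 0"
proof (rule tendsto_0_if_Limsup_eq_0_ennreal)
 interpret finite_measure M by fact
 define D where "D = max C 0"
 have D: "D \<ge> 0" "\<And>m. (\<integral>\<^sup>+x. ennreal (e m x powr q') \<partial>M) \<le> ennreal D"
  using bound by (auto simp: D_def max_def ennreal_neg intro: order_trans[OF bound])
 have *: "limsup (\<lambda>m. \<integral>\<^sup>+x. ennreal (e m x powr q) \<partial>M) \<le> ennreal (K powr (q - q') * D)" if K: "K > 0" for K :: real
 proof -
  have "(\<lambda>m. \<integral>\<^sup>+x. ennreal (min (e m x) K powr q) \<partial>M) \<longlonglongrightarrow> (\<integral>\<^sup>+x. 0 \<partial>M)"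
  proof (rule nn_integral_dominated_convergence[where w="\<lambda>x. ennreal (K powr q)"])
   show "(\<integral>\<^sup>+x. ennreal (K powr q) \<partial>M) < \<infinity>"
    by (simp add: ennreal_mult_less_top less_top[symmetric] ennreal_mult_eq_top_iff emeasure_finite)
   show "AE x in M. (\<lambda>m. ennreal (min (e m x) K powr q)) \<longlonglongrightarrow> 0"
    using ae
   proof eventually_elim
    case (elim x)
    have "(\<lambda>m. min (e m x) K) \<longlonglongrightarrow> min 0 K"
     by (intro tendsto_intros elim)
    then have "(\<lambda>m. min (e m x) K powr q) \<longlonglongrightarrow> 0 powr q"
     using K nonneg q by (intro tendsto_powr') auto
    then show ?case by (simp add: tendsto_ennrealI flip: ennreal_0)
   qed
  qed (use K nonneg q in \<open>auto intro!: AE_I2 ennreal_leI powr_mono2\<close>)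
  then have lim: "(\<lambda>m. (\<integral>\<^sup>+x. ennreal (min (e m x) K powr q) \<partial>M) + ennreal (K powr (q - q') * D)) \<longlonglongrightarrow> 0 + ennreal (K powr (q - q') * D)"
   by (intro tendsto_add tendsto_const) simp_all
  have "(\<integral>\<^sup>+x. ennreal (e m x powr q) \<partial>M) \<le> (\<integral>\<^sup>+x. ennreal (min (e m x) K powr q) \<partial>M) + ennreal (K powr (q - q') * D)" for m
  proof -
   have "(\<integral>\<^sup>+x. ennreal (e m x powr q) \<partial>M)
     \<le> (\<integral>\<^sup>+x. ennreal (min (e m x) K powr q) + ennreal (K powr (q - q')) * ennreal (e m x powr q') \<partial>M)"
   proof (intro nn_integral_mono)
    fix x
    have "e m x powr q \<le> min (e m x) K powr q + K powr (q - q') * e m x powr q'"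
    proof (cases "e m x \<le> K")
     case False
     then have "e m x powr (q - q') \<le> K powr (q - q')"
      using K q by (intro powr_mono2') auto
     then have "e m x powr (q - q') * e m x powr q' \<le> K powr (q - q') * e m x powr q'"
      by (intro mult_right_mono) auto
     moreover have "e m x powr (q - q') * e m x powr q' = e m x powr q"
      by (simp flip: powr_add)
     ultimately show ?thesis by (simp add: add_increasing)
    qed simp
    then show "ennreal (e m x powr q) \<le> ennreal (min (e m x) K powr q) + ennreal (K powr (q - q')) * ennreal (e m x powr q')"
     by (simp flip: ennreal_mult ennreal_plus)
   qed
   also have "\<dots> = (\<integral>\<^sup>+x. ennreal (min (e m x) K powr q) \<partial>M) + ennreal (K powr (q - q')) * (\<integral>\<^sup>+x. ennreal (e m x powr q') \<partial>M)"
    by (subst nn_integral_add) (auto simp: nn_integral_cmult)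
   also have "\<dots> \<le> (\<integral>\<^sup>+x. ennreal (min (e m x) K powr q) \<partial>M) + ennreal (K powr (q - q')) * ennreal D"
    by (intro add_left_mono mult_left_mono D) auto
   finally show ?thesis by (simp add: ennreal_mult D)
  qed
  then have "limsup (\<lambda>m. \<integral>\<^sup>+x. ennreal (e m x powr q) \<partial>M) \<le>
   limsup (\<lambda>m. (\<integral>\<^sup>+x. ennreal (min (e m x) K powr q) \<partial>M) + ennreal (K powr (q - q') * D))"
   by (intro Limsup_mono always_eventually allI)
  also have "\<dots> = ennreal (K powr (q - q') * D)"
   using lim_imp_Limsup[OF _ lim] by simp
  finally show ?thesis .
 qed
 have "((\<lambda>K. K powr (q - q') * D) \<longlongrightarrow> 0 * D) at_top"
  using q by (intro tendsto_intros tendsto_neg_powr filterlim_ident) auto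
 then have "((\<lambda>K. ennreal (K powr (q - q') * D)) \<longlongrightarrow> ennreal 0) at_top"
  by (intro tendsto_ennrealI) simp
 then have "limsup (\<lambda>m. \<integral>\<^sup>+x. ennreal (e m x powr q) \<partial>M) \<le> ennreal 0"
  by (rule tendsto_lowerbound) (auto intro!: eventually_mono[OF eventually_gt_at_top[of 0]] *)
 then show "limsup (\<lambda>m. \<integral>\<^sup>+x. ennreal (e m x powr q) \<partial>M) = 0" by simp
qed

section \<open>Continuity of translations in the mean\<close>

lemma nn_integral_lborel_translate:
 fixes f :: "'a::euclidean_space => ennreal"
 assumes [measurable]: "f \<in> borel_measurable borel"
 shows "(\<integral>\<^sub>+x. f (x + c)) = (\<integral>\<^sub>+x. f x)"
proof -
 have "(\<integral>\<^sub>+x. f x) = (\<integral>\<^sup>+x. f x \<partial>(distr lborel borel ((+) c)))"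
  by (subst lborel_distr_plus) simp
 also have "\<dots> = (\<integral>\<^sub>+x. f (c + x))"
  by (subst nn_integral_distr) auto
 finally show ?thesis by (simp add: add.commute)
qed

lemma nn_integral_lborel_affine:
 fixes f :: "'a::euclidean_space => ennreal"
 assumes [measurable]: "f \<in> borel_measurable borel" and c: "c \<noteq> 0"
 shows "(\<integral>\<^sub>+x. f x) = ennreal (\<bar>c\<bar> ^ DIM('a)) * (\<integral>\<^sub>+x. f (t + c *\<^sub>R x))"
proof -
 have "(\<integral>\<^sub>+x. f x) = (\<integral>\<^sup>+x. f x \<partial>density (distr lborel borel (\<lambda>x. t + c *\<^sub>R x)) (\<lambda>_. ennreal (\<bar>c\<bar> ^ DIM('a))))"
  using lborel_affine[OF c, of t] by (rule arg_cong)
 then show ?thesis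
  by (simp add: nn_integral_density nn_integral_distr nn_integral_cmult)
qed

lemma AE_lborel_translate:
 fixes P :: "'a::euclidean_space => bool"
 assumes "AE x in lborel. P x"
 shows "AE x in lborel. P (x + c)"
proof -
 obtain N where N: "{x. \<not> P x} \<subseteq> N" "N \<in> null_sets lborel"
  by (rule AE_E[OF assms]) (auto simp: null_sets_def)
 have [measurable]: "N \<in> sets borel" using N by auto
 have "AE x in lborel. (\<lambda>x. indicator N (x + c) :: ennreal) x = 0"
 proof (subst nn_integral_0_iff_AE[symmetric])
  have "(\<integral>\<^sub>+x. indicator N (x + c)) = (\<integral>\<^sup>+x. indicator N x \<partial>(lborel::'a measure))"
   by (rule nn_integral_lborel_translate) auto
  then show "(\<integral>\<^sub>+x. indicator N (x + c)) = 0" using N by auto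
 qed auto
 then show ?thesis
  by eventually_elim (use N in \<open>auto simp: indicator_def split: if_splits\<close>)
qed

text \<open>Translation preserves \<open>lborel\<close>, so a function within \<open>e\<close> of
 \<open>g\<close> moves in the mean by at most \<open>2 e\<close> more than \<open>g\<close> does.\<close>
lemma L1_translation_approx:
 fixes f :: "'a::euclidean_space => real"
 assumes [measurable]: "f \<in> borel_measurable borel"
  and ap: "\<And>e. e > 0 ==> \<exists>g. g \<in> borel_measurable borel \<and>
    (\<lambda>n. \<integral>\<^sub>+x. ennreal \<bar>g (x + \<zeta> n) - g x\<bar>) \<longlonglongrightarrow> 0 \<and>
    (\<integral>\<^sub>+x. ennreal \<bar>f x - g x\<bar>) \<le> ennreal e"
 shows "(\<lambda>n. \<integral>\<^sub>+x. ennreal \<bar>f (x + \<zeta> n) - f x\<bar>) \<longlonglongrightarrow> 0"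
proof (rule tendsto_0_if_Limsup_eq_0_ennreal)
 have lim2: "limsup (\<lambda>n. \<integral>\<^sub>+x. ennreal \<bar>f (x + \<zeta> n) - f x\<bar>) \<le> ennreal (2 * e)" if e: "e > 0" for e :: real
 proof -
  obtain g where [measurable]: "g \<in> borel_measurable borel"
   and g: "(\<lambda>n. \<integral>\<^sub>+x. ennreal \<bar>g (x + \<zeta> n) - g x\<bar>) \<longlonglongrightarrow> 0"
    "(\<integral>\<^sub>+x. ennreal \<bar>f x - g x\<bar>) \<le> ennreal e"
   using ap[OF e] by blast
  have "(\<integral>\<^sub>+x. ennreal \<bar>f (x + \<zeta> n) - f x\<bar>) \<le> (\<integral>\<^sub>+x. ennreal \<bar>g (x + \<zeta> n) - g x\<bar>) + ennreal (2 * e)" for n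
  proof -
   have "(\<integral>\<^sub>+x. ennreal \<bar>f (x + \<zeta> n) - f x\<bar>) \<le>
    (\<integral>\<^sub>+x. ennreal \<bar>g (x + \<zeta> n) - g x\<bar> + (ennreal \<bar>f (x + \<zeta> n) - g (x + \<zeta> n)\<bar> + ennreal \<bar>f x - g x\<bar>))"
    by (intro nn_integral_mono) (auto simp flip: ennreal_plus intro!: ennreal_leI)
   also have "\<dots> = (\<integral>\<^sub>+x. ennreal \<bar>g (x + \<zeta> n) - g x\<bar>) + ((\<integral>\<^sub>+x. ennreal \<bar>f (x + \<zeta> n) - g (x + \<zeta> n)\<bar>)
     + (\<integral>\<^sub>+x. ennreal \<bar>f x - g x\<bar>))"
    by (simp add: nn_integral_add)
   also have "(\<integral>\<^sub>+x. ennreal \<bar>f (x + \<zeta> n) - g (x + \<zeta> n)\<bar>) = (\<integral>\<^sub>+x. ennreal \<bar>f x - g x\<bar>)"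
    by (rule nn_integral_lborel_translate[of "\<lambda>x. ennreal \<bar>f x - g x\<bar>"]) auto
   also have "(\<integral>\<^sub>+x. ennreal \<bar>g (x + \<zeta> n) - g x\<bar>) + ((\<integral>\<^sub>+x. ennreal \<bar>f x - g x\<bar>) + (\<integral>\<^sub>+x. ennreal \<bar>f x - g x\<bar>))
     \<le> (\<integral>\<^sub>+x. ennreal \<bar>g (x + \<zeta> n) - g x\<bar>) + (ennreal e + ennreal e)"
    by (intro add_mono g order_refl)
   finally show ?thesis using e by (simp flip: ennreal_plus)
  qed
  then have "limsup (\<lambda>n. \<integral>\<^sub>+x. ennreal \<bar>f (x + \<zeta> n) - f x\<bar>) \<le>
   limsup (\<lambda>n. (\<integral>\<^sub>+x. ennreal \<bar>g (x + \<zeta> n) - g x\<bar>) + ennreal (2 * e))"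
   by (intro Limsup_mono always_eventually allI)
  also have "\<dots> = ennreal (2 * e)"
  proof -
   have "(\<lambda>n. (\<integral>\<^sub>+x. ennreal \<bar>g (x + \<zeta> n) - g x\<bar>) + ennreal (2 * e)) \<longlonglongrightarrow> 0 + ennreal (2 * e)"
    by (intro tendsto_add g tendsto_const)
   from lim_imp_Limsup[OF _ this] show ?thesis by simp
  qed
  finally show ?thesis .
 qed
 have lim3: "limsup (\<lambda>n. \<integral>\<^sub>+x. ennreal \<bar>f (x + \<zeta> n) - f x\<bar>) \<le> ennreal e" if "e > 0" for e :: real
  using lim2[of "e/2"] that by simp
 then have "limsup (\<lambda>n. \<integral>\<^sub>+x. ennreal \<bar>f (x + \<zeta> n) - f x\<bar>) \<le> 0"
  using ennreal_le_epsilon[of 0 "limsup (\<lambda>n. \<integral>\<^sub>+x. ennreal \<bar>f (x + \<zeta> n) - f x\<bar>)"] by simp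
 then show "limsup (\<lambda>n. \<integral>\<^sub>+x. ennreal \<bar>f (x + \<zeta> n) - f x\<bar>) = 0" by simp
qed

text \<open>For open \<open>U\<close> the part of \<open>U\<close> that a small translation moves out of
 \<open>U\<close> vanishes pointwise in the limit, so its measure tends to 0. The part that moves into
 \<open>U\<close> has the same measure, because translation preserves \<open>lborel\<close>.\<close>
lemma L1_translation_indicator_open:
 fixes U :: "'a::euclidean_space set"
 assumes U: "open U" "emeasure lborel U < \<infinity>" and \<zeta>: "\<zeta> \<longlonglongrightarrow> 0"
 shows "(\<lambda>n. \<integral>\<^sub>+x. ennreal \<bar>indicator U (x + \<zeta> n) - indicator U x\<bar>) \<longlonglongrightarrow> 0"
proof -
 have [measurable]: "U \<in> sets borel" using U by auto
 define W where "W = (\<lambda>n x. indicator U x * indicator (-U) (x + \<zeta> n) :: ennreal)"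
 have [measurable]: "W n \<in> borel_measurable borel" for n
  unfolding W_def by measurable
 have W0: "(\<lambda>n. \<integral>\<^sub>+x. W n x) \<longlonglongrightarrow> (\<integral>\<^sup>+x. 0 \<partial>(lborel::'a measure))"
 proof (rule nn_integral_dominated_convergence[where w="indicator U"])
  show "AE x in lborel. (\<lambda>n. W n x) \<longlonglongrightarrow> 0"
  proof (intro AE_I2)
   fix x
   show "(\<lambda>n. W n x) \<longlonglongrightarrow> 0"
   proof (cases "x \<in> U")
    case True
    have "(\<lambda>n. x + \<zeta> n) \<longlonglongrightarrow> x + 0" by (intro tendsto_intros \<zeta>)
    then have "eventually (\<lambda>n. x + \<zeta> n \<in> U) sequentially"
     using U True by (simp add: topological_tendstoD)
    then show ?thesis
     by (intro tendsto_eventually, eventually_elim) (simp add: W_def)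
   qed (simp add: W_def)
  qed
 qed (use U in \<open>auto simp: W_def split: split_indicator\<close>)
 have eq: "(\<integral>\<^sub>+x. indicator U (x + \<zeta> n) * indicator (-U) x) = (\<integral>\<^sub>+x. W n x)" for n
 proof -
  define a where "a = (\<integral>\<^sup>+x. indicator U x * indicator U (x + \<zeta> n) \<partial>(lborel::'a measure))"
  have "a \<le> (\<integral>\<^sup>+x. indicator U x \<partial>(lborel::'a measure))"
   unfolding a_def by (intro nn_integral_mono) (auto split: split_indicator)
  then have fin: "a \<noteq> \<infinity>" using U by auto
  have "a + (\<integral>\<^sub>+x. indicator U (x + \<zeta> n) * indicator (-U) x) = (\<integral>\<^sup>+x. indicator U (x + \<zeta> n) \<partial>(lborel::'a measure))"
   unfolding a_def
   by (subst nn_integral_add[symmetric]) (auto simp del: nn_integral_indicator intro!: nn_integral_cong split: split_indicator)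
  also have "\<dots> = (\<integral>\<^sup>+x. indicator U x \<partial>(lborel::'a measure))"
   by (rule nn_integral_lborel_translate) auto
  also have "\<dots> = a + (\<integral>\<^sub>+x. W n x)"
   unfolding a_def W_def
   by (subst nn_integral_add[symmetric]) (auto simp del: nn_integral_indicator intro!: nn_integral_cong split: split_indicator)
  finally show ?thesis using fin by (simp add: ennreal_add_left_cancel)
 qed
 have "(\<integral>\<^sub>+x. ennreal \<bar>indicator U (x + \<zeta> n) - indicator U x\<bar>) = 2 * (\<integral>\<^sub>+x. W n x)" for n
 proof -
  have "(\<integral>\<^sub>+x. ennreal \<bar>indicator U (x + \<zeta> n) - indicator U x\<bar>) =
   (\<integral>\<^sub>+x. indicator U (x + \<zeta> n) * indicator (-U) x + W n x)"
   by (intro nn_integral_cong) (auto simp: W_def split: split_indicator)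
  also have "\<dots> = 2 * (\<integral>\<^sub>+x. W n x)"
   by (subst nn_integral_add) (auto simp: eq mult_2)
  finally show ?thesis .
 qed
 moreover have "(\<lambda>n. 2 * (\<integral>\<^sub>+x. W n x)) \<longlonglongrightarrow> 2 * 0"
  using W0 by (intro ennreal_tendsto_cmult) auto
 ultimately show ?thesis by simp
qed

text \<open>Outer regularity reduces indicators to open sets; linearity and density of simple functions do the
 rest.\<close>
lemma L1_translation_continuous:
 fixes f :: "'a::euclidean_space => real"
 assumes f: "integrable lborel f" and \<zeta>: "\<zeta> \<longlonglongrightarrow> 0"
 shows "(\<lambda>n. \<integral>\<^sub>+x. ennreal \<bar>f (x + \<zeta> n) - f x\<bar>) \<longlonglongrightarrow> 0"
 using f
proof (induction rule: integrable_induct)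
 case (base A c)
 have [measurable]: "A \<in> sets borel" using base by simp
 have ind: "(\<lambda>n. \<integral>\<^sub>+x. ennreal \<bar>indicator A (x + \<zeta> n) - indicator A x\<bar>) \<longlonglongrightarrow> 0"
 proof (rule L1_translation_approx)
  fix e :: real assume "e > 0"
  obtain U where U: "open U" "A \<subseteq> U" "emeasure lborel (U - A) < ennreal e"
   using outer_regular_lborel[of A e] \<open>e > 0\<close> by auto
  have [measurable]: "U \<in> sets borel" using U by auto
  have "emeasure lborel U \<le> emeasure lborel A + emeasure lborel (U - A)"
   using U by (subst plus_emeasure) (auto simp: Un_absorb1)
  also have "\<dots> < \<infinity>" using base U by (auto simp: less_top intro: less_trans)
  finally have fin: "emeasure lborel U < \<infinity>" .
  have "(\<integral>\<^sub>+x. ennreal \<bar>indicator A x - indicator U x\<bar>) = (\<integral>\<^sub>+x. indicator (U - A) x)"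
   using U by (intro nn_integral_cong) (auto split: split_indicator)
  then have "(\<integral>\<^sub>+x. ennreal \<bar>indicator A x - indicator U x\<bar>) \<le> ennreal e"
   using U by simp
  then show "\<exists>g. g \<in> borel_measurable borel \<and>
    (\<lambda>n. \<integral>\<^sub>+x. ennreal \<bar>g (x + \<zeta> n) - g x\<bar>) \<longlonglongrightarrow> 0 \<and>
    (\<integral>\<^sub>+x. ennreal \<bar>indicator A x - g x\<bar>) \<le> ennreal e"
   using L1_translation_indicator_open[OF U(1) fin \<zeta>] by (intro exI[of _ "indicator U"]) auto
 qed auto
 have "(\<integral>\<^sub>+x. ennreal \<bar>indicat_real A (x + \<zeta> n) *\<^sub>R c - indicat_real A x *\<^sub>R c\<bar>)
  = ennreal \<bar>c\<bar> * (\<integral>\<^sub>+x. ennreal \<bar>indicator A (x + \<zeta> n) - indicator A x\<bar>)" for n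
  by (subst nn_integral_cmult[symmetric])
   (auto simp flip: ennreal_mult abs_mult simp: algebra_simps intro!: nn_integral_cong)
 moreover have "(\<lambda>n. ennreal \<bar>c\<bar> * (\<integral>\<^sub>+x. ennreal \<bar>indicator A (x + \<zeta> n) - indicator A x\<bar>)) \<longlonglongrightarrow> ennreal \<bar>c\<bar> * 0"
  by (intro ennreal_tendsto_cmult ind) auto
 ultimately show ?case by simp
next
 case (add f g)
 have [measurable]: "f \<in> borel_measurable borel" "g \<in> borel_measurable borel" using add by auto
 have "(\<lambda>n. (\<integral>\<^sub>+x. ennreal \<bar>f (x + \<zeta> n) - f x\<bar>) + (\<integral>\<^sub>+x. ennreal \<bar>g (x + \<zeta> n) - g x\<bar>)) \<longlonglongrightarrow> 0 + 0"
  by (intro tendsto_add add)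
 then have lim: "(\<lambda>n. (\<integral>\<^sub>+x. ennreal \<bar>f (x + \<zeta> n) - f x\<bar>) + (\<integral>\<^sub>+x. ennreal \<bar>g (x + \<zeta> n) - g x\<bar>)) \<longlonglongrightarrow> 0"
  by simp
 show ?case
 proof (rule tendsto_sandwich[OF _ _ tendsto_const lim])
  show "\<forall>\<^sub>F n in sequentially. (\<integral>\<^sub>+x. ennreal \<bar>f (x + \<zeta> n) + g (x + \<zeta> n) - (f x + g x)\<bar>)
   \<le> (\<integral>\<^sub>+x. ennreal \<bar>f (x + \<zeta> n) - f x\<bar>) + (\<integral>\<^sub>+x. ennreal \<bar>g (x + \<zeta> n) - g x\<bar>)"
   by (subst nn_integral_add[symmetric])
    (auto simp flip: ennreal_plus intro!: always_eventually nn_integral_mono ennreal_leI)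
 qed simp
next
 case (lim f s)
 have [measurable]: "f \<in> borel_measurable borel" "\<And>i. s i \<in> borel_measurable borel" using lim by auto
 show ?case
 proof (rule L1_translation_approx)
  fix e :: real assume "e > 0"
  have "(\<lambda>i. \<integral>\<^sub>+x. ennreal (norm (f x - s i x))) \<longlonglongrightarrow> 0"
  proof -
   have "(\<lambda>i. \<integral>\<^sub>+x. ennreal (norm (f x - s i x))) \<longlonglongrightarrow> (\<integral>\<^sup>+x. 0 \<partial>(lborel::'a measure))"
   proof (rule nn_integral_dominated_convergence[where w="\<lambda>x. ennreal (3 * norm (f x))"])
    have "integrable lborel (\<lambda>x. 3 * norm (f x))" using lim by auto
    then show "(\<integral>\<^sub>+x. ennreal (3 * norm (f x))) < \<infinity>"
     by (simp only: integrable_iff_bounded) simp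
    show "AE x in lborel. ennreal (norm (f x - s j x)) \<le> ennreal (3 * norm (f x))" for j
    proof (intro AE_I2 ennreal_leI)
     fix x
     show "norm (f x - s j x) \<le> 3 * norm (f x)" 
      using norm_triangle_ineq4[of "f x" "s j x"] lim(3)[of x j] by simp
    qed
    show "AE x in lborel. (\<lambda>i. ennreal (norm (f x - s i x))) \<longlonglongrightarrow> 0"
    proof (intro AE_I2)
     fix x
     have "(\<lambda>i. norm (f x - s i x)) \<longlonglongrightarrow> norm (f x - f x)"
      by (intro tendsto_intros lim(2)) auto
     then show "(\<lambda>i. ennreal (norm (f x - s i x))) \<longlonglongrightarrow> 0"
      by (simp add: tendsto_ennrealI flip: ennreal_0)
    qed
   qed auto
   then show ?thesis by simp
  qed
  then have "eventually (\<lambda>i. (\<integral>\<^sub>+x. ennreal (norm (f x - s i x))) < ennreal e) sequentially"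
   using \<open>e > 0\<close> by (auto dest!: order_tendstoD(2)[where a="ennreal e"])
  then obtain i where "(\<integral>\<^sub>+x. ennreal \<bar>f x - s i x\<bar>) < ennreal e"
   by (auto simp: eventually_sequentially)
  then show "\<exists>g. g \<in> borel_measurable borel \<and>
    (\<lambda>n. \<integral>\<^sub>+x. ennreal \<bar>g (x + \<zeta> n) - g x\<bar>) \<longlonglongrightarrow> 0 \<and>
    (\<integral>\<^sub>+x. ennreal \<bar>f x - g x\<bar>) \<le> ennreal e"
   using lim by (intro exI[of _ "s i"]) auto
 qed auto
qed

section \<open>Almost everywhere convergence of convex combinations\<close>

text \<open>A form of weak compactness. Among the convex combinations \<open>S\<close> of \<open>N\<^sub>j,
 N\<^sub>j\<^sub>+\<^sub>1, \<dots>\<close> choose almost minimisers of \<open>\<integral>exp (- S)\<close>.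
 This functional is bounded and strictly convex, so by the parallelogram identity the functions \<open>exp (- S
 / 2)\<close> are Cauchy in \<open>L\<^sup>2\<close>, and a subsequence converges almost everywhere. By Fatou's
 lemma the limit is not 0, so that \<open>S\<close> itself converges.\<close>
lemma convex_combinations_AE_convergent:
 fixes N :: "nat => 'a => real"
 assumes fin: "finite_measure M" and [measurable]: "\<And>k. N k \<in> borel_measurable M"
  and nonneg: "\<And>k x. N k x \<ge> 0"
  and bound: "\<And>k. (\<integral>\<^sup>+x. ennreal (N k x) \<partial>M) \<le> ennreal C"
 obtains w :: "nat => nat => real" and b :: "nat => nat" and h :: "'a => real"
 where "\<And>j k. w j k \<ge> 0" "\<And>j k. k < j ==> w j k = 0" "\<And>j. (\<Sum>k\<le>b j. w j k) = 1"
  "h \<in> borel_measurable M" "\<And>x. h x \<ge> 0"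
  "AE x in M. (\<lambda>j. \<Sum>k\<le>b j. w j k * N k x) \<longlonglongrightarrow> h x"
proof -
 interpret finite_measure M by fact
 define CW :: "nat => ((nat => real) \<times> nat) set" where
  "CW = (\<lambda>j. {(w, b). (\<forall>k. w k \<ge> 0) \<and> (\<forall>k<j. w k = 0) \<and> (\<forall>k>b. w k = 0) \<and> (\<Sum>k\<le>b. w k) = 1})"
 define S where "S = (\<lambda>(wb :: (nat => real) \<times> nat) x. \<Sum>k\<le>snd wb. fst wb k * N k x)"
 define I where "I = (\<lambda>wb. \<integral>x. exp (- S wb x) \<partial>M)"
 define i where "i = (\<lambda>j. INF wb\<in>CW j. I wb)"
 have [measurable]: "S wb \<in> borel_measurable M" for wb
  unfolding S_def by measurable
 have S_nonneg: "S wb x \<ge> 0" if "wb \<in> CW j" for wb x j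
  using that nonneg by (auto simp: S_def CW_def intro!: sum_nonneg)
 have CW_mono: "CW k \<subseteq> CW j" if "j \<le> k" for j k
  using that by (auto simp: CW_def)
 have CW_ne: "((\<lambda>k. if k = j then 1 else 0), j) \<in> CW j" for j
  by (auto simp: CW_def)
 have int_exp: "integrable M (\<lambda>x. exp (- S wb x))" if "wb \<in> CW j" for wb j
  by (rule integrable_const_bound[of _ 1]) (use S_nonneg[OF that] in auto)
 have I_nonneg: "I wb \<ge> 0" for wb
  unfolding I_def by (intro integral_nonneg_AE) auto
 have bdd: "bdd_below (I ` CW j)" for j
  using I_nonneg by (intro bdd_belowI[of _ 0]) auto
 have i_le: "i j \<le> I wb" if "wb \<in> CW j" for j wb
  unfolding i_def by (intro cINF_lower bdd that)
 have i_mono: "incseq i"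
  unfolding i_def by (intro monoI cINF_superset_mono bdd CW_mono) (use CW_ne in auto)
 have i_bdd: "i j \<le> measure M (space M)" for j
 proof -
  have "i j \<le> I ((\<lambda>k. if k = j then 1 else 0), j)"
   by (intro i_le CW_ne)
  also have "\<dots> \<le> (\<integral>x. 1 \<partial>M)"
   unfolding I_def by (intro integral_mono int_exp[OF CW_ne] integrable_const) (use S_nonneg[OF CW_ne] in auto)
  finally show ?thesis by simp
 qed
 obtain l where l: "i \<longlonglongrightarrow> l"
  by (rule incseq_convergent[OF i_mono, of "measure M (space M)"]) (use i_bdd in blast)+
 then have i_Cauchy: "Cauchy i" by (rule LIMSEQ_imp_Cauchy)
 have "\<exists>wb\<in>CW j. I wb < i j + 1 / (real j + 1)" for j
  using cInf_lessD[of "I ` CW j" "i j + 1 / (real j + 1)"] CW_ne[of j]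
  by (auto simp: i_def)
 then obtain wb where wb: "\<And>j. wb j \<in> CW j" "\<And>j. I (wb j) < i j + 1 / (real j + 1)"
  by metis
 \<comment> \<open>The square of \<open>f j\<close> is the integrand of \<open>I\<close>, so that the parallelogram identity applies.\<close>
 define f where "f = (\<lambda>j x. exp (- S (wb j) x / 2))"
 have f_bound: "0 \<le> f j x" "f j x \<le> 1" for j x
  using S_nonneg[OF wb(1), of j x] by (auto simp: f_def)
 have [measurable]: "f j \<in> borel_measurable M" for j
  unfolding f_def by measurable
 have int_f: "integrable M (f j)" for j
  by (rule integrable_const_bound[of _ 1]) (use f_bound in auto)
 have int_f2: "integrable M (\<lambda>x. (f j x - f k x)\<^sup>2)" for j k
 proof (rule integrable_const_bound[of _ 1])
  have "\<bar>f j x - f k x\<bar> \<le> 1" for x using f_bound[of j x] f_bound[of k x] by auto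
  then have "(f j x - f k x)\<^sup>2 \<le> 1" for x by (simp add: abs_square_le_1)
  then show "AE x in M. norm ((f j x - f k x)\<^sup>2) \<le> 1" by auto
 qed auto
 \<comment> \<open>The average of two almost minimisers is again admissible, so it cannot have a much smaller integral.\<close>
 have sq: "(\<integral>x. (f j x - f k x)\<^sup>2 \<partial>M) \<le> \<bar>i j - i k\<bar> + 2 / (real n + 1)" if "n \<le> j" "n \<le> k" for n j k
 proof -
  define m where "m = min j k"
  define mid where "mid = ((\<lambda>l. (fst (wb j) l + fst (wb k) l) / 2), max (snd (wb j)) (snd (wb k)))"
  have ext: "(\<Sum>l\<le>max (snd (wb j)) (snd (wb k)). fst (wb j') l * g l) = (\<Sum>l\<le>snd (wb j'). fst (wb j') l * g l)"
   if "j' \<in> {j, k}" for j' and g :: "nat => real"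
   using that wb(1)[of j'] by (intro sum.mono_neutral_right) (auto simp: CW_def split: prod.splits)
  have mid: "mid \<in> CW m"
   using wb(1)[of j] wb(1)[of k] ext[of j "\<lambda>_. 1"] ext[of k "\<lambda>_. 1"]
   by (auto simp: CW_def mid_def m_def split_beta sum.distrib simp flip: sum_divide_distrib)
  have Smid: "S mid x = (S (wb j) x + S (wb k) x) / 2" for x
   using ext[of j "\<lambda>l. N l x"] ext[of k "\<lambda>l. N l x"]
   by (simp add: S_def mid_def sum.distrib field_simps flip: sum_divide_distrib)
  have "(f j x - f k x)\<^sup>2 = exp (- S (wb j) x) + exp (- S (wb k) x) - 2 * exp (- S mid x)" for x
   by (simp add: f_def Smid power2_eq_square algebra_simps add_divide_distrib diff_divide_distrib flip: exp_add)
  then have "(\<integral>x. (f j x - f k x)\<^sup>2 \<partial>M) = I (wb j) + I (wb k) - 2 * I mid"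
   using int_exp[OF wb(1), of j] int_exp[OF wb(1), of k] int_exp[OF mid] by (simp add: I_def)
  also have "\<dots> \<le> (i j + 1 / (real j + 1)) + (i k + 1 / (real k + 1)) - 2 * i m"
   using wb(2)[of j] wb(2)[of k] i_le[OF mid] by linarith
  also have "i j + i k - 2 * i m = \<bar>i j - i k\<bar>"
   using i_mono by (cases "j \<le> k") (auto simp: m_def min_def mono_def)
  then have "(i j + 1 / (real j + 1)) + (i k + 1 / (real k + 1)) - 2 * i m = \<bar>i j - i k\<bar> + 1 / (real j + 1) + 1 / (real k + 1)"
   by linarith
  also have "1 / (real j + 1) \<le> 1 / (real n + 1)" using that by (simp add: frac_le)
  also have "1 / (real k + 1) \<le> 1 / (real n + 1)" using that by (simp add: frac_le)
  finally show ?thesis by simp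
 qed
 have "\<exists>n. \<forall>j\<ge>n. \<forall>k\<ge>n. (LINT x|M. norm (f j x - f k x)) < e" if "e > 0" for e
 proof -
  define \<mu> where "\<mu> = measure M (space M)"
  define \<delta> where "\<delta> = e / (\<mu> + 1)"
  have \<mu>: "\<mu> \<ge> 0" by (simp add: \<mu>_def)
  have \<delta>: "\<delta> > 0" using that \<mu> by (simp add: \<delta>_def)
  have "\<delta> * \<mu> < e" using that \<mu> by (simp add: \<delta>_def field_simps)
  have pos: "e * \<delta> / 4 > 0" using that \<delta> by simp
  obtain n1 where n1: "\<And>j k. j \<ge> n1 ==> k \<ge> n1 ==> \<bar>i j - i k\<bar> < e * \<delta> / 4"
   using i_Cauchy pos unfolding Cauchy_iff real_norm_def by meson
  obtain n2 :: nat where n2: "8 / (e * \<delta>) < real n2" using reals_Archimedean2 by blast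
  have n2': "2 / (real (max n1 n2) + 1) \<le> e * \<delta> / 4"
  proof -
   have "8 / (e * \<delta>) \<le> real (max n1 n2) + 1" using n2 by linarith
   then show ?thesis using that \<delta> by (simp add: field_simps)
  qed
  have "(LINT x|M. norm (f j x - f k x)) < e" if jk: "j \<ge> max n1 n2" "k \<ge> max n1 n2" for j k
  proof -
   have "(\<integral>x. (f j x - f k x)\<^sup>2 \<partial>M) \<le> \<bar>i j - i k\<bar> + 2 / (real (max n1 n2) + 1)"
    by (rule sq) (use jk in auto)
   also have "\<dots> \<le> e * \<delta> / 4 + e * \<delta> / 4"
    using n1[of j k] jk n2' by (intro add_mono) auto
   finally have s: "(\<integral>x. (f j x - f k x)\<^sup>2 \<partial>M) \<le> e * \<delta> / 2" by linarith
   have "(LINT x|M. norm (f j x - f k x)) \<le> (LINT x|M. (\<delta> + (f j x - f k x)\<^sup>2 / \<delta>) / 2)"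
   proof (intro integral_mono)
    fix x
    have "2 * \<delta> * a \<le> \<delta>\<^sup>2 + a\<^sup>2" for a :: real
     using sum_squares_bound[of \<delta> a] by simp
    from this[of "\<bar>f j x - f k x\<bar>"]
    have "2 * \<delta> * \<bar>f j x - f k x\<bar> \<le> \<delta>\<^sup>2 + (f j x - f k x)\<^sup>2"
     by (simp only: power2_abs)
    then show "norm (f j x - f k x) \<le> (\<delta> + (f j x - f k x)\<^sup>2 / \<delta>) / 2"
     using \<delta> by (simp add: field_simps power2_eq_square)
   qed (use int_f int_f2 in auto)
   also have "\<dots> = (\<delta> * \<mu> + (\<integral>x. (f j x - f k x)\<^sup>2 \<partial>M) / \<delta>) / 2"
    using int_f2 by (simp add: \<mu>_def mult.commute)
   also have "\<dots> \<le> (\<delta> * \<mu> + (e * \<delta> / 2) / \<delta>) / 2"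
    using s \<delta> by (intro divide_right_mono add_left_mono) auto
   also have "\<dots> < e" using \<open>\<delta> * \<mu> < e\<close> \<delta> \<open>e > 0\<close> by simp
   finally show ?thesis .
  qed
  then show ?thesis by blast
 qed
 then obtain r where r: "strict_mono r" "AE x in M. Cauchy (\<lambda>j. f (r j) x)"
  using cauchy_L1_AE_cauchy_subseq[of M f] int_f by blast
 define W where "W = (\<lambda>x. lim (\<lambda>j. f (r j) x))"
 define h where "h = (\<lambda>x. max 0 (- 2 * ln (W x)))"
 have [measurable]: "W \<in> borel_measurable M"
  unfolding W_def by measurable
 have [measurable]: "h \<in> borel_measurable M" unfolding h_def by measurable
 have S_bound: "(\<integral>\<^sup>+x. ennreal (S (wb j) x) \<partial>M) \<le> ennreal C" for j
 proof -
  have w: "fst (wb j) k \<ge> 0" "(\<Sum>k\<le>snd (wb j). fst (wb j) k) = 1" for k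
   using wb(1)[of j] by (auto simp: CW_def split_beta)
  have "(\<integral>\<^sup>+x. ennreal (S (wb j) x) \<partial>M) = (\<integral>\<^sup>+x. (\<Sum>k\<le>snd (wb j). ennreal (fst (wb j) k) * ennreal (N k x)) \<partial>M)"
   using w nonneg by (auto simp: S_def sum_ennreal simp flip: ennreal_mult intro!: nn_integral_cong)
  also have "\<dots> = (\<Sum>k\<le>snd (wb j). ennreal (fst (wb j) k) * (\<integral>\<^sup>+x. ennreal (N k x) \<partial>M))"
   by (subst nn_integral_sum) (auto simp: nn_integral_cmult)
  also have "\<dots> \<le> (\<Sum>k\<le>snd (wb j). ennreal (fst (wb j) k) * ennreal C)"
   by (intro sum_mono mult_left_mono bound) auto
  also have "\<dots> = ennreal C"
   using w by (simp add: sum_ennreal flip: sum_distrib_right)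
  finally show ?thesis .
 qed
 have "(\<integral>\<^sup>+x. liminf (\<lambda>j. ennreal (S (wb (r j)) x)) \<partial>M) \<le> liminf (\<lambda>j. \<integral>\<^sup>+x. ennreal (S (wb (r j)) x) \<partial>M)"
  by (intro nn_integral_liminf) auto
 also have "\<dots> \<le> ennreal C"
  by (intro Liminf_le) (auto intro!: always_eventually S_bound)
 also have "\<dots> < \<infinity>" by simp
 finally have "AE x in M. liminf (\<lambda>j. ennreal (S (wb (r j)) x)) < \<infinity>"
  by (intro finite_nn_integral_imp_ae_finite) auto
 then have "AE x in M. (\<lambda>j. S (wb (r j)) x) \<longlonglongrightarrow> h x"
  using r(2)
 proof eventually_elim
  case (elim x)
  have lim: "(\<lambda>j. f (r j) x) \<longlonglongrightarrow> W x"
   using elim(2) unfolding W_def by (simp add: Cauchy_convergent_iff convergent_LIMSEQ_iff)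
  have W: "0 \<le> W x" "W x \<le> 1"
   using LIMSEQ_le_const[OF lim, of 0] LIMSEQ_le_const2[OF lim, of 1] f_bound by auto
  have "W x \<noteq> 0"
  proof
   assume "W x = 0"
   then have "filterlim (\<lambda>j. f (r j) x) (at_right 0) sequentially"
    using lim by (auto simp: filterlim_at f_def)
   then have "filterlim (\<lambda>j. ln (f (r j) x)) at_bot sequentially"
    by (rule filterlim_compose[OF ln_at_0])
   then have "filterlim (\<lambda>j. - ln (f (r j) x)) at_top sequentially"
    by (simp add: filterlim_uminus_at_top)
   then have "filterlim (\<lambda>j. S (wb (r j)) x / 2) at_top sequentially"
    by (simp add: f_def)
   then have "filterlim (\<lambda>j. 2 * (S (wb (r j)) x / 2)) at_top sequentially"
    by (intro filterlim_tendsto_pos_mult_at_top[OF tendsto_const]) auto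
   then have "filterlim (\<lambda>j. S (wb (r j)) x) at_top sequentially" by simp
   then have "(\<lambda>j. ennreal (S (wb (r j)) x)) \<longlonglongrightarrow> \<infinity>"
    by (auto simp: infinity_ennreal_def tendsto_top_iff_ennreal filterlim_at_top_dense ennreal_less_iff)
   then have "liminf (\<lambda>j. ennreal (S (wb (r j)) x)) = \<infinity>"
    by (intro lim_imp_Liminf) auto
   then show False using elim(1) by simp
  qed
  then have "W x > 0" using W by simp
  then have "(\<lambda>j. - 2 * ln (f (r j) x)) \<longlonglongrightarrow> - 2 * ln (W x)"
   by (intro tendsto_intros lim) auto
  moreover have "- 2 * ln (W x) = h x"
   using W \<open>W x > 0\<close> by (simp add: h_def max_def)
  ultimately show ?case by (simp add: f_def)
 qed
 then have ae: "AE x in M. (\<lambda>j. \<Sum>k\<le>snd (wb (r j)). fst (wb (r j)) k * N k x) \<longlonglongrightarrow> h x"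
  by (simp add: S_def)
 show thesis
 proof (rule that[of "\<lambda>j. fst (wb (r j))" "\<lambda>j. snd (wb (r j))" h])
  show "fst (wb (r j)) k = 0" if "k < j" for j k
   using wb(1)[of "r j"] seq_suble[OF r(1), of j] that by (auto simp: CW_def split_beta)
 qed (use wb(1) ae in \<open>auto simp: CW_def split_beta h_def\<close>)
qed

section \<open>Lipschitz changes of variables\<close>

lemma nn_integral_mono_emeasure:
 assumes sets: "sets N = sets M" and le: "\<And>E. E \<in> sets M ==> emeasure N E \<le> emeasure M E"
 shows "(\<integral>\<^sup>+x. f x \<partial>N) \<le> (\<integral>\<^sup>+x. f x \<partial>M)"
proof (rule nn_integral_mono_measure[OF sets])
 have "emeasure N E \<le> emeasure M E" for E
  using le[of E] sets by (cases "E \<in> sets M") (auto simp: emeasure_notin_sets)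
 then show "N \<le> M"
  by (simp add: le_measure[OF sets])
qed

text \<open>Cover \<open>E\<close> by cubes of almost the same total measure. The image of a cube of side
 \<open>S\<close> lies in a cube of side \<open>2 L n S\<close>, since the diameter of a cube is at most
 \<open>n\<close> times its side.\<close>
lemma emeasure_Lipschitz_image_le:
 fixes s :: "'b::euclidean_space => 'a::euclidean_space"
 assumes dim: "DIM('a) = DIM('b)" and s: "L-lipschitz_on A s"
  and E: "E \<in> sets borel" "bounded E" "E \<subseteq> A" "s ` E \<in> sets borel"
 shows "emeasure lborel (s ` E) \<le> ennreal ((2 * L * DIM('b)) ^ DIM('b)) * emeasure lborel E"
proof -
 have L: "L \<ge> 0" using lipschitz_on_nonneg[OF s] .
 define n where "n = DIM('b)"
 define C where "C = (2 * L * n) ^ n"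
 have C: "C \<ge> 0" using L by (simp add: C_def)
 obtain c where c: "c > 0" "\<And>x. x \<in> E ==> norm x \<le> c"
  using E(2) bounded_pos by blast
 have Ec: "E \<subseteq> cbox (- c *\<^sub>R One) (c *\<^sub>R One)"
 proof
  fix x assume "x \<in> E"
  then have "\<bar>x \<bullet> i\<bar> \<le> c" if "i \<in> Basis" for i
   using c(2)[of x] Basis_le_norm[OF that, of x] by linarith
  then show "x \<in> cbox (- c *\<^sub>R One) (c *\<^sub>R One)"
   by (auto simp: mem_box abs_le_iff minus_le_iff)
 qed
 have lmE: "E \<in> lmeasurable"
  using E by (intro bounded_set_imp_lmeasurable) auto
 have main: "emeasure lborel (s ` E) \<le> ennreal (C * (measure lebesgue E + e))" if e: "e > 0" for e
 proof -
  obtain \<D> where D: "countable \<D>"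
    "\<And>K. K \<in> \<D> ==> K \<subseteq> cbox (- c *\<^sub>R One) (c *\<^sub>R One) \<and> K \<noteq> {} \<and> (\<exists>c d. K = cbox c d)"
    "pairwise (\<lambda>A B. interior A \<inter> interior B = {}) \<D>"
    "\<And>u v. cbox u v \<in> \<D> ==> \<exists>m. \<forall>i \<in> Basis. v \<bullet> i - u \<bullet> i = ((c *\<^sub>R One) \<bullet> i - (- c *\<^sub>R One) \<bullet> i)/2^m"
    "E \<subseteq> \<Union>\<D>" "\<Union>\<D> \<in> lmeasurable" "measure lebesgue (\<Union>\<D>) \<le> measure lebesgue E + e"
   by (rule measurable_outer_intervals_bounded[OF lmE Ec e]) metis
  have box: "\<exists>T\<in>lmeasurable. s ` (K \<inter> A) \<subseteq> T \<and> measure lebesgue T \<le> C * measure lebesgue K" if K: "K \<in> \<D>" for K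
  proof (cases "K \<inter> A = {}")
   case True
   then show ?thesis using C by (intro bexI[of _ "{}"]) auto
  next
   case False
   then obtain y where y: "y \<in> K" "y \<in> A" by blast
   obtain u v where uv: "K = cbox u v" using D(2) K by blast
   obtain m where m: "\<And>i. i \<in> Basis ==> v \<bullet> i - u \<bullet> i = 2 * c / 2 ^ m"
    using D(4)[of u v] K uv by auto
   define S where "S = 2 * c / 2 ^ m"
   have S: "S > 0" using c by (simp add: S_def)
   have measK: "measure lebesgue K = S ^ n"
    using m S y uv by (auto simp: content_cbox_if S_def n_def)
   define R where "R = L * n * S"
   have R: "R \<ge> 0" using L S by (simp add: R_def)
   define T where "T = cbox (s y - R *\<^sub>R One) (s y + R *\<^sub>R One)"
   have "measure lebesgue T = (2 * R) ^ n"
    using R dim by (auto simp: T_def content_cbox_if box_eq_empty n_def algebra_simps)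
   then have mT: "measure lebesgue T = C * measure lebesgue K"
    by (simp add: measK C_def R_def power_mult_distrib)
   have sub: "s ` (K \<inter> A) \<subseteq> T"
   proof (clarify)
    fix x assume x: "x \<in> K" "x \<in> A"
    have "norm (x - y) \<le> (\<Sum>i\<in>Basis. \<bar>(x - y) \<bullet> i\<bar>)" by (rule norm_le_l1)
    also have "\<dots> \<le> (\<Sum>i\<in>(Basis::'b set). S)"
    proof (rule sum_mono)
     fix i :: 'b assume i: "i \<in> Basis"
     show "\<bar>(x - y) \<bullet> i\<bar> \<le> S"
      using x(1) y(1) i m[OF i] unfolding uv mem_box S_def by (auto simp: inner_diff_left abs_le_iff dest!: bspec[OF _ i])
    qed
    finally have "norm (x - y) \<le> n * S" by (simp add: n_def)
    then have "dist (s x) (s y) \<le> R"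
     using lipschitz_onD[OF s x(2) y(2)] L mult_left_mono[of "dist x y" "n * S" L]
     by (simp add: R_def dist_norm mult.assoc)
    then have "\<bar>(s x - s y) \<bullet> i\<bar> \<le> R" if "i \<in> Basis" for i
     using Basis_le_norm[OF that, of "s x - s y"] by (simp add: dist_norm)
    then show "s x \<in> T"
     by (auto simp: T_def mem_box inner_diff_left inner_add_left abs_le_iff algebra_simps)
   qed
   show ?thesis using sub mT by (intro bexI[of _ T]) (auto simp: T_def)
  qed
  then obtain T where T: "\<And>K. K \<in> \<D> ==> T K \<in> lmeasurable" "\<And>K. K \<in> \<D> ==> s ` (K \<inter> A) \<subseteq> T K"
    "\<And>K. K \<in> \<D> ==> measure lebesgue (T K) \<le> C * measure lebesgue K"
   by metis
  have fin: "measure lebesgue (\<Union>K\<in>F. T K) \<le> C * (measure lebesgue E + e)" if F: "F \<subseteq> \<D>" "finite F" for F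
  proof -
   have "measure lebesgue (\<Union>K\<in>F. T K) \<le> (\<Sum>K\<in>F. measure lebesgue (T K))"
    using F T by (intro measure_UNION_le) auto
   also have "\<dots> \<le> (\<Sum>K\<in>F. C * measure lebesgue K)"
    using F T by (intro sum_mono) auto
   also have "\<dots> = C * measure lebesgue (\<Union>F)"
   proof -
    have "negligible (K \<inter> K')" if KK: "K \<in> F" "K' \<in> F" "K \<noteq> K'" for K K'
    proof -
     have "interior (K \<inter> K') = {}"
      using D(3) KK F by (auto simp: pairwise_def interior_Int)
     moreover have "convex (K \<inter> K')"
      using D(2)[of K] D(2)[of K'] KK F by (metis convex_Int convex_box(1) subsetD)
     ultimately show ?thesis by (simp add: negligible_convex_interior)
    qed
    moreover have "K \<in> lmeasurable" if "K \<in> F" for K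
     using D(2)[of K] F that by (metis lmeasurable_cbox subsetD)
    ultimately show ?thesis
     by (subst measure_negligible_finite_Union[OF F(2)]) (auto simp: pairwise_def sum_distrib_left)
   qed
   also have "\<dots> \<le> C * measure lebesgue (\<Union>\<D>)"
   proof (intro mult_left_mono measure_mono_fmeasurable C D Union_mono F)
    have "K \<in> sets lebesgue" if "K \<in> F" for K
     using D(2)[of K] F that by (metis lmeasurable_cbox fmeasurableD subsetD)
    then show "\<Union> F \<in> sets lebesgue" using F by auto
   qed
   also have "\<dots> \<le> C * (measure lebesgue E + e)"
    by (intro mult_left_mono D C)
   finally show ?thesis .
  qed
  have TU: "(\<Union>K\<in>\<D>. T K) \<in> lmeasurable" "measure lebesgue (\<Union>K\<in>\<D>. T K) \<le> C * (measure lebesgue E + e)"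
   by (rule fmeasurable_UN_bound[OF D(1) T(1) fin] measure_UN_bound[OF D(1) T(1) fin]; assumption)+
  have "s ` E \<subseteq> (\<Union>K\<in>\<D>. T K)"
   using D(5) T(2) E(3) by blast
  then have "emeasure lebesgue (s ` E) \<le> emeasure lebesgue (\<Union>K\<in>\<D>. T K)"
   using TU by (intro emeasure_mono) auto
  also have "\<dots> = ennreal (measure lebesgue (\<Union>K\<in>\<D>. T K))"
   using TU(1) by (simp add: emeasure_eq_measure2)
  also have "\<dots> \<le> ennreal (C * (measure lebesgue E + e))"
   using TU(2) by (rule ennreal_leI)
  finally show ?thesis using E(4) by simp
 qed
 have "emeasure lborel (s ` E) \<le> ennreal (C * measure lebesgue E)"
 proof (rule ennreal_le_epsilon)
  fix e :: real assume e: "e > 0"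
  have "emeasure lborel (s ` E) \<le> ennreal (C * (measure lebesgue E + e / (C + 1)))"
   using C e by (intro main) auto
  also have "C * (measure lebesgue E + e / (C + 1)) \<le> C * measure lebesgue E + e"
   using C e by (simp add: field_simps)
  then have "ennreal (C * (measure lebesgue E + e / (C + 1))) \<le> ennreal (C * measure lebesgue E + e)"
   by (rule ennreal_leI)
  also have "\<dots> = ennreal (C * measure lebesgue E) + ennreal e"
   using C e by (simp add: ennreal_plus)
  finally show "emeasure lborel (s ` E) \<le> ennreal (C * measure lebesgue E) + ennreal e" .
 qed
 also have "\<dots> = ennreal C * emeasure lebesgue E"
  using lmE C by (simp add: ennreal_mult emeasure_eq_measure2)
 finally show ?thesis using E by (simp add: C_def n_def)
qed

text \<open>The image measure of \<open>lborel\<close> on \<open>B\<close> under \<open>\<phi>\<close> gives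
 \<open>E\<close> the measure of \<open>s ` E\<close>, which is at most a constant times that of
 \<open>E\<close>.\<close>
lemma nn_integral_Lipschitz_pullback_le:
 fixes \<phi> :: "'a::euclidean_space => 'b::euclidean_space"
 assumes dim: "DIM('a) = DIM('b)" and B: "compact B" and \<phi>: "continuous_on B \<phi>"
  and inv: "\<And>w. w \<in> B ==> s (\<phi> w) = w" and s: "L-lipschitz_on (\<phi> ` B) s"
  and [measurable]: "H \<in> borel_measurable borel"
 shows "(\<integral>\<^sub>+w. H (\<phi> w) * indicator B w) \<le>
  ennreal ((2 * L * DIM('b)) ^ DIM('b)) * (\<integral>\<^sub>+z. H z * indicator (\<phi> ` B) z)"
proof -
 have [measurable]: "B \<in> sets borel" using B by (simp add: borel_compact)
 have cB: "compact (\<phi> ` B)" by (intro compact_continuous_image \<phi> B)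
 then have [measurable]: "\<phi> ` B \<in> sets borel" by (simp add: borel_compact)
 define C where "C = (2 * L * DIM('b)) ^ DIM('b)"
 have meas: "\<phi> \<in> restrict_space lborel B \<rightarrow>\<^sub>M borel"
  using borel_measurable_continuous_on_restrict[OF \<phi>] by (simp add: measurable_def space_restrict_space sets_restrict_space)
 define N where "N = distr (restrict_space lborel B) borel \<phi>"
 define M where "M = density lborel (\<lambda>z. ennreal C * indicator (\<phi> ` B) z :: ennreal)"
 have "(\<integral>\<^sup>+z. H z \<partial>N) \<le> (\<integral>\<^sup>+z. H z \<partial>M)"
 proof (rule nn_integral_mono_emeasure)
  show "sets N = sets M" by (simp add: N_def M_def)
  fix E assume "E \<in> sets M"
  then have [measurable]: "E \<in> sets borel" by (simp add: M_def)
  have eq: "\<phi> -` E \<inter> B = s ` (E \<inter> \<phi> ` B)" using inv by force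
  have "\<phi> -` E \<inter> space (restrict_space lborel B) \<in> sets (restrict_space lborel B)"
   by (rule measurable_sets[OF meas]) auto
  then have pre: "\<phi> -` E \<inter> B \<in> sets borel"
   by (auto simp: space_restrict_space sets_restrict_space)
  have "emeasure N E = emeasure lborel (\<phi> -` E \<inter> B)"
   unfolding N_def using meas pre
   by (subst emeasure_distr) (auto simp: space_restrict_space emeasure_restrict_space)
  also have "\<dots> = emeasure lborel (s ` (E \<inter> \<phi> ` B))" by (simp add: eq)
  also have "\<dots> \<le> ennreal C * emeasure lborel (E \<inter> \<phi> ` B)"
   unfolding C_def using pre cB eq
   by (intro emeasure_Lipschitz_image_le[OF dim s]) (auto intro: bounded_subset compact_imp_bounded)
  also have "\<dots> = emeasure M E"
   by (simp add: M_def emeasure_density nn_integral_cmult mult.assoc Int_commute flip: indicator_inter_arith)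
  finally show "emeasure N E \<le> emeasure M E" .
 qed
 also have "(\<integral>\<^sup>+z. H z \<partial>N) = (\<integral>\<^sub>+w. H (\<phi> w) * indicator B w)"
  unfolding N_def using meas by (subst nn_integral_distr) (auto simp: nn_integral_restrict_space)
 also have "(\<integral>\<^sup>+z. H z \<partial>M) = ennreal C * (\<integral>\<^sub>+z. H z * indicator (\<phi> ` B) z)"
  unfolding M_def by (subst nn_integral_density) (auto simp: nn_integral_cmult[symmetric] mult_ac)
 finally show ?thesis by (simp add: C_def)
qed

section \<open>Mollifiers\<close>

text \<open>The class of functions \<open>P (1/x) exp (- 1/x)\<close> on the positive axis, extended by 0, is
 closed under differentiation; an induction over the order can therefore prove smoothness.\<close>
definition flat_fun :: "real poly => real => real" where
 "flat_fun P x = (if x > 0 then poly P (1/x) * exp (- 1/x) else 0)"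

lemma poly_times_exp_minus_at_top: "((\<lambda>y. poly P y * exp (- y)) \<longlongrightarrow> 0) at_top" for P :: "real poly"
proof -
 have "((\<lambda>y. \<Sum>i\<le>degree P. coeff P i * (y ^ i / exp y)) \<longlongrightarrow> (\<Sum>i\<le>degree P. coeff P i * 0)) at_top"
  by (intro tendsto_sum tendsto_mult tendsto_const tendsto_power_div_exp_0)
 moreover have "(\<Sum>i\<le>degree P. coeff P i * (y ^ i / exp y)) = poly P y * exp (- y)" for y
  by (simp add: poly_altdef sum_distrib_right exp_minus divide_inverse mult.assoc)
 ultimately show ?thesis by simp
qed

lemma flat_fun_has_derivative:
 "(flat_fun P has_real_derivative flat_fun ([:0, 0, 1:] * (P - pderiv P)) x) (at x)"
proof -
 consider "x > 0" | "x < 0" | "x = 0" by linarith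
 then show ?thesis
 proof cases
  case 1
  have "((\<lambda>x. poly P (1/x) * exp (- 1/x)) has_real_derivative
    poly (pderiv P) (1/x) * (- 1/x\<^sup>2) * exp (- 1/x) + poly P (1/x) * (exp (- 1/x) * (1/x\<^sup>2))) (at x)"
   using 1 by (auto intro!: derivative_eq_intros DERIV_chain2[OF poly_DERIV] simp: power2_eq_square field_simps)
  also have "poly (pderiv P) (1/x) * (- 1/x\<^sup>2) * exp (- 1/x) + poly P (1/x) * (exp (- 1/x) * (1/x\<^sup>2))
   = flat_fun ([:0, 0, 1:] * (P - pderiv P)) x"
   using 1 by (simp add: flat_fun_def power2_eq_square field_simps)
  finally show ?thesis
   by (rule has_field_derivative_transform_within_open[where S="{0<..}"]) (use 1 in \<open>auto simp: flat_fun_def\<close>)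
 next
  case 2
  have "((\<lambda>x. 0) has_real_derivative flat_fun ([:0, 0, 1:] * (P - pderiv P)) x) (at x)"
   using 2 by (simp add: flat_fun_def)
  then show ?thesis
   by (rule has_field_derivative_transform_within_open[where S="{..<0}"]) (use 2 in \<open>auto simp: flat_fun_def\<close>)
 next
  case 3
  have "((\<lambda>h. flat_fun P h / h) \<longlongrightarrow> 0) (at_right 0)"
  proof -
   have "((\<lambda>h. poly ([:0, 1:] * P) (inverse h) * exp (- inverse h)) \<longlongrightarrow> 0) (at_right 0)"
    by (rule filterlim_compose[OF poly_times_exp_minus_at_top filterlim_inverse_at_top_right])
   then show ?thesis
    by (rule Lim_transform_eventually)
     (auto simp: eventually_at_right_field flat_fun_def field_simps intro!: exI[of _ 1])
  qed
  moreover have "((\<lambda>h. flat_fun P h / h) \<longlongrightarrow> 0) (at_left 0)"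
   by (rule tendsto_eventually) (auto simp: eventually_at_left_field flat_fun_def intro!: exI[of _ "-1"])
  ultimately have "((\<lambda>h. flat_fun P h / h) \<longlongrightarrow> 0) (at 0)"
   by (simp add: filterlim_at_split)
  then show ?thesis using 3 by (simp add: DERIV_def flat_fun_def)
 qed
qed

lemma partial_deriv_eqI:
 "(f has_derivative f') (at z) ==> partial_deriv i f z = f' (axis i 1)"
 by (simp add: partial_deriv_def flip: frechet_derivative_at)

lemma C_k_Suc_imp: "C_k (Suc k) f ==> C_k k f"
proof (induction k arbitrary: f)
 case 0
 then show ?case by (auto intro: differentiable_imp_continuous_on)
next
 case (Suc k)
 then show ?case by (metis C_k.simps(2))
qed

lemma differentiable_on_UNIV_D:
 "f differentiable_on UNIV ==> (f has_derivative frechet_derivative f (at z)) (at z)"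
 by (simp add: differentiable_on_def frechet_derivative_works)

lemma C_k_const: "C_k k (\<lambda>z. c)"
proof (induction k arbitrary: c)
 case (Suc k)
 have "partial_deriv i (\<lambda>z. c) = (\<lambda>z. 0)" for i :: 'a
  by (rule ext) (simp add: partial_deriv_eqI[OF has_derivative_const])
 then show ?case using Suc by (simp add: differentiable_on_const)
qed simp

lemma C_k_coordinate: "C_k k (\<lambda>z. z $ i)"
proof (cases k)
 case (Suc l)
 have d: "((\<lambda>z. z $ i) has_derivative (\<lambda>h. h $ i)) (at z)" for z :: "real^'a"
  by (intro bounded_linear_imp_has_derivative bounded_linear_vec_nth)
 have "partial_deriv j (\<lambda>z. z $ i) = (\<lambda>z. axis j 1 $ i)" for j :: 'a
  by (rule ext) (simp add: partial_deriv_eqI[OF d])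
 moreover have "(\<lambda>z::real^'a. z $ i) differentiable_on UNIV"
  using d by (auto simp: differentiable_on_def differentiable_def)
 ultimately show ?thesis using Suc by (simp add: C_k_const)
qed (auto intro: continuous_intros)

lemma C_k_add: "C_k k f ==> C_k k g ==> C_k k (\<lambda>z. f z + g z)"
proof (induction k arbitrary: f g)
 case (Suc k)
 have "partial_deriv i (\<lambda>z. f z + g z) = (\<lambda>z. partial_deriv i f z + partial_deriv i g z)" for i
 proof
  fix z
  have "((\<lambda>z. f z + g z) has_derivative (\<lambda>h. frechet_derivative f (at z) h + frechet_derivative g (at z) h)) (at z)"
   using Suc.prems by (intro has_derivative_add differentiable_on_UNIV_D) auto
  from partial_deriv_eqI[OF this] show "partial_deriv i (\<lambda>z. f z + g z) z = partial_deriv i f z + partial_deriv i g z"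
   by (simp add: partial_deriv_def)
 qed
 then show ?case using Suc by (auto intro: differentiable_on_add)
qed (auto intro: continuous_intros)

lemma C_k_mult: "C_k k f ==> C_k k g ==> C_k k (\<lambda>z. f z * g z)"
proof (induction k arbitrary: f g)
 case (Suc k)
 have "partial_deriv i (\<lambda>z. f z * g z) = (\<lambda>z. f z * partial_deriv i g z + partial_deriv i f z * g z)" for i
 proof
  fix z
  have "((\<lambda>z. f z * g z) has_derivative (\<lambda>h. f z * frechet_derivative g (at z) h + frechet_derivative f (at z) h * g z)) (at z)"
   using Suc.prems by (intro has_derivative_mult differentiable_on_UNIV_D) auto
  from partial_deriv_eqI[OF this] show "partial_deriv i (\<lambda>z. f z * g z) z = f z * partial_deriv i g z + partial_deriv i f z * g z"
   by (simp add: partial_deriv_def)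
 qed
 then show ?case using Suc C_k_Suc_imp[OF Suc.prems(1)] C_k_Suc_imp[OF Suc.prems(2)]
  by (auto intro!: differentiable_on_mult C_k_add)
qed (auto intro: continuous_intros)

lemma C_k_translate: "C_k k f ==> C_k k (\<lambda>z. f (z - a))"
proof (induction k arbitrary: f)
 case 0
 then show ?case
  by (auto intro!: continuous_on_compose2[of UNIV f UNIV "\<lambda>z. z - a"] continuous_intros)
next
 case (Suc k)
 have d: "((\<lambda>z. f (z - a)) has_derivative frechet_derivative f (at (z - a))) (at z)" for z
 proof -
  have "((\<lambda>z. z - a) has_derivative (\<lambda>h. h)) (at z)"
   by (auto intro!: derivative_eq_intros)
  then show ?thesis
   using has_derivative_compose[of "\<lambda>z. z - a" "\<lambda>h. h" z UNIV f] differentiable_on_UNIV_D[of f "z - a"] Suc.prems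
   by simp
 qed
 have "partial_deriv i (\<lambda>z. f (z - a)) = (\<lambda>z. partial_deriv i f (z - a))" for i
  by (rule ext) (simp add: partial_deriv_eqI[OF d] partial_deriv_def)
 moreover have "(\<lambda>z. f (z - a)) differentiable_on UNIV"
  using d by (auto simp: differentiable_on_def differentiable_def)
 ultimately show ?case using Suc by simp
qed

definition bump :: "real => real^'n::finite => real" where
 "bump r z = flat_fun 1 (r\<^sup>2 - (\<Sum>i\<in>UNIV. z $ i * z $ i))"

lemma norm_sq_coordinates: "(norm z)\<^sup>2 = (\<Sum>i\<in>UNIV. z $ i * z $ i)" for z :: "real^'n::finite"
 by (simp add: power2_norm_eq_inner inner_vec_def)

text \<open>The chain rule turns the partial derivatives into coordinates times functions of the same form with
 another polynomial, hence the generalisation over \<open>P\<close>.\<close>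
lemma C_k_flat_fun_radial:
 "C_k k (\<lambda>z::real^'n::finite. flat_fun P (r\<^sup>2 - (\<Sum>i\<in>UNIV. z $ i * z $ i)))"
proof (induction k arbitrary: P)
 case 0
 have "continuous_on UNIV (flat_fun P)"
  by (meson DERIV_isCont continuous_at_imp_continuous_on flat_fun_has_derivative)
 then show ?case
  by (auto intro!: continuous_on_compose2[of UNIV "flat_fun P"] continuous_intros)
next
 case (Suc k)
 define Q where "Q = [:0, 0, 1:] * (P - pderiv P)"
 have d: "((\<lambda>z::real^'n. flat_fun P (r\<^sup>2 - (\<Sum>i\<in>UNIV. z $ i * z $ i))) has_derivative
   (\<lambda>h. flat_fun Q (r\<^sup>2 - (\<Sum>i\<in>UNIV. z $ i * z $ i)) * (- (\<Sum>i\<in>UNIV. z $ i * h $ i + h $ i * z $ i)))) (at z)" for z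
 proof -
  have "((\<lambda>z. r\<^sup>2 - (\<Sum>i\<in>UNIV. z $ i * z $ i)) has_derivative (\<lambda>h. - (\<Sum>i\<in>UNIV. z $ i * h $ i + h $ i * z $ i))) (at z)"
   by (auto intro!: derivative_eq_intros bounded_linear_imp_has_derivative bounded_linear_vec_nth)
  moreover have "(flat_fun P has_derivative (*) (flat_fun Q (r\<^sup>2 - (\<Sum>i\<in>UNIV. z $ i * z $ i)))) (at (r\<^sup>2 - (\<Sum>i\<in>UNIV. z $ i * z $ i)))"
   using flat_fun_has_derivative[of P] by (simp add: has_field_derivative_def Q_def)
  ultimately show ?thesis
   using has_derivative_compose by fastforce
 qed
 have "partial_deriv j (\<lambda>z::real^'n. flat_fun P (r\<^sup>2 - (\<Sum>i\<in>UNIV. z $ i * z $ i))) =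
  (\<lambda>z. flat_fun Q (r\<^sup>2 - (\<Sum>i\<in>UNIV. z $ i * z $ i)) * (- 2 * z $ j))" for j
 proof
  fix z :: "real^'n"
  have "(\<Sum>i\<in>UNIV. z $ i * axis j 1 $ i + axis j 1 $ i * z $ i) = (\<Sum>i\<in>UNIV. if i = j then 2 * z $ j else 0)"
   by (intro sum.cong) (auto simp: axis_def)
  then show "partial_deriv j (\<lambda>z::real^'n. flat_fun P (r\<^sup>2 - (\<Sum>i\<in>UNIV. z $ i * z $ i))) z =
   flat_fun Q (r\<^sup>2 - (\<Sum>i\<in>UNIV. z $ i * z $ i)) * (- 2 * z $ j)"
   by (simp add: partial_deriv_eqI[OF d])
 qed
 moreover have "C_k k (\<lambda>z. flat_fun Q (r\<^sup>2 - (\<Sum>i\<in>UNIV. z $ i * z $ i)) * (- 2 * z $ j))" for j :: 'n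
  by (intro C_k_mult Suc C_k_const C_k_coordinate)
 moreover have "(\<lambda>z::real^'n. flat_fun P (r\<^sup>2 - (\<Sum>i\<in>UNIV. z $ i * z $ i))) differentiable_on UNIV"
  using d by (auto simp: differentiable_on_def differentiable_def)
 ultimately show ?case by simp
qed

lemma bump_C_k: "C_k k (bump r)"
 unfolding bump_def[abs_def] by (rule C_k_flat_fun_radial)

lemma bump_nonneg: "bump r z \<ge> 0"
 by (simp add: bump_def flat_fun_def)

lemma bump_pos_iff: "r > 0 ==> bump r z \<noteq> 0 \<longleftrightarrow> norm z < r"
proof -
 assume "r > 0"
 have "(norm z)\<^sup>2 < r\<^sup>2 \<longleftrightarrow> norm z < r"
  using \<open>r > 0\<close> by (metis norm_ge_zero less_eq_real_def power_less_imp_less_base power_strict_mono zero_less_numeral)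
 then show ?thesis by (auto simp: bump_def flat_fun_def simp flip: norm_sq_coordinates)
qed

lemma bump_minus: "bump r (- z) = bump r z"
 by (simp add: bump_def)

lemma bump_continuous: "continuous_on UNIV (bump r)"
 using bump_C_k[of 0 r] by simp

lemma bump_measurable [measurable]: "bump r \<in> borel_measurable borel"
 by (intro borel_measurable_continuous_onI bump_continuous)

lemma bump_bound: "bump r z \<le> 1"
 by (simp add: bump_def flat_fun_def)

lemma bump_integral:
 assumes "r > 0"
 shows "(\<integral>\<^sub>+z. ennreal (bump r z)) \<noteq> 0" "(\<integral>\<^sub>+z. ennreal (bump r z)) < \<infinity>"
proof -
 show "(\<integral>\<^sup>+z. ennreal (bump r z) \<partial>(lborel :: (real^'n) measure)) \<noteq> 0"
 proof
  assume "(\<integral>\<^sup>+z. ennreal (bump r z) \<partial>(lborel :: (real^'n) measure)) = 0"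
  then have "AE z in (lborel :: (real^'n) measure). ennreal (bump r z) = 0"
   by (subst (asm) nn_integral_0_iff_AE) auto
  then have "AE z in (lborel :: (real^'n) measure). z \<notin> ball 0 r"
   by eventually_elim (use bump_nonneg bump_pos_iff[OF assms] in \<open>auto simp: ennreal_eq_0_iff intro: antisym\<close>)
  then have "emeasure lborel (ball (0::real^'n) r) = 0"
   by (subst (asm) AE_iff_measurable[of "ball 0 r"]) auto
  then have "ball (0::real^'n) r \<in> null_sets lborel" by auto
  then have "negligible (ball (0::real^'n) r)"
   by (simp add: negligible_iff_null_sets null_sets_completionI)
  then show False using assms
   using open_not_negligible[of "ball (0::real^'n) r"] by simp
 qed
 have "ennreal (bump r z) \<le> indicator (cball 0 r) z" for z :: "real^'n"
  using bump_bound[of r z] bump_pos_iff[OF assms, of z] by (cases "norm z \<le> r") auto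
 then have "(\<integral>\<^sup>+z. ennreal (bump r z) \<partial>(lborel :: (real^'n) measure)) \<le> (\<integral>\<^sup>+z. indicator (cball 0 r) z \<partial>(lborel :: (real^'n) measure))"
  by (intro nn_integral_mono)
 also have "(\<integral>\<^sup>+z. indicator (cball 0 r) z \<partial>(lborel :: (real^'n) measure)) < \<infinity>" using emeasure_bounded_finite[of "cball (0::real^'n) r"] by simp
 finally show "(\<integral>\<^sup>+z. ennreal (bump r z) \<partial>(lborel :: (real^'n) measure)) < \<infinity>" .
qed

definition mollifier :: "real => real^'n::finite => real" where
 "mollifier r z = bump r z / enn2real (\<integral>\<^sup>+z. ennreal (bump r z) \<partial>(lborel :: (real^'n) measure))"

lemma mollifier_nonneg: "mollifier r z \<ge> 0"
 by (simp add: mollifier_def bump_nonneg)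

lemma mollifier_C_k: "C_k k (mollifier r)"
 unfolding mollifier_def[abs_def] divide_inverse by (intro C_k_mult C_k_const bump_C_k)

lemma mollifier_eq_0: "r > 0 ==> r \<le> norm z ==> mollifier r z = 0"
 using bump_pos_iff[of r z] by (auto simp: mollifier_def)

lemma mollifier_minus: "mollifier r (- z) = mollifier r z"
 by (simp add: mollifier_def bump_minus)

lemma mollifier_continuous: "continuous_on UNIV (mollifier r)"
 using mollifier_C_k[of 0 r] by simp

lemma mollifier_measurable [measurable]: "mollifier r \<in> borel_measurable borel"
 by (intro borel_measurable_continuous_onI mollifier_continuous)

lemma mollifier_bounded: "\<exists>B. \<forall>z. mollifier r z \<le> B"
 unfolding mollifier_def using bump_bound by (metis divide_right_mono enn2real_nonneg)

lemma mollifier_integral: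
 assumes "r > 0"
 shows "(\<integral>\<^sup>+z. ennreal (mollifier r z) \<partial>(lborel :: (real^'n::finite) measure)) = 1"
proof -
 define c where "c = (\<integral>\<^sup>+z. ennreal (bump r z) \<partial>(lborel :: (real^'n) measure))"
 have c: "c \<noteq> 0" "c < \<infinity>" using bump_integral[OF assms] by (auto simp: c_def)
 then have c': "enn2real c > 0" "ennreal (enn2real c) = c" by (auto simp: enn2real_positive_iff less_top pos2 zero_less_iff_neq_zero)
 have "(\<integral>\<^sup>+z. ennreal (mollifier r z) \<partial>(lborel :: (real^'n) measure)) = (\<integral>\<^sup>+z. ennreal (bump r z) / c \<partial>(lborel :: (real^'n) measure))"
  using c' by (intro nn_integral_cong) (simp add: mollifier_def c_def[symmetric] divide_ennreal[symmetric] bump_nonneg)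
 also have "\<dots> = c / c" by (simp add: nn_integral_divide c_def)
 also have "\<dots> = 1" using c by (simp add: ennreal_divide_self)
 finally show ?thesis .
qed

section \<open>Mollification\<close>

lemma AE_lebesgue_on_iff:
 "\<Omega> \<in> sets borel ==> (AE z in lebesgue_on \<Omega>. P z) \<longleftrightarrow> (AE z\<in>\<Omega> in lborel. P z)"
 by (subst AE_restrict_space_iff) (auto simp: AE_completion_iff)

lemma nn_integral_lebesgue_on:
 "\<Omega> \<in> sets borel ==> (\<integral>\<^sup>+z. f z \<partial>lebesgue_on \<Omega>) = (\<integral>\<^sub>+z. f z * indicator \<Omega> z)"
 by (subst nn_integral_restrict_space) (auto simp: nn_integral_completion)

lemma borel_representative:
 fixes f :: "'a::euclidean_space => real"
 assumes f: "f \<in> borel_measurable (lebesgue_on \<Omega>)" and \<Omega>: "\<Omega> \<in> sets borel"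
 obtains f' where "f' \<in> borel_measurable borel" "\<And>z. z \<notin> \<Omega> ==> f' z = 0" "AE z\<in>\<Omega> in lborel. f' z = f z"
proof -
 have "(\<lambda>z. if z \<in> \<Omega> then f z else 0) \<in> borel_measurable lebesgue"
  using f \<Omega> by (subst borel_measurable_if) auto
 from completion_ex_borel_measurable_real[OF this]
 obtain g where g: "g \<in> borel_measurable lborel" "AE z in lborel. (if z \<in> \<Omega> then f z else 0) = g z"
  by auto
 have [measurable]: "g \<in> borel_measurable borel" "\<Omega> \<in> sets borel" using g \<Omega> by auto
 show thesis
 proof (rule that[of "\<lambda>z. if z \<in> \<Omega> then g z else 0"])
  show "AE z\<in>\<Omega> in lborel. (if z \<in> \<Omega> then g z else 0) = f z"
   using g(2) by eventually_elim auto
 qed auto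
qed

lemma integrable_mult_bounded:
 fixes f h :: "'a => real"
 assumes f: "integrable M f" and [measurable]: "h \<in> borel_measurable M" and B: "\<And>x. \<bar>h x\<bar> \<le> B"
 shows "integrable M (\<lambda>x. f x * h x)"
proof (rule Bochner_Integration.integrable_bound[of M "\<lambda>x. B * f x"])
 show "AE x in M. norm (f x * h x) \<le> norm (B * f x)"
 proof (intro AE_I2)
  fix x
  have "\<bar>h x\<bar> \<le> \<bar>B\<bar>" using B[of x] by linarith
  then show "norm (f x * h x) \<le> norm (B * f x)"
   using mult_left_mono[of "\<bar>h x\<bar>" "\<bar>B\<bar>" "\<bar>f x\<bar>"] by (simp add: abs_mult mult.commute)
 qed
qed (use f in auto)

definition mollify :: "real => (real^'n::finite => real) => real^'n => real" where
 "mollify r f z = (\<integral>y. f y * mollifier r (y - z) \<partial>lborel)"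

lemma mollifier_abs_bounded: "\<exists>B. \<forall>z. \<bar>mollifier r z\<bar> \<le> B"
 using mollifier_bounded[of r] by (simp add: mollifier_nonneg)

lemma mollify_integrable:
 fixes f :: "real^'n::finite => real"
 assumes "integrable lborel f"
 shows "integrable lborel (\<lambda>y. f y * mollifier r (y - z))"
proof -
 obtain B where "\<And>x::real^'n. \<bar>mollifier r x\<bar> \<le> B" using mollifier_abs_bounded by blast
 then show ?thesis by (intro integrable_mult_bounded[OF assms, of _ B]) auto
qed

lemma mollify_nonneg: "(\<And>y. f y \<ge> 0) ==> mollify r f z \<ge> 0"
 unfolding mollify_def by (intro integral_nonneg_AE) (auto simp: mollifier_nonneg)

lemma mollify_continuous:
 fixes f :: "real^'n::finite => real"
 assumes f: "integrable lborel f"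
 shows "continuous_on UNIV (mollify r f)"
proof (rule continuous_at_imp_continuous_on, rule ballI)
 fix z :: "real^'n"
 obtain B where B: "\<And>x::real^'n. \<bar>mollifier r x\<bar> \<le> B" using mollifier_abs_bounded by blast
 have [measurable]: "f \<in> borel_measurable borel" using f by auto
 show "isCont (mollify r f) z"
 proof (unfold continuous_at_sequentially, intro allI impI)
  fix x assume x: "x \<longlonglongrightarrow> z"
  show "(mollify r f \<circ> x) \<longlonglongrightarrow> mollify r f z"
   unfolding o_def mollify_def
  proof (rule integral_dominated_convergence[where w="\<lambda>y. B * \<bar>f y\<bar>"])
   show "AE y in lborel. (\<lambda>n. f y * mollifier r (y - x n)) \<longlonglongrightarrow> f y * mollifier r (y - z)"
   proof (intro AE_I2 tendsto_mult tendsto_const)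
    fix y
    have "(\<lambda>n. y - x n) \<longlonglongrightarrow> y - z" by (intro tendsto_intros x)
    then show "(\<lambda>n. mollifier r (y - x n)) \<longlonglongrightarrow> mollifier r (y - z)"
     by (intro continuous_on_tendsto_compose[OF mollifier_continuous]) auto
   qed
   show "AE y in lborel. norm (f y * mollifier r (y - x n)) \<le> B * \<bar>f y\<bar>" for n
    using mult_left_mono[OF B, of "\<bar>f _\<bar>"] by (intro AE_I2) (simp add: abs_mult mult.commute)
  qed (use f in auto)
 qed
qed

lemma mollify_measurable [measurable]:
 "integrable lborel f ==> mollify r f \<in> borel_measurable borel"
 by (intro borel_measurable_continuous_onI mollify_continuous)

lemma nn_integral_mollifier_shift:
 assumes "r > 0"
 shows "(\<integral>\<^sup>+y. ennreal (mollifier r (y - z)) \<partial>(lborel :: (real^'n::finite) measure)) = 1"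
 using nn_integral_lborel_translate[of "\<lambda>y. ennreal (mollifier r (y :: real^'n))" "- z"] mollifier_integral[OF assms] by simp

lemma integral_mollifier_shift:
 assumes "r > 0"
 shows "(\<integral>y. mollifier r (y - z) \<partial>(lborel :: (real^'n::finite) measure)) = 1"
 using nn_integral_mollifier_shift[OF assms, of z]
 by (subst integral_eq_nn_integral) (auto simp: mollifier_nonneg)

lemma integrable_mollifier_shift:
 fixes z :: "real^'n::finite"
 assumes "r > 0"
 shows "integrable lborel (\<lambda>y. mollifier r (y - z))"
 using nn_integral_mollifier_shift[OF assms, of z] by (intro integrableI_nonneg) (auto simp: mollifier_nonneg)

text \<open>The mollifier has mass 1, so \<open>f z\<close> is itself an average and the difference is an
 average of increments of \<open>f\<close>.\<close>
lemma mollify_minus_self_le: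
 fixes f :: "real^'n::finite => real"
 assumes f: "integrable lborel f" and r: "r > 0"
 shows "ennreal \<bar>mollify r f z - f z\<bar> \<le> (\<integral>\<^sub>+y. ennreal \<bar>f (z + y) - f z\<bar> * ennreal (mollifier r y))"
proof -
 have [measurable]: "f \<in> borel_measurable borel" using f by auto
 have int: "integrable lborel (\<lambda>y. f y * mollifier r (y - z) - f z * mollifier r (y - z))"
  by (intro Bochner_Integration.integrable_diff mollify_integrable f integrable_mult_right integrable_mollifier_shift r)
 have "mollify r f z - f z = (\<integral>y. f y * mollifier r (y - z) - f z * mollifier r (y - z) \<partial>lborel)"
  using integral_mollifier_shift[OF r, of z]
  by (subst Bochner_Integration.integral_diff[OF mollify_integrable[OF f] integrable_mult_right[OF integrable_mollifier_shift[OF r]]])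
   (simp add: mollify_def)
 then have "ennreal \<bar>mollify r f z - f z\<bar> \<le> (\<integral>\<^sub>+y. ennreal \<bar>f y * mollifier r (y - z) - f z * mollifier r (y - z)\<bar>)"
  using integral_norm_bound_ennreal[OF int] by simp
 also have "\<dots> = (\<integral>\<^sub>+y. ennreal \<bar>f y - f z\<bar> * ennreal (mollifier r (y - z)))"
  by (intro nn_integral_cong) (simp add: mollifier_nonneg abs_mult flip: ennreal_mult left_diff_distrib)
 also have "\<dots> = (\<integral>\<^sub>+y. ennreal \<bar>f (y + z) - f z\<bar> * ennreal (mollifier r (y + z - z)))"
  by (rule nn_integral_lborel_translate[of "\<lambda>y. ennreal \<bar>f y - f z\<bar> * ennreal (mollifier r (y - z))", symmetric]) measurable
 finally show ?thesis by (simp add: add.commute)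
qed

lemma L1_translation_uniform:
 fixes f :: "'a::euclidean_space => real"
 assumes f: "integrable lborel f" and e: "e > 0"
 shows "\<exists>d>0. \<forall>y. norm y < d --> (\<integral>\<^sub>+x. ennreal \<bar>f (x + y) - f x\<bar>) \<le> ennreal e"
proof (rule ccontr)
 assume "\<not> ?thesis"
 then have "\<exists>y. norm y < 1 / (real n + 1) \<and> \<not> (\<integral>\<^sub>+x. ennreal \<bar>f (x + y) - f x\<bar>) \<le> ennreal e" for n :: nat
  by (metis of_nat_0_le_iff add_nonneg_pos zero_less_one divide_pos_pos)
 then obtain y where y: "\<And>n. norm (y n) < 1 / (real n + 1)" "\<And>n. \<not> (\<integral>\<^sub>+x. ennreal \<bar>f (x + y n) - f x\<bar>) \<le> ennreal e"
  by metis
 have "y \<longlonglongrightarrow> 0"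
 proof (rule Lim_null_comparison[OF always_eventually])
  show "\<forall>n. norm (y n) \<le> 1 / (real n + 1)" using y(1) less_imp_le by blast
  show "(\<lambda>n. 1 / (real n + 1)) \<longlonglongrightarrow> 0" using LIMSEQ_inverse_real_of_nat by (simp add: inverse_eq_divide add.commute)
 qed
 from order_tendstoD(2)[OF L1_translation_continuous[OF f this], of "ennreal e"] e
 have "eventually (\<lambda>n. (\<integral>\<^sub>+x. ennreal \<bar>f (x + y n) - f x\<bar>) < ennreal e) sequentially" by simp
 then obtain n where "(\<integral>\<^sub>+x. ennreal \<bar>f (x + y n) - f x\<bar>) < ennreal e"
  by (auto simp: eventually_sequentially)
 then show False using y(2)[of n] by simp
qed

lemma mollify_L1_tendsto:
 fixes f :: "real^'n::finite => real"
 assumes f: "integrable lborel f" and r: "\<And>n. r n > 0" "r \<longlonglongrightarrow> 0"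
 shows "(\<lambda>n. \<integral>\<^sub>+z. ennreal \<bar>mollify (r n) f z - f z\<bar>) \<longlonglongrightarrow> 0"
proof (rule tendsto_0_if_Limsup_eq_0_ennreal)
 have [measurable]: "f \<in> borel_measurable borel" using f by auto
 have L: "limsup (\<lambda>n. \<integral>\<^sub>+z. ennreal \<bar>mollify (r n) f z - f z\<bar>) \<le> 0 + ennreal e" if e: "e > 0" for e :: real
 proof -
  obtain d where d: "d > 0" "\<And>y. norm y < d ==> (\<integral>\<^sub>+x. ennreal \<bar>f (x + y) - f x\<bar>) \<le> ennreal e"
   using L1_translation_uniform[OF f e] by blast
  have "(\<integral>\<^sub>+z. ennreal \<bar>mollify (r n) f z - f z\<bar>) \<le> ennreal e" if n: "r n < d" for n
  proof -
   have "(\<integral>\<^sub>+z. ennreal \<bar>mollify (r n) f z - f z\<bar>) \<le>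
    (\<integral>\<^sub>+z. (\<integral>\<^sub>+y. ennreal \<bar>f (z + y) - f z\<bar> * ennreal (mollifier (r n) y)))"
    by (intro nn_integral_mono mollify_minus_self_le f r)
   also have "\<dots> = (\<integral>\<^sub>+y. (\<integral>\<^sub>+z. ennreal \<bar>f (z + y) - f z\<bar> * ennreal (mollifier (r n) y)))"
    by (rule lborel_pair.Fubini') measurable
   also have "\<dots> = (\<integral>\<^sub>+y. (\<integral>\<^sub>+z. ennreal \<bar>f (z + y) - f z\<bar>) * ennreal (mollifier (r n) y))"
    by (intro nn_integral_cong nn_integral_multc) measurable
   also have "\<dots> \<le> (\<integral>\<^sup>+y. ennreal e * ennreal (mollifier (r n) y) \<partial>(lborel :: (real^'n) measure))"
   proof (intro nn_integral_mono)
    fix y :: "real^'n"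
    show "(\<integral>\<^sub>+z. ennreal \<bar>f (z + y) - f z\<bar>) * ennreal (mollifier (r n) y) \<le> ennreal e * ennreal (mollifier (r n) y)"
     using d(2)[of y] n mollifier_eq_0[of "r n" y] r(1)[of n]
     by (cases "norm y < d") (auto intro: mult_right_mono)
   qed
   also have "\<dots> = ennreal e"
    using mollifier_integral[OF r(1), where 'n = 'n] by (subst nn_integral_cmult) auto
   finally show ?thesis .
  qed
  then have "limsup (\<lambda>n. \<integral>\<^sub>+z. ennreal \<bar>mollify (r n) f z - f z\<bar>) \<le> ennreal e"
   using order_tendstoD(2)[OF r(2) d(1)] by (intro Limsup_bounded) (auto elim: eventually_mono)
  then show ?thesis by simp
 qed
 have "limsup (\<lambda>n. \<integral>\<^sub>+z. ennreal \<bar>mollify (r n) f z - f z\<bar>) \<le> 0"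
  by (rule ennreal_le_epsilon) (rule L)
 then show "limsup (\<lambda>n. \<integral>\<^sub>+z. ennreal \<bar>mollify (r n) f z - f z\<bar>) = 0" by simp
qed

text \<open>Jensen's inequality for the probability density \<open>mollifier r (y - z)\<close>, with a factor
 \<open>2\<^sup>p\<close> from the elementary Hoelder bound.\<close>
lemma mollify_powr_le:
 fixes g :: "real^'n::finite => real"
 assumes g: "integrable lborel g" "\<And>y. g y \<ge> 0" and r: "r > 0" and p: "p \<ge> 1"
 shows "ennreal (mollify r g z powr p) \<le> ennreal (2 powr p) * (\<integral>\<^sub>+y. ennreal (g y powr p) * ennreal (mollifier r (y - z)))"
proof -
 have [measurable]: "g \<in> borel_measurable borel" using g by auto
 define M where "M = density lborel (\<lambda>y::real^'n. ennreal (mollifier r (y - z)))"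
 have M: "emeasure M (space M) \<le> ennreal 1"
  using nn_integral_mollifier_shift[OF r, of z] by (simp add: M_def emeasure_density)
 have [measurable]: "g \<in> borel_measurable M" by (simp add: M_def)
 have "ennreal (enn2real (\<integral>\<^sup>+y. ennreal (g y) \<partial>M) powr p) \<le> ennreal (2 powr p * 1 powr (p - 1)) * (\<integral>\<^sup>+y. ennreal (g y powr p) \<partial>M)"
  by (rule nn_integral_Jensen_bound[OF _ g(2) M _ p]) auto
 moreover have "(\<integral>\<^sup>+y. ennreal (g y) \<partial>M) = ennreal (mollify r g z)"
  unfolding mollify_def M_def
  using mollify_integrable[OF g(1)] g(2)
  by (subst nn_integral_eq_integral[symmetric])
   (auto simp: nn_integral_density mollifier_nonneg ennreal_mult mult.commute)
 moreover have "(\<integral>\<^sup>+y. ennreal (g y powr p) \<partial>M) = (\<integral>\<^sub>+y. ennreal (g y powr p) * ennreal (mollifier r (y - z)))"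
  unfolding M_def by (subst nn_integral_density) (auto simp: mult.commute)
 ultimately show ?thesis by (simp add: mollify_nonneg[OF g(2)])
qed

lemma nn_integral_mollify_powr_le:
 fixes g :: "real^'n::finite => real"
 assumes g: "integrable lborel g" "\<And>y. g y \<ge> 0" and r: "r > 0" and p: "p \<ge> 1"
 shows "(\<integral>\<^sub>+z. ennreal (mollify r g z powr p)) \<le> ennreal (2 powr p) * (\<integral>\<^sub>+y. ennreal (g y powr p))"
proof -
 have [measurable]: "g \<in> borel_measurable borel" using g by auto
 have "(\<integral>\<^sub>+z. ennreal (mollify r g z powr p)) \<le>
  (\<integral>\<^sub>+z. ennreal (2 powr p) * (\<integral>\<^sub>+y. ennreal (g y powr p) * ennreal (mollifier r (y - z))))"
  by (intro nn_integral_mono mollify_powr_le assms)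
 also have "\<dots> = ennreal (2 powr p) * (\<integral>\<^sub>+z. (\<integral>\<^sub>+y. ennreal (g y powr p) * ennreal (mollifier r (y - z))))"
  by (rule nn_integral_cmult) measurable
 also have "(\<integral>\<^sub>+z. (\<integral>\<^sub>+y. ennreal (g y powr p) * ennreal (mollifier r (y - z)))) =
  (\<integral>\<^sub>+y. (\<integral>\<^sub>+z. ennreal (g y powr p) * ennreal (mollifier r (y - z))))"
  by (rule lborel_pair.Fubini') measurable
 also have "\<dots> = (\<integral>\<^sub>+y. ennreal (g y powr p))"
 proof (intro nn_integral_cong)
  fix y :: "real^'n"
  have "mollifier r (y - z) = mollifier r (z - y)" for z :: "real^'n"
   using mollifier_minus[of r "y - z"] by simp
  then show "(\<integral>\<^sub>+z. ennreal (g y powr p) * ennreal (mollifier r (y - z))) = ennreal (g y powr p)"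
   using nn_integral_mollifier_shift[OF r, of y] by (subst nn_integral_cmult) auto
 qed
 finally show ?thesis .
qed

section \<open>From weak gradients to segment bounds\<close>

lemma frechet_derivative_partial_deriv:
 fixes f :: "real^'n::finite => real"
 assumes "f differentiable_on UNIV"
 shows "frechet_derivative f (at z) h = (\<Sum>i\<in>UNIV. h $ i * partial_deriv i f z)"
proof -
 have lin: "linear (frechet_derivative f (at z))"
  using differentiable_on_UNIV_D[OF assms] by (rule has_derivative_linear)
 have "frechet_derivative f (at z) h = frechet_derivative f (at z) (\<Sum>i\<in>UNIV. h $ i *\<^sub>R axis i 1)"
  using basis_expansion[of h] by (simp add: scalar_mult_eq_scaleR)
 also have "\<dots> = (\<Sum>i\<in>UNIV. h $ i * partial_deriv i f z)"
  by (simp add: linear_sum[OF lin] linear_scale[OF lin] partial_deriv_def)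
 finally show ?thesis .
qed

lemma partial_deriv_eq_0_outside:
 fixes \<eta> :: "real^'n::finite => real"
 assumes "closed K" "\<And>z. z \<notin> K ==> \<eta> z = 0" "x \<notin> K"
 shows "partial_deriv i \<eta> x = 0"
proof -
 have "((\<lambda>z. 0) has_derivative (\<lambda>h. 0)) (at x)" by simp
 then have "(\<eta> has_derivative (\<lambda>h. 0)) (at x)"
  by (rule has_derivative_transform_within_open[where s="- K"]) (use assms in auto)
 then show ?thesis by (simp add: partial_deriv_eqI)
qed

lemma partial_deriv_bounded:
 fixes \<eta> :: "real^'n::finite => real"
 assumes \<eta>: "C_k (Suc 0) \<eta>" and K: "compact K" "\<And>z. z \<notin> K ==> \<eta> z = 0"
 shows "\<exists>B. \<forall>z. \<bar>partial_deriv i \<eta> z\<bar> \<le> B"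
proof -
 have "continuous_on K (partial_deriv i \<eta>)"
  using \<eta> by (auto intro: continuous_on_subset)
 then have "bounded (partial_deriv i \<eta> ` K)"
  using K by (intro compact_imp_bounded compact_continuous_image)
 then obtain B where B: "\<And>z. z \<in> K ==> \<bar>partial_deriv i \<eta> z\<bar> \<le> B"
  by (auto simp: bounded_iff)
 have "partial_deriv i \<eta> z = 0" if "z \<notin> K" for z
  using partial_deriv_eq_0_outside[OF compact_imp_closed[OF K(1)] K(2) that] .
 then have "\<bar>partial_deriv i \<eta> z\<bar> \<le> max B 0" for z
  using B[of z] by (cases "z \<in> K") auto
 then show ?thesis by blast
qed

lemma test_function_Lipschitz:
 fixes \<eta> :: "real^'n::finite => real"
 assumes \<eta>: "C_k (Suc 0) \<eta>" and K: "compact K" "\<And>z. z \<notin> K ==> \<eta> z = 0"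
 shows "\<exists>B\<ge>0. \<forall>x y. \<bar>\<eta> x - \<eta> y\<bar> \<le> B * norm (x - y)"
proof -
 obtain B where B: "\<And>i z. \<bar>partial_deriv i \<eta> z\<bar> \<le> B i"
  using partial_deriv_bounded[OF assms] by metis
 have B0: "(\<Sum>i\<in>UNIV. B i) \<ge> 0"
  using B by (intro sum_nonneg) (meson abs_ge_zero order_trans)
 have d: "\<eta> differentiable_on UNIV" using \<eta> by simp
 have on: "onorm (frechet_derivative \<eta> (at x)) \<le> (\<Sum>i\<in>UNIV. B i)" for x
 proof (rule onorm_le)
  fix h
  have "norm (frechet_derivative \<eta> (at x) h) \<le> (\<Sum>i\<in>UNIV. \<bar>h $ i * partial_deriv i \<eta> x\<bar>)"
   by (simp add: frechet_derivative_partial_deriv[OF d])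
  also have "\<dots> \<le> (\<Sum>i\<in>UNIV. norm h * B i)"
   unfolding abs_mult by (intro sum_mono mult_mono B component_le_norm_cart) auto
  finally show "norm (frechet_derivative \<eta> (at x) h) \<le> (\<Sum>i\<in>UNIV. B i) * norm h"
   by (simp add: sum_distrib_left mult.commute)
 qed
 have "norm (\<eta> x - \<eta> y) \<le> (\<Sum>i\<in>UNIV. B i) * norm (x - y)" for x y
  by (rule differentiable_bound[of UNIV \<eta> "\<lambda>x. frechet_derivative \<eta> (at x)"])
   (use on differentiable_on_UNIV_D[OF d] in auto)
 then show ?thesis using B0 by auto
qed

lemma directional_difference_quotient_tendsto:
 fixes \<eta> :: "real^'n::finite => real"
 assumes \<eta>: "C_k (Suc 0) \<eta>" and K: "compact K" "\<And>z. z \<notin> K ==> \<eta> z = 0" and f: "integrable lborel f"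
 shows "((\<lambda>s. \<integral>y. f y * ((\<eta> (y + s *\<^sub>R h) - \<eta> y) / s) \<partial>lborel) \<longlongrightarrow>
   (\<integral>y. f y * (\<Sum>i\<in>UNIV. h $ i * partial_deriv i \<eta> y) \<partial>lborel)) (at 0)"
proof -
 have d: "\<eta> differentiable_on UNIV" using \<eta> by simp
 then have "continuous_on UNIV \<eta>" by (rule differentiable_imp_continuous_on)
 then have [measurable]: "\<eta> \<in> borel_measurable borel" by (rule borel_measurable_continuous_onI)
 have [measurable]: "partial_deriv i \<eta> \<in> borel_measurable borel" for i
  using \<eta> by (intro borel_measurable_continuous_onI) auto
 have [measurable]: "f \<in> borel_measurable borel" using f by auto
 obtain B where B: "B \<ge> 0" "\<And>x y. \<bar>\<eta> x - \<eta> y\<bar> \<le> B * norm (x - y)"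
  using test_function_Lipschitz[OF \<eta> K] by blast
 show ?thesis
 proof (subst tendsto_at_iff_sequentially, intro allI impI)
  fix s :: "nat => real" assume s: "\<forall>n. s n \<in> UNIV - {0}" "s \<longlonglongrightarrow> 0"
  show "((\<lambda>s. \<integral>y. f y * ((\<eta> (y + s *\<^sub>R h) - \<eta> y) / s) \<partial>lborel) \<circ> s) \<longlonglongrightarrow>
   (\<integral>y. f y * (\<Sum>i\<in>UNIV. h $ i * partial_deriv i \<eta> y) \<partial>lborel)"
   unfolding o_def
  proof (rule integral_dominated_convergence[where w="\<lambda>y. \<bar>f y\<bar> * (B * norm h)"])
   show "AE y in lborel. (\<lambda>n. f y * ((\<eta> (y + s n *\<^sub>R h) - \<eta> y) / s n)) \<longlonglongrightarrow> f y * (\<Sum>i\<in>UNIV. h $ i * partial_deriv i \<eta> y)"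
   proof (intro AE_I2 tendsto_mult tendsto_const)
    fix y
    have "((\<lambda>s. y + s *\<^sub>R h) has_derivative (\<lambda>s. s *\<^sub>R h)) (at 0)"
     by (auto intro!: derivative_eq_intros)
    then have "((\<lambda>s. \<eta> (y + s *\<^sub>R h)) has_derivative (\<lambda>s. frechet_derivative \<eta> (at y) (s *\<^sub>R h))) (at 0)"
     using has_derivative_compose[of "\<lambda>s. y + s *\<^sub>R h" "\<lambda>s. s *\<^sub>R h" 0 UNIV \<eta> "frechet_derivative \<eta> (at y)"]
      differentiable_on_UNIV_D[OF d, of y] by simp
    then have "((\<lambda>s. \<eta> (y + s *\<^sub>R h)) has_real_derivative (\<Sum>i\<in>UNIV. h $ i * partial_deriv i \<eta> y)) (at 0)"
     by (simp add: has_field_derivative_def frechet_derivative_partial_deriv[OF d] mult_commute_abs mult.assoc flip: sum_distrib_left)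
    then have "((\<lambda>s. (\<eta> (y + s *\<^sub>R h) - \<eta> y) / s) \<longlongrightarrow> (\<Sum>i\<in>UNIV. h $ i * partial_deriv i \<eta> y)) (at 0)"
     by (simp add: DERIV_def)
    then show "(\<lambda>n. (\<eta> (y + s n *\<^sub>R h) - \<eta> y) / s n) \<longlonglongrightarrow> (\<Sum>i\<in>UNIV. h $ i * partial_deriv i \<eta> y)"
     using s by (auto simp: tendsto_at_iff_sequentially o_def)
   qed
   show "AE y in lborel. norm (f y * ((\<eta> (y + s n *\<^sub>R h) - \<eta> y) / s n)) \<le> \<bar>f y\<bar> * (B * norm h)" for n
   proof (intro AE_I2)
    fix y
    have "\<bar>\<eta> (y + s n *\<^sub>R h) - \<eta> y\<bar> / \<bar>s n\<bar> \<le> B * norm h"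
     using B(2)[of "y + s n *\<^sub>R h" y] s(1) by (simp add: divide_le_eq mult_ac)
    then show "norm (f y * ((\<eta> (y + s n *\<^sub>R h) - \<eta> y) / s n)) \<le> \<bar>f y\<bar> * (B * norm h)"
     using mult_left_mono[of _ _ "\<bar>f y\<bar>"] by (simp add: abs_mult flip: times_divide_eq_right)
   qed
  qed (use f in auto)
 qed
qed

lemma test_functionD:
 assumes "\<eta> \<in> test_functions \<Omega>"
 shows "C_k k \<eta>" "compact (closure {z. \<eta> z \<noteq> 0})" "closure {z. \<eta> z \<noteq> 0} \<subseteq> \<Omega>"
  "z \<notin> closure {z. \<eta> z \<noteq> 0} ==> \<eta> z = 0"
 using assms closure_subset[of "{z. \<eta> z \<noteq> 0}"] by (auto simp: test_functions_def)

lemma test_function_bounded: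
 fixes \<eta> :: "real^'n::finite => real"
 assumes "\<eta> \<in> test_functions \<Omega>"
 shows "\<eta> \<in> borel_measurable borel" "\<exists>B. \<forall>z. \<bar>\<eta> z\<bar> \<le> B"
proof -
 have c: "continuous_on UNIV \<eta>" using test_functionD(1)[OF assms, of 0] by simp
 then show "\<eta> \<in> borel_measurable borel" by (rule borel_measurable_continuous_onI)
 have "bounded (\<eta> ` closure {z. \<eta> z \<noteq> 0})"
  using test_functionD(2)[OF assms] c by (intro compact_imp_bounded compact_continuous_image) (auto intro: continuous_on_subset)
 then obtain B where B: "\<And>z. z \<in> closure {z. \<eta> z \<noteq> 0} ==> \<bar>\<eta> z\<bar> \<le> B"
  by (auto simp: bounded_iff)
 have "\<bar>\<eta> z\<bar> \<le> max B 0" for z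
  using B[of z] test_functionD(4)[OF assms, of z] by (cases "z \<in> closure {z. \<eta> z \<noteq> 0}") auto
 then show "\<exists>B. \<forall>z. \<bar>\<eta> z\<bar> \<le> B" by blast
qed

lemma mollifier_test_function:
 fixes x :: "real^'n::finite"
 assumes "r > 0" "cball x r \<subseteq> \<Omega>"
 shows "(\<lambda>y. mollifier r (y - x)) \<in> test_functions \<Omega>"
proof -
 have "{y. mollifier r (y - x) \<noteq> 0} \<subseteq> cball x r"
  using mollifier_eq_0[OF assms(1)] by (force simp: dist_norm norm_minus_commute not_le intro: less_imp_le)
 then have sub: "closure {y. mollifier r (y - x) \<noteq> 0} \<subseteq> cball x r"
  by (intro closure_minimal) auto
 then have "compact (closure {y. mollifier r (y - x) \<noteq> 0})"
  by (meson bounded_cball bounded_subset closed_closure compact_eq_bounded_closed)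
 then show ?thesis
  using sub assms(2) by (auto simp: test_functions_def intro: C_k_translate mollifier_C_k)
qed

text \<open>The definition of a weak gradient speaks of functions that are only Lebesgue measurable on
 \<open>\<Omega>\<close>; the Borel representative \<open>f\<close> lets the identity be used with integrals
 over the whole space.\<close>
lemma weak_gradient_lborel:
 fixes f f0 :: "real^'n::finite => real"
 assumes \<Omega>: "open \<Omega>" and wg: "weak_gradient \<Omega> f0 G" and [measurable]: "f \<in> borel_measurable borel"
  and ae: "AE z\<in>\<Omega> in lborel. f z = f0 z" and \<eta>: "\<eta> \<in> test_functions \<Omega>"
 shows "integrable lebesgue (\<lambda>y. G y $ i * \<eta> y)"
  "(\<integral>y. f y * partial_deriv i \<eta> y \<partial>lborel) = - (\<integral>y. G y $ i * \<eta> y \<partial>lebesgue)"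
proof -
 have \<Omega>b: "\<Omega> \<in> sets borel" using \<Omega> by auto
 define K where "K = closure {z. \<eta> z \<noteq> 0}"
 have K: "compact K" "K \<subseteq> \<Omega>" "\<And>z. z \<notin> K ==> \<eta> z = 0"
  unfolding K_def using test_functionD(2,3,4)[OF \<eta>] by blast+
 have d0: "partial_deriv i \<eta> z = 0" if "z \<notin> K" for z
  using partial_deriv_eq_0_outside[OF compact_imp_closed[OF K(1)] K(3) that] .
 have out: "partial_deriv i \<eta> z = 0" "\<eta> z = 0" if "z \<notin> \<Omega>" for z
  using d0[of z] K that by blast+
 have [measurable]: "\<eta> \<in> borel_measurable borel" and "\<exists>B. \<forall>z. \<bar>\<eta> z\<bar> \<le> B"
  using test_function_bounded[OF \<eta>] by auto
 then obtain B where B: "\<And>z. \<bar>\<eta> z\<bar> \<le> B" by blast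
 have C1: "C_k (Suc 0) \<eta>" using test_functionD(1)[OF \<eta>] .
 then have [measurable]: "partial_deriv i \<eta> \<in> borel_measurable borel"
  by (intro borel_measurable_continuous_onI) auto
 obtain B' where B': "\<And>z. \<bar>partial_deriv i \<eta> z\<bar> \<le> B'"
  using partial_deriv_bounded[OF C1 K(1) K(3)] by blast
 have aiK: "f0 absolutely_integrable_on K" "G absolutely_integrable_on K"
  using wg K by (auto simp: weak_gradient_def)
 have "integrable lebesgue (\<lambda>y. (indicator K y *\<^sub>R G y) $ i * \<eta> y)"
 proof (rule integrable_mult_bounded[OF _ _ B])
  show "integrable lebesgue (\<lambda>y. (indicator K y *\<^sub>R G y) $ i)"
   using aiK(2) unfolding set_integrable_def by (rule integrable_bounded_linear[OF bounded_linear_vec_nth])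
 qed (rule measurable_completion, simp)
 moreover have "(indicator K y *\<^sub>R G y) $ i * \<eta> y = G y $ i * \<eta> y" for y
  using K(3)[of y] by (auto simp: indicator_def)
 ultimately show int: "integrable lebesgue (\<lambda>y. G y $ i * \<eta> y)" by (simp only:)
 have int2: "integrable lebesgue (\<lambda>y. (indicator K y *\<^sub>R f0 y) * partial_deriv i \<eta> y)"
  by (rule integrable_mult_bounded[OF _ _ B']) (use aiK(1) in \<open>auto simp: set_integrable_def intro: measurable_completion\<close>)
 have eq2: "(indicator K y *\<^sub>R f0 y) * partial_deriv i \<eta> y = f0 y * partial_deriv i \<eta> y" for y
  using d0[of y] by (auto simp: indicator_def)
 have "(\<integral>y. f y * partial_deriv i \<eta> y \<partial>lborel) = (\<integral>y. f y * partial_deriv i \<eta> y \<partial>lebesgue)"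
  by (subst integral_completion) auto
 also have "\<dots> = (\<integral>y. f0 y * partial_deriv i \<eta> y \<partial>lebesgue)"
 proof (rule integral_cong_AE)
  show "(\<lambda>y. f0 y * partial_deriv i \<eta> y) \<in> borel_measurable lebesgue"
   using int2 unfolding eq2 by auto
  have "AE y in lborel. f y * partial_deriv i \<eta> y = f0 y * partial_deriv i \<eta> y"
   using ae by eventually_elim (use d0 K(2) in auto)
  then show "AE y in lebesgue. f y * partial_deriv i \<eta> y = f0 y * partial_deriv i \<eta> y"
   by (simp add: AE_completion_iff)
 qed (rule measurable_completion, measurable)
 also have "\<dots> = (LINT z|lebesgue_on \<Omega>. f0 z * partial_deriv i \<eta> z)"
  using \<Omega>b out by (subst integral_restrict_space) (auto intro!: Bochner_Integration.integral_cong simp: indicator_def)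
 also have "\<dots> = - (LINT z|lebesgue_on \<Omega>. G z $ i * \<eta> z)"
  using wg \<eta> by (auto simp: weak_gradient_def)
 also have "(LINT z|lebesgue_on \<Omega>. G z $ i * \<eta> z) = (\<integral>y. G y $ i * \<eta> y \<partial>lebesgue)"
  using \<Omega>b out by (subst integral_restrict_space) (auto intro!: Bochner_Integration.integral_cong simp: indicator_def)
 finally show "(\<integral>y. f y * partial_deriv i \<eta> y \<partial>lborel) = - (\<integral>y. G y $ i * \<eta> y \<partial>lebesgue)" .
qed

text \<open>By the weak gradient identity with the test function \<open>mollifier r (y - x)\<close>, the
 directional derivative of \<open>mollify r f\<close> at \<open>x\<close> is an average of \<open>\<xi>
 \<bullet> G\<close>, which is at most \<open>norm \<xi>\<close> times the same average of \<open>g\<close>.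
 Integrate this along the segment.\<close>
lemma mollify_increment_bound:
 fixes f f0 g :: "real^'n::finite => real"
 assumes \<Omega>: "open \<Omega>" and wg: "weak_gradient \<Omega> f0 G" and f: "integrable lborel f"
  and ae: "AE z\<in>\<Omega> in lborel. f z = f0 z"
  and g: "integrable lborel g" "\<And>z. g z \<ge> 0" and Gg: "AE z\<in>\<Omega> in lborel. norm (G z) \<le> g z"
  and r: "r > 0" and ball: "\<And>t. t \<in> {0..1} ==> cball (z + t *\<^sub>R \<xi>) r \<subseteq> \<Omega>"
 shows "ennreal \<bar>mollify r f (z + \<xi>) - mollify r f z\<bar>
   \<le> ennreal (norm \<xi>) * segment_integral (mollify r g) z \<xi>"
proof -
 have fm: "f \<in> borel_measurable borel" using f by auto
 define D where "D = (\<lambda>t. \<Sum>i\<in>UNIV. \<xi> $ i * (\<integral>y. G y $ i * mollifier r (y - (z + t *\<^sub>R \<xi>)) \<partial>lebesgue))"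
 define \<phi> where "\<phi> = (\<lambda>t. norm \<xi> * mollify r g (z + t *\<^sub>R \<xi>))"
 have deriv: "((\<lambda>t. mollify r f (z + t *\<^sub>R \<xi>)) has_real_derivative D t) (at t)"
  and bound: "\<bar>D t\<bar> \<le> \<phi> t" if t: "t \<in> {0..1}" for t
 proof -
  define x where "x = z + t *\<^sub>R \<xi>"
  define \<eta> where "\<eta> = (\<lambda>y. mollifier r (y - x))"
  have \<eta>: "\<eta> \<in> test_functions \<Omega>"
   unfolding \<eta>_def using ball[OF t] by (intro mollifier_test_function r) (simp add: x_def)
  have C1: "C_k (Suc 0) \<eta>" by (rule test_functionD(1)[OF \<eta>])
  have out: "y \<notin> cball x r ==> \<eta> y = 0" for y
   unfolding \<eta>_def by (rule mollifier_eq_0[OF r]) (simp add: dist_norm norm_minus_commute)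
  have [measurable]: "\<eta> \<in> borel_measurable borel" unfolding \<eta>_def by measurable
  have pm: "partial_deriv i \<eta> \<in> borel_measurable borel" for i
   using C1 by (intro borel_measurable_continuous_onI) auto
  have intp: "integrable lborel (\<lambda>y. f y * partial_deriv i \<eta> y)" for i
  proof -
   obtain B where "\<And>z. \<bar>partial_deriv i \<eta> z\<bar> \<le> B"
    using partial_deriv_bounded[OF C1 compact_cball out, of x r] by blast
   then show ?thesis using pm by (intro integrable_mult_bounded[OF f, of _ B]) auto
  qed
  have Deq: "(\<integral>y. f y * (\<Sum>i\<in>UNIV. (- \<xi>) $ i * partial_deriv i \<eta> y) \<partial>lborel) = D t"
  proof -
   have "(\<integral>y. f y * (\<Sum>i\<in>UNIV. (- \<xi>) $ i * partial_deriv i \<eta> y) \<partial>lborel)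
    = (\<integral>y. (\<Sum>i\<in>UNIV. - \<xi> $ i * (f y * partial_deriv i \<eta> y)) \<partial>lborel)"
    by (intro Bochner_Integration.integral_cong) (auto simp: sum_distrib_left mult_ac)
   also have "\<dots> = (\<Sum>i\<in>UNIV. - \<xi> $ i * (\<integral>y. f y * partial_deriv i \<eta> y \<partial>lborel))"
    using intp by (subst Bochner_Integration.integral_sum) auto
   also have "\<dots> = D t"
    unfolding weak_gradient_lborel(2)[OF \<Omega> wg fm ae \<eta>] by (simp add: D_def \<eta>_def x_def)
   finally show ?thesis .
  qed
  have "mollify r f (z + (t + s) *\<^sub>R \<xi>) - mollify r f (z + t *\<^sub>R \<xi>) = (\<integral>y. f y * (\<eta> (y + s *\<^sub>R (- \<xi>)) - \<eta> y) \<partial>lborel)" for s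
  proof -
   have e: "\<eta> (y + s *\<^sub>R (- \<xi>)) = mollifier r (y - (z + (t + s) *\<^sub>R \<xi>))" for y
    by (simp add: \<eta>_def x_def algebra_simps)
   have e2: "\<eta> y = mollifier r (y - (z + t *\<^sub>R \<xi>))" for y by (simp add: \<eta>_def x_def)
   show ?thesis
    unfolding e unfolding e2 mollify_def right_diff_distrib
    by (rule Bochner_Integration.integral_diff[symmetric]) (intro mollify_integrable f)+
  qed
  then have q: "(mollify r f (z + (t + s) *\<^sub>R \<xi>) - mollify r f (z + t *\<^sub>R \<xi>)) / s = (\<integral>y. f y * ((\<eta> (y + s *\<^sub>R (- \<xi>)) - \<eta> y) / s) \<partial>lborel)" for s
   by simp
  show "((\<lambda>t. mollify r f (z + t *\<^sub>R \<xi>)) has_real_derivative D t) (at t)"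
   unfolding DERIV_def q
   by (rule directional_difference_quotient_tendsto[OF C1 compact_cball out f, of x r "- \<xi>", unfolded Deq])
  have intG: "integrable lebesgue (\<lambda>y. G y $ i * \<eta> y)" for i
   by (rule weak_gradient_lborel(1)[OF \<Omega> wg fm ae \<eta>])
  have ig: "integrable lebesgue (\<lambda>y. g y * \<eta> y)"
   unfolding \<eta>_def using mollify_integrable[OF g(1)] by (intro integrable_completion[THEN iffD2]) auto
  have "\<bar>D t\<bar> = \<bar>\<integral>y. (\<Sum>i\<in>UNIV. \<xi> $ i * (G y $ i * \<eta> y)) \<partial>lebesgue\<bar>"
   using intG by (subst Bochner_Integration.integral_sum) (auto simp: D_def \<eta>_def x_def)
  also have "\<dots> \<le> (\<integral>y. norm \<xi> * (g y * \<eta> y) \<partial>lebesgue)"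
  proof (rule order_trans[OF integral_norm_bound[where 'a=real, unfolded real_norm_def]], rule integral_mono_AE)
   show "integrable lebesgue (\<lambda>y. \<bar>\<Sum>i\<in>UNIV. \<xi> $ i * (G y $ i * \<eta> y)\<bar>)" using intG by auto
   show "integrable lebesgue (\<lambda>y. norm \<xi> * (g y * \<eta> y))" using ig by auto
   have "AE y in lborel. \<bar>\<Sum>i\<in>UNIV. \<xi> $ i * (G y $ i * \<eta> y)\<bar> \<le> norm \<xi> * (g y * \<eta> y)"
    using Gg
   proof eventually_elim
    case (elim y)
    have e: "(\<Sum>i\<in>UNIV. \<xi> $ i * (G y $ i * \<eta> y)) = (\<xi> \<bullet> G y) * \<eta> y"
     by (simp add: inner_vec_def sum_distrib_right mult.assoc)
    have pos: "\<eta> y \<ge> 0" by (simp add: \<eta>_def mollifier_nonneg)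
    show ?case
    proof (cases "y \<in> \<Omega>")
     case True
     have "\<bar>\<xi> \<bullet> G y\<bar> \<le> norm \<xi> * norm (G y)" by (rule Cauchy_Schwarz_ineq2)
     also have "\<dots> \<le> norm \<xi> * g y" using elim True by (intro mult_left_mono) auto
     finally have "\<bar>\<xi> \<bullet> G y\<bar> * \<eta> y \<le> norm \<xi> * g y * \<eta> y" by (rule mult_right_mono) (rule pos)
     then show ?thesis using pos unfolding e by (simp add: abs_mult mult.assoc)
    next
     case False
     then have "\<eta> y = 0" using out[of y] ball[OF t] unfolding x_def by blast
     then show ?thesis by simp
    qed
   qed
   then show "AE y in lebesgue. \<bar>\<Sum>i\<in>UNIV. \<xi> $ i * (G y $ i * \<eta> y)\<bar> \<le> norm \<xi> * (g y * \<eta> y)"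
    by (simp add: AE_completion_iff)
  qed
  also have "\<dots> = norm \<xi> * (\<integral>y. g y * \<eta> y \<partial>lborel)"
   using g(1) by (simp add: integral_completion)
  also have "\<dots> = \<phi> t" by (simp add: \<phi>_def mollify_def \<eta>_def x_def)
  finally show "\<bar>D t\<bar> \<le> \<phi> t" .
 qed
 have Dint: "(D has_integral (mollify r f (z + 1 *\<^sub>R \<xi>) - mollify r f (z + 0 *\<^sub>R \<xi>))) {0..1}"
  by (rule fundamental_theorem_of_calculus)
   (use deriv in \<open>auto simp: has_real_derivative_iff_has_vector_derivative intro: has_vector_derivative_at_within\<close>)
 have "continuous_on {0..1} \<phi>"
  unfolding \<phi>_def
  by (intro continuous_intros continuous_on_compose2[OF mollify_continuous[OF g(1)]]) auto
 then have \<phi>int: "\<phi> integrable_on {0..1}" by (rule integrable_continuous_interval)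
 have "\<bar>mollify r f (z + \<xi>) - mollify r f z\<bar> = norm (integral {0..1} D)"
  using Dint by (simp add: integral_unique)
 also have "\<dots> \<le> integral {0..1} \<phi>"
  by (rule Henstock_Kurzweil_Integration.integral_norm_bound_integral) (use Dint \<phi>int bound in \<open>auto simp: has_integral_integrable\<close>)
 finally have "ennreal \<bar>mollify r f (z + \<xi>) - mollify r f z\<bar> \<le> ennreal (integral {0..1} \<phi>)"
  by (rule ennreal_leI)
 also have "\<dots> = (\<integral>\<^sub>+t. ennreal (\<phi> t) * indicator {0..1} t)"
  by (rule nn_integral_has_integral_lebesgue'[OF _ integrable_integral[OF \<phi>int], symmetric])
   (simp add: \<phi>_def mollify_nonneg g)
 also have "\<dots> = ennreal (norm \<xi>) * segment_integral (mollify r g) z \<xi>"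
  using g(1) by (subst nn_integral_cmult[symmetric]) (auto simp: \<phi>_def ennreal_mult mollify_nonneg g mult.assoc)
 finally show ?thesis .
qed

text \<open>Along a subsequence the integrals are summable, so the sum of the functions is finite almost
 everywhere and its terms tend to 0.\<close>
lemma nn_integral_tendsto_0_AE_subseq:
 fixes e :: "nat => 'a => ennreal"
 assumes [measurable]: "\<And>n. e n \<in> borel_measurable M" and lim: "(\<lambda>n. \<integral>\<^sup>+x. e n x \<partial>M) \<longlonglongrightarrow> 0"
 obtains r :: "nat => nat" where "strict_mono r" "AE x in M. (\<lambda>n. e (r n) x) \<longlonglongrightarrow> 0"
proof -
 have "\<exists>N. \<forall>n\<ge>N. (\<integral>\<^sup>+x. e n x \<partial>M) < ennreal ((1/2) ^ k)" for k
  using order_tendstoD(2)[OF lim, of "ennreal ((1/2)^k)"] by (auto simp: eventually_sequentially)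
 then obtain N where N: "\<And>k n. n \<ge> N k ==> (\<integral>\<^sup>+x. e n x \<partial>M) < ennreal ((1/2) ^ k)"
  by metis
 define r where "r = rec_nat (N 0) (\<lambda>k m. max (Suc m) (N (Suc k)))"
 have r: "strict_mono r"
  unfolding strict_mono_Suc_iff by (auto simp: r_def)
 have rN: "r k \<ge> N k" for k by (cases k) (auto simp: r_def)
 have "(\<integral>\<^sup>+x. (\<Sum>k. e (r k) x) \<partial>M) = (\<Sum>k. \<integral>\<^sup>+x. e (r k) x \<partial>M)"
  by (rule nn_integral_suminf) auto
 also have "\<dots> \<le> (\<Sum>k. ennreal ((1/2) ^ k))"
  by (intro suminf_le less_imp_le N rN) auto
 also have "\<dots> = ennreal (\<Sum>k. (1/2) ^ k)"
  by (rule suminf_ennreal2) auto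
 also have "\<dots> < \<infinity>" by simp
 finally have "AE x in M. (\<Sum>k. e (r k) x) < \<infinity>"
  by (intro finite_nn_integral_imp_ae_finite) auto
 then have "AE x in M. (\<lambda>n. e (r n) x) \<longlonglongrightarrow> 0"
 proof eventually_elim
  case (elim x)
  have fin: "e (r k) x < \<infinity>" for k
   using elim by (metis ennreal_suminf_lessD infinity_ennreal_def)
  have "summable (\<lambda>k. enn2real (e (r k) x))"
  proof (rule summable_suminf_not_top)
   have "(\<Sum>k. ennreal (enn2real (e (r k) x))) = (\<Sum>k. e (r k) x)"
    using fin by simp
   then show "(\<Sum>k. ennreal (enn2real (e (r k) x))) \<noteq> top" using elim by simp
  qed auto
  then have "(\<lambda>k. enn2real (e (r k) x)) \<longlonglongrightarrow> 0" by (rule summable_LIMSEQ_zero)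
  then have "(\<lambda>k. ennreal (enn2real (e (r k) x))) \<longlonglongrightarrow> ennreal 0" by (rule tendsto_ennrealI)
  then show ?case using fin by simp
 qed
 with r show thesis by (rule that)
qed

lemma segment_neighbourhood:
 fixes z \<xi> :: "'a::euclidean_space"
 assumes "open \<Omega>" "closed_segment z (z + \<xi>) \<subseteq> \<Omega>"
 obtains \<rho> where "\<rho> > 0" "\<And>t. t \<in> {0..1} ==> cball (z + t *\<^sub>R \<xi>) \<rho> \<subseteq> \<Omega>"
proof -
 have seg: "z + t *\<^sub>R \<xi> \<in> closed_segment z (z + \<xi>)" if "t \<in> {0..1}" for t
  using that by (auto simp: in_segment algebra_simps intro!: exI[of _ t])
 obtain \<rho> where "\<rho> > 0" "(\<Union>x\<in>closed_segment z (z + \<xi>). cball x \<rho>) \<subseteq> \<Omega>"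
  using compact_subset_open_imp_cball_epsilon_subset[OF compact_segment assms(1,2)] by blast
 then show thesis using that[of \<rho>] seg by blast
qed

text \<open>By Fubini and translation invariance, averaging along segments preserves the integral; convergence
 in \<open>L\<^sup>1\<close> therefore passes to almost all segments in a fixed direction.\<close>
lemma nn_integral_segment_average:
 fixes h :: "'a::euclidean_space => ennreal"
 assumes [measurable]: "h \<in> borel_measurable borel"
 shows "(\<integral>\<^sub>+z. (\<integral>\<^sub>+t. h (z + t *\<^sub>R \<xi>) * indicator {0..1::real} t)) = (\<integral>\<^sub>+z. h z)"
proof -
 have "(\<integral>\<^sub>+z. (\<integral>\<^sub>+t. h (z + t *\<^sub>R \<xi>) * indicator {0..1::real} t))
  = (\<integral>\<^sub>+t. (\<integral>\<^sub>+z. h (z + t *\<^sub>R \<xi>) * indicator {0..1::real} t))"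
  by (rule lborel_pair.Fubini') measurable
 also have "\<dots> = (\<integral>\<^sub>+t. (\<integral>\<^sub>+z. h z) * indicator {0..1::real} t)"
  by (intro nn_integral_cong) (simp add: nn_integral_multc nn_integral_lborel_translate)
 also have "\<dots> = (\<integral>\<^sub>+z. h z)" by (simp add: nn_integral_cmult)
 finally show ?thesis .
qed

text \<open>Let the radius tend to 0 in \<open>mollify_increment_bound\<close>, along a subsequence for which
 \<open>f\<close> at both endpoints and the segment averages of \<open>g\<close> converge almost
 everywhere.\<close>
lemma weak_gradient_imp_segment_bound:
 fixes f f0 g :: "real^'n::finite => real"
 assumes \<Omega>: "open \<Omega>" and wg: "weak_gradient \<Omega> f0 G" and f: "integrable lborel f"
  and ae: "AE z\<in>\<Omega> in lborel. f z = f0 z"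
  and g: "integrable lborel g" "\<And>z. g z \<ge> 0" and Gg: "AE z\<in>\<Omega> in lborel. norm (G z) \<le> g z"
 shows "AE z in lborel. closed_segment z (z + \<xi>) \<subseteq> \<Omega> --> ennreal \<bar>f z - f (z + \<xi>)\<bar>
   \<le> ennreal (norm \<xi>) * segment_integral g z \<xi>"
proof -
 have [measurable]: "f \<in> borel_measurable borel" "g \<in> borel_measurable borel" using f g by auto
 note [measurable] = mollify_measurable[OF f] mollify_measurable[OF g(1)]
 define r where "r = (\<lambda>n. 1 / (real n + 1))"
 have r: "\<And>n. r n > 0" "r \<longlonglongrightarrow> 0"
  using LIMSEQ_inverse_real_of_nat by (auto simp: r_def inverse_eq_divide add.commute)
 define a where "a = (\<lambda>n z. ennreal \<bar>mollify (r n) f z - f z\<bar>)"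
 define b where "b = (\<lambda>n z. ennreal \<bar>mollify (r n) g z - g z\<bar>)"
 have [measurable]: "a n \<in> borel_measurable borel" "b n \<in> borel_measurable borel" for n
  unfolding a_def b_def by measurable
 define e where "e = (\<lambda>n z. a n z + a n (z + \<xi>) + (\<integral>\<^sub>+t. b n (z + t *\<^sub>R \<xi>) * indicator {0..1} t))"
 have [measurable]: "e n \<in> borel_measurable borel" for n unfolding e_def by measurable
 have "(\<integral>\<^sub>+z. e n z) = (\<integral>\<^sub>+z. a n z) + (\<integral>\<^sub>+z. a n z) + (\<integral>\<^sub>+z. b n z)" for n
  by (simp add: e_def nn_integral_add nn_integral_lborel_translate nn_integral_segment_average)
 moreover have "(\<lambda>n. (\<integral>\<^sub>+z. a n z) + (\<integral>\<^sub>+z. a n z) + (\<integral>\<^sub>+z. b n z)) \<longlonglongrightarrow> 0 + 0 + 0"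
  unfolding a_def b_def by (intro tendsto_add mollify_L1_tendsto f g r)
 ultimately have "(\<lambda>n. \<integral>\<^sub>+z. e n z) \<longlonglongrightarrow> 0" by simp
 then obtain k :: "nat => nat" where k: "strict_mono k" "AE z in lborel. (\<lambda>n. e (k n) z) \<longlonglongrightarrow> 0"
  by (rule nn_integral_tendsto_0_AE_subseq[rotated]) auto
 have rk: "(\<lambda>n. r (k n)) \<longlonglongrightarrow> 0" using LIMSEQ_subseq_LIMSEQ[OF r(2) k(1)] by (simp add: o_def)
 show ?thesis
  using k(2)
 proof (eventually_elim, intro impI)
  fix z assume e0: "(\<lambda>n. e (k n) z) \<longlonglongrightarrow> 0" and seg: "closed_segment z (z + \<xi>) \<subseteq> \<Omega>"
  define J where "J = segment_integral g z \<xi>"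
  obtain \<rho> where \<rho>: "\<rho> > 0" "\<And>t. t \<in> {0..1} ==> cball (z + t *\<^sub>R \<xi>) \<rho> \<subseteq> \<Omega>"
   using segment_neighbourhood[OF \<Omega> seg] by blast
  have main: "ennreal \<bar>f z - f (z + \<xi>)\<bar> \<le> ennreal (norm \<xi>) * J + (1 + ennreal (norm \<xi>)) * e n z" if n: "r n < \<rho>" for n
  proof -
   have ball: "cball (z + t *\<^sub>R \<xi>) (r n) \<subseteq> \<Omega>" if "t \<in> {0..1}" for t
    using \<rho>(2)[OF that] subset_cball[of "r n" \<rho>] n by force
   define c where "c = (\<integral>\<^sub>+t. b n (z + t *\<^sub>R \<xi>) * indicator {0..1} t)"
   have "ennreal \<bar>mollify (r n) f (z + \<xi>) - mollify (r n) f z\<bar>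
    \<le> ennreal (norm \<xi>) * segment_integral (mollify (r n) g) z \<xi>"
    by (rule mollify_increment_bound[OF \<Omega> wg f ae g Gg r(1) ball])
   also have "\<dots> \<le> ennreal (norm \<xi>) * (\<integral>\<^sub>+t. (ennreal (g (z + t *\<^sub>R \<xi>)) + b n (z + t *\<^sub>R \<xi>)) * indicator {0..1} t)"
    by (intro mult_left_mono nn_integral_mono mult_right_mono)
     (auto simp: b_def g(2) simp flip: ennreal_plus intro!: ennreal_leI)
   also have "\<dots> = ennreal (norm \<xi>) * (J + c)"
    unfolding J_def c_def by (subst nn_integral_add[symmetric]) (auto simp: distrib_right)
   finally have 1: "ennreal \<bar>mollify (r n) f (z + \<xi>) - mollify (r n) f z\<bar> \<le> ennreal (norm \<xi>) * (J + c)" .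
   have "ennreal \<bar>f z - f (z + \<xi>)\<bar> \<le> a n z + a n (z + \<xi>) + ennreal \<bar>mollify (r n) f (z + \<xi>) - mollify (r n) f z\<bar>"
    unfolding a_def by (simp flip: ennreal_plus)
   also have "\<dots> \<le> (a n z + a n (z + \<xi>)) + ennreal (norm \<xi>) * (J + c)"
    by (intro add_left_mono 1)
   also have "\<dots> \<le> (a n z + a n (z + \<xi>) + c) + ennreal (norm \<xi>) * (J + (a n z + a n (z + \<xi>) + c))"
   proof (intro add_mono[of "a n z + a n (z + \<xi>)"] mult_left_mono)
    show "a n z + a n (z + \<xi>) \<le> a n z + a n (z + \<xi>) + c" by (rule add_increasing2) auto
    show "J + c \<le> J + (a n z + a n (z + \<xi>) + c)" by (intro add_left_mono add_increasing) auto
   qed auto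
   also have "\<dots> = ennreal (norm \<xi>) * J + (1 + ennreal (norm \<xi>)) * e n z"
    unfolding e_def c_def by (simp add: algebra_simps)
   finally show ?thesis .
  qed
  have "(\<lambda>n. ennreal (norm \<xi>) * J + (1 + ennreal (norm \<xi>)) * e (k n) z) \<longlonglongrightarrow> ennreal (norm \<xi>) * J + (1 + ennreal (norm \<xi>)) * 0"
   by (intro tendsto_add tendsto_const ennreal_tendsto_cmult e0) (simp add: less_top[symmetric])
  then have "ennreal \<bar>f z - f (z + \<xi>)\<bar> \<le> ennreal (norm \<xi>) * J + (1 + ennreal (norm \<xi>)) * 0"
  proof (rule tendsto_lowerbound)
   show "\<forall>\<^sub>F n in sequentially. ennreal \<bar>f z - f (z + \<xi>)\<bar> \<le> ennreal (norm \<xi>) * J + (1 + ennreal (norm \<xi>)) * e (k n) z"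
    using order_tendstoD(2)[OF rk \<rho>(1)] by eventually_elim (rule main)
  qed simp
  then show "ennreal \<bar>f z - f (z + \<xi>)\<bar> \<le> ennreal (norm \<xi>) * segment_integral g z \<xi>"
   by (simp add: J_def)
 qed
qed

text \<open>The exceptional set may depend on \<open>\<xi>\<close>. This is all that Fubini's theorem can use,
 and it is stable under limits.\<close>
definition segment_bound ::
 "(real^'n::finite) set => 'x metric => (real^'n => 'x) => (real^'n => real) => bool" where
 "segment_bound \<Omega> X u g \<longleftrightarrow> (\<forall>\<xi>. AE z in lborel. closed_segment z (z + \<xi>) \<subseteq> \<Omega> -->
  ennreal (mdist X (u z) (u (z + \<xi>)))
   \<le> ennreal (norm \<xi>) * segment_integral g z \<xi>)"

lemma Lp_maps_values:
 assumes "u \<in> Lp_maps p \<Omega> X" "z \<in> \<Omega>"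
 shows "u z \<in> mspace X"
proof -
 have "u \<in> space (lebesgue_on \<Omega>) \<rightarrow> space (sigma (mspace X) {U. openin (mtopology_of X) U})"
  using assms(1) by (auto simp: Lp_maps_def dest!: measurable_space)
 moreover have "space (sigma (mspace X) {U. openin (mtopology_of X) U}) = mspace X"
  by (intro space_measure_of) (use openin_subset[of "mtopology_of X"] in force)
 ultimately show ?thesis using assms(2) by (auto simp: space_restrict_space)
qed

lemma Lp_maps_dense_sequence:
 fixes u :: "real^'n::finite => 'x"
 assumes u: "u \<in> Lp_maps p \<Omega> X" and \<Omega>: "\<Omega> \<in> sets borel"
 obtains x :: "nat => 'x" where "\<And>i. x i \<in> mspace X"
  "AE z\<in>\<Omega> in lborel. (\<forall>\<epsilon>>0. \<exists>i. mdist X (x i) (u z) < \<epsilon>)"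
proof -
 from u obtain N x0 where N: "N \<in> null_sets (lebesgue_on \<Omega>)"
   and sep: "separable_space (subtopology (mtopology_of X) (u ` (\<Omega> - N)))" and x0: "x0 \<in> mspace X"
  by (auto simp: Lp_maps_def)
 then obtain C where C: "countable C" "C \<subseteq> topspace (subtopology (mtopology_of X) (u ` (\<Omega> - N)))"
   "subtopology (mtopology_of X) (u ` (\<Omega> - N)) closure_of C = topspace (subtopology (mtopology_of X) (u ` (\<Omega> - N)))"
  by (auto simp: separable_space_def)
 define x where "x = from_nat_into (insert x0 C)"
 have x: "range x = insert x0 C" unfolding x_def using C(1) by (intro range_from_nat_into) auto
 have xX: "x i \<in> mspace X" for i
 proof -
  have "x i \<in> insert x0 C" using x by auto
  then show ?thesis using C(2) x0 by auto
 qed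
 have "AE z in lebesgue_on \<Omega>. z \<notin> N" using N by (rule AE_not_in)
 then have "AE z\<in>\<Omega> in lborel. z \<notin> N" by (rule AE_lebesgue_on_iff[OF \<Omega>, THEN iffD1])
 then have "AE z\<in>\<Omega> in lborel. (\<forall>\<epsilon>>0. \<exists>i. mdist X (x i) (u z) < \<epsilon>)"
 proof (eventually_elim, intro impI allI)
  fix z and \<epsilon> :: real assume z: "z \<in> \<Omega> --> z \<notin> N" "z \<in> \<Omega>" and \<epsilon>: "\<epsilon> > 0"
  have uz: "u z \<in> mspace X" using Lp_maps_values[OF u z(2)] .
  have "u z \<in> subtopology (mtopology_of X) (u ` (\<Omega> - N)) closure_of C"
   unfolding C(3) using z uz by auto
  then have cl: "\<And>T. u z \<in> T ==> openin (subtopology (mtopology_of X) (u ` (\<Omega> - N))) T ==> \<exists>y. y \<in> C \<and> y \<in> T"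
   unfolding in_closure_of by metis
  have "openin (subtopology (mtopology_of X) (u ` (\<Omega> - N))) (u ` (\<Omega> - N) \<inter> mball_of X (u z) \<epsilon>)"
   by (simp add: openin_subtopology_Int2 mball_of_def mtopology_of_def Metric_space.openin_mball[OF Metric_space_mspace_mdist])
  moreover have "u z \<in> u ` (\<Omega> - N) \<inter> mball_of X (u z) \<epsilon>"
   using z uz \<epsilon> by (auto simp: mball_of_def Metric_space.in_mball[OF Metric_space_mspace_mdist] Metric_space.mdist_zero[OF Metric_space_mspace_mdist])
  ultimately obtain y where y: "y \<in> C" "y \<in> mball_of X (u z) \<epsilon>"
   using cl[of "u ` (\<Omega> - N) \<inter> mball_of X (u z) \<epsilon>"] by (meson IntD2)
  then obtain i where "x i = y" using x by (metis insertCI rangeE)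
  then show "\<exists>i. mdist X (x i) (u z) < \<epsilon>"
   using y(2) by (auto simp: mball_of_def Metric_space.in_mball[OF Metric_space_mspace_mdist] Metric_space.commute[OF Metric_space_mspace_mdist])
 qed
 with xX show thesis by (rule that)
qed

lemma mdist_nonneg_of: "mdist X x y \<ge> 0"
 by (rule Metric_space.nonneg[OF Metric_space_mspace_mdist])

lemma mdist_commute_of: "mdist X x y = mdist X y x"
 by (rule Metric_space.commute[OF Metric_space_mspace_mdist])

lemma mdist_triangle_of: "x \<in> mspace X ==> y \<in> mspace X ==> z \<in> mspace X ==> mdist X x z \<le> mdist X x y + mdist X y z"
 by (rule Metric_space.triangle[OF Metric_space_mspace_mdist])

lemma mdist_self_of: "x \<in> mspace X ==> mdist X x x = 0"
 using Metric_space.mdist_zero[OF Metric_space_mspace_mdist] .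

lemma abs_mdist_diff_le:
 assumes "x \<in> mspace X" "y \<in> mspace X" "z \<in> mspace X"
 shows "\<bar>mdist X x y - mdist X x z\<bar> \<le> mdist X y z"
 using mdist_triangle_of[of x X y z] mdist_triangle_of[of x X z y] assms mdist_commute_of[of X y z] by linarith

text \<open>The distance to a dense sequence determines all distances. Since only the functions \<open>mdist X x
 \<circ> u\<close> are known to be measurable and Sobolev, this identity is what gives access to \<open>mdist X
 (u z) (u w)\<close>.\<close>
lemma mdist_eq_SUP_dense:
 assumes x: "\<And>i. x i \<in> mspace X" and a: "a \<in> mspace X" and b: "b \<in> mspace X"
  and dense: "\<forall>\<epsilon>>0. \<exists>i::nat. mdist X (x i) a < \<epsilon>"
 shows "ennreal (mdist X a b) = (SUP i. ennreal \<bar>mdist X (x i) a - mdist X (x i) b\<bar>)"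
proof (rule antisym)
 show "(SUP i. ennreal \<bar>mdist X (x i) a - mdist X (x i) b\<bar>) \<le> ennreal (mdist X a b)"
  by (intro SUP_least ennreal_leI abs_mdist_diff_le assms)
 show "ennreal (mdist X a b) \<le> (SUP i. ennreal \<bar>mdist X (x i) a - mdist X (x i) b\<bar>)"
 proof (rule ennreal_le_epsilon)
  fix e :: real assume "e > 0"
  then obtain i where i: "mdist X (x i) a < e / 2" using dense by (meson half_gt_zero)
  have "mdist X a b \<le> mdist X (x i) a + mdist X (x i) b"
   using mdist_triangle_of[OF a x[of i] b] by (simp add: mdist_commute_of)
  then have "mdist X a b \<le> \<bar>mdist X (x i) a - mdist X (x i) b\<bar> + e" using i by linarith
  then have "ennreal (mdist X a b) \<le> ennreal (\<bar>mdist X (x i) a - mdist X (x i) b\<bar> + e)" by (rule ennreal_leI)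
  also have "\<dots> = ennreal \<bar>mdist X (x i) a - mdist X (x i) b\<bar> + ennreal e"
   using \<open>e > 0\<close> by (intro ennreal_plus) auto
  also have "\<dots> \<le> (SUP i. ennreal \<bar>mdist X (x i) a - mdist X (x i) b\<bar>) + ennreal e"
   by (intro add_right_mono SUP_upper) auto
  finally show "ennreal (mdist X a b) \<le> (SUP i. ennreal \<bar>mdist X (x i) a - mdist X (x i) b\<bar>) + ennreal e" .
 qed
qed

lemma integrable_of_powr_bounded_support:
 fixes f :: "'a::euclidean_space => real"
 assumes [measurable]: "f \<in> borel_measurable borel" and \<Omega>: "bounded \<Omega>" "\<Omega> \<in> sets borel"
  and out: "\<And>z. z \<notin> \<Omega> ==> f z = 0" and p: "p \<ge> 1" and fin: "(\<integral>\<^sub>+z. ennreal (\<bar>f z\<bar> powr p)) < \<infinity>"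
 shows "integrable lborel f"
proof (rule integrableI_bounded)
 have [measurable]: "\<Omega> \<in> sets borel" by fact
 have "(\<integral>\<^sub>+z. ennreal (norm (f z))) \<le> (\<integral>\<^sub>+z. indicator \<Omega> z + ennreal (\<bar>f z\<bar> powr p))"
 proof (intro nn_integral_mono)
  fix z
  have "\<bar>f z\<bar> \<le> 1 + \<bar>f z\<bar> powr p" using powr_split_bound[of "\<bar>f z\<bar>" 1 p] p by simp
  then have "ennreal \<bar>f z\<bar> \<le> 1 + ennreal (\<bar>f z\<bar> powr p)"
   by (metis ennreal_1 ennreal_leI ennreal_plus powr_ge_zero zero_le_one)
  then show "ennreal (norm (f z)) \<le> indicator \<Omega> z + ennreal (\<bar>f z\<bar> powr p)"
   using out[of z] by (cases "z \<in> \<Omega>") auto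
 qed
 also have "\<dots> = emeasure lborel \<Omega> + (\<integral>\<^sub>+z. ennreal (\<bar>f z\<bar> powr p))"
  by (subst nn_integral_add) auto
 also have "\<dots> < \<infinity>" using fin emeasure_bounded_finite[OF \<Omega>(1)] by simp
 finally show "(\<integral>\<^sub>+z. ennreal (norm (f z))) < \<infinity>" .
qed simp

lemma Lp_space_representative:
 fixes f0 :: "real^'n::finite => real"
 assumes f0: "f0 \<in> Lp_space p \<Omega>" and \<Omega>: "bounded \<Omega>" "open \<Omega>" and p: "p \<ge> 1"
 obtains f where "f \<in> borel_measurable borel" "\<And>z. z \<notin> \<Omega> ==> f z = 0" "AE z\<in>\<Omega> in lborel. f z = f0 z"
  "integrable lborel f" "(\<integral>\<^sub>+z. ennreal (\<bar>f z\<bar> powr p)) = ennreal (LINT z|lebesgue_on \<Omega>. \<bar>f0 z\<bar> powr p)"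
proof -
 have \<Omega>b: "\<Omega> \<in> sets borel" using \<Omega> by auto
 have f0': "f0 \<in> borel_measurable (lebesgue_on \<Omega>)" "integrable (lebesgue_on \<Omega>) (\<lambda>z. \<bar>f0 z\<bar> powr p)"
  using f0 by (auto simp: Lp_space_def)
 obtain f where f: "f \<in> borel_measurable borel" "\<And>z. z \<notin> \<Omega> ==> f z = 0" "AE z\<in>\<Omega> in lborel. f z = f0 z"
  using borel_representative[OF f0'(1) \<Omega>b] by blast
 have "(\<integral>\<^sub>+z. ennreal (\<bar>f z\<bar> powr p)) = (\<integral>\<^sub>+z. ennreal (\<bar>f0 z\<bar> powr p) * indicator \<Omega> z)"
  by (rule nn_integral_cong_AE) (use f(3) in eventually_elim, use f(2) in \<open>auto simp: indicator_def\<close>)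
 also have "\<dots> = (\<integral>\<^sup>+z. ennreal (\<bar>f0 z\<bar> powr p) \<partial>lebesgue_on \<Omega>)"
  by (simp add: nn_integral_lebesgue_on[OF \<Omega>b])
 also have "\<dots> = ennreal (LINT z|lebesgue_on \<Omega>. \<bar>f0 z\<bar> powr p)"
  by (rule nn_integral_eq_integral[OF f0'(2)]) auto
 finally have eq: "(\<integral>\<^sub>+z. ennreal (\<bar>f z\<bar> powr p)) = ennreal (LINT z|lebesgue_on \<Omega>. \<bar>f0 z\<bar> powr p)" .
 have "integrable lborel f"
  by (rule integrable_of_powr_bounded_support[OF f(1) \<Omega>(1) \<Omega>b f(2) p]) (simp_all add: eq)
 with f eq show thesis by (intro that)
qed

text \<open>Apply the scalar segment bound to \<open>mdist X x \<circ> u\<close> for \<open>x\<close> in a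
 countable set that is dense in almost all of the image, and take the supremum over \<open>x\<close>.\<close>
lemma W1p_maps_segment_bound:
 fixes u :: "real^'n::finite => 'x"
 assumes \<Omega>: "bounded \<Omega>" "open \<Omega>" and p: "p \<ge> 1" and u: "u \<in> Lp_maps p \<Omega> X"
  and g0: "g0 \<in> gradient_bounds p \<Omega> X u"
 obtains g where "g \<in> borel_measurable borel" "\<And>z. g z \<ge> 0" "\<And>z. z \<notin> \<Omega> ==> g z = 0" "integrable lborel g"
  "(\<integral>\<^sub>+z. ennreal (g z powr p)) = ennreal (LINT z|lebesgue_on \<Omega>. \<bar>g0 z\<bar> powr p)"
  "segment_bound \<Omega> X u g"
  "\<And>x. x \<in> mspace X ==> \<exists>G. weak_gradient \<Omega> (\<lambda>z. mdist X x (u z)) G \<and> (AE z\<in>\<Omega> in lborel. norm (G z) \<le> g z)"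
proof -
 have \<Omega>b: "\<Omega> \<in> sets borel" using \<Omega> by auto
 have g0Lp: "g0 \<in> Lp_space p \<Omega>" using g0 by (auto simp: gradient_bounds_def)
 obtain g1 where g1: "g1 \<in> borel_measurable borel" "\<And>z. z \<notin> \<Omega> ==> g1 z = 0" "AE z\<in>\<Omega> in lborel. g1 z = g0 z"
  "integrable lborel g1" "(\<integral>\<^sub>+z. ennreal (\<bar>g1 z\<bar> powr p)) = ennreal (LINT z|lebesgue_on \<Omega>. \<bar>g0 z\<bar> powr p)"
  using Lp_space_representative[OF g0Lp \<Omega> p] by blast
 define g where "g = (\<lambda>z. \<bar>g1 z\<bar>)"
 have g: "g \<in> borel_measurable borel" "\<And>z. g z \<ge> 0" "\<And>z. z \<notin> \<Omega> ==> g z = 0" "integrable lborel g"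
  using g1 by (auto simp: g_def)
 have grad: "\<exists>G. weak_gradient \<Omega> (\<lambda>z. mdist X x (u z)) G \<and> (AE z\<in>\<Omega> in lborel. norm (G z) \<le> g z)"
  if x: "x \<in> mspace X" for x
 proof -
  obtain G where G: "weak_gradient \<Omega> (\<lambda>z. mdist X x (u z)) G" "AE z in lebesgue_on \<Omega>. norm (G z) \<le> g0 z"
   using g0 x by (auto simp: gradient_bounds_def)
  have "AE z\<in>\<Omega> in lborel. norm (G z) \<le> g0 z" using G(2) by (rule AE_lebesgue_on_iff[OF \<Omega>b, THEN iffD1])
  then have "AE z\<in>\<Omega> in lborel. norm (G z) \<le> g z"
   using g1(3) by eventually_elim (auto simp: g_def)
  with G(1) show ?thesis by blast
 qed
 obtain x :: "nat => 'x" where x: "\<And>i. x i \<in> mspace X"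
  "AE z\<in>\<Omega> in lborel. (\<forall>\<epsilon>>0. \<exists>i. mdist X (x i) (u z) < \<epsilon>)"
  using Lp_maps_dense_sequence[OF u \<Omega>b] by blast
 have "segment_bound \<Omega> X u g"
  unfolding segment_bound_def
 proof
  fix \<xi>
  define J where "J = (\<lambda>z. \<integral>\<^sub>+t. ennreal (g (z + t *\<^sub>R \<xi>)) * indicator {0..1} t)"
  have "AE z in lborel. closed_segment z (z + \<xi>) \<subseteq> \<Omega> -->
    ennreal \<bar>mdist X (x i) (u z) - mdist X (x i) (u (z + \<xi>))\<bar> \<le> ennreal (norm \<xi>) * J z" for i
  proof -
   obtain G where G: "weak_gradient \<Omega> (\<lambda>z. mdist X (x i) (u z)) G" "AE z\<in>\<Omega> in lborel. norm (G z) \<le> g z"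
    using grad[OF x(1)] by blast
   have "(\<lambda>z. mdist X (x i) (u z)) \<in> Lp_space p \<Omega>"
    using g0 x(1) by (auto simp: gradient_bounds_def W1p_def)
   from Lp_space_representative[OF this \<Omega> p]
   obtain f where f: "AE z\<in>\<Omega> in lborel. f z = mdist X (x i) (u z)" "integrable lborel f"
    by blast
   have "AE z in lborel. closed_segment z (z + \<xi>) \<subseteq> \<Omega> --> ennreal \<bar>f z - f (z + \<xi>)\<bar> \<le> ennreal (norm \<xi>) * J z"
    unfolding J_def by (rule weak_gradient_imp_segment_bound[OF \<Omega>(2) G(1) f(2,1) g(4,2) G(2)])
   then show ?thesis
    using f(1) AE_lborel_translate[OF f(1), of \<xi>]
    by eventually_elim (metis ends_in_segment(1) ends_in_segment(2) subsetD)
  qed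
  then have "AE z in lborel. \<forall>i. closed_segment z (z + \<xi>) \<subseteq> \<Omega> -->
    ennreal \<bar>mdist X (x i) (u z) - mdist X (x i) (u (z + \<xi>))\<bar> \<le> ennreal (norm \<xi>) * J z"
   by (subst AE_all_countable) blast
  then show "AE z in lborel. closed_segment z (z + \<xi>) \<subseteq> \<Omega> --> ennreal (mdist X (u z) (u (z + \<xi>)))
   \<le> ennreal (norm \<xi>) * segment_integral g z \<xi>"
   using x(2)
  proof (eventually_elim, intro impI)
   fix z
   assume 1: "\<forall>i. closed_segment z (z + \<xi>) \<subseteq> \<Omega> -->
     ennreal \<bar>mdist X (x i) (u z) - mdist X (x i) (u (z + \<xi>))\<bar> \<le> ennreal (norm \<xi>) * J z"
    and 2: "z \<in> \<Omega> --> (\<forall>\<epsilon>>0. \<exists>i. mdist X (x i) (u z) < \<epsilon>)" and seg: "closed_segment z (z + \<xi>) \<subseteq> \<Omega>"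
   have in\<Omega>: "z \<in> \<Omega>" "z + \<xi> \<in> \<Omega>" using seg by auto
   have "ennreal (mdist X (u z) (u (z + \<xi>))) = (SUP i. ennreal \<bar>mdist X (x i) (u z) - mdist X (x i) (u (z + \<xi>))\<bar>)"
    using 2 in\<Omega> by (intro mdist_eq_SUP_dense x Lp_maps_values[OF u]) auto
   also have "\<dots> \<le> ennreal (norm \<xi>) * J z" by (intro SUP_least) (use 1 seg in auto)
   finally show "ennreal (mdist X (u z) (u (z + \<xi>)))
    \<le> ennreal (norm \<xi>) * segment_integral g z \<xi>"
    by (simp add: J_def)
  qed
 qed
 moreover have "(\<integral>\<^sub>+z. ennreal (g z powr p)) = ennreal (LINT z|lebesgue_on \<Omega>. \<bar>g0 z\<bar> powr p)"
  using g1(5) by (simp add: g_def)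
 ultimately show thesis using that g grad by blast
qed

section \<open>Almost isometric subsequences\<close>

lemma mdist_measurable:
 assumes u: "u \<in> M \<rightarrow>\<^sub>M sigma (mspace X) {U. openin (mtopology_of X) U}" and x: "x \<in> mspace X"
 shows "(\<lambda>z. mdist X x (u z)) \<in> borel_measurable M"
proof (rule borel_measurableI_less)
 fix a :: real
 have sp: "space (sigma (mspace X) {U. openin (mtopology_of X) U}) = mspace X"
  by (rule space_measure_of) (use openin_subset[of "mtopology_of X"] in force)
 have uX: "u z \<in> mspace X" if "z \<in> space M" for z
  using measurable_space[OF u that] sp by simp
 have "openin (mtopology_of X) (mball_of X x a)"
  by (simp add: mball_of_def mtopology_of_def Metric_space.openin_mball[OF Metric_space_mspace_mdist])
 then have "mball_of X x a \<in> sets (sigma (mspace X) {U. openin (mtopology_of X) U})"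
  using openin_subset[of "mtopology_of X"] by (subst sets_measure_of) force+
 then have "u -` mball_of X x a \<inter> space M \<in> sets M"
  by (rule measurable_sets[OF u])
 moreover have "u -` mball_of X x a \<inter> space M = {z \<in> space M. mdist X x (u z) < a}"
  using uX x by auto
 ultimately show "{z \<in> space M. mdist X x (u z) < a} \<in> sets M" by simp
qed

lemma Lp_maps_mdist_measurable:
 "u \<in> Lp_maps p \<Omega> X ==> x \<in> mspace X ==> (\<lambda>z. mdist X x (u z)) \<in> borel_measurable (lebesgue_on \<Omega>)"
 by (intro mdist_measurable) (auto simp: Lp_maps_def)

text \<open>For a non-separable \<open>X\<close> the function \<open>mdist X (u z) (u w)\<close> need not be
 jointly measurable; the supremum over a dense sequence is a Borel function that agrees with it off a null
 set.\<close>
lemma distance_representative: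
 fixes u :: "real^'n::finite => 'x"
 assumes u: "u \<in> Lp_maps p \<Omega> X" and \<Omega>: "\<Omega> \<in> sets borel" and x0: "x0 \<in> mspace X"
 obtains \<delta> :: "real^'n => real^'n => ennreal" and e :: "real^'n => ennreal" and N
 where "(\<lambda>(z, w). \<delta> z w) \<in> borel_measurable (borel \<Otimes>\<^sub>M borel)" "e \<in> borel_measurable borel" "N \<in> null_sets lborel"
  "\<And>z w. z \<in> \<Omega> - N ==> w \<in> \<Omega> - N ==> \<delta> z w = ennreal (mdist X (u z) (u w))"
  "\<And>z. z \<in> \<Omega> - N ==> e z = ennreal (mdist X x0 (u z))"
proof -
 obtain x :: "nat => 'x" where x: "\<And>i. x i \<in> mspace X"
  "AE z\<in>\<Omega> in lborel. (\<forall>\<epsilon>>0. \<exists>i. mdist X (x i) (u z) < \<epsilon>)"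
  using Lp_maps_dense_sequence[OF u \<Omega>] by blast
 have "\<exists>f. f \<in> borel_measurable borel \<and> (AE z\<in>\<Omega> in lborel. f z = mdist X y (u z))" if "y \<in> mspace X" for y
  using borel_representative[OF Lp_maps_mdist_measurable[OF u that] \<Omega>] by metis
 then obtain f where f: "\<And>y. y \<in> mspace X ==> f y \<in> borel_measurable borel"
  "\<And>y. y \<in> mspace X ==> AE z\<in>\<Omega> in lborel. f y z = mdist X y (u z)"
  by metis
 have [measurable]: "f (x i) \<in> borel_measurable borel" for i by (rule f(1)[OF x(1)])
 have "AE z in lborel. \<forall>i. z \<in> \<Omega> --> f (x i) z = mdist X (x i) (u z)"
  by (subst AE_all_countable) (use f(2)[OF x(1)] in blast)
 then have "AE z\<in>\<Omega> in lborel. (\<forall>i. f (x i) z = mdist X (x i) (u z)) \<and> f x0 z = mdist X x0 (u z) \<and> (\<forall>\<epsilon>>0. \<exists>i. mdist X (x i) (u z) < \<epsilon>)"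
  using f(2)[OF x0] x(2) by eventually_elim blast
 then obtain N where N: "{z \<in> space lborel. \<not> (z \<in> \<Omega> --> (\<forall>i. f (x i) z = mdist X (x i) (u z)) \<and> f x0 z = mdist X x0 (u z) \<and> (\<forall>\<epsilon>>0. \<exists>i. mdist X (x i) (u z) < \<epsilon>))} \<subseteq> N"
   "emeasure lborel N = 0" "N \<in> sets lborel"
  by (rule AE_E)
 have good: "(\<forall>i. f (x i) z = mdist X (x i) (u z))" "f x0 z = mdist X x0 (u z)" "\<forall>\<epsilon>>0. \<exists>i. mdist X (x i) (u z) < \<epsilon>"
  if "z \<in> \<Omega> - N" for z using subsetD[OF N(1), of z] that by auto
 show thesis
 proof (rule that[of "\<lambda>z w. SUP i. ennreal \<bar>f (x i) z - f (x i) w\<bar>" "\<lambda>z. ennreal (f x0 z)" N])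
  show "(SUP i. ennreal \<bar>f (x i) z - f (x i) w\<bar>) = ennreal (mdist X (u z) (u w))"
   if zw: "z \<in> \<Omega> - N" "w \<in> \<Omega> - N" for z w
   using zw good[OF zw(1)] good[OF zw(2)] Lp_maps_values[OF u]
   by (subst mdist_eq_SUP_dense[of x X "u z" "u w"]) (auto simp: x)
  show "(\<lambda>z. ennreal (f x0 z)) \<in> borel_measurable borel" using f(1)[OF x0] by measurable
 qed (use N good in \<open>auto simp: null_sets_def\<close>)
qed

text \<open>With \<open>w = z + \<xi>\<close>, integrate the segment bound over \<open>z\<close> for fixed
 \<open>\<xi>\<close>: the segments stay in \<open>Q\<close> by convexity, so each \<open>\<xi>\<close>
 contributes at most \<open>d\<close> times the integral of \<open>g\<close> over \<open>Q\<close>.\<close>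
lemma segment_bound_Poincare:
 fixes u :: "real^'n::finite => 'x"
 assumes sb: "segment_bound \<Omega> X u g"
  and \<delta>[measurable]: "(\<lambda>(z, w). \<delta> z w) \<in> borel_measurable (borel \<Otimes>\<^sub>M borel)" and N: "N \<in> null_sets lborel"
  and \<delta>_eq: "\<And>z w. z \<in> \<Omega> - N ==> w \<in> \<Omega> - N ==> \<delta> z w = ennreal (mdist X (u z) (u w))"
  and g[measurable]: "g \<in> borel_measurable borel"
  and Q[measurable]: "Q \<in> sets borel" and "convex Q" "Q \<subseteq> \<Omega>"
  and D[measurable]: "D \<in> sets borel" and QD: "\<And>z w. z \<in> Q ==> w \<in> Q ==> w - z \<in> D"
  and d: "\<And>\<xi>. \<xi> \<in> D ==> norm \<xi> \<le> d"
 shows "(\<integral>\<^sub>+z. (\<integral>\<^sub>+w. \<delta> z w * indicator Q z * indicator Q w))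
  \<le> ennreal d * emeasure lborel D * (\<integral>\<^sub>+z. ennreal (g z) * indicator Q z)"
proof -
 have [measurable]: "(\<lambda>z. \<delta> (a z) (b z)) \<in> borel_measurable M" if [measurable]: "a \<in> borel_measurable M" "b \<in> borel_measurable M" for a b and M :: "'c measure"
  using measurable_compose[OF measurable_Pair[OF that] \<delta>] by simp
 define gQ where "gQ = (\<lambda>z. ennreal (g z) * indicator Q z)"
 have [measurable]: "gQ \<in> borel_measurable borel" unfolding gQ_def by measurable
 have "(\<integral>\<^sub>+z. (\<integral>\<^sub>+w. \<delta> z w * indicator Q z * indicator Q w))
  = (\<integral>\<^sub>+z. (\<integral>\<^sub>+\<xi>. \<delta> z (\<xi> + z) * indicator Q z * indicator Q (\<xi> + z)))"
  by (intro nn_integral_cong nn_integral_lborel_translate[symmetric, of "\<lambda>w. \<delta> _ w * indicator Q _ * indicator Q w"]) measurable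
 also have "\<dots> = (\<integral>\<^sub>+\<xi>. (\<integral>\<^sub>+z. \<delta> z (\<xi> + z) * indicator Q z * indicator Q (\<xi> + z)))"
  by (rule lborel_pair.Fubini') measurable
 also have "\<dots> \<le> (\<integral>\<^sub>+\<xi>. ennreal d * (\<integral>\<^sub>+z. gQ z) * indicator D \<xi>)"
 proof (intro nn_integral_mono)
  fix \<xi> :: "real^'n"
  show "(\<integral>\<^sub>+z. \<delta> z (\<xi> + z) * indicator Q z * indicator Q (\<xi> + z)) \<le> ennreal d * (\<integral>\<^sub>+z. gQ z) * indicator D \<xi>"
  proof (cases "\<xi> \<in> D")
   case False
   then have z0: "\<delta> z (\<xi> + z) * indicator Q z * indicator Q (\<xi> + z) = 0" for z
    using QD[of z "\<xi> + z"] by (auto simp: indicator_def)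
   show ?thesis unfolding z0 by simp
  next
   case True
   have "(\<integral>\<^sub>+z. \<delta> z (\<xi> + z) * indicator Q z * indicator Q (\<xi> + z))
     \<le> (\<integral>\<^sub>+z. ennreal d * (\<integral>\<^sub>+t. gQ (z + t *\<^sub>R \<xi>) * indicator {0..1} t))"
   proof (rule nn_integral_mono_AE)
    have "AE z in lborel. z \<notin> N" using N by (rule AE_not_in)
    moreover from AE_lborel_translate[OF this, of \<xi>] have "AE z in lborel. z + \<xi> \<notin> N" .
    moreover have "AE z in lborel. closed_segment z (z + \<xi>) \<subseteq> \<Omega> -->
     ennreal (mdist X (u z) (u (z + \<xi>))) \<le> ennreal (norm \<xi>) * segment_integral g z \<xi>"
     using sb by (auto simp: segment_bound_def)
    ultimately show "AE z in lborel. \<delta> z (\<xi> + z) * indicator Q z * indicator Q (\<xi> + z)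
      \<le> ennreal d * (\<integral>\<^sub>+t. gQ (z + t *\<^sub>R \<xi>) * indicator {0..1} t)"
    proof eventually_elim
     case (elim z)
     show ?case
     proof (cases "z \<in> Q \<and> z + \<xi> \<in> Q")
      case True
      then have seg: "closed_segment z (z + \<xi>) \<subseteq> Q"
       using \<open>convex Q\<close> by (simp add: closed_segment_subset)
      have "\<delta> z (\<xi> + z) = ennreal (mdist X (u z) (u (z + \<xi>)))"
       using elim True \<open>Q \<subseteq> \<Omega>\<close> by (subst \<delta>_eq) (auto simp: add.commute)
      also have "\<dots> \<le> ennreal (norm \<xi>) * segment_integral g z \<xi>"
       using elim(3) seg \<open>Q \<subseteq> \<Omega>\<close> by auto
      also have "segment_integral g z \<xi> = (\<integral>\<^sub>+t. gQ (z + t *\<^sub>R \<xi>) * indicator {0..1} t)"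
      proof (intro nn_integral_cong)
       fix t :: real
       have "z + t *\<^sub>R \<xi> \<in> closed_segment z (z + \<xi>)" if "t \<in> {0..1}"
        using that by (auto simp: in_segment algebra_simps intro!: exI[of _ t])
       then show "ennreal (g (z + t *\<^sub>R \<xi>)) * indicator {0..1} t = gQ (z + t *\<^sub>R \<xi>) * indicator {0..1} t"
        using seg by (auto simp: gQ_def indicator_def)
      qed
      also have "ennreal (norm \<xi>) * (\<integral>\<^sub>+t. gQ (z + t *\<^sub>R \<xi>) * indicator {0..1} t)
        \<le> ennreal d * (\<integral>\<^sub>+t. gQ (z + t *\<^sub>R \<xi>) * indicator {0..1} t)"
       using d[OF \<open>\<xi> \<in> D\<close>] by (intro mult_right_mono ennreal_leI) auto
      finally show ?thesis using True by (simp add: add.commute)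
     next
      case False
      then have z0: "\<delta> z (\<xi> + z) * indicator Q z * indicator Q (\<xi> + z) = 0"
       by (auto simp: indicator_def add.commute)
      show ?thesis unfolding z0 by simp
     qed
    qed
   qed
   also have "\<dots> = ennreal d * (\<integral>\<^sub>+z. gQ z)"
    by (subst nn_integral_cmult) (auto simp: nn_integral_segment_average)
   finally show ?thesis using True by simp
  qed
 qed
 also have "\<dots> = ennreal d * (\<integral>\<^sub>+z. gQ z) * emeasure lborel D"
  by (subst nn_integral_cmult_indicator) auto
 finally show ?thesis by (simp add: gQ_def mult_ac)
qed

lemma exists_point_below_average:
 fixes \<Phi> :: "'a::euclidean_space => ennreal"
 assumes [measurable]: "\<Phi> \<in> borel_measurable borel" "Q \<in> sets borel" and N: "N \<in> null_sets lborel"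
  and Q: "emeasure lborel Q > 0" "emeasure lborel Q < \<infinity>"
  and le: "(\<integral>\<^sub>+c. \<Phi> c * indicator Q c) \<le> B * emeasure lborel Q" and B: "B < B'"
 shows "\<exists>c\<in>Q - N. \<Phi> c \<le> B'"
proof (rule ccontr)
 assume "\<not> ?thesis"
 then have neg: "\<And>c. c \<in> Q - N ==> B' \<le> \<Phi> c" by (auto simp: not_le intro: less_imp_le)
 have "B' * emeasure lborel Q = (\<integral>\<^sub>+c. B' * indicator Q c)"
  by (simp add: nn_integral_cmult_indicator)
 also have "\<dots> \<le> (\<integral>\<^sub>+c. \<Phi> c * indicator Q c)"
 proof (rule nn_integral_mono_AE)
  have "AE c in lborel. c \<notin> N" using N by (rule AE_not_in)
  then show "AE c in lborel. B' * indicator Q c \<le> \<Phi> c * indicator Q c"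
   by eventually_elim (use neg in \<open>auto simp: indicator_def\<close>)
 qed
 also have "\<dots> \<le> B * emeasure lborel Q" by (rule le)
 finally have "B' * emeasure lborel Q \<le> B * emeasure lborel Q" .
 moreover have "B * emeasure lborel Q < B' * emeasure lborel Q"
  using Q B by (metis ennreal_mult_strict_right_mono infinity_ennreal_def mult.commute)
 ultimately show False by simp
qed

text \<open>Half-open cubes, so that distinct cubes of one lattice are disjoint and cover the space.\<close>
definition lattice_cube :: "real => ('n::finite => int) => (real^'n) set" where
 "lattice_cube h k = {z. \<forall>i. \<lfloor>z $ i / h\<rfloor> = k i}"

lemma lattice_cube_iff:
 assumes "h > 0"
 shows "z \<in> lattice_cube h k \<longleftrightarrow> (\<forall>i. h * k i \<le> z $ i \<and> z $ i < h * k i + h)"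
 using assms by (auto simp: lattice_cube_def floor_eq_iff le_divide_eq divide_less_eq algebra_simps)

lemma lattice_cube_borel: "lattice_cube h k \<in> sets borel"
 unfolding lattice_cube_def by measurable

lemma lattice_cube_convex:
 assumes "h > 0" shows "convex (lattice_cube h k)"
proof -
 have "lattice_cube h k = (\<Inter>i. {z. axis i 1 \<bullet> z \<ge> h * k i} \<inter> {z. axis i 1 \<bullet> z < h * k i + h})"
  using lattice_cube_iff[OF assms] by (auto simp: inner_axis')
 then show ?thesis
  by (auto intro!: convex_INT convex_Int convex_halfspace_ge convex_halfspace_lt)
qed

lemma lattice_cube_disjoint: "k \<noteq> k' ==> lattice_cube h k \<inter> lattice_cube h k' = {}"
 by (auto simp: lattice_cube_def fun_eq_iff)

lemma lattice_cube_measure: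
 assumes h: "h > 0"
 shows "emeasure lborel (lattice_cube h k :: (real^'n::finite) set) = ennreal (h ^ CARD('n))"
proof -
 define a :: "real^'n" where "a = (\<chi> i. h * k i)"
 define b :: "real^'n" where "b = (\<chi> i. h * k i + h)"
 have ab: "\<And>i. i \<in> Basis ==> a \<bullet> i \<le> b \<bullet> i"
  using h by (auto simp: Basis_vec_def a_def b_def inner_axis)
 have pr: "(\<Prod>i\<in>Basis. (b - a) \<bullet> i) = h ^ CARD('n)"
 proof -
  have "(\<Prod>i\<in>Basis. (b - a) \<bullet> i) = (\<Prod>i\<in>(Basis :: (real^'n) set). h)"
   by (intro prod.cong) (auto simp: Basis_vec_def a_def b_def inner_axis)
  then show ?thesis by simp
 qed
 have "box a b \<subseteq> lattice_cube h k" "lattice_cube h k \<subseteq> cbox a b"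
  by (auto simp: lattice_cube_iff[OF h] mem_box_cart a_def b_def less_imp_le)
 then have "emeasure lborel (box a b) \<le> emeasure lborel (lattice_cube h k :: (real^'n) set)"
  "emeasure lborel (lattice_cube h k :: (real^'n) set) \<le> emeasure lborel (cbox a b)"
  by (intro emeasure_mono; auto simp: lattice_cube_borel)+
 then show ?thesis
  using emeasure_lborel_cbox[OF ab] emeasure_lborel_box[OF ab] pr by simp
qed

lemma lattice_cube_diff:
 assumes "h > 0" "z \<in> lattice_cube h k" "w \<in> lattice_cube h k"
 shows "w - z \<in> cbox (\<chi> i. - h) (\<chi> i. h)"
proof -
 have "- h \<le> w $ i - z $ i \<and> w $ i - z $ i \<le> h" for i
  using assms(2,3) unfolding lattice_cube_iff[OF assms(1)] by (smt (verit))
 then show ?thesis by (auto simp: mem_box_cart)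
qed

lemma norm_le_of_cube:
 fixes \<xi> :: "real^'n::finite" and h :: real
 assumes "\<xi> \<in> cbox (\<chi> i. - h) (\<chi> i. h)"
 shows "norm \<xi> \<le> CARD('n) * h"
proof -
 have "norm \<xi> \<le> (\<Sum>i\<in>UNIV. \<bar>\<xi> $ i\<bar>)" by (rule norm_le_l1_cart)
 also have "\<dots> \<le> (\<Sum>i\<in>(UNIV::'n set). h)"
  using assms by (intro sum_mono) (auto simp: mem_box_cart abs_le_iff minus_le_iff)
 finally show ?thesis by simp
qed

lemma difference_cube_measure:
 assumes h: "h > 0"
 shows "emeasure lborel (cbox (\<chi> i. - h) (\<chi> i. h) :: (real^'n::finite) set) = ennreal (2 ^ CARD('n) * h ^ CARD('n))"
proof -
 define a :: "real^'n" where "a = (\<chi> i. - h)"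
 define b :: "real^'n" where "b = (\<chi> i. h)"
 have ab: "\<And>i. i \<in> Basis ==> a \<bullet> i \<le> b \<bullet> i"
  using h by (auto simp: Basis_vec_def a_def b_def inner_axis)
 have "(\<Prod>i\<in>Basis. (b - a) \<bullet> i) = (\<Prod>i\<in>(Basis :: (real^'n) set). 2 * h)"
  by (intro prod.cong) (auto simp: Basis_vec_def a_def b_def inner_axis)
 then show ?thesis
  using emeasure_lborel_cbox[OF ab] by (simp add: a_def b_def power_mult_distrib)
qed

text \<open>As the mesh tends to 0, the cubes that lie inside the open set \<open>\<Omega>\<close> eventually
 contain each of its points, so the uncovered part has measure tending to 0; boundedness keeps their number
 finite.\<close>
lemma lattice_cubes_exhaust:
 fixes \<Omega> :: "(real^'n::finite) set"
 assumes \<Omega>: "open \<Omega>" "bounded \<Omega>" and \<theta>: "\<theta> > 0"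
 obtains h and K :: "('n => int) set" where "0 < h" "h \<le> \<theta>" "finite K" "\<And>k. k \<in> K ==> lattice_cube h k \<subseteq> \<Omega>"
  "emeasure lborel (\<Omega> - (\<Union>k\<in>K. lattice_cube h k)) \<le> ennreal \<theta>"
proof -
 have [measurable]: "\<Omega> \<in> sets borel" using \<Omega> by auto
 define h where "h = (\<lambda>n::nat. 1 / (real n + 1))"
 define K where "K = (\<lambda>n. {k::'n => int. lattice_cube (h n) k \<subseteq> \<Omega>})"
 have h: "h n > 0" for n by (simp add: h_def)
 have hlim: "h \<longlonglongrightarrow> 0" using LIMSEQ_inverse_real_of_nat by (simp add: h_def[abs_def] inverse_eq_divide add.commute)
 obtain R where R: "\<And>z. z \<in> \<Omega> ==> norm z \<le> R" using \<Omega>(2) by (auto simp: bounded_iff)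
 have finK: "finite (K n)" for n
 proof (rule finite_subset)
  show "K n \<subseteq> PiE UNIV (\<lambda>_. {- \<lceil>R / h n\<rceil> .. \<lceil>R / h n\<rceil>})"
  proof
   fix k assume k: "k \<in> K n"
   define z :: "real^'n" where "z = (\<chi> i. h n * k i)"
   have "z \<in> lattice_cube (h n) k" using h[of n] by (simp add: lattice_cube_iff z_def)
   then have "norm z \<le> R" using k R by (auto simp: K_def)
   then have "\<bar>h n * k i\<bar> \<le> R" for i
    using component_le_norm_cart[of z i] by (simp add: z_def)
   then have "\<bar>real_of_int (k i)\<bar> \<le> R / h n" for i
    using h[of n] by (simp add: abs_mult le_divide_eq mult.commute)
   then have "k i \<in> {- \<lceil>R / h n\<rceil> .. \<lceil>R / h n\<rceil>}" for i
    by (smt (verit, best) atLeastAtMost_iff le_of_int_ceiling of_int_le_iff of_int_minus)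
   then show "k \<in> PiE UNIV (\<lambda>_. {- \<lceil>R / h n\<rceil> .. \<lceil>R / h n\<rceil>})" by (auto simp: PiE_iff)
  qed
  show "finite (PiE (UNIV :: 'n set) (\<lambda>_. {- \<lceil>R / h n\<rceil> .. \<lceil>R / h n\<rceil>}))"
   by (intro finite_PiE) auto
 qed
 define U where "U = (\<lambda>n. \<Union>k\<in>K n. lattice_cube (h n) k)"
 have [measurable]: "U n \<in> sets borel" for n
  unfolding U_def by (intro sets.finite_UN finK lattice_cube_borel)
 have "(\<lambda>n. \<integral>\<^sub>+z. indicator (\<Omega> - U n) z) \<longlonglongrightarrow> (\<integral>\<^sup>+z. 0 \<partial>(lborel :: (real^'n) measure))"
 proof (rule nn_integral_dominated_convergence[where w="indicator \<Omega>"])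
  show "(\<integral>\<^sub>+z. indicator \<Omega> z) < \<infinity>" using emeasure_bounded_finite[OF \<Omega>(2)] by simp
  show "AE z in lborel. (\<lambda>n. indicator (\<Omega> - U n) z :: ennreal) \<longlonglongrightarrow> 0"
  proof (rule AE_I2)
   fix z :: "real^'n"
   show "(\<lambda>n. indicator (\<Omega> - U n) z :: ennreal) \<longlonglongrightarrow> 0"
   proof (cases "z \<in> \<Omega>")
    case True
    then obtain \<epsilon> where \<epsilon>: "\<epsilon> > 0" "cball z \<epsilon> \<subseteq> \<Omega>" using \<Omega>(1) by (auto simp: open_contains_cball)
    have "(\<lambda>n. CARD('n) * h n) \<longlonglongrightarrow> real CARD('n) * 0" by (intro tendsto_intros hlim)
    then have "eventually (\<lambda>n. CARD('n) * h n < \<epsilon>) sequentially"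
     using \<epsilon> by (intro order_tendstoD(2)[of _ "real CARD('n) * 0"]) auto
    then have "eventually (\<lambda>n. indicator (\<Omega> - U n) z = (0::ennreal)) sequentially"
    proof eventually_elim
     case (elim n)
     define k where "k = (\<lambda>i. \<lfloor>z $ i / h n\<rfloor>)"
     have zk: "z \<in> lattice_cube (h n) k" by (simp add: lattice_cube_def k_def)
     have "lattice_cube (h n) k \<subseteq> cball z \<epsilon>"
     proof
      fix w assume "w \<in> lattice_cube (h n) k"
      from norm_le_of_cube[OF lattice_cube_diff[OF h zk this]] elim
      show "w \<in> cball z \<epsilon>" by (simp add: dist_norm norm_minus_commute)
     qed
     then have "k \<in> K n" using \<epsilon>(2) by (auto simp: K_def)
     then have "z \<in> U n" using zk by (auto simp: U_def)
     then show ?case by simp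
    qed
    then show ?thesis by (rule tendsto_eventually)
   qed simp
  qed
 qed (auto simp: indicator_def)
 then have "(\<lambda>n. emeasure lborel (\<Omega> - U n)) \<longlonglongrightarrow> 0" by simp
 then have "eventually (\<lambda>n. emeasure lborel (\<Omega> - U n) < ennreal \<theta>) sequentially"
  using \<theta> by (intro order_tendstoD(2)) auto
 moreover have "eventually (\<lambda>n. h n < \<theta>) sequentially"
  using order_tendstoD(2)[OF hlim \<theta>] .
 ultimately have "eventually (\<lambda>n. emeasure lborel (\<Omega> - U n) < ennreal \<theta> \<and> h n < \<theta>) sequentially"
  by eventually_elim simp
 then obtain n where "emeasure lborel (\<Omega> - U n) < ennreal \<theta>" "h n < \<theta>"
  by (auto simp: eventually_sequentially)
 with h finK show thesis
  by (intro that[of "h n" "K n"]) (auto simp: U_def K_def less_imp_le)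
qed

lemma sum_nn_integral_lattice_cubes_le:
 fixes f :: "real^'n::finite => ennreal"
 assumes [measurable]: "f \<in> borel_measurable borel" and K: "finite K" "\<And>k. k \<in> K ==> lattice_cube h k \<subseteq> \<Omega>"
 shows "(\<Sum>k\<in>K. \<integral>\<^sub>+z. f z * indicator (lattice_cube h k) z) \<le> (\<integral>\<^sub>+z. f z * indicator \<Omega> z)"
proof -
 have [measurable]: "lattice_cube h k \<in> sets borel" for k :: "'n => int" by (rule lattice_cube_borel)
 have "(\<Sum>k\<in>K. \<integral>\<^sub>+z. f z * indicator (lattice_cube h k) z) = (\<integral>\<^sub>+z. (\<Sum>k\<in>K. f z * indicator (lattice_cube h k) z))"
  by (rule nn_integral_sum[symmetric]) measurable
 also have "\<dots> \<le> (\<integral>\<^sub>+z. f z * indicator \<Omega> z)"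
 proof (intro nn_integral_mono)
  fix z :: "real^'n"
  have "(\<Sum>k\<in>K. indicator (lattice_cube h k) z :: ennreal) = indicator (\<Union>k\<in>K. lattice_cube h k) z"
   using K(1) lattice_cube_disjoint by (intro indicator_UN_disjoint[symmetric]) (auto simp: disjoint_family_on_def)
  also have "\<dots> \<le> indicator \<Omega> z" using K(2) by (auto simp: indicator_def)
  finally show "(\<Sum>k\<in>K. f z * indicator (lattice_cube h k) z) \<le> f z * indicator \<Omega> z"
   by (simp add: mult_left_mono flip: sum_distrib_left)
 qed
 finally show ?thesis .
qed

text \<open>On each cube the mean over \<open>c\<close> of the sum of two quantities is controlled: the
 integrated distance to \<open>u c\<close>, by the Poincare inequality, and \<open>e c\<close>, weighted by
 \<open>h\<^sup>n\<^sup>+\<^sup>1\<close>. Some \<open>c\<close> outside \<open>N\<close> is almost below that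
 mean. The summand \<open>A'\<close> in \<open>C\<close> pays for the slack.\<close>
lemma good_centres:
 fixes u :: "real^'n::finite => 'x" and g :: "real^'n => real" and A A' h :: real
 defines "C \<equiv> CARD('n) * 2 ^ CARD('n) * A + A + A'"
 assumes sb: "segment_bound \<Omega> X u g"
  and \<delta>[measurable]: "(\<lambda>(z, w). \<delta> z w) \<in> borel_measurable (borel \<Otimes>\<^sub>M borel)" and e[measurable]: "e \<in> borel_measurable borel"
  and N: "N \<in> null_sets lborel"
  and \<delta>_eq: "\<And>z w. z \<in> \<Omega> - N ==> w \<in> \<Omega> - N ==> \<delta> z w = ennreal (mdist X (u z) (u w))"
  and g[measurable]: "g \<in> borel_measurable borel" and \<Omega>: "\<Omega> \<in> sets borel"
  and A: "A \<ge> 0" "(\<integral>\<^sub>+z. ennreal (g z) * indicator \<Omega> z) \<le> ennreal A" "(\<integral>\<^sub>+z. e z * indicator \<Omega> z) \<le> ennreal A"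
  and A': "A' \<ge> 0" "emeasure lborel \<Omega> \<le> ennreal A'"
  and h: "h > 0" and K: "finite K" "\<And>k. k \<in> K ==> lattice_cube h k \<subseteq> \<Omega>"
 obtains c where "\<And>k. k \<in> K ==> c k \<in> lattice_cube h k - N" "\<And>k. k \<in> K ==> ennreal (h ^ CARD('n)) * e (c k) \<le> ennreal C"
  "(\<Sum>k\<in>K. \<integral>\<^sub>+z. \<delta> z (c k) * indicator (lattice_cube h k) z) \<le> ennreal (h * C)"
proof -
 define n where "n = CARD('n)"
 have [measurable]: "lattice_cube h k \<in> sets borel" for k :: "'n => int" by (rule lattice_cube_borel)
 have [measurable]: "(\<lambda>z. \<delta> (a z) (b z)) \<in> borel_measurable M" if [measurable]: "a \<in> borel_measurable M" "b \<in> borel_measurable M" for a b and M :: "'c measure"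
  using measurable_compose[OF measurable_Pair[OF that] \<delta>] by simp
 have C: "C \<ge> 0" using A A' by (simp add: C_def)
 define I where "I = (\<lambda>k c. \<integral>\<^sub>+z. \<delta> z c * indicator (lattice_cube h k) z)"
 have [measurable]: "I k \<in> borel_measurable borel" for k unfolding I_def by measurable
 define \<Phi> where "\<Phi> = (\<lambda>k c. I k c + ennreal (h * h ^ n) * e c)"
 define B where "B = (\<lambda>k. ennreal (n * h * 2 ^ n) * (\<integral>\<^sub>+z. ennreal (g z) * indicator (lattice_cube h k) z)
  + ennreal h * (\<integral>\<^sub>+z. e z * indicator (lattice_cube h k) z))"
 have sumB: "(\<Sum>k\<in>K. B k + ennreal (h * h ^ n)) \<le> ennreal (h * C)"
 proof -
  have s1: "(\<Sum>k\<in>K. \<integral>\<^sub>+z. ennreal (g z) * indicator (lattice_cube h k) z) \<le> ennreal A"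
   by (rule order_trans[OF sum_nn_integral_lattice_cubes_le[OF _ K] A(2)]) measurable
  have s2: "(\<Sum>k\<in>K. \<integral>\<^sub>+z. e z * indicator (lattice_cube h k) z) \<le> ennreal A"
   by (rule order_trans[OF sum_nn_integral_lattice_cubes_le[OF _ K] A(3)]) measurable
  have "(\<Sum>k\<in>K. \<integral>\<^sub>+z. 1 * indicator (lattice_cube h k) z) \<le> (\<integral>\<^sub>+z. 1 * indicator \<Omega> z)"
   by (rule sum_nn_integral_lattice_cubes_le[OF _ K]) measurable
  then have s3: "(\<Sum>k\<in>K. ennreal (h ^ n)) \<le> ennreal A'"
   using A'(2) \<Omega> by (simp add: lattice_cube_measure[OF h] n_def)
  have "(\<Sum>k\<in>K. B k + ennreal (h * h ^ n)) = ennreal (n * h * 2 ^ n) * (\<Sum>k\<in>K. \<integral>\<^sub>+z. ennreal (g z) * indicator (lattice_cube h k) z)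
   + ennreal h * (\<Sum>k\<in>K. \<integral>\<^sub>+z. e z * indicator (lattice_cube h k) z) + ennreal h * (\<Sum>k\<in>K. ennreal (h ^ n))"
   unfolding B_def ennreal_mult[OF less_imp_le[OF h] zero_le_power[OF less_imp_le[OF h]]] sum.distrib sum_distrib_left ..
  also have "\<dots> \<le> ennreal (n * h * 2 ^ n) * ennreal A + ennreal h * ennreal A + ennreal h * ennreal A'"
   by (intro add_mono mult_left_mono s1 s2 s3) auto
  also have "\<dots> = ennreal (h * C)"
   using h A(1) A'(1) by (simp add: C_def n_def algebra_simps flip: ennreal_mult ennreal_plus)
  finally show ?thesis .
 qed
 have "\<exists>c\<in>lattice_cube h k - N. \<Phi> k c \<le> B k + ennreal (h * h ^ n)" if k: "k \<in> K" for k
 proof (rule exists_point_below_average[OF _ lattice_cube_borel N, where B = "B k"])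
  show "\<Phi> k \<in> borel_measurable borel" unfolding \<Phi>_def by measurable
  show "0 < emeasure lborel (lattice_cube h k)" "emeasure lborel (lattice_cube h k) < \<infinity>"
   using h by (simp_all add: lattice_cube_measure)
  have "B k \<le> (\<Sum>k\<in>K. B k + ennreal (h * h ^ n))"
   using member_le_sum[OF k _ K(1), of "\<lambda>k. B k + ennreal (h * h ^ n)"] by (auto intro: order_trans[rotated])
  then have "B k < \<infinity>" using sumB by (auto simp: top_unique less_top[symmetric])
  then show "B k < B k + ennreal (h * h ^ n)" 
   using h by (cases "B k") (auto simp: ennreal_less_iff simp flip: ennreal_plus)
  have P: "(\<integral>\<^sub>+c. (\<integral>\<^sub>+z. \<delta> z c * indicator (lattice_cube h k) z * indicator (lattice_cube h k) c))
    \<le> ennreal (n * h) * ennreal (2 ^ n * h ^ n) * (\<integral>\<^sub>+z. ennreal (g z) * indicator (lattice_cube h k) z)"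
   unfolding n_def difference_cube_measure[OF h, symmetric]
   by (subst lborel_pair.Fubini', measurable)
    (rule segment_bound_Poincare[OF sb \<delta> N \<delta>_eq g lattice_cube_borel lattice_cube_convex[OF h] K(2)[OF k] _ lattice_cube_diff[OF h] norm_le_of_cube]; simp)
  have "(\<integral>\<^sub>+c. \<Phi> k c * indicator (lattice_cube h k) c)
   = (\<integral>\<^sub>+c. (\<integral>\<^sub>+z. \<delta> z c * indicator (lattice_cube h k) z * indicator (lattice_cube h k) c))
    + ennreal (h * h ^ n) * (\<integral>\<^sub>+z. e z * indicator (lattice_cube h k) z)"
   unfolding \<Phi>_def I_def distrib_right mult.assoc[of "ennreal (h * h ^ n)"]
   by (subst nn_integral_add, measurable) (simp add: nn_integral_cmult nn_integral_multc)
  also have "\<dots> \<le> ennreal (n * h) * ennreal (2 ^ n * h ^ n) * (\<integral>\<^sub>+z. ennreal (g z) * indicator (lattice_cube h k) z)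
    + ennreal (h * h ^ n) * (\<integral>\<^sub>+z. e z * indicator (lattice_cube h k) z)"
   by (intro add_right_mono P)
  also have "\<dots> = B k * emeasure lborel (lattice_cube h k)"
  proof -
   have "ennreal (n * h) * ennreal (2 ^ n * h ^ n) = ennreal (n * h * 2 ^ n) * ennreal (h ^ n)"
    "ennreal (h * h ^ n) = ennreal h * ennreal (h ^ n)"
    using h by (simp_all add: mult_ac flip: ennreal_mult)
   then show ?thesis
    unfolding lattice_cube_measure[OF h] n_def[symmetric] B_def by (simp only: distrib_left distrib_right mult_ac)
  qed
  finally show "(\<integral>\<^sub>+c. \<Phi> k c * indicator (lattice_cube h k) c) \<le> B k * emeasure lborel (lattice_cube h k)" .
 qed
 then obtain c where c: "\<And>k. k \<in> K ==> c k \<in> lattice_cube h k - N" "\<And>k. k \<in> K ==> \<Phi> k (c k) \<le> B k + ennreal (h * h ^ n)"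
  by metis
 have sum\<Phi>: "(\<Sum>k\<in>K. \<Phi> k (c k)) \<le> ennreal (h * C)"
  by (rule order_trans[OF sum_mono[OF c(2)] sumB])
 show thesis
 proof (rule that[of c])
  show "(\<Sum>k\<in>K. \<integral>\<^sub>+z. \<delta> z (c k) * indicator (lattice_cube h k) z) \<le> ennreal (h * C)"
   by (rule order_trans[OF sum_mono sum\<Phi>]) (simp add: \<Phi>_def I_def)
  fix k assume k: "k \<in> K"
  have "ennreal h * (ennreal (h ^ n) * e (c k)) \<le> \<Phi> k (c k)"
   using h by (simp add: \<Phi>_def ennreal_mult mult.assoc add_increasing)
  also have "\<dots> \<le> (\<Sum>k\<in>K. \<Phi> k (c k))" by (rule member_le_sum[OF k _ K(1)]) auto
  also have "\<dots> \<le> ennreal h * ennreal C" using sum\<Phi> h C by (simp add: ennreal_mult)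
  finally show "ennreal (h ^ CARD('n)) * e (c k) \<le> ennreal C"
   using h by (subst (asm) ennreal_mult_le_mult_iff) (auto simp: n_def)
 qed (rule c(1))
qed

lemma bounded_sequences_common_subsequence:
 fixes y :: "nat => nat => real"
 assumes "\<And>i. bounded (range (y i))"
 obtains s :: "nat => nat" where "strict_mono s" "\<And>i. convergent (\<lambda>m. y i (s m))"
proof -
 interpret subseqs "\<lambda>i s. convergent (\<lambda>m. y i (s m))"
 proof
  fix i and s :: "nat => nat"
  have "bounded (range (\<lambda>m. y i (s m)))" using assms[of i] by (rule bounded_subset) auto
  then obtain l r where "strict_mono r" "((\<lambda>m. y i (s m)) \<circ> r) \<longlonglongrightarrow> l"
   using bounded_imp_convergent_subsequence by blast
  then show "\<exists>r'. strict_mono r' \<and> convergent (\<lambda>m. y i ((s \<circ> r') m))"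
   by (auto simp: o_def convergent_def)
 qed
 have "convergent (\<lambda>m. y i (diagseq m))" for i
 proof -
  have "convergent (\<lambda>m. y i ((diagseq \<circ> ((+) (Suc i))) m))"
  proof (rule diagseq_holds)
   fix r s :: "nat => nat" and n assume "strict_mono r" "convergent (\<lambda>m. y n (s m))"
   then show "convergent (\<lambda>m. y n ((s \<circ> r) m))"
    using convergent_subseq_convergent[of "\<lambda>m. y n (s m)" r] by (simp add: o_def)
  qed
  then have "convergent (\<lambda>m. y i (diagseq (m + Suc i)))" by (simp add: o_def add.commute)
  then show ?thesis
   using convergent_ignore_initial_segment[of "\<lambda>m. y i (diagseq m)" "Suc i"] by simp
 qed
 then show thesis using that subseq_diagseq by blast
qed

lemma strict_mono_above: "\<exists>r::nat => nat. strict_mono r \<and> (\<forall>k. N k \<le> r k)"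
proof (intro exI conjI allI)
 show "strict_mono (\<lambda>k. k + (\<Sum>i\<le>k. N i))" by (simp add: strict_mono_Suc_iff)
 show "N k \<le> k + (\<Sum>i\<le>k. N i)" for k using member_le_sum[of k "{..k}" N] by simp
qed

text \<open>At scale \<open>j\<close> the cubes have side at most \<open>4\<^sup>-\<^sup>j\<close>, so by
 Markov's inequality the points further than \<open>2\<^sup>-\<^sup>j\<close> from the value at the centre of
 their cube have measure of order \<open>2\<^sup>-\<^sup>j\<close>. The mutual distances of the finitely many
 centre values are bounded in \<open>m\<close>; a common subsequence makes them converge for every
 \<open>j\<close>, and \<open>r\<close> is chosen so that they have settled up to
 \<open>2\<^sup>-\<^sup>j\<close> from index \<open>r j\<close> on. The constant is \<open>5 = 2 + 2 +
 1\<close>: two replacements of points by centres in each of the two maps, and the variation of the centre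
 distances.\<close>
lemma subsequence_almost_isometric:
 fixes u :: "nat => real^'n::finite => 'x" and g :: "nat => real^'n => real"
 assumes \<Omega>: "open \<Omega>" "bounded \<Omega>" and u: "\<And>m. u m \<in> Lp_maps p \<Omega> X" and sb: "\<And>m. segment_bound \<Omega> X (u m) (g m)"
  and g: "\<And>m. g m \<in> borel_measurable borel" and A: "A \<ge> 0" "\<And>m. (\<integral>\<^sub>+z. ennreal (g m z) * indicator \<Omega> z) \<le> ennreal A"
  and x0: "x0 \<in> mspace X" "\<And>m. (\<integral>\<^sub>+z. ennreal (mdist X x0 (u m z)) * indicator \<Omega> z) \<le> ennreal A"
 obtains r :: "nat => nat" and G :: "nat => (real^'n) set" and B :: real
 where "strict_mono r" "\<And>j. G j \<in> sets borel" "\<And>j. G j \<subseteq> \<Omega>" "\<And>j. emeasure lborel (\<Omega> - G j) \<le> ennreal (B * (1/2) ^ j)"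
  "\<And>j z w. z \<in> G j ==> w \<in> G j ==>
   \<bar>mdist X (u (r j) z) (u (r j) w) - mdist X (u (r (Suc j)) z) (u (r (Suc j)) w)\<bar> \<le> 5 * (1/2) ^ j"
proof -
 have \<Omega>b[measurable]: "\<Omega> \<in> sets borel" using \<Omega> by auto
 define A' where "A' = measure lborel \<Omega>"
 have A': "A' \<ge> 0" "emeasure lborel \<Omega> \<le> ennreal A'"
  using emeasure_bounded_finite[OF \<Omega>(2)] by (auto simp: A'_def emeasure_eq_ennreal_measure less_top)
 define C where "C = CARD('n) * 2 ^ CARD('n) * A + A + A'"
 have C: "C \<ge> 0" using A A' by (simp add: C_def)
 define P where "P = (\<lambda>m \<delta> N. (\<lambda>(z, w). \<delta> z w) \<in> borel_measurable (borel \<Otimes>\<^sub>M borel) \<and> N \<in> null_sets lborel \<and>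
  (\<forall>z w. z \<in> \<Omega> - N --> w \<in> \<Omega> - N --> \<delta> z w = ennreal (mdist X (u m z) (u m w))) \<and>
  (\<forall>h>0. \<forall>K::('n => int) set. finite K --> (\<forall>k\<in>K. lattice_cube h k \<subseteq> \<Omega>) -->
   (\<exists>c. (\<forall>k\<in>K. c k \<in> lattice_cube h k - N \<and> mdist X x0 (u m (c k)) \<le> C / h ^ CARD('n)) \<and>
     (\<Sum>k\<in>K. \<integral>\<^sub>+z. \<delta> z (c k) * indicator (lattice_cube h k) z) \<le> ennreal (h * C))))"
 have "\<exists>\<delta> N. P m \<delta> N" for m
 proof -
  obtain \<delta> :: "real^'n => real^'n => ennreal" and e N
   where 1: "(\<lambda>(z, w). \<delta> z w) \<in> borel_measurable (borel \<Otimes>\<^sub>M borel)" "e \<in> borel_measurable borel" "N \<in> null_sets lborel"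
   and 2: "\<And>z w. z \<in> \<Omega> - N ==> w \<in> \<Omega> - N ==> \<delta> z w = ennreal (mdist X (u m z) (u m w))"
   and 3: "\<And>z. z \<in> \<Omega> - N ==> e z = ennreal (mdist X x0 (u m z))"
   using distance_representative[OF u[of m] \<Omega>b x0(1)] by blast
  have "(\<integral>\<^sub>+z. e z * indicator \<Omega> z) = (\<integral>\<^sub>+z. ennreal (mdist X x0 (u m z)) * indicator \<Omega> z)"
  proof (rule nn_integral_cong_AE)
   show "AE z in lborel. e z * indicator \<Omega> z = ennreal (mdist X x0 (u m z)) * indicator \<Omega> z"
    using AE_not_in[OF 1(3)] by eventually_elim (use 3 in \<open>auto simp: indicator_def\<close>)
  qed
  then have 4: "(\<integral>\<^sub>+z. e z * indicator \<Omega> z) \<le> ennreal A" using x0(2)[of m] by simp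
  have "\<exists>c. (\<forall>k\<in>K. c k \<in> lattice_cube h k - N \<and> mdist X x0 (u m (c k)) \<le> C / h ^ CARD('n)) \<and>
     (\<Sum>k\<in>K. \<integral>\<^sub>+z. \<delta> z (c k) * indicator (lattice_cube h k) z) \<le> ennreal (h * C)"
   if h: "h > 0" and K: "finite K" "\<And>k. k \<in> K ==> lattice_cube h k \<subseteq> \<Omega>" for h and K :: "('n => int) set"
  proof -
   obtain c where c: "\<And>k. k \<in> K ==> c k \<in> lattice_cube h k - N" "\<And>k. k \<in> K ==> ennreal (h ^ CARD('n)) * e (c k) \<le> ennreal C"
    "(\<Sum>k\<in>K. \<integral>\<^sub>+z. \<delta> z (c k) * indicator (lattice_cube h k) z) \<le> ennreal (h * C)"
    using good_centres[OF sb[of m] 1(1,2,3) 2 g[of m] \<Omega>b A(1) A(2)[of m] 4 A' h K] unfolding C_def by blast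
   have "mdist X x0 (u m (c k)) \<le> C / h ^ CARD('n)" if k: "k \<in> K" for k
   proof -
    have "c k \<in> \<Omega> - N" using c(1)[OF k] K(2)[OF k] by auto
    then have "ennreal (h ^ CARD('n) * mdist X x0 (u m (c k))) \<le> ennreal C"
     using c(2)[OF k] 3[of "c k"] h by (simp add: ennreal_mult mdist_nonneg_of)
    then have "h ^ CARD('n) * mdist X x0 (u m (c k)) \<le> C" using C by simp
    then show ?thesis using h by (simp add: le_divide_eq mult.commute)
   qed
   with c show ?thesis by blast
  qed
  with 1 2 show ?thesis unfolding P_def by (intro exI[of _ \<delta>] exI[of _ N]) blast
 qed
 then obtain \<delta> N where P: "\<And>m. P m (\<delta> m) (N m)" by metis
 have \<delta>: "\<And>m. (\<lambda>(z, w). \<delta> m z w) \<in> borel_measurable (borel \<Otimes>\<^sub>M borel)" and N: "\<And>m. N m \<in> null_sets lborel"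
  and \<delta>_eq: "\<And>m z w. z \<in> \<Omega> - N m ==> w \<in> \<Omega> - N m ==> \<delta> m z w = ennreal (mdist X (u m z) (u m w))"
  and centres: "\<And>m h (K::('n => int) set). h > 0 ==> finite K ==> (\<forall>k\<in>K. lattice_cube h k \<subseteq> \<Omega>) ==>
   \<exists>c. (\<forall>k\<in>K. c k \<in> lattice_cube h k - N m \<and> mdist X x0 (u m (c k)) \<le> C / h ^ CARD('n)) \<and>
     (\<Sum>k\<in>K. \<integral>\<^sub>+z. \<delta> m z (c k) * indicator (lattice_cube h k) z) \<le> ennreal (h * C)"
  using P unfolding P_def by blast+
 have "\<exists>h (K::('n => int) set). 0 < h \<and> h \<le> (1/4) ^ j \<and> finite K \<and> (\<forall>k\<in>K. lattice_cube h k \<subseteq> \<Omega>) \<and>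
   emeasure lborel (\<Omega> - (\<Union>k\<in>K. lattice_cube h k)) \<le> ennreal ((1/4) ^ j)" for j :: nat
  using lattice_cubes_exhaust[OF \<Omega>, of "(1/4) ^ j"] by (metis zero_less_divide_1_iff zero_less_numeral zero_less_power)
 then obtain h and K :: "nat => ('n => int) set" where h: "\<And>j. 0 < h j" "\<And>j. h j \<le> (1/4) ^ j" and K: "\<And>j. finite (K j)" "\<And>j. \<forall>k\<in>K j. lattice_cube (h j) k \<subseteq> \<Omega>"
  "\<And>j. emeasure lborel (\<Omega> - (\<Union>k\<in>K j. lattice_cube (h j) k)) \<le> ennreal ((1/4) ^ j)"
  by metis
 define PC where "PC = (\<lambda>j m c. (\<forall>k\<in>K j. c k \<in> lattice_cube (h j) k - N m \<and> mdist X x0 (u m (c k)) \<le> C / h j ^ CARD('n)) \<and>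
     (\<Sum>k\<in>K j. \<integral>\<^sub>+z. \<delta> m z (c k) * indicator (lattice_cube (h j) k) z) \<le> ennreal (h j * C))"
 have "\<exists>c. PC j m c" for j m
  unfolding PC_def by (rule centres[OF h(1) K(1,2)])
 then obtain c where "\<And>j m. PC j m (c j m)" by metis
 then have c: "\<And>j m k. k \<in> K j ==> c j m k \<in> lattice_cube (h j) k - N m"
   "\<And>j m k. k \<in> K j ==> mdist X x0 (u m (c j m k)) \<le> C / h j ^ CARD('n)"
   "\<And>j m. (\<Sum>k\<in>K j. \<integral>\<^sub>+z. \<delta> m z (c j m k) * indicator (lattice_cube (h j) k) z) \<le> ennreal (h j * C)"
  unfolding PC_def by blast+
 have c\<Omega>: "c j m k \<in> \<Omega> - N m" if "k \<in> K j" for j m k using c(1)[OF that] K(2) that by blast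
 have uc: "u m (c j m k) \<in> mspace X" if "k \<in> K j" for j m k
  using c\<Omega>[OF that, of m] Lp_maps_values[OF u] by blast
 define a where "a = (\<lambda>j m k k'. mdist X (u m (c j m k)) (u m (c j m k')))"
 have a_bound: "\<bar>a j m k k'\<bar> \<le> 2 * C / h j ^ CARD('n)" if "k \<in> K j" "k' \<in> K j" for j m k k'
  using mdist_triangle_of[OF uc[OF that(1)] x0(1) uc[OF that(2)], of m m] c(2)[OF that(1), of m] c(2)[OF that(2), of m]
  by (simp add: a_def mdist_nonneg_of mdist_commute_of[of X _ x0])
 define y where "y = (\<lambda>i m. case from_nat i of (j, k, k') => if k \<in> K j \<and> k' \<in> K j then a j m k k' else 0)"
 obtain s :: "nat => nat" where s: "strict_mono s" "\<And>i. convergent (\<lambda>m. y i (s m))"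
 proof (rule bounded_sequences_common_subsequence[of y])
  fix i
  obtain j :: nat and k k' :: "'n => int" where i: "from_nat i = (j, k, k')" by (metis prod_cases3)
  have "\<bar>y i m\<bar> \<le> \<bar>2 * C / h j ^ CARD('n)\<bar>" for m
   using order_trans[OF a_bound[of k j k' m] abs_ge_self] by (auto simp del: abs_divide simp: y_def i)
  then show "bounded (range (y i))" by (auto simp: bounded_iff)
 qed blast
 define l where "l = (\<lambda>j k k'. lim (\<lambda>m. a j (s m) k k'))"
 have l: "(\<lambda>m. a j (s m) k k') \<longlonglongrightarrow> l j k k'" if "k \<in> K j" "k' \<in> K j" for j k k'
  using s(2)[of "to_nat (j, k, k')"] that by (simp add: y_def l_def convergent_LIMSEQ_iff)
 have "\<exists>M. \<forall>m\<ge>M. \<forall>k\<in>K j. \<forall>k'\<in>K j. \<bar>a j (s m) k k' - l j k k'\<bar> \<le> (1/2) ^ j / 2" for j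
 proof -
  have "eventually (\<lambda>m. \<forall>k\<in>K j. \<forall>k'\<in>K j. \<bar>a j (s m) k k' - l j k k'\<bar> \<le> (1/2) ^ j / 2) sequentially"
  proof (intro eventually_ball_finite ballI K)
   fix k k' assume kk: "k \<in> K j" "k' \<in> K j"
   have "eventually (\<lambda>m. dist (a j (s m) k k') (l j k k') < (1/2) ^ j / 2) sequentially"
    by (rule tendstoD[OF l[OF kk]]) simp
   then show "eventually (\<lambda>m. \<bar>a j (s m) k k' - l j k k'\<bar> \<le> (1/2) ^ j / 2) sequentially"
    by eventually_elim (simp add: dist_real_def)
  qed
  then show ?thesis by (simp add: eventually_sequentially)
 qed
 then obtain M where M: "\<And>j m k k'. m \<ge> M j ==> k \<in> K j ==> k' \<in> K j ==> \<bar>a j (s m) k k' - l j k k'\<bar> \<le> (1/2) ^ j / 2"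
  by metis
 obtain t where t: "strict_mono t" "\<And>j. M j \<le> t j" using strict_mono_above[of M] by blast
 define r where "r = s \<circ> t"
 have r: "strict_mono r" unfolding r_def by (rule strict_mono_o[OF s(1) t(1)])
 have a_close: "\<bar>a j (r j) k k' - a j (r (Suc j)) k k'\<bar> \<le> (1/2) ^ j" if "k \<in> K j" "k' \<in> K j" for j k k'
 proof -
  have "M j \<le> t (Suc j)" using t(2)[of j] strict_monoD[OF t(1), of j "Suc j"] by simp
  then show ?thesis using M[OF t(2)[of j] that] M[OF _ that, of "t (Suc j)"] unfolding r_def o_def by linarith
 qed
 \<comment> \<open>\<open>T j m\<close> collects the points whose value is within \<open>2\<^sup>-\<^sup>j\<close> of the value at the centre of their cube.\<close>
 define T where "T = (\<lambda>j m. \<Union>k\<in>K j. {z \<in> lattice_cube (h j) k. \<delta> m z (c j m k) \<le> ennreal ((1/2) ^ j)})"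
 define G where "G = (\<lambda>j. T j (r j) \<inter> T j (r (Suc j)) - N (r j) - N (r (Suc j)))"
 have [measurable]: "(\<lambda>z. \<delta> m z w) \<in> borel_measurable borel" for m w
 proof -
  have "(\<lambda>z. (z, w)) \<in> borel \<rightarrow>\<^sub>M borel \<Otimes>\<^sub>M borel" by measurable
  from measurable_compose[OF this \<delta>] show ?thesis by simp
 qed
 have [measurable]: "lattice_cube (h j) k \<in> sets borel" for j and k :: "'n => int" by (rule lattice_cube_borel)
 have meas1: "{z \<in> lattice_cube (h j) k. \<delta> m z w \<le> ennreal \<theta>} \<in> sets borel" for j m k w \<theta>
  by measurable
 have [measurable]: "T j m \<in> sets borel" for j m
  unfolding T_def by (intro sets.finite_UN K meas1)
 have [measurable]: "N m \<in> sets borel" for m using N[of m] by auto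
 have T_sub: "T j m \<subseteq> \<Omega>" for j m using K(2) by (auto simp: T_def)
 have bad: "emeasure lborel ((\<Union>k\<in>K j. lattice_cube (h j) k) - T j m) \<le> ennreal (C * (1/2) ^ j)" for j m
 proof -
  define S where "S = (\<lambda>k. {z \<in> UNIV. 1 \<le> ennreal (2 ^ j) * (\<delta> m z (c j m k) * indicator (lattice_cube (h j) k) z)} \<inter> UNIV)"
  have [measurable]: "S k \<in> sets borel" for k unfolding S_def by measurable
  have "(\<Union>k\<in>K j. lattice_cube (h j) k) - T j m \<subseteq> (\<Union>k\<in>K j. S k)"
  proof
   fix z assume "z \<in> (\<Union>k\<in>K j. lattice_cube (h j) k) - T j m"
   then obtain k where k: "k \<in> K j" "z \<in> lattice_cube (h j) k" "ennreal ((1/2) ^ j) < \<delta> m z (c j m k)"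
    by (auto simp: T_def not_le)
   have "1 = ennreal (2 ^ j) * ennreal ((1/2) ^ j)"
    by (simp flip: ennreal_mult power_mult_distrib)
   also have "\<dots> \<le> ennreal (2 ^ j) * \<delta> m z (c j m k)" using k by (intro mult_left_mono) auto
   finally have "z \<in> S k" using k by (simp add: S_def)
   with k(1) show "z \<in> (\<Union>k\<in>K j. S k)" by blast
  qed
  then have "emeasure lborel ((\<Union>k\<in>K j. lattice_cube (h j) k) - T j m) \<le> emeasure lborel (\<Union>k\<in>K j. S k)"
   by (intro emeasure_mono) (auto intro!: sets.finite_UN K)
  also have "\<dots> \<le> (\<Sum>k\<in>K j. emeasure lborel (S k))" by (intro emeasure_subadditive_finite K) auto
  also have "\<dots> \<le> (\<Sum>k\<in>K j. ennreal (2 ^ j) * (\<integral>\<^sub>+z. \<delta> m z (c j m k) * indicator (lattice_cube (h j) k) z * indicator UNIV z))"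
   unfolding S_def by (intro sum_mono order_trans[OF eq_refl nn_integral_Markov_inequality]) auto
  also have "\<dots> = ennreal (2 ^ j) * (\<Sum>k\<in>K j. \<integral>\<^sub>+z. \<delta> m z (c j m k) * indicator (lattice_cube (h j) k) z)"
   by (simp add: sum_distrib_left)
  also have "\<dots> \<le> ennreal (2 ^ j) * ennreal (h j * C)" by (intro mult_left_mono c(3)) auto
  also have "\<dots> \<le> ennreal (2 ^ j) * ennreal ((1/4) ^ j * C)"
   by (intro mult_left_mono ennreal_leI mult_right_mono h C) auto
  also have "\<dots> = ennreal (C * (1/2) ^ j)"
  proof -
   have "(2::real) ^ j * (1/4) ^ j = (1/2) ^ j" by (simp flip: power_mult_distrib)
   then show ?thesis using C by (simp flip: ennreal_mult add: mult_ac)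
  qed
  finally show ?thesis .
 qed
 show thesis
 proof (rule that[of r G "1 + 2 * C"])
  show "strict_mono r" by (rule r)
  show "G j \<in> sets borel" for j unfolding G_def by measurable
  show "G j \<subseteq> \<Omega>" for j using T_sub by (auto simp: G_def)
  show "emeasure lborel (\<Omega> - G j) \<le> ennreal ((1 + 2 * C) * (1/2) ^ j)" for j
  proof -
   define U where "U = (\<Union>k\<in>K j. lattice_cube (h j) k)"
   have [measurable]: "U \<in> sets borel" unfolding U_def by (intro sets.finite_UN K) measurable
   have "emeasure lborel (\<Omega> - G j) \<le> emeasure lborel ((\<Omega> - U) \<union> (U - T j (r j)) \<union> (U - T j (r (Suc j))) \<union> N (r j) \<union> N (r (Suc j)))"
    by (intro emeasure_mono) (auto simp: G_def)
   also have "\<dots> \<le> emeasure lborel (\<Omega> - U) + emeasure lborel (U - T j (r j)) + emeasure lborel (U - T j (r (Suc j))) + emeasure lborel (N (r j)) + emeasure lborel (N (r (Suc j)))"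
    by (intro order_trans[OF emeasure_subadditive] add_right_mono) measurable
   also have "\<dots> \<le> ennreal ((1/4) ^ j) + ennreal (C * (1/2) ^ j) + ennreal (C * (1/2) ^ j) + 0 + 0"
    using N bad[of j "r j"] bad[of j "r (Suc j)"] K(3)[of j] unfolding U_def by (intro add_mono) auto
   also have "\<dots> = ennreal ((1/4) ^ j + C * (1/2) ^ j + C * (1/2) ^ j)" using C by (simp flip: ennreal_plus)
   also have "\<dots> \<le> ennreal ((1 + 2 * C) * (1/2) ^ j)"
   proof (intro ennreal_leI)
    have "(1/4::real) ^ j \<le> (1/2) ^ j" by (intro power_mono) auto
    then show "(1/4) ^ j + C * (1/2) ^ j + C * (1/2) ^ j \<le> (1 + 2 * C) * (1/2) ^ j" by (simp add: algebra_simps)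
   qed
   finally show ?thesis .
  qed
  fix j z w assume zw: "z \<in> G j" "w \<in> G j"
  define \<eta> :: real where "\<eta> = (1/2) ^ j"
  have near: "\<exists>k\<in>K j. v \<in> lattice_cube (h j) k \<and> mdist X (u m v) (u m (c j m k)) \<le> \<eta>" if "v \<in> G j" "m = r j \<or> m = r (Suc j)" for v m
  proof -
   have v: "v \<in> T j m" "v \<in> \<Omega> - N m" using that T_sub by (auto simp: G_def)
   then obtain k where k: "k \<in> K j" "v \<in> lattice_cube (h j) k" "\<delta> m v (c j m k) \<le> ennreal \<eta>"
    by (auto simp: T_def \<eta>_def)
   then have "mdist X (u m v) (u m (c j m k)) \<le> \<eta>"
    using \<delta>_eq[OF v(2) c\<Omega>[OF k(1)]] by (simp add: \<eta>_def)
   with k show ?thesis by blast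
  qed
  have uniq: "k = k'" if "v \<in> lattice_cube (h j) k" "v \<in> lattice_cube (h j) k'" for v k k'
   using lattice_cube_disjoint[of k k' "h j"] that by auto
  obtain k where k: "k \<in> K j" "z \<in> lattice_cube (h j) k" using near[OF zw(1), of "r j"] by blast
  obtain k' where k': "k' \<in> K j" "w \<in> lattice_cube (h j) k'" using near[OF zw(2), of "r j"] by blast
  have close: "\<bar>mdist X (u m z) (u m w) - a j m k k'\<bar> \<le> 2 * \<eta>" if m: "m = r j \<or> m = r (Suc j)" for m
  proof -
   have z: "mdist X (u m z) (u m (c j m k)) \<le> \<eta>" using near[OF zw(1) m] uniq k by metis
   have w: "mdist X (u m w) (u m (c j m k')) \<le> \<eta>" using near[OF zw(2) m] uniq k' by metis
   have in\<Omega>: "z \<in> \<Omega>" "w \<in> \<Omega>" using zw T_sub by (auto simp: G_def)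
   note X = Lp_maps_values[OF u[of m] in\<Omega>(1)] Lp_maps_values[OF u[of m] in\<Omega>(2)] uc[OF k(1), of m] uc[OF k'(1), of m]
   show ?thesis
    using abs_mdist_diff_le[OF X(1,2,4)] abs_mdist_diff_le[OF X(4,1,3)] z w
    by (simp add: a_def mdist_commute_of[of X "u m (c j m k')"])
  qed
  show "\<bar>mdist X (u (r j) z) (u (r j) w) - mdist X (u (r (Suc j)) z) (u (r (Suc j)) w)\<bar> \<le> 5 * (1/2) ^ j"
   using close[of "r j"] close[of "r (Suc j)"] a_close[OF k(1) k'(1)] unfolding \<eta>_def by linarith
 qed
qed

section \<open>Gluing a chain of copies\<close>

text \<open>McShane's extension formula applied to the values \<open>f (a z) + \<epsilon>\<close> prescribed at
 \<open>b z\<close>. The distances of the \<open>b z\<close> may be smaller than those of the \<open>a z\<close>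
 by \<open>2 \<epsilon>\<close>, which is why the formula may miss the prescribed values by
 \<open>\<epsilon>\<close> on either side.\<close>
lemma McShane_transfer:
 fixes X :: "'x metric" and a b :: "'i => 'x" and \<epsilon> :: real
 assumes lip: "\<And>x y. x \<in> mspace X ==> y \<in> mspace X ==> \<bar>f x - f y\<bar> \<le> mdist X x y"
  and G: "z0 \<in> G" and ab: "\<And>z. z \<in> G ==> a z \<in> mspace X" "\<And>z. z \<in> G ==> b z \<in> mspace X"
  and close: "\<And>z w. z \<in> G ==> w \<in> G ==> \<bar>mdist X (a z) (a w) - mdist X (b z) (b w)\<bar> \<le> 2 * \<epsilon>"
 shows "\<exists>E. (\<forall>x\<in>mspace X. \<forall>y\<in>mspace X. \<bar>E x - E y\<bar> \<le> mdist X x y) \<and> (\<forall>z\<in>G. \<bar>f (a z) - E (b z)\<bar> \<le> \<epsilon>)"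
proof -
 define E where "E = (\<lambda>y. INF z\<in>G. f (a z) + \<epsilon> + mdist X (b z) y)"
 have low: "f (a w) - \<epsilon> - mdist X (b w) y \<le> f (a z) + \<epsilon> + mdist X (b z) y"
  if "z \<in> G" "w \<in> G" "y \<in> mspace X" for z w y
  using lip[OF ab(1)[OF that(2)] ab(1)[OF that(1)]] close[OF that(2,1)] mdist_triangle_of[OF ab(2)[OF that(2)] that(3) ab(2)[OF that(1)]]
   mdist_commute_of[of X y "b z"] by linarith
 have bdd: "bdd_below ((\<lambda>z. f (a z) + \<epsilon> + mdist X (b z) y) ` G)" if "y \<in> mspace X" for y
  using low[OF _ G that] by (intro bdd_belowI2)
 have E_le: "E y \<le> f (a z) + \<epsilon> + mdist X (b z) y" if "z \<in> G" "y \<in> mspace X" for z y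
  unfolding E_def by (intro cINF_lower bdd that)
 have E_ge: "c \<le> E y" if "\<And>z. z \<in> G ==> c \<le> f (a z) + \<epsilon> + mdist X (b z) y" for c y
  unfolding E_def using G that by (intro cINF_greatest) auto
 have half: "E x - mdist X x y \<le> E y" if xy: "x \<in> mspace X" "y \<in> mspace X" for x y
 proof (rule E_ge)
  fix z assume z: "z \<in> G"
  show "E x - mdist X x y \<le> f (a z) + \<epsilon> + mdist X (b z) y"
   using E_le[OF z xy(1)] mdist_triangle_of[OF ab(2)[OF z] xy(2) xy(1)] mdist_commute_of[of X x y] by linarith
 qed
 show ?thesis
 proof (intro exI[of _ E] conjI ballI)
  fix x y assume "x \<in> mspace X" "y \<in> mspace X"
  then show "\<bar>E x - E y\<bar> \<le> mdist X x y"
   using half[of x y] half[of y x] mdist_commute_of[of X x y] by linarith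
 next
  fix z assume z: "z \<in> G"
  have "E (b z) \<le> f (a z) + \<epsilon>" using E_le[OF z ab(2)[OF z]] mdist_self_of[OF ab(2)[OF z]] by simp
  moreover have "f (a z) - \<epsilon> \<le> E (b z)"
   using low[OF _ z ab(2)[OF z]] mdist_self_of[OF ab(2)[OF z]] by (intro E_ge) simp
  ultimately show "\<bar>f (a z) - E (b z)\<bar> \<le> \<epsilon>" by linarith
 qed
qed

text \<open>\<open>Z\<close> is found through its 1-Lipschitz functions. A family \<open>F\<close> of
 1-Lipschitz functions, one on each copy of \<open>X\<close>, is admissible if it changes by at most
 \<open>\<epsilon> j\<close> between corresponding points of the copies \<open>j\<close> and \<open>Suc
 j\<close>; the distance on the disjoint union is the supremum of the differences of admissible families. By
 \<open>McShane_transfer\<close> every 1-Lipschitz function on one copy belongs to an admissible family, so each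
 copy sits isometrically; step functions separate the copies. \<open>Z\<close> is its completion, realised
 inside the bounded functions on the disjoint union.\<close>
lemma glue_chain_of_copies:
 fixes X :: "'x metric" and a :: "nat => 'i => 'x" and G :: "nat => 'i set" and \<epsilon> :: "nat => real"
 assumes \<epsilon>: "\<And>j. \<epsilon> j > 0" and G: "\<And>j. G j \<noteq> {}"
  and aX: "\<And>j z. z \<in> G j ==> a j z \<in> mspace X" "\<And>j z. z \<in> G j ==> a (Suc j) z \<in> mspace X"
  and close: "\<And>j z w. z \<in> G j ==> w \<in> G j ==> \<bar>mdist X (a j z) (a j w) - mdist X (a (Suc j) z) (a (Suc j) w)\<bar> \<le> 2 * \<epsilon> j"
 obtains Z :: "'x target metric" and \<phi> :: "nat => 'x => 'x target"
 where "mcomplete_of Z" "\<And>j. isometric_embedding X Z (\<phi> j)"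
  "\<And>j z. z \<in> G j ==> mdist Z (\<phi> j (a j z)) (\<phi> (Suc j) (a (Suc j) z)) \<le> \<epsilon> j"
proof -
 define lip where "lip = (\<lambda>f :: 'x => real. \<forall>x\<in>mspace X. \<forall>y\<in>mspace X. \<bar>f x - f y\<bar> \<le> mdist X x y)"
 define Adm where "Adm = {F :: nat => 'x => real. (\<forall>j. lip (F j)) \<and> (\<forall>j. \<forall>z\<in>G j. \<bar>F j (a j z) - F (Suc j) (a (Suc j) z)\<bar> \<le> \<epsilon> j)}"
 have up: "\<exists>E. lip E \<and> (\<forall>z\<in>G j. \<bar>f (a j z) - E (a (Suc j) z)\<bar> \<le> \<epsilon> j)"
  and down: "\<exists>E. lip E \<and> (\<forall>z\<in>G j. \<bar>f (a (Suc j) z) - E (a j z)\<bar> \<le> \<epsilon> j)" if f: "lip f" for f j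
 proof -
  obtain z0 where z0: "z0 \<in> G j" using G by blast
  have l: "\<And>x y. x \<in> mspace X ==> y \<in> mspace X ==> \<bar>f x - f y\<bar> \<le> mdist X x y" using f by (auto simp: lip_def)
  show "\<exists>E. lip E \<and> (\<forall>z\<in>G j. \<bar>f (a j z) - E (a (Suc j) z)\<bar> \<le> \<epsilon> j)"
   unfolding lip_def by (rule McShane_transfer[OF l z0 aX close])
  show "\<exists>E. lip E \<and> (\<forall>z\<in>G j. \<bar>f (a (Suc j) z) - E (a j z)\<bar> \<le> \<epsilon> j)"
   unfolding lip_def
   by (rule McShane_transfer[OF l z0 aX(2,1)]) (use close[of _ j] in \<open>simp_all add: abs_minus_commute\<close>)
 qed
 have extend: "\<exists>F\<in>Adm. F m = f" if f: "lip f" for f m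
 proof -
  define U where "U = rec_nat f (\<lambda>k f. SOME E. lip E \<and> (\<forall>z\<in>G (m + k). \<bar>f (a (m + k) z) - E (a (Suc (m + k)) z)\<bar> \<le> \<epsilon> (m + k)))"
  define D where "D = rec_nat f (\<lambda>k f. SOME E. lip E \<and> (\<forall>z\<in>G (m - Suc k). \<bar>f (a (Suc (m - Suc k)) z) - E (a (m - Suc k) z)\<bar> \<le> \<epsilon> (m - Suc k)))"
  have U0: "U 0 = f" and D0: "D 0 = f" by (simp_all add: U_def D_def)
  have U: "lip (U k) \<and> (k > 0 --> (\<forall>z\<in>G (m + k - 1). \<bar>U (k - 1) (a (m + k - 1) z) - U k (a (m + k) z)\<bar> \<le> \<epsilon> (m + k - 1)))" for k
  proof (induction k)
   case (Suc k)
   have "U (Suc k) = (SOME E. lip E \<and> (\<forall>z\<in>G (m + k). \<bar>U k (a (m + k) z) - E (a (Suc (m + k)) z)\<bar> \<le> \<epsilon> (m + k)))"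
    by (simp add: U_def)
   with someI_ex[OF up[of "U k" "m + k"]] Suc show ?case by simp
  qed (use f U0 in simp)
  have D: "lip (D k) \<and> (k > 0 --> (\<forall>z\<in>G (m - k). \<bar>D (k - 1) (a (Suc (m - k)) z) - D k (a (m - k) z)\<bar> \<le> \<epsilon> (m - k)))" for k
  proof (induction k)
   case (Suc k)
   have "D (Suc k) = (SOME E. lip E \<and> (\<forall>z\<in>G (m - Suc k). \<bar>D k (a (Suc (m - Suc k)) z) - E (a (m - Suc k) z)\<bar> \<le> \<epsilon> (m - Suc k)))"
    by (simp add: D_def)
   with someI_ex[OF down[of "D k" "m - Suc k"]] Suc show ?case by simp
  qed (use f D0 in simp)
  define F where "F = (\<lambda>j. if m \<le> j then U (j - m) else D (m - j))"
  have "F \<in> Adm"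
   unfolding Adm_def
  proof (intro CollectI conjI allI ballI)
   show "lip (F j)" for j using U D by (simp add: F_def)
   fix j z assume z: "z \<in> G j"
   show "\<bar>F j (a j z) - F (Suc j) (a (Suc j) z)\<bar> \<le> \<epsilon> j"
   proof (cases "m \<le> j")
    case True
    then show ?thesis using U[of "Suc j - m"] z by (simp add: F_def Suc_diff_le)
   next
    case False
    then have "F (Suc j) = D (m - j - 1)" using U0 D0 by (auto simp: F_def not_le not_less_eq_eq dest: le_antisym)
    then show ?thesis using D[of "m - j"] z False by (simp add: F_def abs_minus_commute)
   qed
  qed
  moreover have "F m = f" by (simp add: F_def U0)
  ultimately show ?thesis by blast
 qed
 define M where "M = (UNIV :: nat set) \<times> mspace X"
 define d where "d = (\<lambda>p q. if p \<in> M \<and> q \<in> M then SUP F\<in>Adm. \<bar>F (fst p) (snd p) - F (fst q) (snd q)\<bar> else 0)"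
 have const: "(\<lambda>j x. 0) \<in> Adm" using \<epsilon> by (auto simp: Adm_def lip_def mdist_nonneg_of less_imp_le)
 have bound_up: "\<exists>B. \<forall>F\<in>Adm. \<bar>F m x - F (m + k) y\<bar> \<le> B" if "x \<in> mspace X" "y \<in> mspace X" for m k x y
  using that(2)
 proof (induction k arbitrary: y)
  case 0
  then show ?case using that(1) by (intro exI[of _ "mdist X x y"]) (auto simp: Adm_def lip_def)
 next
  case (Suc k)
  obtain z where z: "z \<in> G (m + k)" using G by blast
  obtain B where B: "\<And>F. F \<in> Adm ==> \<bar>F m x - F (m + k) (a (m + k) z)\<bar> \<le> B"
   using Suc.IH[OF aX(1)[OF z]] by blast
  have "\<bar>F m x - F (m + Suc k) y\<bar> \<le> B + \<epsilon> (m + k) + mdist X (a (Suc (m + k)) z) y" if F: "F \<in> Adm" for F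
  proof -
   have "\<bar>F (m + k) (a (m + k) z) - F (Suc (m + k)) (a (Suc (m + k)) z)\<bar> \<le> \<epsilon> (m + k)"
    "\<bar>F (Suc (m + k)) (a (Suc (m + k)) z) - F (Suc (m + k)) y\<bar> \<le> mdist X (a (Suc (m + k)) z) y"
    using F z aX(2)[OF z] Suc.prems by (auto simp: Adm_def lip_def)
   with B[OF F] show ?thesis by simp
  qed
  then show ?case by blast
 qed
 have bdd: "bdd_above ((\<lambda>F. \<bar>F (fst p) (snd p) - F (fst q) (snd q)\<bar>) ` Adm)" if "p \<in> M" "q \<in> M" for p q
 proof -
  obtain m x k y where [simp]: "p = (m, x)" "q = (k, y)" by (cases p, cases q)
  have xy: "x \<in> mspace X" "y \<in> mspace X" using that by (auto simp: M_def)
  have "\<exists>B. \<forall>F\<in>Adm. \<bar>F m x - F k y\<bar> \<le> B"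
   using bound_up[OF xy, of m "k - m"] bound_up[OF xy(2,1), of k "m - k"]
   by (cases "m \<le> k") (auto simp: abs_minus_commute)
  then show ?thesis by (auto simp: bdd_above_def)
 qed
 have d_ge: "\<bar>F (fst p) (snd p) - F (fst q) (snd q)\<bar> \<le> d p q" if "F \<in> Adm" "p \<in> M" "q \<in> M" for F p q
  unfolding d_def using that by (auto intro!: cSUP_upper bdd)
 have d_le: "d p q \<le> c" if "p \<in> M" "q \<in> M" "\<And>F. F \<in> Adm ==> \<bar>F (fst p) (snd p) - F (fst q) (snd q)\<bar> \<le> c" for p q c
  unfolding d_def using const that by (auto intro!: cSUP_least)
 have d_same: "d (m, x) (m, y) = mdist X x y" if xy: "x \<in> mspace X" "y \<in> mspace X" for m x y
 proof (rule antisym)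
  show "d (m, x) (m, y) \<le> mdist X x y" by (rule d_le) (use xy in \<open>auto simp: Adm_def lip_def M_def\<close>)
  have "lip (\<lambda>y. mdist X x y)" unfolding lip_def using abs_mdist_diff_le[OF xy(1)] by blast
  then obtain F where F: "F \<in> Adm" "F m = (\<lambda>y. mdist X x y)" using extend by blast
  show "mdist X x y \<le> d (m, x) (m, y)"
   using d_ge[OF F(1), of "(m, x)" "(m, y)"] xy by (simp add: F(2) mdist_self_of M_def)
 qed
 have sep: "d p q > 0" if pq: "p \<in> M" "q \<in> M" "fst p < fst q" for p q
 proof -
  have "(\<lambda>j x. if j \<le> fst p then 0 else \<epsilon> (fst p)) \<in> Adm"
   using \<epsilon> by (auto simp: Adm_def lip_def mdist_nonneg_of less_imp_le dest: le_antisym simp flip: not_less_eq_eq)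
  from d_ge[OF this pq(1,2)] show ?thesis using pq(3) \<epsilon>[of "fst p"] by simp
 qed
 have d_comm: "d p q = d q p" for p q by (auto simp: d_def abs_minus_commute)
 interpret DM: Metric_space M d
 proof
  fix p q r
  show "0 \<le> d p q" using d_ge[OF const, of p q] by (auto simp: d_def)
  show "d p q = d q p" by (rule d_comm)
  show "(d p q = 0) = (p = q)" if "p \<in> M" "q \<in> M"
  proof
   assume 0: "d p q = 0"
   have "fst p = fst q"
    using sep[OF that] sep[OF that(2,1)] 0 d_comm[of p q] by (metis less_irrefl linorder_less_linear)
   moreover from this have "mdist X (snd p) (snd q) = 0"
    using d_same[of "snd p" "snd q" "fst p"] 0 that by (cases p, cases q) (auto simp: M_def)
   then have "snd p = snd q"
    using that Metric_space.zero[OF Metric_space_mspace_mdist, of "snd p" X "snd q"] by (auto simp: M_def)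
   ultimately show "p = q" by (simp add: prod_eq_iff)
  next
   assume "p = q"
   then show "d p q = 0" using d_same[of "snd p" "snd q" "fst p"] that by (cases p) (auto simp: M_def mdist_self_of)
  qed
  show "d p r \<le> d p q + d q r" if "p \<in> M" "q \<in> M" "r \<in> M"
  proof (rule d_le[OF that(1,3)])
   fix F assume F: "F \<in> Adm"
   show "\<bar>F (fst p) (snd p) - F (fst r) (snd r)\<bar> \<le> d p q + d q r"
    using d_ge[OF F that(1,2)] d_ge[OF F that(2,3)] by linarith
  qed
 qed
 obtain f :: "nat \<times> 'x => nat \<times> 'x => real" and S where S: "S \<subseteq> mspace (funspace M euclidean_metric)"
   "mcomplete_of (submetric (funspace M euclidean_metric) S)" "f \<in> M \<rightarrow> S"
   "\<And>x y. x \<in> M ==> y \<in> M ==> mdist (funspace M euclidean_metric) (f x) (f y) = d x y"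
 proof (rule DM.metric_completion_explicit)
  fix f :: "nat \<times> 'x => nat \<times> 'x => real" and S
  assume 1: "S \<subseteq> mspace (funspace M euclidean_metric)" "mcomplete_of (submetric (funspace M euclidean_metric) S)" "f \<in> M \<rightarrow> S"
   and 2: "\<And>x y. x \<in> M ==> y \<in> M ==> mdist (funspace M euclidean_metric) (f x) (f y) = d x y"
  show thesis by (rule that[OF 1 2])
 qed
 define Z where "Z = submetric (funspace M euclidean_metric) S"
 show thesis
 proof (rule that[of Z "\<lambda>j x. f (j, x)"])
  show "mcomplete_of Z" unfolding Z_def by (rule S(2))
  show "isometric_embedding X Z (\<lambda>x. f (j, x))" for j
   using S(1,3) S(4) d_same by (auto simp: isometric_embedding_def Z_def M_def Pi_iff)
  show "mdist Z (f (j, a j z)) (f (Suc j, a (Suc j) z)) \<le> \<epsilon> j" if z: "z \<in> G j" for j z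
  proof -
   have "d (j, a j z) (Suc j, a (Suc j) z) \<le> \<epsilon> j" by (rule d_le) (use z aX[OF z] in \<open>auto simp: Adm_def M_def\<close>)
   then show ?thesis using S(4)[of "(j, a j z)" "(Suc j, a (Suc j) z)"] aX[OF z] by (simp add: Z_def M_def)
  qed
 qed
qed

section \<open>Almost everywhere limits of metric space valued maps\<close>

lemma openin_mtopology_of:
 "openin (mtopology_of Z) U \<longleftrightarrow> U \<subseteq> mspace Z \<and> (\<forall>x\<in>U. \<exists>r>0. \<forall>y\<in>mspace Z. mdist Z x y < r --> y \<in> U)"
proof -
 interpret M: Metric_space "mspace Z" "mdist Z" by (rule Metric_space_mspace_mdist)
 have "M.mball x r \<subseteq> U \<longleftrightarrow> (\<forall>y\<in>mspace Z. mdist Z x y < r --> y \<in> U)" if "x \<in> mspace Z" for x r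
  using that by (auto simp: subset_iff)
 then show ?thesis
  unfolding mtopology_of_def M.openin_mtopology by (meson subsetD)
qed

lemma separable_space_of_dense_sequence:
 fixes c :: "nat => 'z"
 assumes c: "\<And>i. c i \<in> mspace Z" and S: "S \<subseteq> mspace Z" and dense: "\<And>s \<epsilon>. s \<in> S ==> \<epsilon> > 0 ==> \<exists>i. mdist Z (c i) s < \<epsilon>"
 shows "separable_space (subtopology (mtopology_of Z) S)"
proof -
 define P where "P = (\<lambda>(i, k) s. s \<in> S \<and> mdist Z (c i) s < 1 / real (Suc k))"
 define C where "C = (\<lambda>p. SOME s. P p s) ` {p. \<exists>s. P p s}"
 have C_S: "C \<subseteq> S" using someI_ex[of "P _"] by (force simp: C_def P_def)
 have "S \<subseteq> subtopology (mtopology_of Z) S closure_of C"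
 proof
  fix s assume s: "s \<in> S"
  show "s \<in> subtopology (mtopology_of Z) S closure_of C"
   unfolding in_closure_of
  proof (intro conjI allI impI)
   show "s \<in> topspace (subtopology (mtopology_of Z) S)" using s S by auto
   fix T assume T: "s \<in> T \<and> openin (subtopology (mtopology_of Z) S) T"
   then obtain U where U: "openin (mtopology_of Z) U" "T = U \<inter> S" by (auto simp: openin_subtopology)
   then obtain r where r: "r > 0" "\<And>y. y \<in> mspace Z ==> mdist Z s y < r ==> y \<in> U"
    using T by (auto simp: openin_mtopology_of)
   obtain k where k: "2 / r < real k" using reals_Archimedean2 by blast
   obtain i where i: "mdist Z (c i) s < 1 / real (Suc k)" using dense[OF s, of "1 / real (Suc k)"] by auto
   define y where "y = (SOME s. P (i, k) s)"
   have ex: "\<exists>s. P (i, k) s" using i s by (auto simp: P_def)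
   have y: "y \<in> S" "mdist Z (c i) y < 1 / real (Suc k)" using someI_ex[OF ex] by (auto simp: y_def P_def)
   have "mdist Z s y \<le> mdist Z (c i) s + mdist Z (c i) y"
    using mdist_triangle_of[of s Z "c i" y] s y S c mdist_commute_of[of Z s "c i"] by auto
   also have "\<dots> < 2 / real (Suc k)" using i y by simp
   also have "\<dots> < r"
   proof -
    have "2 < real k * r" using k r(1) by (simp add: divide_less_eq)
    also have "\<dots> \<le> r * real (Suc k)" using r(1) by (simp add: algebra_simps)
    finally show ?thesis by (simp add: divide_less_eq)
   qed
   finally have "y \<in> T" using r(2)[of y] y S U(2) by auto
   moreover have "y \<in> C" using ex unfolding C_def y_def by blast
   ultimately show "\<exists>y. y \<in> C \<and> y \<in> T" by blast
  qed
 qed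
 moreover have "topspace (subtopology (mtopology_of Z) S) = S" using S by auto
 ultimately have "subtopology (mtopology_of Z) S closure_of C = topspace (subtopology (mtopology_of Z) S)"
  using closure_of_subset_topspace[of "subtopology (mtopology_of Z) S" C] by auto
 moreover have "countable C" unfolding C_def by (intro countable_image countableI_type)
 ultimately show ?thesis unfolding separable_space_def using C_S S by auto
qed

lemma Lp_mapsI:
 fixes f :: "real^'n::finite => 'z" and c :: "nat => 'z"
 assumes meas: "f \<in> lebesgue_on \<Omega> \<rightarrow>\<^sub>M sigma (mspace Z) {U. openin (mtopology_of Z) U}" and \<Omega>: "\<Omega> \<in> sets borel"
  and fZ: "\<And>z. z \<in> \<Omega> ==> f z \<in> mspace Z"
  and c: "\<And>i. c i \<in> mspace Z" "AE z\<in>\<Omega> in lborel. (\<forall>\<epsilon>>0. \<exists>i. mdist Z (c i) (f z) < \<epsilon>)"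
  and y: "y \<in> mspace Z" "(\<integral>\<^sub>+z. ennreal (mdist Z y (f z) powr q) * indicator \<Omega> z) < \<infinity>"
 shows "f \<in> Lp_maps q \<Omega> Z"
proof -
 have "AE z in lebesgue_on \<Omega>. \<forall>\<epsilon>>0. \<exists>i. mdist Z (c i) (f z) < \<epsilon>"
  using c(2) by (rule AE_lebesgue_on_iff[OF \<Omega>, THEN iffD2])
 then obtain N where N: "{z \<in> space (lebesgue_on \<Omega>). \<not> (\<forall>\<epsilon>>0. \<exists>i. mdist Z (c i) (f z) < \<epsilon>)} \<subseteq> N"
  "emeasure (lebesgue_on \<Omega>) N = 0" "N \<in> sets (lebesgue_on \<Omega>)" by (rule AE_E)
 have "separable_space (subtopology (mtopology_of Z) (f ` (\<Omega> - N)))"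
 proof (rule separable_space_of_dense_sequence[where c = c])
  fix s and \<epsilon> :: real assume s: "s \<in> f ` (\<Omega> - N)" and \<epsilon>: "\<epsilon> > 0"
  obtain z where z: "z \<in> \<Omega>" "z \<notin> N" "s = f z" using s by blast
  have "\<forall>\<epsilon>>0. \<exists>i. mdist Z (c i) (f z) < \<epsilon>" using subsetD[OF N(1), of z] z by auto
  then show "\<exists>i. mdist Z (c i) s < \<epsilon>" using \<epsilon> z by auto
 qed (use c fZ in auto)
 moreover have "(\<lambda>z. mdist Z y (f z)) \<in> Lp_space q \<Omega>"
 proof -
  have m[measurable]: "(\<lambda>z. mdist Z y (f z)) \<in> borel_measurable (lebesgue_on \<Omega>)" by (rule mdist_measurable[OF meas y(1)])
  have "integrable (lebesgue_on \<Omega>) (\<lambda>z. norm (mdist Z y (f z)) powr q)"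
   using y(2) by (intro integrableI_bounded) (auto simp: nn_integral_lebesgue_on[OF \<Omega>] mdist_nonneg_of)
  with m show ?thesis by (simp add: Lp_space_def)
 qed
 ultimately show ?thesis using meas N y(1) by (auto simp: Lp_maps_def null_sets_def)
qed

lemma isometric_embedding_measurable:
 assumes \<phi>: "isometric_embedding X Z \<phi>" and u: "u \<in> M \<rightarrow>\<^sub>M sigma (mspace X) {U. openin (mtopology_of X) U}"
  and uX: "\<And>z. z \<in> space M ==> u z \<in> mspace X"
 shows "\<phi> \<circ> u \<in> M \<rightarrow>\<^sub>M sigma (mspace Z) {U. openin (mtopology_of Z) U}"
proof (rule measurable_measure_of)
 show "{U. openin (mtopology_of Z) U} \<subseteq> Pow (mspace Z)" by (auto simp: openin_mtopology_of)
 show "\<phi> \<circ> u \<in> space M \<rightarrow> mspace Z" using \<phi> uX by (auto simp: isometric_embedding_def)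
 fix U assume "U \<in> {U. openin (mtopology_of Z) U}"
 then have U: "openin (mtopology_of Z) U" by simp
 have "openin (mtopology_of X) (\<phi> -` U \<inter> mspace X)"
  unfolding openin_mtopology_of
 proof (intro conjI ballI)
  fix x assume x: "x \<in> \<phi> -` U \<inter> mspace X"
  then obtain r where "r > 0" "\<And>y. y \<in> mspace Z ==> mdist Z (\<phi> x) y < r ==> y \<in> U"
   using U by (auto simp: openin_mtopology_of)
  then show "\<exists>r>0. \<forall>y\<in>mspace X. mdist X x y < r --> y \<in> \<phi> -` U \<inter> mspace X"
   using \<phi> x by (intro exI[of _ r]) (auto simp: isometric_embedding_def Pi_iff)
 qed auto
 then have "\<phi> -` U \<inter> mspace X \<in> sets (sigma (mspace X) {U. openin (mtopology_of X) U})"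
  by (subst sets_measure_of) (auto simp: openin_mtopology_of)
 from measurable_sets[OF u this] have "u -` (\<phi> -` U \<inter> mspace X) \<inter> space M \<in> sets M" .
 moreover have "u -` (\<phi> -` U \<inter> mspace X) \<inter> space M = (\<phi> \<circ> u) -` U \<inter> space M" using uX by auto
 ultimately show "(\<phi> \<circ> u) -` U \<inter> space M \<in> sets M" by simp
qed

text \<open>An open set \<open>U\<close> is the increasing union of the closed sets \<open>V k\<close> of points
 at distance at least \<open>1 / Suc k\<close> from its complement. Almost everywhere, \<open>v z \<in>
 U\<close> iff for some \<open>k\<close> eventually \<open>f j z \<in> V k\<close>. Completeness of Lebesgue
 measure takes care of the exceptional set.\<close>
lemma AE_limit_measurable:
 fixes f :: "nat => real^'n::finite => 'z"
 assumes f: "\<And>j. f j \<in> lebesgue_on \<Omega> \<rightarrow>\<^sub>M sigma (mspace Z) {U. openin (mtopology_of Z) U}" and \<Omega>: "\<Omega> \<in> sets borel"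
  and fZ: "\<And>j z. z \<in> \<Omega> ==> f j z \<in> mspace Z" and vZ: "\<And>z. z \<in> \<Omega> ==> v z \<in> mspace Z"
  and lim: "AE z\<in>\<Omega> in lborel. (\<lambda>j. mdist Z (f j z) (v z)) \<longlonglongrightarrow> 0"
 shows "v \<in> lebesgue_on \<Omega> \<rightarrow>\<^sub>M sigma (mspace Z) {U. openin (mtopology_of Z) U}"
proof (rule measurable_measure_of)
 show "{U. openin (mtopology_of Z) U} \<subseteq> Pow (mspace Z)" by (auto simp: openin_mtopology_of)
 show "v \<in> space (lebesgue_on \<Omega>) \<rightarrow> mspace Z" using vZ by auto
 fix U assume "U \<in> {U. openin (mtopology_of Z) U}"
 then have U: "openin (mtopology_of Z) U" by simp
 define V where "V = (\<lambda>k::nat. {y \<in> mspace Z. \<forall>w\<in>mspace Z. mdist Z y w < 1 / real (Suc k) --> w \<in> U})"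
 have V_closed: "openin (mtopology_of Z) (mspace Z - V k)" for k
  unfolding openin_mtopology_of
 proof (intro conjI ballI)
  fix y assume "y \<in> mspace Z - V k"
  then obtain w where w: "y \<in> mspace Z" "w \<in> mspace Z" "mdist Z y w < 1 / real (Suc k)" "w \<notin> U"
   by (auto simp: V_def)
  show "\<exists>r>0. \<forall>x\<in>mspace Z. mdist Z y x < r --> x \<in> mspace Z - V k"
  proof (intro exI[of _ "1 / real (Suc k) - mdist Z y w"] conjI ballI impI)
   fix x assume x: "x \<in> mspace Z" "mdist Z y x < 1 / real (Suc k) - mdist Z y w"
   then have "mdist Z x w < 1 / real (Suc k)"
    using mdist_triangle_of[OF x(1) w(1,2)] mdist_commute_of[of Z x y] by linarith
   then show "x \<in> mspace Z - V k" using x w by (auto simp: V_def)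
  qed (use w in simp)
 qed auto
 have sV: "{z \<in> \<Omega>. f j z \<in> V k} \<in> sets (lebesgue_on \<Omega>)" for j k
 proof -
  have "mspace Z - V k \<in> sets (sigma (mspace Z) {U. openin (mtopology_of Z) U})"
   using V_closed[of k] by (subst sets_measure_of) (auto simp: openin_mtopology_of)
  from sets.Diff[OF sets.top measurable_sets[OF f this, of j]]
  have "\<Omega> - f j -` (mspace Z - V k) \<inter> \<Omega> \<in> sets (lebesgue_on \<Omega>)" by simp
  moreover have "\<Omega> - f j -` (mspace Z - V k) \<inter> \<Omega> = {z \<in> \<Omega>. f j z \<in> V k}" using fZ by auto
  ultimately show ?thesis by simp
 qed
 define A where "A = (\<Union>k. \<Union>J. \<Inter>j\<in>{J..}. {z \<in> \<Omega>. f j z \<in> V k})"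
 have A: "A \<in> sets (lebesgue_on \<Omega>)"
  unfolding A_def by (intro sets.countable_UN sets.countable_INT' image_subsetI sV) auto
 have iff: "v z \<in> U \<longleftrightarrow> z \<in> A" if z: "z \<in> \<Omega>" and l: "(\<lambda>j. mdist Z (f j z) (v z)) \<longlonglongrightarrow> 0" for z
 proof
  assume "v z \<in> U"
  then obtain r where r: "r > 0" "\<And>y. y \<in> mspace Z ==> mdist Z (v z) y < r ==> y \<in> U"
   using U by (auto simp: openin_mtopology_of)
  obtain k where k: "1 / real (Suc k) < r / 2" using r(1) nat_approx_posE[of "r/2"] by auto
  have "eventually (\<lambda>j. mdist Z (f j z) (v z) < r / 2) sequentially"
   using order_tendstoD(2)[OF l, of "r/2"] r by simp
  then obtain J where J: "\<And>j. j \<ge> J ==> mdist Z (f j z) (v z) < r / 2" by (auto simp: eventually_sequentially)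
  have "f j z \<in> V k" if "j \<ge> J" for j
   unfolding V_def
  proof (intro CollectI conjI ballI impI fZ z)
   fix w assume w: "w \<in> mspace Z" "mdist Z (f j z) w < 1 / real (Suc k)"
   show "w \<in> U"
    using mdist_triangle_of[OF vZ[OF z] fZ[OF z] w(1), of j] J[OF that] k w mdist_commute_of[of Z "v z" "f j z"]
    by (intro r) auto
  qed
  then show "z \<in> A" using z by (auto simp: A_def)
 next
  assume "z \<in> A"
  then obtain k J where J: "\<And>j. j \<ge> J ==> f j z \<in> V k" by (auto simp: A_def)
  have "eventually (\<lambda>j. mdist Z (f j z) (v z) < 1 / real (Suc k)) sequentially"
   using order_tendstoD(2)[OF l, of "1 / real (Suc k)"] by simp
  then obtain J' where "\<And>j. j \<ge> J' ==> mdist Z (f j z) (v z) < 1 / real (Suc k)" by (auto simp: eventually_sequentially)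
  then show "v z \<in> U" using J[of "max J J'"] vZ[OF z] by (auto simp: V_def)
 qed
 have "AE z in lebesgue_on \<Omega>. (\<lambda>j. mdist Z (f j z) (v z)) \<longlonglongrightarrow> 0"
  using lim by (rule AE_lebesgue_on_iff[OF \<Omega>, THEN iffD2])
 then have "AE z in lebesgue_on \<Omega>. z \<in> v -` U \<longleftrightarrow> z \<in> A"
  using AE_space by eventually_elim (use iff in auto)
 then have "AE z in lebesgue_on \<Omega>. z \<in> v -` U \<inter> space (lebesgue_on \<Omega>) \<longleftrightarrow> z \<in> A"
  using AE_space by eventually_elim auto
 then have "AE z\<in>\<Omega> in lborel. (z \<in> v -` U \<inter> \<Omega> \<longleftrightarrow> z \<in> A)"
  by (simp add: AE_lebesgue_on_iff[OF \<Omega>])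
 then have "AE z in lebesgue. z \<in> A \<longleftrightarrow> z \<in> v -` U \<inter> \<Omega>"
  unfolding AE_completion_iff by eventually_elim (auto simp: A_def)
 then have "v -` U \<inter> \<Omega> \<in> sets lebesgue"
  by (rule completion.in_sets_AE) (use A \<Omega> in \<open>auto simp: sets_restrict_space_iff\<close>)
 then show "v -` U \<inter> space (lebesgue_on \<Omega>) \<in> sets (lebesgue_on \<Omega>)"
  using \<Omega> by (auto simp: sets_restrict_space_iff)
qed

text \<open>Borel-Cantelli: almost every \<open>z\<close> lies in all but finitely many \<open>G j\<close>,
 where the distances of consecutive terms are summable. At the remaining points \<open>v\<close> takes the
 arbitrary value \<open>z0\<close>.\<close>
lemma AE_limit_exists:
 fixes f :: "nat => real^'n::finite => 'z"
 assumes Z: "mcomplete_of Z" and z0: "z0 \<in> mspace Z" and fZ: "\<And>j z. z \<in> \<Omega> ==> f j z \<in> mspace Z"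
  and G: "\<And>j. G j \<in> sets borel" and \<Omega>: "\<Omega> \<in> sets borel" and small: "\<And>j. emeasure lborel (\<Omega> - G j) \<le> ennreal (B * (1/2) ^ j)"
  and close: "\<And>j z. z \<in> \<Omega> ==> z \<in> G j ==> mdist Z (f j z) (f (Suc j) z) \<le> c * (1/2) ^ j"
 obtains v where "\<And>z. v z \<in> mspace Z" "AE z\<in>\<Omega> in lborel. (\<lambda>j. mdist Z (f j z) (v z)) \<longlonglongrightarrow> 0"
proof -
 define v where "v = (\<lambda>z. if \<exists>y\<in>mspace Z. (\<lambda>j. mdist Z (f j z) y) \<longlonglongrightarrow> 0 then SOME y. y \<in> mspace Z \<and> (\<lambda>j. mdist Z (f j z) y) \<longlonglongrightarrow> 0 else z0)"
 have v1: "v z \<in> mspace Z \<and> (\<lambda>j. mdist Z (f j z) (v z)) \<longlonglongrightarrow> 0" if "\<exists>y\<in>mspace Z. (\<lambda>j. mdist Z (f j z) y) \<longlonglongrightarrow> 0" for z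
  using someI_ex[of "\<lambda>y. y \<in> mspace Z \<and> (\<lambda>j. mdist Z (f j z) y) \<longlonglongrightarrow> 0"] that by (auto simp: v_def)
 have v2: "v z \<in> mspace Z" for z
 proof (cases "\<exists>y\<in>mspace Z. (\<lambda>j. mdist Z (f j z) y) \<longlonglongrightarrow> 0")
  case True then show ?thesis using v1 by blast
 next
  case False then show ?thesis using z0 unfolding v_def by (simp only: if_False)
 qed
 have "summable (\<lambda>j. measure lborel (\<Omega> - G j))"
 proof (rule summable_comparison_test_ev)
  have "norm (measure lborel (\<Omega> - G j)) \<le> \<bar>B\<bar> * (1/2) ^ j" for j
  proof -
   have "ennreal (B * (1/2) ^ j) \<le> ennreal (\<bar>B\<bar> * (1/2) ^ j)" by (intro ennreal_leI mult_right_mono) auto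
   then have "measure lborel (\<Omega> - G j) \<le> \<bar>B\<bar> * (1/2) ^ j"
    using order_trans[OF small[of j]] unfolding measure_def by (intro enn2real_leI) auto
   then show ?thesis by simp
  qed
  then show "eventually (\<lambda>j. norm (measure lborel (\<Omega> - G j)) \<le> \<bar>B\<bar> * (1/2) ^ j) sequentially" by simp
 qed (intro summable_mult summable_geometric, simp)
 then have "AE z in lborel. eventually (\<lambda>j. z \<in> space lborel - (\<Omega> - G j)) sequentially"
 proof (rule borel_cantelli_AE1[rotated 2])
  show "\<Omega> - G j \<in> sets lborel" for j using G \<Omega> by auto
  show "emeasure lborel (\<Omega> - G j) < \<infinity>" for j
   using small[of j] by (metis ennreal_less_top infinity_ennreal_def order_le_less_trans)
 qed
 then have "AE z\<in>\<Omega> in lborel. (\<lambda>j. mdist Z (f j z) (v z)) \<longlonglongrightarrow> 0"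
 proof (eventually_elim, intro impI)
  fix z assume ev: "eventually (\<lambda>j. z \<in> space lborel - (\<Omega> - G j)) sequentially" and z: "z \<in> \<Omega>"
  then obtain J where J: "\<And>j. j \<ge> J ==> z \<in> G j" by (auto simp: eventually_sequentially)
  have step: "mdist Z (f j z) (f (j + k) z) \<le> (\<Sum>i\<in>{j..<j + k}. c * (1/2) ^ i)" if "j \<ge> J" for j k
  proof (induction k)
   case (Suc k)
   have "mdist Z (f j z) (f (Suc (j + k)) z) \<le> mdist Z (f j z) (f (j + k) z) + c * (1/2) ^ (j + k)"
    using mdist_triangle_of[of "f j z" Z "f (j + k) z" "f (Suc (j + k)) z"] fZ[OF z] close[OF z J, of "j + k"] that by simp
   with Suc show ?case by simp
  qed (simp add: mdist_self_of fZ z)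
  have c: "c \<ge> 0" using close[OF z J, of J] mdist_nonneg_of[of Z "f J z" "f (Suc J) z"]
   by (metis order_refl order_trans zero_le_mult_iff zero_less_power half_gt_zero zero_less_one not_less)
  have geo: "(\<Sum>i\<in>{j..<j + k}. c * (1/2) ^ i) \<le> 2 * c * (1/2) ^ j" for j k
  proof -
   have "(\<Sum>i\<in>{j..<j + k}. c * (1/2) ^ i) = 2 * c * (1/2) ^ j - 2 * c * (1/2) ^ (j + k)"
    by (induction k) (auto simp: power_add algebra_simps)
   also have "\<dots> \<le> 2 * c * (1/2) ^ j" using c by simp
   finally show ?thesis .
  qed
  have "(\<lambda>j. 2 * c * (1/2) ^ j) \<longlonglongrightarrow> 2 * c * 0" by (intro tendsto_intros LIMSEQ_power_zero) auto
  then have small': "\<exists>N\<ge>J. 2 * c * (1/2) ^ N < \<epsilon>" if "\<epsilon> > 0" for \<epsilon>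
   using order_tendstoD(2)[of _ _ sequentially \<epsilon>] that unfolding eventually_sequentially
   by (metis (no_types, lifting) mult_zero_right nle_le order_refl)
  interpret ZM: Metric_space "mspace Z" "mdist Z" by (rule Metric_space_mspace_mdist)
  have "ZM.MCauchy (\<lambda>j. f j z)"
   unfolding ZM.MCauchy_def
  proof (intro conjI allI impI)
   show "range (\<lambda>j. f j z) \<subseteq> mspace Z" using fZ z by auto
   fix \<epsilon> :: real assume "\<epsilon> > 0"
   then obtain N where N: "N \<ge> J" "2 * c * (1/2) ^ N < \<epsilon> / 2" using small'[of "\<epsilon> / 2"] by auto
   have d: "mdist Z (f N z) (f n z) < \<epsilon> / 2" if "n \<ge> N" for n
    using step[OF N(1), of "n - N"] geo[of N "n - N"] N(2) that by simp
   have "mdist Z (f n z) (f n' z) < \<epsilon>" if "N \<le> n" "N \<le> n'" for n n'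
    using d[OF that(1)] d[OF that(2)] mdist_triangle_of[OF fZ[OF z, of n] fZ[OF z, of N] fZ[OF z, of n']] mdist_commute_of[of Z "f N z" "f n z"]
    by linarith
   then show "\<exists>N. \<forall>n n'. N \<le> n --> N \<le> n' --> mdist Z (f n z) (f n' z) < \<epsilon>" by blast
  qed
  then obtain y where "limitin ZM.mtopology (\<lambda>j. f j z) y sequentially"
   using Z by (auto simp: mcomplete_of_def ZM.mcomplete_def)
  then have "y \<in> mspace Z" "(\<lambda>j. mdist Z (f j z) y) \<longlonglongrightarrow> 0"
   unfolding ZM.limit_metric_sequentially LIMSEQ_iff by (simp_all add: mdist_nonneg_of) meson
  then show "(\<lambda>j. mdist Z (f j z) (v z)) \<longlonglongrightarrow> 0" using v1 by blast
 qed
 with v2 show thesis by (rule that)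
qed

section \<open>Limits of segment bounds\<close>

lemma tail_combination_tendsto:
 fixes a :: "nat => real" and w :: "nat => nat => real"
 assumes w: "\<And>j k. w j k \<ge> 0" "\<And>j k. k < j ==> w j k = 0" "\<And>j. (\<Sum>k\<le>b j. w j k) = 1" and a: "a \<longlonglongrightarrow> l"
 shows "(\<lambda>j. \<Sum>k\<le>b j. w j k * a k) \<longlonglongrightarrow> l"
proof (rule LIMSEQ_I)
 fix e :: real assume "e > 0"
 then obtain N where N: "\<And>k. k \<ge> N ==> \<bar>a k - l\<bar> < e / 2" using LIMSEQ_D[OF a, of "e/2"] by auto
 have "norm ((\<Sum>k\<le>b j. w j k * a k) - l) < e" if j: "j \<ge> N" for j
 proof -
  have "(\<Sum>k\<le>b j. w j k * a k) - l = (\<Sum>k\<le>b j. w j k * (a k - l))"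
   using w(3)[of j] by (simp add: right_diff_distrib sum_subtractf flip: sum_distrib_right)
  also have "norm \<dots> \<le> (\<Sum>k\<le>b j. norm (w j k * (a k - l)))" by (rule norm_sum)
  also have "\<dots> \<le> (\<Sum>k\<le>b j. w j k * (e / 2))"
  proof (rule sum_mono)
   fix k
   show "norm (w j k * (a k - l)) \<le> w j k * (e / 2)"
    using w(1)[of j k] w(2)[of k j] mult_left_mono[OF less_imp_le[OF N[of k]] w(1)[of j k]] j
    by (cases "k < j") (auto simp: abs_mult)
  qed
  also have "\<dots> = e / 2" using w(3)[of j] by (simp flip: sum_distrib_right sum_divide_distrib)
  finally show ?thesis using \<open>e > 0\<close> by simp
 qed
 then show "\<exists>N. \<forall>j\<ge>N. norm ((\<Sum>k\<le>b j. w j k * a k) - l) < e" by blast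
qed

lemma convex_combination_powr_le:
 fixes c :: "nat => real"
 assumes w: "\<And>k. w k \<ge> 0" "(\<Sum>k\<le>b. w k) = 1" and c: "\<And>k. c k \<ge> 0" and p: "p \<ge> 1"
 shows "ennreal ((\<Sum>k\<le>b. w k * c k) powr p) \<le> ennreal (2 powr p) * (\<Sum>k\<le>b. ennreal (w k) * ennreal (c k powr p))"
proof -
 define M where "M = point_measure {..b} (\<lambda>k. ennreal (w k))"
 have M: "emeasure M (space M) \<le> ennreal 1"
  using w by (simp add: M_def space_point_measure emeasure_point_measure_finite sum_ennreal)
 have "ennreal (enn2real (\<integral>\<^sup>+k. ennreal (c k) \<partial>M) powr p) \<le> ennreal (2 powr p * 1 powr (p - 1)) * (\<integral>\<^sup>+k. ennreal (c k powr p) \<partial>M)"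
  by (rule nn_integral_Jensen_bound[OF _ c M _ p]) (auto simp: M_def)
 moreover have "(\<integral>\<^sup>+k. ennreal (c k) \<partial>M) = ennreal (\<Sum>k\<le>b. w k * c k)"
  unfolding M_def using w c by (subst nn_integral_point_measure_finite) (auto simp: sum_ennreal simp flip: ennreal_mult)
 moreover have "(\<integral>\<^sup>+k. ennreal (c k powr p) \<partial>M) = (\<Sum>k\<le>b. ennreal (w k) * ennreal (c k powr p))"
  unfolding M_def by (subst nn_integral_point_measure_finite) auto
 ultimately show ?thesis using w c by (simp add: sum_nonneg)
qed

lemma finite_measure_density_indicator:
 fixes \<Omega> :: "'a::euclidean_space set"
 assumes "bounded \<Omega>" "\<Omega> \<in> sets borel"
 shows "finite_measure (density lborel (indicator \<Omega>))" "emeasure (density lborel (indicator \<Omega>)) UNIV = emeasure lborel \<Omega>"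
proof -
 show eq: "emeasure (density lborel (indicator \<Omega>)) UNIV = emeasure lborel \<Omega>"
  using assms by (subst emeasure_density) auto
 show "finite_measure (density lborel (indicator \<Omega>))"
  using eq emeasure_bounded_finite[OF assms(1)] by (intro finite_measureI) simp
qed

lemma AE_density_indicator:
 fixes \<Omega> :: "'a::euclidean_space set"
 assumes "\<Omega> \<in> sets borel"
 shows "(AE z in density lborel (indicator \<Omega>). P z) \<longleftrightarrow> (AE z\<in>\<Omega> in lborel. P z)"
 using assms by (subst AE_density) (auto simp: indicator_def)

lemma nn_integral_density_indicator:
 fixes \<Omega> :: "'a::euclidean_space set"
 assumes "\<Omega> \<in> sets borel" "f \<in> borel_measurable borel"
 shows "(\<integral>\<^sup>+z. f z \<partial>density lborel (indicator \<Omega>)) = (\<integral>\<^sub>+z. f z * indicator \<Omega> z)"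
 using assms by (subst nn_integral_density) (auto simp: mult.commute)

lemma abs_diff_powr_le:
 fixes a b p :: real
 assumes "a \<ge> 0" "b \<ge> 0" "p \<ge> 0"
 shows "\<bar>a - b\<bar> powr p \<le> a powr p + b powr p"
proof -
 have "\<bar>a - b\<bar> powr p \<le> max a b powr p" using assms by (intro powr_mono2) auto
 also have "\<dots> \<le> a powr p + b powr p" by (auto simp: max_def)
 finally show ?thesis .
qed

text \<open>The functions \<open>g j\<close> need not converge, but convex combinations of their tails do almost
 everywhere, and because of the bound in \<open>L\<^sup>p\<close> with \<open>p > 1\<close> also in
 \<open>L\<^sup>1\<close>. The same combinations of the distances \<open>mdist Z (f k z) (f k (z +
 \<xi>))\<close> converge to the distance of the limits.\<close>
lemma segment_bound_limit:
 fixes f :: "nat => real^'n::finite => 'z" and g :: "nat => real^'n => real"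
 assumes \<Omega>: "open \<Omega>" "bounded \<Omega>" and p: "p > 1"
  and fZ: "\<And>j z. z \<in> \<Omega> ==> f j z \<in> mspace Z" and vZ: "\<And>z. v z \<in> mspace Z"
  and lim: "AE z\<in>\<Omega> in lborel. (\<lambda>j. mdist Z (f j z) (v z)) \<longlonglongrightarrow> 0"
  and sb: "\<And>j. segment_bound \<Omega> Z (f j) (g j)"
  and g[measurable]: "\<And>j. g j \<in> borel_measurable borel" and g0: "\<And>j z. g j z \<ge> 0" "\<And>j z. z \<notin> \<Omega> ==> g j z = 0"
  and C: "C \<ge> 0" "\<And>j. (\<integral>\<^sub>+z. ennreal (g j z powr p)) \<le> ennreal C"
 obtains h where "h \<in> borel_measurable borel" "\<And>z. h z \<ge> 0" "\<And>z. z \<notin> \<Omega> ==> h z = 0"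
  "(\<integral>\<^sub>+z. ennreal (h z powr p)) < \<infinity>" "segment_bound \<Omega> Z v h"
proof -
 have \<Omega>b[measurable]: "\<Omega> \<in> sets borel" using \<Omega> by auto
 define M where "M = density lborel (indicator \<Omega> :: real^'n => ennreal)"
 have finM: "finite_measure M" unfolding M_def by (rule finite_measure_density_indicator[OF \<Omega>(2) \<Omega>b])
 have sM: "sets M = sets borel" by (simp add: M_def)
 have mM: "F \<in> borel_measurable M" if "F \<in> borel_measurable borel" for F :: "real^'n => real"
  using that unfolding measurable_cong_sets[OF sM refl] .
 define A where "A = measure lborel \<Omega> + 1"
 have A: "A > 0" "emeasure M (space M) \<le> ennreal A"
  using finite_measure_density_indicator(2)[OF \<Omega>(2) \<Omega>b] emeasure_bounded_finite[OF \<Omega>(2)]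
  by (auto simp: A_def M_def emeasure_eq_ennreal_measure less_top intro!: ennreal_leI add_nonneg_pos)
 have nnM: "(\<integral>\<^sup>+z. F z \<partial>M) = (\<integral>\<^sub>+z. F z * indicator \<Omega> z)" if "F \<in> borel_measurable borel" for F
  unfolding M_def by (rule nn_integral_density_indicator[OF \<Omega>b that])
 have gpM: "(\<integral>\<^sup>+z. ennreal (g j z powr p) \<partial>M) \<le> ennreal C" for j
  using g0(2) by (subst nnM) (auto intro!: order_trans[OF nn_integral_mono C(2)[of j]] split: split_indicator)
 have gM: "(\<integral>\<^sup>+z. ennreal (g j z) \<partial>M) \<le> ennreal (2 * A powr (1 - 1/p) * C powr (1/p))" for j
  by (rule nn_integral_Holder_bound[OF mM[OF g] g0(1) A(2,1) _ gpM C(1)]) (use p in auto)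
 have gMm: "g j \<in> borel_measurable M" for j by (rule mM[OF g])
 obtain w :: "nat => nat => real" and b h0 where w: "\<And>j k. w j k \<ge> 0" "\<And>j k. k < j ==> w j k = 0" "\<And>j. (\<Sum>k\<le>b j. w j k) = 1"
  and h0: "h0 \<in> borel_measurable M" "\<And>z. h0 z \<ge> 0" "AE z in M. (\<lambda>j. \<Sum>k\<le>b j. w j k * g k z) \<longlonglongrightarrow> h0 z"
  by (rule convex_combinations_AE_convergent[where N = g, OF finM gMm g0(1) gM]) (rule that)
 have [measurable]: "h0 \<in> borel_measurable borel" using h0(1) unfolding measurable_cong_sets[OF sM refl] .
 define h where "h = (\<lambda>z. if z \<in> \<Omega> then h0 z else 0)"
 have h: "h \<in> borel_measurable borel" "\<And>z. h z \<ge> 0" "\<And>z. z \<notin> \<Omega> ==> h z = 0"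
  unfolding h_def by (measurable, use h0(2) in auto)
 note [measurable] = h(1)
 define H where "H = (\<lambda>j z. \<Sum>k\<le>b j. w j k * g k z)"
 have [measurable]: "H j \<in> borel_measurable borel" for j unfolding H_def by measurable
 have H0: "H j z \<ge> 0" "z \<notin> \<Omega> ==> H j z = 0" for j z using w(1) g0 by (auto simp: H_def intro!: sum_nonneg)
 have Hlim: "AE z in lborel. (\<lambda>j. H j z) \<longlonglongrightarrow> h z"
  using h0(3) unfolding M_def AE_density_indicator[OF \<Omega>b]
  by eventually_elim (use g0(2) in \<open>auto simp: H_def h_def\<close>)
 have Hp: "(\<integral>\<^sub>+z. ennreal (H j z powr p)) \<le> ennreal (2 powr p * C)" for j
 proof -
  have "(\<integral>\<^sub>+z. ennreal (H j z powr p)) \<le> (\<integral>\<^sub>+z. ennreal (2 powr p) * (\<Sum>k\<le>b j. ennreal (w j k) * ennreal (g k z powr p)))"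
   unfolding H_def using p by (intro nn_integral_mono convex_combination_powr_le w g0) auto
  also have "\<dots> = ennreal (2 powr p) * (\<Sum>k\<le>b j. ennreal (w j k) * (\<integral>\<^sub>+z. ennreal (g k z powr p)))"
   by (simp add: nn_integral_cmult nn_integral_sum)
  also have "\<dots> \<le> ennreal (2 powr p) * (\<Sum>k\<le>b j. ennreal (w j k) * ennreal C)"
   by (intro mult_left_mono sum_mono C) auto
  also have "\<dots> = ennreal (2 powr p * C)"
   using w C(1) by (simp add: sum_ennreal ennreal_mult flip: sum_distrib_right)
  finally show ?thesis .
 qed
 have hp: "(\<integral>\<^sub>+z. ennreal (h z powr p)) \<le> ennreal (2 powr p * C)"
 proof -
  have "(\<integral>\<^sub>+z. ennreal (h z powr p)) = (\<integral>\<^sub>+z. liminf (\<lambda>j. ennreal (H j z powr p)))"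
  proof (rule nn_integral_cong_AE)
   show "AE z in lborel. ennreal (h z powr p) = liminf (\<lambda>j. ennreal (H j z powr p))"
    using Hlim
   proof eventually_elim
    case (elim z)
    have "(\<lambda>j. H j z powr p) \<longlonglongrightarrow> h z powr p"
     by (rule tendsto_powr'[OF elim tendsto_const]) (use H0 p in auto)
    then have "(\<lambda>j. ennreal (H j z powr p)) \<longlonglongrightarrow> ennreal (h z powr p)" by (rule tendsto_ennrealI)
    then show ?case by (intro lim_imp_Liminf[symmetric]) auto
   qed
  qed
  also have "\<dots> \<le> liminf (\<lambda>j. \<integral>\<^sub>+z. ennreal (H j z powr p))" by (intro nn_integral_liminf) auto
  also have "\<dots> \<le> ennreal (2 powr p * C)" by (intro Liminf_le) (auto intro!: always_eventually Hp)
  finally show ?thesis .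
 qed
 have L1: "(\<lambda>j. \<integral>\<^sub>+z. ennreal \<bar>H j z - h z\<bar>) \<longlonglongrightarrow> 0"
 proof -
  have "(\<lambda>j. \<integral>\<^sup>+z. ennreal (\<bar>H j z - h z\<bar> powr 1) \<partial>M) \<longlonglongrightarrow> 0"
  proof (rule AE_tendsto_bounded_imp_Lq_tendsto[OF finM, where q' = p and C = "2 powr p * C + 2 powr p * C"])
   show "AE z in M. (\<lambda>j. \<bar>H j z - h z\<bar>) \<longlonglongrightarrow> 0"
    using Hlim unfolding M_def AE_density_indicator[OF \<Omega>b]
    by eventually_elim (auto intro: tendsto_rabs_zero simp: LIM_zero)
   fix j
   have "(\<integral>\<^sup>+z. ennreal (\<bar>H j z - h z\<bar> powr p) \<partial>M) \<le> (\<integral>\<^sub>+z. ennreal (\<bar>H j z - h z\<bar> powr p))"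
    by (subst nnM) (auto intro!: nn_integral_mono split: split_indicator)
   also have "\<dots> \<le> (\<integral>\<^sub>+z. ennreal (H j z powr p) + ennreal (h z powr p))"
    using abs_diff_powr_le[OF H0(1) h(2)] p by (intro nn_integral_mono) (auto simp flip: ennreal_plus intro!: ennreal_leI)
   also have "\<dots> \<le> ennreal (2 powr p * C) + ennreal (2 powr p * C)"
    by (subst nn_integral_add) (auto intro!: add_mono Hp hp)
   finally show "(\<integral>\<^sup>+z. ennreal (\<bar>H j z - h z\<bar> powr p) \<partial>M) \<le> ennreal (2 powr p * C + 2 powr p * C)"
    using C(1) by (subst ennreal_plus) auto
   show "(\<lambda>z. \<bar>H j z - h z\<bar>) \<in> borel_measurable M" by (intro mM) measurable
  qed (use p in auto)
  moreover have "(\<integral>\<^sup>+z. ennreal (\<bar>H j z - h z\<bar> powr 1) \<partial>M) = (\<integral>\<^sub>+z. ennreal \<bar>H j z - h z\<bar>)" for j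
   using H0(2) h(3) by (subst nnM) (auto intro!: nn_integral_cong split: split_indicator)
  ultimately show ?thesis by simp
 qed
 have "segment_bound \<Omega> Z v h"
  unfolding segment_bound_def
 proof
  fix \<xi> :: "real^'n"
  define e where "e = (\<lambda>j z. \<integral>\<^sub>+t. ennreal \<bar>H j (z + t *\<^sub>R \<xi>) - h (z + t *\<^sub>R \<xi>)\<bar> * indicator {0..1} t)"
  have [measurable]: "e j \<in> borel_measurable borel" for j unfolding e_def by measurable
  have "(\<integral>\<^sub>+z. e j z) = (\<integral>\<^sub>+z. ennreal \<bar>H j z - h z\<bar>)" for j
   unfolding e_def by (rule nn_integral_segment_average[of "\<lambda>z. ennreal \<bar>H j z - h z\<bar>"]) measurable
  then have "(\<lambda>j. \<integral>\<^sub>+z. e j z) \<longlonglongrightarrow> 0" using L1 by simp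
  then obtain r :: "nat => nat" where r: "strict_mono r" "AE z in lborel. (\<lambda>j. e (r j) z) \<longlonglongrightarrow> 0"
   by (rule nn_integral_tendsto_0_AE_subseq[rotated]) auto
  define J where "J = (\<lambda>F z. \<integral>\<^sub>+t. ennreal (F (z + t *\<^sub>R \<xi>)) * indicator {0..1} t)"
  have JH: "J (H j) z = (\<Sum>k\<le>b j. ennreal (w j k) * J (g k) z)" for j z
  proof -
   have "J (H j) z = (\<integral>\<^sub>+t. (\<Sum>k\<le>b j. ennreal (w j k) * (ennreal (g k (z + t *\<^sub>R \<xi>)) * indicator {0..1} t)))"
    unfolding J_def H_def using w g0
    by (intro nn_integral_cong) (auto simp: atMost_def sum_ennreal sum_distrib_right mult.assoc[symmetric] simp flip: ennreal_mult split: split_indicator)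
   also have "\<dots> = (\<Sum>k\<le>b j. ennreal (w j k) * J (g k) z)"
    unfolding J_def by (subst nn_integral_sum) (auto simp: nn_integral_cmult)
   finally show ?thesis .
  qed
  have Jle: "J (H j) z \<le> J h z + e j z" for j z
   unfolding J_def e_def using h(2)
   by (subst nn_integral_add[symmetric]) (auto intro!: nn_integral_mono ennreal_leI split: split_indicator simp flip: ennreal_plus)
  have "AE z in lborel. \<forall>k. closed_segment z (z + \<xi>) \<subseteq> \<Omega> --> ennreal (mdist Z (f k z) (f k (z + \<xi>))) \<le> ennreal (norm \<xi>) * J (g k) z"
   using sb by (subst AE_all_countable) (auto simp: segment_bound_def J_def)
  then show "AE z in lborel. closed_segment z (z + \<xi>) \<subseteq> \<Omega> --> ennreal (mdist Z (v z) (v (z + \<xi>)))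
    \<le> ennreal (norm \<xi>) * segment_integral h z \<xi>"
   using lim AE_lborel_translate[OF lim, of \<xi>] r(2)
  proof (eventually_elim, intro impI)
   fix z
   assume 1: "\<forall>k. closed_segment z (z + \<xi>) \<subseteq> \<Omega> --> ennreal (mdist Z (f k z) (f k (z + \<xi>))) \<le> ennreal (norm \<xi>) * J (g k) z"
    and 2: "z \<in> \<Omega> --> (\<lambda>j. mdist Z (f j z) (v z)) \<longlonglongrightarrow> 0" "z + \<xi> \<in> \<Omega> --> (\<lambda>j. mdist Z (f j (z + \<xi>)) (v (z + \<xi>))) \<longlonglongrightarrow> 0"
    and 3: "(\<lambda>j. e (r j) z) \<longlonglongrightarrow> 0" and seg: "closed_segment z (z + \<xi>) \<subseteq> \<Omega>"
   have z: "z \<in> \<Omega>" "z + \<xi> \<in> \<Omega>" using seg by auto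
   define a where "a = (\<lambda>k. mdist Z (f k z) (f k (z + \<xi>)))"
   define S where "S = (\<lambda>j. \<Sum>k\<le>b j. w j k * a k)"
   have a0: "a k \<ge> 0" for k by (simp add: a_def mdist_nonneg_of)
   have "(\<lambda>k. a k - mdist Z (v z) (v (z + \<xi>))) \<longlonglongrightarrow> 0"
   proof (rule Lim_null_comparison[OF always_eventually])
    show "\<forall>k. norm (a k - mdist Z (v z) (v (z + \<xi>))) \<le> mdist Z (f k z) (v z) + mdist Z (f k (z + \<xi>)) (v (z + \<xi>))"
    proof
     fix k
     show "norm (a k - mdist Z (v z) (v (z + \<xi>))) \<le> mdist Z (f k z) (v z) + mdist Z (f k (z + \<xi>)) (v (z + \<xi>))"
      using abs_mdist_diff_le[OF fZ[OF z(1), of k] fZ[OF z(2), of k] vZ[of "z + \<xi>"]] abs_mdist_diff_le[OF vZ[of "z + \<xi>"] fZ[OF z(1), of k] vZ[of z]]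
      by (simp add: a_def mdist_commute_of[of Z "v (z + \<xi>)"])
    qed
    show "(\<lambda>k. mdist Z (f k z) (v z) + mdist Z (f k (z + \<xi>)) (v (z + \<xi>))) \<longlonglongrightarrow> 0"
     using tendsto_add[OF 2(1)[rule_format, OF z(1)] 2(2)[rule_format, OF z(2)]] by simp
   qed
   then have alim: "a \<longlonglongrightarrow> mdist Z (v z) (v (z + \<xi>))" by (rule LIM_zero_cancel)
   have "S \<longlonglongrightarrow> mdist Z (v z) (v (z + \<xi>))" unfolding S_def
    by (rule tail_combination_tendsto[where w = w and b = b, OF w(1) w(2) w(3) alim])
   then have Slim: "(\<lambda>j. ennreal (S (r j))) \<longlonglongrightarrow> ennreal (mdist Z (v z) (v (z + \<xi>)))"
    using LIMSEQ_subseq_LIMSEQ[OF _ r(1), of S] by (intro tendsto_ennrealI) (auto simp: o_def)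
   have Sle: "ennreal (S j) \<le> ennreal (norm \<xi>) * (J h z + e j z)" for j
   proof -
    have "ennreal (S j) = (\<Sum>k\<le>b j. ennreal (w j k) * ennreal (a k))"
     unfolding S_def using w a0 by (auto simp: sum_ennreal simp flip: ennreal_mult)
    also have "\<dots> \<le> (\<Sum>k\<le>b j. ennreal (w j k) * (ennreal (norm \<xi>) * J (g k) z))"
     using 1 seg by (intro sum_mono mult_left_mono) (auto simp: a_def)
    also have "\<dots> = ennreal (norm \<xi>) * J (H j) z"
     unfolding JH by (simp add: sum_distrib_left mult_ac)
    also have "\<dots> \<le> ennreal (norm \<xi>) * (J h z + e j z)" by (intro mult_left_mono Jle) auto
    finally show ?thesis .
   qed
   have "(\<lambda>j. ennreal (norm \<xi>) * (J h z + e (r j) z)) \<longlonglongrightarrow> ennreal (norm \<xi>) * (J h z + 0)"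
    by (intro ennreal_tendsto_cmult tendsto_add tendsto_const 3) simp
   from LIMSEQ_le[OF Slim this] Sle
   show "ennreal (mdist Z (v z) (v (z + \<xi>))) \<le> ennreal (norm \<xi>) * segment_integral h z \<xi>"
    by (auto simp: J_def)
  qed
 qed
 moreover have "(\<integral>\<^sub>+z. ennreal (h z powr p)) < \<infinity>"
  using hp by (rule order_le_less_trans) simp
 ultimately show thesis using that h by blast
qed

section \<open>From segment bounds to weak gradients\<close>

lemma integral_lborel_translate:
 fixes f :: "'a::euclidean_space => real"
 assumes [measurable]: "f \<in> borel_measurable borel"
 shows "(\<integral>x. f (x + c) \<partial>lborel) = (\<integral>x. f x \<partial>lborel)"
proof -
 have "(\<integral>x. f x \<partial>lborel) = (\<integral>x. f x \<partial>(distr lborel borel ((+) c)))" by (subst lborel_distr_plus) simp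
 also have "\<dots> = (\<integral>x. f (c + x) \<partial>lborel)" by (subst integral_distr) auto
 finally show ?thesis by (simp add: add.commute)
qed

lemma integrable_lborel_translate:
 fixes f :: "'a::euclidean_space => real"
 assumes "integrable lborel f"
 shows "integrable lborel (\<lambda>x. f (x + c))"
proof -
 have "integrable (distr lborel borel ((+) c)) f" by (subst lborel_distr_plus) (rule assms)
 then have "integrable lborel (\<lambda>x. f (c + x))" using assms by (subst (asm) integrable_distr_eq) auto
 then show ?thesis by (simp add: add.commute)
qed

text \<open>Makes the domain of the difference quotients measurable.\<close>
lemma open_segment_domain:
 fixes \<Omega> :: "'a::euclidean_space set"
 assumes "open \<Omega>"
 shows "open {z. closed_segment z (z + \<xi>) \<subseteq> \<Omega>}"
 unfolding open_contains_ball
proof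
 fix z assume "z \<in> {z. closed_segment z (z + \<xi>) \<subseteq> \<Omega>}"
 then obtain \<rho> where \<rho>: "\<rho> > 0" "\<And>t. t \<in> {0..1} ==> cball (z + t *\<^sub>R \<xi>) \<rho> \<subseteq> \<Omega>"
  using segment_neighbourhood[OF assms] by blast
 have "closed_segment x (x + \<xi>) \<subseteq> \<Omega>" if "x \<in> ball z \<rho>" for x
 proof
  fix y assume "y \<in> closed_segment x (x + \<xi>)"
  then obtain t where t: "t \<in> {0..1}" "y = x + t *\<^sub>R \<xi>" by (auto simp: in_segment algebra_simps)
  then have "y \<in> cball (z + t *\<^sub>R \<xi>) \<rho>" using that by (simp add: dist_norm)
  then show "y \<in> \<Omega>" using \<rho>(2)[OF t(1)] by blast
 qed
 then show "\<exists>\<rho>>0. ball z \<rho> \<subseteq> {z. closed_segment z (z + \<xi>) \<subseteq> \<Omega>}" using \<rho>(1) by blast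
qed

text \<open>For small \<open>s k\<close> all segments that start in the support of \<open>\<eta>\<close> stay in
 \<open>\<Omega>\<close>; a translation then moves the difference quotient from \<open>f\<close> to
 \<open>\<eta>\<close>, where it converges uniformly.\<close>
lemma difference_quotient_pairing_tendsto:
 fixes f \<eta> :: "real^'n::finite => real"
 assumes \<Omega>: "open \<Omega>" and f: "integrable lborel f" and \<eta>: "\<eta> \<in> test_functions \<Omega>" and s: "\<And>k. s k > 0" "s \<longlonglongrightarrow> 0"
 shows "(\<lambda>k. \<integral>z. (if closed_segment z (z + s k *\<^sub>R e) \<subseteq> \<Omega> then (f (z + s k *\<^sub>R e) - f z) / s k else 0) * \<eta> z \<partial>lborel)
  \<longlonglongrightarrow> - (\<integral>z. f z * (\<Sum>i\<in>UNIV. e $ i * partial_deriv i \<eta> z) \<partial>lborel)"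
proof -
 have [measurable]: "f \<in> borel_measurable borel" using f by auto
 have [measurable]: "\<eta> \<in> borel_measurable borel" by (rule test_function_bounded(1)[OF \<eta>])
 obtain B where B: "\<And>z. \<bar>\<eta> z\<bar> \<le> B" using test_function_bounded(2)[OF \<eta>] by blast
 define K where "K = closure {z. \<eta> z \<noteq> 0}"
 have K: "compact K" "K \<subseteq> \<Omega>" "\<And>z. z \<notin> K ==> \<eta> z = 0"
  unfolding K_def using test_functionD(2,3,4)[OF \<eta>] by blast+
 obtain \<rho> where \<rho>: "\<rho> > 0" "(\<Union>x\<in>K. cball x \<rho>) \<subseteq> \<Omega>"
  using compact_subset_open_imp_cball_epsilon_subset[OF K(1) \<Omega> K(2)] by blast
 have "(\<lambda>k. s k * norm e) \<longlonglongrightarrow> 0 * norm e" by (intro tendsto_intros s)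
 then have ev: "eventually (\<lambda>k. s k * norm e < \<rho>) sequentially" using order_tendstoD(2)[of _ "0 * norm e" sequentially \<rho>] \<rho>(1) by simp
 have eq: "(\<integral>z. (if closed_segment z (z + s k *\<^sub>R e) \<subseteq> \<Omega> then (f (z + s k *\<^sub>R e) - f z) / s k else 0) * \<eta> z \<partial>lborel)
   = (\<integral>y. f y * ((\<eta> (y + s k *\<^sub>R (- e)) - \<eta> y) / s k) \<partial>lborel)" if k: "s k * norm e < \<rho>" for k
 proof -
  have seg: "closed_segment z (z + s k *\<^sub>R e) \<subseteq> \<Omega>" if "z \<in> K" for z
  proof -
   have "closed_segment z (z + s k *\<^sub>R e) \<subseteq> cball z \<rho>"
    using k s(1)[of k] \<rho>(1) by (intro closed_segment_subset) (auto simp: dist_norm)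
   then show ?thesis using \<rho>(2) that by blast
  qed
  have i1: "integrable lborel (\<lambda>z. f (z + s k *\<^sub>R e) * \<eta> z)" "integrable lborel (\<lambda>z. f z * \<eta> z)"
   by (intro integrable_mult_bounded[OF _ _ B] integrable_lborel_translate f; measurable)+
  have i2: "integrable lborel (\<lambda>z. f z * \<eta> (z + s k *\<^sub>R (- e)))"
   by (intro integrable_mult_bounded[OF f _ B]) measurable
  have "(\<integral>z. (if closed_segment z (z + s k *\<^sub>R e) \<subseteq> \<Omega> then (f (z + s k *\<^sub>R e) - f z) / s k else 0) * \<eta> z \<partial>lborel)
    = (\<integral>z. (f (z + s k *\<^sub>R e) * \<eta> z - f z * \<eta> z) / s k \<partial>lborel)"
  proof (intro Bochner_Integration.integral_cong refl)
   fix z show "(if closed_segment z (z + s k *\<^sub>R e) \<subseteq> \<Omega> then (f (z + s k *\<^sub>R e) - f z) / s k else 0) * \<eta> z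
     = (f (z + s k *\<^sub>R e) * \<eta> z - f z * \<eta> z) / s k"
    using seg[of z] K(3)[of z] by (cases "z \<in> K") (auto simp: left_diff_distrib)
  qed
  also have "\<dots> = ((\<integral>z. f (z + s k *\<^sub>R e) * \<eta> z \<partial>lborel) - (\<integral>z. f z * \<eta> z \<partial>lborel)) / s k"
   using i1 by simp
  also have "(\<integral>z. f (z + s k *\<^sub>R e) * \<eta> z \<partial>lborel) = (\<integral>z. f z * \<eta> (z + s k *\<^sub>R (- e)) \<partial>lborel)"
   using integral_lborel_translate[of "\<lambda>z. f z * \<eta> (z + s k *\<^sub>R (- e))" "s k *\<^sub>R e"] by simp
  also have "((\<integral>z. f z * \<eta> (z + s k *\<^sub>R (- e)) \<partial>lborel) - (\<integral>z. f z * \<eta> z \<partial>lborel)) / s k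
    = (\<integral>y. (f y * \<eta> (y + s k *\<^sub>R (- e)) - f y * \<eta> y) / s k \<partial>lborel)"
   using i1(2) i2 by simp
  finally show ?thesis by (simp add: right_diff_distrib)
 qed
 have "(\<lambda>k. \<integral>y. f y * ((\<eta> (y + s k *\<^sub>R (- e)) - \<eta> y) / s k) \<partial>lborel) \<longlonglongrightarrow> (\<integral>y. f y * (\<Sum>i\<in>UNIV. (- e) $ i * partial_deriv i \<eta> y) \<partial>lborel)"
  using directional_difference_quotient_tendsto[OF test_functionD(1)[OF \<eta>] K(1,3) f, of "- e"] s
  unfolding tendsto_at_iff_sequentially o_def by (auto simp: less_imp_neq[symmetric])
 also have "(\<integral>y. f y * (\<Sum>i\<in>UNIV. (- e) $ i * partial_deriv i \<eta> y) \<partial>lborel) = - (\<integral>z. f z * (\<Sum>i\<in>UNIV. e $ i * partial_deriv i \<eta> z) \<partial>lborel)"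
  by (simp add: sum_negf flip: Bochner_Integration.integral_minus)
 finally show ?thesis
  by (rule Lim_transform_eventually) (use ev in eventually_elim, simp add: eq)
qed

text \<open>The difference quotients \<open>Q k\<close> of \<open>f\<close> in direction \<open>e\<close> are
 bounded by \<open>norm e * (g + B k)\<close>, where \<open>B k\<close> tends to 0 in \<open>L\<^sup>1\<close>
 by continuity of translations. Convex combinations of them converge almost everywhere; the limit is bounded by
 \<open>norm e * g\<close>, and \<open>difference_quotient_pairing_tendsto\<close> identifies its pairing with
 test functions.\<close>
lemma directional_weak_derivative:
 fixes f g :: "real^'n::finite => real"
 assumes \<Omega>: "open \<Omega>" "bounded \<Omega>" and f: "integrable lborel f" and g: "integrable lborel g" "\<And>z. g z \<ge> 0"
  and sb: "segment_bound \<Omega> euclidean_metric f g"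
 obtains D where "D \<in> borel_measurable borel" "\<And>z. \<bar>D z\<bar> \<le> norm e * g z" "\<And>z. z \<notin> \<Omega> ==> D z = 0"
  "\<And>\<eta>. \<eta> \<in> test_functions \<Omega> ==> (\<integral>z. D z * \<eta> z \<partial>lborel) = - (\<integral>z. f z * (\<Sum>i\<in>UNIV. e $ i * partial_deriv i \<eta> z) \<partial>lborel)"
proof -
 have \<Omega>b[measurable]: "\<Omega> \<in> sets borel" using \<Omega> by auto
 have [measurable]: "f \<in> borel_measurable borel" "g \<in> borel_measurable borel" using f g by auto
 define a where "a = norm e"
 have a: "a \<ge> 0" by (simp add: a_def)
 define s0 where "s0 = (\<lambda>k. 1 / (real k + 1))"
 have s0: "\<And>k. s0 k > 0" "s0 \<longlonglongrightarrow> 0"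
  using LIMSEQ_inverse_real_of_nat by (auto simp: s0_def inverse_eq_divide add.commute)
 define E where "E = (\<lambda>s z. \<integral>\<^sub>+t. ennreal \<bar>g (z + t *\<^sub>R (s *\<^sub>R e)) - g z\<bar> * indicator {0..1} t)"
 have [measurable]: "E s \<in> borel_measurable borel" for s unfolding E_def by measurable
 have E_swap: "(\<integral>\<^sub>+z. E s z) = (\<integral>\<^sub>+t. (\<integral>\<^sub>+z. ennreal \<bar>g (z + t *\<^sub>R (s *\<^sub>R e)) - g z\<bar>) * indicator {0..1} t)" for s
 proof -
  have "(\<integral>\<^sub>+z. E s z) = (\<integral>\<^sub>+t. (\<integral>\<^sub>+z. ennreal \<bar>g (z + t *\<^sub>R (s *\<^sub>R e)) - g z\<bar> * indicator {0..1} t))"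
   unfolding E_def by (rule lborel_pair.Fubini') measurable
  then show ?thesis by (simp add: nn_integral_multc)
 qed
 have E_lim0: "(\<lambda>k. \<integral>\<^sub>+z. E (s0 k) z) \<longlonglongrightarrow> 0"
 proof (rule tendsto_0_if_Limsup_eq_0_ennreal)
  have L: "limsup (\<lambda>k. \<integral>\<^sub>+z. E (s0 k) z) \<le> 0 + ennreal \<theta>" if \<theta>: "\<theta> > 0" for \<theta>
  proof -
   obtain d where d: "d > 0" "\<And>y. norm y < d ==> (\<integral>\<^sub>+x. ennreal \<bar>g (x + y) - g x\<bar>) \<le> ennreal \<theta>"
    using L1_translation_uniform[OF g(1) \<theta>] by blast
   have "(\<lambda>k. s0 k * a) \<longlonglongrightarrow> 0 * a" by (intro tendsto_intros s0)
   then have "eventually (\<lambda>k. s0 k * a < d) sequentially" using order_tendstoD(2)[of _ "0 * a" sequentially d] d(1) by simp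
   then have "eventually (\<lambda>k. (\<integral>\<^sub>+z. E (s0 k) z) \<le> ennreal \<theta>) sequentially"
   proof eventually_elim
    case (elim k)
    have "(\<integral>\<^sub>+z. E (s0 k) z) \<le> (\<integral>\<^sub>+t. ennreal \<theta> * indicator {0..1::real} t)"
     unfolding E_swap
    proof (intro nn_integral_mono)
     fix t :: real
     have "norm (t *\<^sub>R (s0 k *\<^sub>R e)) < d" if "t \<in> {0..1}"
     proof -
      have "norm (t *\<^sub>R (s0 k *\<^sub>R e)) = t * (s0 k * a)" using that s0(1)[of k] by (simp add: a_def)
      also have "\<dots> \<le> 1 * (s0 k * a)" using that s0(1)[of k] a by (intro mult_right_mono) auto
      finally show ?thesis using elim by simp
     qed
     then show "(\<integral>\<^sub>+z. ennreal \<bar>g (z + t *\<^sub>R (s0 k *\<^sub>R e)) - g z\<bar>) * indicator {0..1} t \<le> ennreal \<theta> * indicator {0..1} t"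
      using d(2) by (auto split: split_indicator)
    qed
    then show ?case by (simp add: nn_integral_cmult)
   qed
   then show ?thesis by (simp add: Limsup_bounded)
  qed
  have "limsup (\<lambda>k. \<integral>\<^sub>+z. E (s0 k) z) \<le> 0" by (rule ennreal_le_epsilon) (rule L)
  then show "limsup (\<lambda>k. \<integral>\<^sub>+z. E (s0 k) z) = 0" by simp
 qed
 then obtain r :: "nat => nat" where r: "strict_mono r" "AE z in lborel. (\<lambda>k. E (s0 (r k)) z) \<longlonglongrightarrow> 0"
  by (rule nn_integral_tendsto_0_AE_subseq[rotated]) auto
 define s where "s = (\<lambda>k. s0 (r k))"
 have s: "\<And>k. s k > 0" "s \<longlonglongrightarrow> 0" using s0 LIMSEQ_subseq_LIMSEQ[OF s0(2) r(1)] by (auto simp: s_def o_def)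
 have E_lim: "(\<lambda>k. \<integral>\<^sub>+z. E (s k) z) \<longlonglongrightarrow> 0"
  using LIMSEQ_subseq_LIMSEQ[OF E_lim0 r(1)] by (simp add: s_def o_def)
 define I where "I = (\<integral>z. g z \<partial>lborel)"
 have I: "I \<ge> 0" "(\<integral>\<^sub>+z. ennreal (g z)) = ennreal I"
  using g by (auto simp: I_def nn_integral_eq_integral intro: integral_nonneg_AE)
 have E_bound: "(\<integral>\<^sub>+z. E (s k) z) \<le> ennreal (2 * I)" for k
 proof -
  have "(\<integral>\<^sub>+z. ennreal \<bar>g (z + y) - g z\<bar>) \<le> ennreal (2 * I)" for y
  proof -
   have "(\<integral>\<^sub>+z. ennreal \<bar>g (z + y) - g z\<bar>) \<le> (\<integral>\<^sub>+z. ennreal (g (z + y)) + ennreal (g z))"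
    using g(2) by (intro nn_integral_mono) (auto simp flip: ennreal_plus intro!: ennreal_leI simp: abs_le_iff add_increasing add_increasing2)
   also have "\<dots> = ennreal I + ennreal I"
    using nn_integral_lborel_translate[of "\<lambda>z. ennreal (g z)" y] by (simp add: nn_integral_add I)
   finally show ?thesis using I(1) by (simp flip: ennreal_plus)
  qed
  then have "(\<integral>\<^sub>+z. E (s k) z) \<le> (\<integral>\<^sub>+t. ennreal (2 * I) * indicator {0..1::real} t)"
   unfolding E_swap by (intro nn_integral_mono mult_right_mono) auto
  then show ?thesis by (simp add: nn_integral_cmult)
 qed
 define B where "B = (\<lambda>k z. enn2real (E (s k) z))"
 have [measurable]: "B k \<in> borel_measurable borel" for k unfolding B_def by measurable
 have B0: "B k z \<ge> 0" for k z by (simp add: B_def)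
 have B_le: "(\<integral>\<^sub>+z. ennreal (B k z)) \<le> (\<integral>\<^sub>+z. E (s k) z)" for k
  unfolding B_def by (intro nn_integral_mono) (simp add: ennreal_enn2real_if)
 have B_int: "integrable lborel (B k)" for k
  using order_trans[OF B_le E_bound, of k] B0 by (intro integrableI_nonneg) (auto simp: le_less_trans)
 define \<beta> where "\<beta> = (\<lambda>k. \<integral>z. B k z \<partial>lborel)"
 have \<beta>: "\<beta> \<longlonglongrightarrow> 0"
 proof -
  have "ennreal (\<beta> k) = (\<integral>\<^sub>+z. ennreal (B k z))" for k
   unfolding \<beta>_def using B_int B0 by (intro nn_integral_eq_integral[symmetric]) auto
  then have "(\<lambda>k. ennreal (\<beta> k)) \<longlonglongrightarrow> 0"
   using B_le by (intro tendsto_sandwich[OF _ _ tendsto_const E_lim]) auto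
  moreover have "\<beta> k \<ge> 0" for k unfolding \<beta>_def using B0 by (intro integral_nonneg_AE) auto
  ultimately show ?thesis by (simp add: ennreal_tendsto_0_iff)
 qed
 have B_lim: "AE z in lborel. (\<lambda>k. B k z) \<longlonglongrightarrow> 0"
  using r(2) by eventually_elim (auto simp: B_def s_def dest: tendsto_enn2real[of _ 0, unfolded ennreal_0])
 define Q where "Q = (\<lambda>k z. if closed_segment z (z + s k *\<^sub>R e) \<subseteq> \<Omega> then (f (z + s k *\<^sub>R e) - f z) / s k else 0)"
 have [measurable]: "Q k \<in> borel_measurable borel" for k
 proof -
  have [measurable]: "{z. closed_segment z (z + s k *\<^sub>R e) \<subseteq> \<Omega>} \<in> sets borel"
   using open_segment_domain[OF \<Omega>(1)] by (rule borel_open)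
  have Qk: "Q k = (\<lambda>z. if z \<in> {z. closed_segment z (z + s k *\<^sub>R e) \<subseteq> \<Omega>} then (f (z + s k *\<^sub>R e) - f z) / s k else 0)"
   by (simp add: Q_def)
  show ?thesis unfolding Qk by (rule measurable_If_set) simp_all
 qed
 have Q_int: "integrable lborel (Q k)" for k
 proof (rule Bochner_Integration.integrable_bound)
  show "integrable lborel (\<lambda>z. (\<bar>f (z + s k *\<^sub>R e)\<bar> + \<bar>f z\<bar>) / s k)"
   using f integrable_lborel_translate[OF f] by simp
  show "AE z in lborel. norm (Q k z) \<le> norm ((\<bar>f (z + s k *\<^sub>R e)\<bar> + \<bar>f z\<bar>) / s k)"
   using s(1)[of k] by (intro AE_I2) (auto simp: Q_def abs_mult intro!: divide_right_mono)
 qed simp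
 have Q_le: "AE z in lborel. \<bar>Q k z\<bar> \<le> a * (g z + B k z)" for k
 proof -
  have fin: "AE z in lborel. E (s k) z < \<infinity>"
   using E_bound[of k] by (intro finite_nn_integral_imp_ae_finite) (auto simp: le_less_trans)
  have "AE z in lborel. closed_segment z (z + s k *\<^sub>R e) \<subseteq> \<Omega> --> ennreal (dist (f z) (f (z + s k *\<^sub>R e)))
   \<le> ennreal (norm (s k *\<^sub>R e)) * segment_integral g z (s k *\<^sub>R e)"
   using spec[OF sb[unfolded segment_bound_def], of "s k *\<^sub>R e"] by (simp only: mdist_euclidean_metric)
  then show ?thesis
   using fin
  proof eventually_elim
   case (elim z)
   show ?case
   proof (cases "closed_segment z (z + s k *\<^sub>R e) \<subseteq> \<Omega>")
    case True
    have "segment_integral g z (s k *\<^sub>R e)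
      \<le> (\<integral>\<^sub>+t. ennreal (g z) * indicator {0..1::real} t + ennreal \<bar>g (z + t *\<^sub>R (s k *\<^sub>R e)) - g z\<bar> * indicator {0..1} t)"
     using g(2) by (intro nn_integral_mono) (auto split: split_indicator simp flip: ennreal_plus intro!: ennreal_leI)
    also have "\<dots> = ennreal (g z) + E (s k) z"
     unfolding E_def by (subst nn_integral_add) (auto simp: nn_integral_cmult)
    also have "\<dots> = ennreal (g z + B k z)" using elim(2) g(2) by (simp add: B_def ennreal_plus)
    finally have "ennreal (dist (f z) (f (z + s k *\<^sub>R e))) \<le> ennreal (s k * a) * ennreal (g z + B k z)"
     using elim(1) True s(1)[of k] by (auto simp: a_def intro: order_trans[OF _ mult_left_mono])
    also have "\<dots> = ennreal (s k * a * (g z + B k z))"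
     using s(1)[of k] a g(2) B0 by (intro ennreal_mult[symmetric]) (auto simp: less_imp_le)
    finally have "\<bar>f (z + s k *\<^sub>R e) - f z\<bar> \<le> s k * a * (g z + B k z)"
     using s(1)[of k] a g(2)[of z] B0[of k z] by (subst (asm) ennreal_le_iff) (auto simp: dist_real_def abs_minus_commute)
    then show ?thesis using True s(1)[of k] by (simp add: Q_def divide_le_eq mult_ac)
   qed (use a g(2) B0 in \<open>auto simp: Q_def\<close>)
  qed
 qed
 \<comment> \<open>Convex combinations are only available for nonnegative functions, hence the shift.\<close>
 define N where "N = (\<lambda>k z. max 0 (Q k z + a * (g z + B k z)))"
 define M where "M = density lborel (indicator \<Omega> :: real^'n => ennreal)"
 have sM: "sets M = sets borel" by (simp add: M_def)
 have finM: "finite_measure M" unfolding M_def by (rule finite_measure_density_indicator[OF \<Omega>(2) \<Omega>b])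
 have [measurable]: "N k \<in> borel_measurable borel" for k unfolding N_def by measurable
 have NM: "N k \<in> borel_measurable M" for k unfolding measurable_cong_sets[OF sM refl] by measurable
 have N0: "N k z \<ge> 0" for k z by (simp add: N_def)
 have N_int: "(\<integral>\<^sup>+z. ennreal (N k z) \<partial>M) \<le> ennreal (2 * a * (3 * I))" for k
 proof -
  have "(\<integral>\<^sup>+z. ennreal (N k z) \<partial>M) \<le> (\<integral>\<^sub>+z. ennreal (N k z))"
   unfolding M_def by (subst nn_integral_density_indicator[OF \<Omega>b]) (auto intro!: nn_integral_mono split: split_indicator)
  also have "\<dots> \<le> (\<integral>\<^sub>+z. ennreal (2 * a) * (ennreal (g z) + ennreal (B k z)))"
  proof (rule nn_integral_mono_AE)
   show "AE z in lborel. ennreal (N k z) \<le> ennreal (2 * a) * (ennreal (g z) + ennreal (B k z))"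
    using Q_le[of k]
   proof eventually_elim
    case (elim z)
    have "N k z \<le> 2 * a * (g z + B k z)" using elim a g(2)[of z] B0[of k z] by (auto simp: N_def abs_le_iff)
    then show ?case using a g(2) B0 by (simp add: ennreal_leI flip: ennreal_mult ennreal_plus)
   qed
  qed
  also have "\<dots> \<le> ennreal (2 * a) * (ennreal I + ennreal (2 * I))"
   using I order_trans[OF B_le E_bound, of k] by (simp add: nn_integral_cmult nn_integral_add mult_left_mono add_left_mono)
  also have "\<dots> = ennreal (2 * a * (3 * I))" using I(1) a by (simp flip: ennreal_mult ennreal_plus)
  finally show ?thesis .
 qed
 obtain w :: "nat => nat => real" and b h where w: "\<And>j k. w j k \<ge> 0" "\<And>j k. k < j ==> w j k = 0" "\<And>j. (\<Sum>k\<le>b j. w j k) = 1"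
  and h: "h \<in> borel_measurable M" "\<And>z. h z \<ge> 0" "AE z in M. (\<lambda>j. \<Sum>k\<le>b j. w j k * N k z) \<longlonglongrightarrow> h z"
  by (rule convex_combinations_AE_convergent[where N = N, OF finM NM N0 N_int]) (rule that)
 have [measurable]: "h \<in> borel_measurable borel" using h(1) unfolding measurable_cong_sets[OF sM refl] .
 \<comment> \<open>The combinations of the \<open>B k\<close> tend to 0 only in \<open>L\<^sup>1\<close>; clipping turns the limit into a dominated one.\<close>
 define cl where "cl = (\<lambda>z x. max (- (a * g z)) (min (a * g z) x))"
 define P where "P = (\<lambda>j z. \<Sum>k\<le>b j. w j k * Q k z)"
 define Cj where "Cj = (\<lambda>j z. \<Sum>k\<le>b j. w j k * B k z)"
 define D where "D = (\<lambda>z. if z \<in> \<Omega> then cl z (h z - a * g z) else 0)"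
 have [measurable]: "P j \<in> borel_measurable borel" "Cj j \<in> borel_measurable borel" for j
  unfolding P_def Cj_def by measurable
 have [measurable]: "D \<in> borel_measurable borel" unfolding D_def cl_def by measurable
 have ag: "a * g z \<ge> 0" for z using a g(2) by simp
 have cl_le: "\<bar>cl z x\<bar> \<le> a * g z" for z x using ag[of z] by (auto simp: cl_def)
 have D_le: "\<bar>D z\<bar> \<le> a * g z" for z using cl_le ag by (simp add: D_def)
 have P_int: "integrable lborel (P j)" "integrable lborel (Cj j)" for j unfolding P_def Cj_def using Q_int B_int by auto
 have all_Q: "AE z in lborel. \<forall>k. \<bar>Q k z\<bar> \<le> a * (g z + B k z)" by (subst AE_all_countable) (use Q_le in blast)
 have P_le: "AE z in lborel. \<forall>j. \<bar>P j z\<bar> \<le> a * g z + a * Cj j z"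
  using all_Q
 proof (eventually_elim, intro allI)
  fix z j assume q: "\<forall>k. \<bar>Q k z\<bar> \<le> a * (g z + B k z)"
  have "\<bar>P j z\<bar> \<le> (\<Sum>k\<le>b j. w j k * \<bar>Q k z\<bar>)" unfolding P_def using w(1) by (intro order_trans[OF sum_abs]) (simp add: abs_mult)
  also have "\<dots> \<le> (\<Sum>k\<le>b j. w j k * (a * (g z + B k z)))" using w(1) q by (intro sum_mono mult_left_mono) auto
  also have "\<dots> = (\<Sum>k\<le>b j. w j k) * (a * g z) + a * Cj j z"
   by (simp add: Cj_def sum_distrib_left sum_distrib_right sum.distrib[symmetric] algebra_simps)
  finally show "\<bar>P j z\<bar> \<le> a * g z + a * Cj j z" using w(3)[of j] by simp
 qed
 have C_lim: "AE z in lborel. (\<lambda>j. Cj j z) \<longlonglongrightarrow> 0"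
  using B_lim by eventually_elim (simp add: Cj_def tail_combination_tendsto[OF w])
 have P_lim: "AE z\<in>\<Omega> in lborel. (\<lambda>j. P j z) \<longlonglongrightarrow> h z - a * g z"
  using h(3)[unfolded M_def AE_density_indicator[OF \<Omega>b]] C_lim all_Q
 proof (eventually_elim, intro impI)
  fix z assume z: "z \<in> \<Omega>" and 1: "z \<in> \<Omega> --> (\<lambda>j. \<Sum>k\<le>b j. w j k * N k z) \<longlonglongrightarrow> h z" and 2: "(\<lambda>j. Cj j z) \<longlonglongrightarrow> 0"
   and 3: "\<forall>k. \<bar>Q k z\<bar> \<le> a * (g z + B k z)"
  have "N k z = Q k z + a * (g z + B k z)" for k using 3[rule_format, of k] by (simp add: N_def max_def abs_le_iff)
  then have "(\<Sum>k\<le>b j. w j k * N k z) = P j z + (\<Sum>k\<le>b j. w j k) * (a * g z) + a * Cj j z" for j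
   by (simp add: P_def Cj_def sum_distrib_left sum_distrib_right sum.distrib[symmetric] algebra_simps)
  then have "P j z = (\<Sum>k\<le>b j. w j k * N k z) - a * g z - a * Cj j z" for j using w(3)[of j] by simp
  moreover have "(\<lambda>j. (\<Sum>k\<le>b j. w j k * N k z) - a * g z - a * Cj j z) \<longlonglongrightarrow> h z - a * g z - a * 0"
   by (intro tendsto_intros 1[rule_format, OF z] 2)
  ultimately show "(\<lambda>j. P j z) \<longlonglongrightarrow> h z - a * g z" by simp
 qed
 show thesis
 proof (rule that[of D])
  show "D \<in> borel_measurable borel" by measurable
  show "\<bar>D z\<bar> \<le> norm e * g z" for z using D_le by (simp add: a_def)
  show "D z = 0" if "z \<notin> \<Omega>" for z using that by (simp add: D_def)
  fix \<eta> assume \<eta>: "\<eta> \<in> test_functions \<Omega>"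
  have [measurable]: "\<eta> \<in> borel_measurable borel" by (rule test_function_bounded(1)[OF \<eta>])
  obtain S where S: "\<And>z. \<bar>\<eta> z\<bar> \<le> S" using test_function_bounded(2)[OF \<eta>] by blast
  have S0: "S \<ge> 0" using S[of 0] by linarith
  have out: "\<eta> z = 0" if "z \<notin> \<Omega>" for z using test_functionD(3,4)[OF \<eta>] that by blast
  have gS: "integrable lborel (\<lambda>z. a * g z * S)" using g(1) by simp
  have [measurable]: "(\<lambda>z. cl z (P j z)) \<in> borel_measurable borel" for j unfolding cl_def by measurable
  have "(\<lambda>j. \<integral>z. cl z (P j z) * \<eta> z \<partial>lborel) \<longlonglongrightarrow> (\<integral>z. D z * \<eta> z \<partial>lborel)"
  proof (rule integral_dominated_convergence[where w="\<lambda>z. a * g z * S"])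
   show "AE z in lborel. (\<lambda>j. cl z (P j z) * \<eta> z) \<longlonglongrightarrow> D z * \<eta> z"
    using P_lim
   proof eventually_elim
    case (elim z)
    show ?case
    proof (cases "z \<in> \<Omega>")
     case True
     then have "(\<lambda>j. cl z (P j z)) \<longlonglongrightarrow> cl z (h z - a * g z)" unfolding cl_def by (intro tendsto_intros elim[rule_format])
     then show ?thesis using True by (auto simp: D_def intro: tendsto_mult)
    qed (simp add: out)
   qed
   show "AE z in lborel. norm (cl z (P j z) * \<eta> z) \<le> a * g z * S" for j
    using cl_le S ag by (intro AE_I2) (auto simp: abs_mult intro!: mult_mono)
  qed (use gS in auto)
  moreover have "(\<lambda>j. (\<integral>z. P j z * \<eta> z \<partial>lborel) - (\<integral>z. cl z (P j z) * \<eta> z \<partial>lborel)) \<longlonglongrightarrow> 0"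
  proof (rule Lim_null_comparison[OF always_eventually])
   have iP: "integrable lborel (\<lambda>z. P j z * \<eta> z)" for j by (rule integrable_mult_bounded[OF P_int(1) _ S]) measurable
   have icl: "integrable lborel (\<lambda>z. cl z (P j z) * \<eta> z)" for j
   proof (rule Bochner_Integration.integrable_bound[OF gS])
    have "norm (cl z x * \<eta> z) \<le> a * g z * S" for z x
    proof -
     have "\<bar>cl z x\<bar> * \<bar>\<eta> z\<bar> \<le> a * g z * S" by (intro mult_mono cl_le S ag) auto
     then show ?thesis by (simp add: abs_mult)
    qed
    from order_trans[OF this abs_ge_self] show "AE z in lborel. norm (cl z (P j z) * \<eta> z) \<le> norm (a * g z * S)"
     unfolding real_norm_def by (intro AE_I2)
   qed measurable
   show "\<forall>j. norm ((\<integral>z. P j z * \<eta> z \<partial>lborel) - (\<integral>z. cl z (P j z) * \<eta> z \<partial>lborel)) \<le> a * S * (\<Sum>k\<le>b j. w j k * \<beta> k)"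
   proof
    fix j
    have "norm ((\<integral>z. P j z * \<eta> z \<partial>lborel) - (\<integral>z. cl z (P j z) * \<eta> z \<partial>lborel)) = norm (\<integral>z. P j z * \<eta> z - cl z (P j z) * \<eta> z \<partial>lborel)"
     using iP icl by simp
    also have "\<dots> \<le> (\<integral>z. norm (P j z * \<eta> z - cl z (P j z) * \<eta> z) \<partial>lborel)" by (rule integral_norm_bound)
    also have "\<dots> \<le> (\<integral>z. a * S * Cj j z \<partial>lborel)"
    proof (rule integral_mono_AE)
     show "AE z in lborel. norm (P j z * \<eta> z - cl z (P j z) * \<eta> z) \<le> a * S * Cj j z"
      using P_le
     proof eventually_elim
      case (elim z)
      have "\<bar>P j z - cl z (P j z)\<bar> \<le> a * Cj j z"
      proof -
       have "0 \<le> Cj j z" unfolding Cj_def using w(1) B0 by (intro sum_nonneg mult_nonneg_nonneg) auto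
       then have "0 \<le> a * Cj j z" using a by simp
       then show ?thesis
        using elim[rule_format, of j] ag[of z] unfolding cl_def max_def min_def by (auto simp: abs_le_iff algebra_simps)
      qed
      then have "\<bar>P j z - cl z (P j z)\<bar> * \<bar>\<eta> z\<bar> \<le> a * Cj j z * S"
       using S S0 by (intro mult_mono) auto
      moreover have "P j z * \<eta> z - cl z (P j z) * \<eta> z = (P j z - cl z (P j z)) * \<eta> z" by (simp add: algebra_simps)
      ultimately show ?case by (simp add: abs_mult mult_ac)
     qed
    qed (use iP icl P_int(2) in auto)
    also have "\<dots> = a * S * (\<Sum>k\<le>b j. w j k * \<beta> k)"
     using B_int by (simp add: Cj_def \<beta>_def)
    finally show "norm ((\<integral>z. P j z * \<eta> z \<partial>lborel) - (\<integral>z. cl z (P j z) * \<eta> z \<partial>lborel)) \<le> a * S * (\<Sum>k\<le>b j. w j k * \<beta> k)" .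
   qed
   show "(\<lambda>j. a * S * (\<Sum>k\<le>b j. w j k * \<beta> k)) \<longlonglongrightarrow> 0"
    using tendsto_mult[OF tendsto_const[of "a * S"] tail_combination_tendsto[OF w \<beta>]] by simp
  qed
  ultimately have "(\<lambda>j. \<integral>z. P j z * \<eta> z \<partial>lborel) \<longlonglongrightarrow> (\<integral>z. D z * \<eta> z \<partial>lborel)"
   using tendsto_add by fastforce
  moreover have "(\<integral>z. P j z * \<eta> z \<partial>lborel) = (\<Sum>k\<le>b j. w j k * (\<integral>z. Q k z * \<eta> z \<partial>lborel))" for j
  proof -
   have "integrable lborel (\<lambda>z. Q k z * \<eta> z)" for k by (rule integrable_mult_bounded[OF Q_int _ S]) measurable
   then show ?thesis by (simp add: P_def sum_distrib_right mult.assoc)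
  qed
  moreover have "(\<lambda>j. \<Sum>k\<le>b j. w j k * (\<integral>z. Q k z * \<eta> z \<partial>lborel)) \<longlonglongrightarrow> - (\<integral>z. f z * (\<Sum>i\<in>UNIV. e $ i * partial_deriv i \<eta> z) \<partial>lborel)"
   unfolding Q_def by (rule tail_combination_tendsto[OF w difference_quotient_pairing_tendsto[OF \<Omega>(1) f \<eta> s]])
  ultimately show "(\<integral>z. D z * \<eta> z \<partial>lborel) = - (\<integral>z. f z * (\<Sum>i\<in>UNIV. e $ i * partial_deriv i \<eta> z) \<partial>lborel)"
   by (simp only:) (rule LIMSEQ_unique)
 qed
qed

text \<open>Mollifiers centred at points of \<open>\<Omega>\<close> are test functions for small radii, so the
 mollifications of \<open>F\<close> vanish near each point of \<open>\<Omega>\<close>.\<close>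
lemma test_pairing_zero_imp_AE_zero:
 fixes F :: "real^'n::finite => real"
 assumes \<Omega>: "open \<Omega>" and F: "integrable lborel F" and zero: "\<And>\<eta>. \<eta> \<in> test_functions \<Omega> ==> (\<integral>z. F z * \<eta> z \<partial>lborel) = 0"
 shows "AE z\<in>\<Omega> in lborel. F z = 0"
proof -
 have [measurable]: "F \<in> borel_measurable borel" using F by auto
 note [measurable] = mollify_measurable[OF F]
 define r where "r = (\<lambda>n. 1 / (real n + 1))"
 have r: "\<And>n. r n > 0" "r \<longlonglongrightarrow> 0"
  using LIMSEQ_inverse_real_of_nat by (auto simp: r_def inverse_eq_divide add.commute)
 obtain k :: "nat => nat" where k: "strict_mono k" "AE z in lborel. (\<lambda>n. ennreal \<bar>mollify (r (k n)) F z - F z\<bar>) \<longlonglongrightarrow> 0"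
 proof (rule nn_integral_tendsto_0_AE_subseq[OF _ mollify_L1_tendsto[OF F r]])
  show "(\<lambda>z. ennreal \<bar>mollify (r n) F z - F z\<bar>) \<in> borel_measurable lborel" for n by measurable
 qed (rule that)
 have rk: "(\<lambda>n. r (k n)) \<longlonglongrightarrow> 0" using LIMSEQ_subseq_LIMSEQ[OF r(2) k(1)] by (simp add: o_def)
 show ?thesis
  using k(2)
 proof (eventually_elim, intro impI)
  fix z assume l: "(\<lambda>n. ennreal \<bar>mollify (r (k n)) F z - F z\<bar>) \<longlonglongrightarrow> 0" and z: "z \<in> \<Omega>"
  obtain \<rho> where \<rho>: "\<rho> > 0" "cball z \<rho> \<subseteq> \<Omega>" using \<Omega> z by (auto simp: open_contains_cball)
  have "eventually (\<lambda>n. ennreal \<bar>mollify (r (k n)) F z - F z\<bar> = ennreal \<bar>F z\<bar>) sequentially"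
   using order_tendstoD(2)[OF rk \<rho>(1)]
  proof eventually_elim
   case (elim n)
   then have "cball z (r (k n)) \<subseteq> \<Omega>" using subset_cball[of "r (k n)" \<rho> z] \<rho>(2) by auto
   from zero[OF mollifier_test_function[OF r(1) this]] show ?case by (simp add: mollify_def)
  qed
  then have "(\<lambda>n. ennreal \<bar>mollify (r (k n)) F z - F z\<bar>) \<longlonglongrightarrow> ennreal \<bar>F z\<bar>" by (rule tendsto_eventually)
  from LIMSEQ_unique[OF this l] show "F z = 0" by simp
 qed
qed

text \<open>The gradient is assembled from the directional derivatives along the axes. Uniqueness makes the
 directional derivative linear in the direction almost everywhere, so the bound \<open>\<bar>G z \<bullet>
 e\<bar> \<le> norm e * g z\<close> holds for a countable dense set of \<open>e\<close> at once, and \<open>e =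
 G z\<close> gives the norm.\<close>
lemma segment_bound_imp_weak_gradient:
 fixes f f0 g :: "real^'n::finite => real"
 assumes \<Omega>: "open \<Omega>" "bounded \<Omega>" and f: "integrable lborel f" and f0: "f0 \<in> borel_measurable (lebesgue_on \<Omega>)"
  and ae: "AE z\<in>\<Omega> in lborel. f z = f0 z" and g: "integrable lborel g" "\<And>z. g z \<ge> 0"
  and sb: "segment_bound \<Omega> euclidean_metric f g"
 obtains G where "G \<in> borel_measurable borel" "weak_gradient \<Omega> f0 G" "AE z\<in>\<Omega> in lborel. norm (G z) \<le> g z"
proof -
 have \<Omega>b[measurable]: "\<Omega> \<in> sets borel" using \<Omega> by auto
 define PD where "PD = (\<lambda>e D. D \<in> borel_measurable borel \<and> (\<forall>z. \<bar>D z\<bar> \<le> norm e * g z) \<and> (\<forall>z. z \<notin> \<Omega> --> D z = 0) \<and>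
   (\<forall>\<eta>\<in>test_functions \<Omega>. (\<integral>z. D z * \<eta> z \<partial>lborel) = - (\<integral>z. f z * (\<Sum>i\<in>UNIV. e $ i * partial_deriv i \<eta> z) \<partial>lborel)))"
 have "\<exists>D. PD e D" for e
  unfolding PD_def by (rule directional_weak_derivative[OF \<Omega> f g sb, of e]) blast
 then obtain D where "\<And>e. PD e (D e)" by metis
 then have D: "\<And>e. D e \<in> borel_measurable borel" "\<And>e z. \<bar>D e z\<bar> \<le> norm e * g z" "\<And>e z. z \<notin> \<Omega> ==> D e z = 0"
   "\<And>e \<eta>. \<eta> \<in> test_functions \<Omega> ==> (\<integral>z. D e z * \<eta> z \<partial>lborel) = - (\<integral>z. f z * (\<Sum>i\<in>UNIV. e $ i * partial_deriv i \<eta> z) \<partial>lborel)"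
  unfolding PD_def by blast+
 note [measurable] = D(1)
 have D_int: "integrable lborel (D e)" for e
  by (rule Bochner_Integration.integrable_bound[of _ "\<lambda>z. norm e * g z"]) (use g D(2) in \<open>auto intro!: AE_I2 order_trans[OF D(2) abs_ge_self]\<close>)
 define G where "G = (\<lambda>z. \<chi> i. D (axis i 1) z)"
 have G_int: "integrable lborel G"
 proof -
  have "integrable lborel (\<lambda>z. \<Sum>i\<in>UNIV. D (axis i 1) z *\<^sub>R axis i (1::real))" using D_int by auto
  moreover have "(\<Sum>i\<in>UNIV. D (axis i 1) z *\<^sub>R axis i (1::real)) = G z" for z
   using basis_expansion[of "G z"] by (simp add: G_def scalar_mult_eq_scaleR)
  ultimately show ?thesis by simp
 qed
 have inner: "AE z\<in>\<Omega> in lborel. G z \<bullet> e = D e z" for e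
 proof -
  have Ge: "G z \<bullet> e = (\<Sum>i\<in>UNIV. e $ i * D (axis i 1) z)" for z by (simp add: inner_vec_def G_def mult.commute)
  have "AE z\<in>\<Omega> in lborel. G z \<bullet> e - D e z = 0"
  proof (rule test_pairing_zero_imp_AE_zero[OF \<Omega>(1)])
   show "integrable lborel (\<lambda>z. G z \<bullet> e - D e z)" unfolding Ge
    by (intro Bochner_Integration.integrable_diff Bochner_Integration.integrable_sum integrable_mult_right D_int)
   fix \<eta> assume \<eta>: "\<eta> \<in> test_functions \<Omega>"
   have [measurable]: "\<eta> \<in> borel_measurable borel" by (rule test_function_bounded(1)[OF \<eta>])
   obtain S where S: "\<And>z. \<bar>\<eta> z\<bar> \<le> S" using test_function_bounded(2)[OF \<eta>] by blast
   have i1: "integrable lborel (\<lambda>z. D e z * \<eta> z)" for e by (rule integrable_mult_bounded[OF D_int _ S]) measurable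
   have i2: "integrable lborel (\<lambda>z. f z * partial_deriv i \<eta> z)" for i
   proof -
    obtain B where "\<And>z. \<bar>partial_deriv i \<eta> z\<bar> \<le> B"
     using partial_deriv_bounded[OF test_functionD(1,2,4)[OF \<eta>]] by blast
    moreover have "partial_deriv i \<eta> \<in> borel_measurable borel"
     using test_functionD(1)[OF \<eta>, of "Suc 0"] by (intro borel_measurable_continuous_onI) auto
    ultimately show ?thesis by (intro integrable_mult_bounded[OF f]) auto
   qed
   have Daxis: "(\<integral>z. D (axis i 1) z * \<eta> z \<partial>lborel) = - (\<integral>z. f z * partial_deriv i \<eta> z \<partial>lborel)" for i
   proof -
    have "(\<Sum>j\<in>UNIV. axis i 1 $ j * partial_deriv j \<eta> z) = partial_deriv i \<eta> z" for z
     by (simp add: axis_def if_distrib[of "\<lambda>x. x * _"] cong: if_cong)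
    then show ?thesis using D(4)[OF \<eta>, of "axis i 1"] by simp
   qed
   have "(\<integral>z. (G z \<bullet> e - D e z) * \<eta> z \<partial>lborel) = (\<integral>z. (\<Sum>i\<in>UNIV. e $ i * (D (axis i 1) z * \<eta> z)) - D e z * \<eta> z \<partial>lborel)"
    unfolding Ge by (simp add: left_diff_distrib sum_distrib_right mult.assoc)
   also have "\<dots> = (\<Sum>i\<in>UNIV. e $ i * (\<integral>z. D (axis i 1) z * \<eta> z \<partial>lborel)) - (\<integral>z. D e z * \<eta> z \<partial>lborel)"
    using i1 by simp
   also have "(\<integral>z. D e z * \<eta> z \<partial>lborel) = - (\<Sum>i\<in>UNIV. e $ i * (\<integral>z. f z * partial_deriv i \<eta> z \<partial>lborel))"
   proof -
    have "(\<integral>z. f z * (\<Sum>i\<in>UNIV. e $ i * partial_deriv i \<eta> z) \<partial>lborel) = (\<integral>z. (\<Sum>i\<in>UNIV. e $ i * (f z * partial_deriv i \<eta> z)) \<partial>lborel)"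
     by (intro Bochner_Integration.integral_cong refl) (simp add: sum_distrib_left mult_ac)
    then show ?thesis using D(4)[OF \<eta>, of e] i2 by simp
   qed
   finally show "(\<integral>z. (G z \<bullet> e - D e z) * \<eta> z \<partial>lborel) = 0" by (simp add: Daxis sum_negf)
  qed
  then show ?thesis by simp
 qed
 obtain Q :: "(real^'n) set" where Q: "countable Q" "\<And>X. open X ==> X \<noteq> {} ==> \<exists>d\<in>Q. d \<in> X"
  by (rule countable_dense_setE) (rule that)
 have "AE z in lborel. \<forall>e\<in>Q. z \<in> \<Omega> --> G z \<bullet> e = D e z"
  using inner by (intro AE_ball_countable[THEN iffD2] Q) auto
 then have Gg: "AE z\<in>\<Omega> in lborel. norm (G z) \<le> g z"
 proof (eventually_elim, intro impI)
  fix z assume e: "\<forall>e\<in>Q. z \<in> \<Omega> --> G z \<bullet> e = D e z" and z: "z \<in> \<Omega>"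
  have "closure Q = UNIV"
  proof -
   have "x \<in> closure Q" for x
    unfolding closure_iff_nhds_not_empty by (metis Q(2) disjoint_iff interior_subset open_interior subsetD empty_iff interior_maximal)
   then show ?thesis by auto
  qed
  moreover have "closed {e. \<bar>G z \<bullet> e\<bar> \<le> norm e * g z}" by (intro closed_Collect_le continuous_intros)
  moreover have "Q \<subseteq> {e. \<bar>G z \<bullet> e\<bar> \<le> norm e * g z}" using e z D(2)[of _ z] by auto
  ultimately have "\<bar>G z \<bullet> G z\<bar> \<le> norm (G z) * g z"
   using closure_minimal[of Q "{e. \<bar>G z \<bullet> e\<bar> \<le> norm e * g z}"] by (auto dest: subsetD[of UNIV _ "G z"])
  then have "norm (G z) * norm (G z) \<le> norm (G z) * g z"
   by (simp add: power2_norm_eq_inner flip: power2_eq_square)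
  then show "norm (G z) \<le> g z" using g(2)[of z] by (cases "G z = 0") auto
 qed
 have "weak_gradient \<Omega> f0 G"
  unfolding weak_gradient_def
 proof (intro conjI allI impI ballI)
  fix K assume K: "compact K \<and> K \<subseteq> \<Omega>"
  have Kb[measurable]: "K \<in> sets borel" using K by (auto intro: borel_compact)
  have ind: "(\<lambda>z. indicator K z *\<^sub>R f0 z) \<in> borel_measurable lebesgue"
  proof -
   have "(\<lambda>z. if z \<in> \<Omega> then f0 z else 0) \<in> borel_measurable lebesgue" using f0 \<Omega>b by (subst borel_measurable_if) auto
   then have "(\<lambda>z. indicator K z *\<^sub>R (if z \<in> \<Omega> then f0 z else 0)) \<in> borel_measurable lebesgue"
    using Kb by (intro borel_measurable_scaleR[OF measurable_completion[OF borel_measurable_indicator[of K lborel]]]) auto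
   moreover have "indicator K z *\<^sub>R (if z \<in> \<Omega> then f0 z else 0) = indicator K z *\<^sub>R f0 z" for z
    using K by (auto simp: indicator_def)
   ultimately show ?thesis by (simp only:)
  qed
  have fK: "integrable lborel (\<lambda>z. indicator K z *\<^sub>R f z)" using integrable_mult_indicator[of K lborel f] f by auto
  then have "integrable lebesgue (\<lambda>z. indicator K z *\<^sub>R f z)" by (subst integrable_completion) auto
  then show "f0 absolutely_integrable_on K"
   unfolding set_integrable_def
  proof (rule integrable_cong_AE_imp[OF _ ind])
   have "AE z in lborel. indicator K z *\<^sub>R f z = indicator K z *\<^sub>R f0 z"
    using ae by eventually_elim (use K in \<open>auto simp: indicator_def\<close>)
   then show "AE z in lebesgue. indicator K z *\<^sub>R f z = indicator K z *\<^sub>R f0 z" by (simp add: AE_completion_iff)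
  qed
  have "integrable lborel (\<lambda>z. indicator K z *\<^sub>R G z)" using integrable_mult_indicator[of K lborel G] G_int by auto
  then show "G absolutely_integrable_on K" unfolding set_integrable_def by (subst integrable_completion) auto
 next
  fix \<eta> i assume \<eta>: "\<eta> \<in> test_functions \<Omega>"
  have [measurable]: "\<eta> \<in> borel_measurable borel" by (rule test_function_bounded(1)[OF \<eta>])
  have pm[measurable]: "partial_deriv i \<eta> \<in> borel_measurable borel"
   using test_functionD(1)[OF \<eta>, of "Suc 0"] by (intro borel_measurable_continuous_onI) auto
  have out: "partial_deriv i \<eta> z = 0" "\<eta> z = 0" if "z \<notin> \<Omega>" for z
  proof -
   have z: "z \<notin> closure {z. \<eta> z \<noteq> 0}" using test_functionD(3)[OF \<eta>] that by blast
   show "partial_deriv i \<eta> z = 0" by (rule partial_deriv_eq_0_outside[OF closed_closure test_functionD(4)[OF \<eta>] z])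
   show "\<eta> z = 0" by (rule test_functionD(4)[OF \<eta> z])
  qed
  have fm: "f \<in> borel_measurable borel" using f by auto
  have mc: "h \<in> borel_measurable (lebesgue_on \<Omega>)" if "h \<in> borel_measurable borel" for h :: "real^'n => real"
   using that by (intro measurable_restrict_space1 measurable_completion) simp
  have "(LINT z|lebesgue_on \<Omega>. f0 z * partial_deriv i \<eta> z) = (LINT z|lebesgue_on \<Omega>. f z * partial_deriv i \<eta> z)"
  proof (rule integral_cong_AE)
   show "(\<lambda>z. f0 z * partial_deriv i \<eta> z) \<in> borel_measurable (lebesgue_on \<Omega>)"
    by (rule borel_measurable_times[OF f0 mc[OF pm]])
   show "(\<lambda>z. f z * partial_deriv i \<eta> z) \<in> borel_measurable (lebesgue_on \<Omega>)"
    by (rule borel_measurable_times[OF mc[OF fm] mc[OF pm]])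
   show "AE z in lebesgue_on \<Omega>. f0 z * partial_deriv i \<eta> z = f z * partial_deriv i \<eta> z"
    unfolding AE_lebesgue_on_iff[OF \<Omega>b] using ae by eventually_elim auto
  qed
  also have "\<dots> = (\<integral>z. f z * partial_deriv i \<eta> z \<partial>lebesgue)"
   using \<Omega>b out by (subst integral_restrict_space) (auto intro!: Bochner_Integration.integral_cong simp: indicator_def)
  also have "\<dots> = (\<integral>z. f z * partial_deriv i \<eta> z \<partial>lborel)" using fm by (intro integral_completion) auto
  also have "\<dots> = - (\<integral>z. G z $ i * \<eta> z \<partial>lborel)"
  proof -
   have "(\<Sum>j\<in>UNIV. axis i 1 $ j * partial_deriv j \<eta> z) = partial_deriv i \<eta> z" for z
    by (simp add: axis_def if_distrib[of "\<lambda>x. x * _"] cong: if_cong)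
   then show ?thesis using D(4)[OF \<eta>, of "axis i 1"] by (simp add: G_def)
  qed
  also have "(\<integral>z. G z $ i * \<eta> z \<partial>lborel) = (\<integral>z. G z $ i * \<eta> z \<partial>lebesgue)" unfolding G_def by (intro integral_completion[symmetric]) auto
  also have "\<dots> = (LINT z|lebesgue_on \<Omega>. G z $ i * \<eta> z)"
   using \<Omega>b out by (subst integral_restrict_space) (auto intro!: Bochner_Integration.integral_cong simp: indicator_def)
  finally show "(LINT z|lebesgue_on \<Omega>. f0 z * partial_deriv i \<eta> z) = - (LINT z|lebesgue_on \<Omega>. G z $ i * \<eta> z)" .
 qed
 with Gg G_int show thesis by (intro that[of G]) auto
qed

section \<open>Subcritical Sobolev inequality on convex sets\<close>

lemma nn_integral_powr_unit_interval:
 fixes a :: real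
 assumes a: "a > 0"
 shows "(\<integral>\<^sub>+t. ennreal (t powr (a - 1)) * indicator {0<..1} t) \<le> ennreal (1 / a)"
proof -
 have "((\<lambda>t. t powr (a - 1)) has_integral (1 powr (a - 1 + 1) / (a - 1 + 1))) {0..1}"
  using a by (intro has_integral_powr_from_0) auto
 then have "(\<integral>\<^sub>+t. ennreal (indicat_real {0..1} t * t powr (a - 1))) = ennreal (1 / a)"
  using a nn_integral_has_integral_lebesgue[where f = "\<lambda>t. t powr (a - 1)" and I = "1 / a" and \<Omega> = "{0..1}"] by simp
 moreover have "(\<integral>\<^sub>+t. ennreal (t powr (a - 1)) * indicator {0<..1} t) \<le> (\<integral>\<^sub>+t. ennreal (indicat_real {0..1} t * t powr (a - 1)))"
  by (intro nn_integral_mono) (auto simp: indicator_def)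
 ultimately show ?thesis by simp
qed

lemma powr_sum_le:
 fixes x y q :: real
 assumes "x \<ge> 0" "y \<ge> 0" "q \<ge> 0"
 shows "(x + y) powr q \<le> 2 powr q * (x powr q + y powr q)"
proof -
 have "(x + y) powr q \<le> (2 * max x y) powr q" using assms by (intro powr_mono2) auto
 also have "\<dots> = 2 powr q * max x y powr q" using assms by (simp add: powr_mult)
 also have "\<dots> \<le> 2 powr q * (x powr q + y powr q)"
  by (intro mult_left_mono) (auto simp: max_def)
 finally show ?thesis .
qed

lemma nn_integral_lborel_affine_inverse:
 fixes f :: "'a::euclidean_space => ennreal"
 assumes [measurable]: "f \<in> borel_measurable borel" and c: "c \<noteq> 0"
 shows "(\<integral>\<^sub>+x. f (t + c *\<^sub>R x)) = ennreal (1 / \<bar>c\<bar> ^ DIM('a)) * (\<integral>\<^sub>+x. f x)"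
 unfolding nn_integral_lborel_affine[OF assms, of t]
 using c by (simp add: ennreal_mult[symmetric] mult.assoc[symmetric])

text \<open>Average the increment bound over the endpoint \<open>w'\<close>. It remains to bound
 \<open>\<integral> k\<^sub>t(w) dt\<close> in \<open>L\<^sup>q\<close>, where \<open>k\<^sub>t(w)\<close>
 integrates \<open>G ((1 - t) w + t w')\<close> over \<open>w'\<close>. Hoelder's inequality and the
 substitution in \<open>w'\<close> bound \<open>k\<^sub>t\<close> by a multiple of
 \<open>t\<^sup>-\<^sup>n\<^sup>/\<^sup>p\<close> uniformly in \<open>w\<close>, while its norm in
 \<open>L\<^sup>p\<close> is bounded uniformly in \<open>t\<close>; hence the integral of
 \<open>k\<^sub>t\<^sup>q\<close> grows at most like
 \<open>t\<^sup>-\<^sup>n\<^sup>(\<^sup>q\<^sup>/\<^sup>p\<^sup>-\<^sup>1\<^sup>)\<close>. A positive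
 \<open>e\<close> says that this singularity is integrable after Hoelder's inequality in \<open>t\<close>, and
 some \<open>\<beta>\<close> achieves it iff \<open>q\<close> is below the Sobolev conjugate. The constant
 depends on \<open>B\<close> only through bounds for its measure, so it serves for all sets of an
 exhaustion.\<close>
lemma Sobolev_bound_of_segment_bound:
 fixes F G :: "'a::euclidean_space => real" and B :: "'a set"
 assumes B[measurable]: "B \<in> sets borel"
  and b: "0 < b0" "ennreal b0 \<le> emeasure lborel B" "emeasure lborel B \<le> ennreal b1" "0 < b1"
  and F[measurable]: "F \<in> borel_measurable borel" and F0: "\<And>w. F w \<ge> 0"
  and G[measurable]: "G \<in> borel_measurable borel" and G0: "\<And>w. G w \<ge> 0"
  and inc: "\<And>w w'. w \<in> B ==> w' \<in> B ==>
   ennreal (F w) \<le> ennreal (F w') + ennreal \<Lambda> * segment_integral G w (w' - w)"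
  and \<Lambda>: "\<Lambda> \<ge> 0" and S: "S \<ge> 0" "(\<integral>\<^sub>+w. ennreal (F w) * indicator B w) \<le> ennreal S"
  and I: "I \<ge> 0" "(\<integral>\<^sub>+w. ennreal (G w powr p)) \<le> ennreal I"
  and p: "p \<ge> 1" and q: "q \<ge> p" and \<beta>: "\<beta> > 0"
  and e: "e = (1 - \<beta>) * q + \<beta> - DIM('a) * (q / p - 1)" "e > 0"
 shows "(\<integral>\<^sub>+w. ennreal (F w powr q) * indicator B w) \<le> ennreal (2 powr q * ((S / b0) powr q * b1 +
  (\<Lambda> * (2 * (1 / \<beta>) powr (1 - 1 / q)) / b0) powr q *
  ((2 * b1 powr (1 - 1 / p)) powr q * I powr (q / p - 1) * (2 ^ DIM('a) * b1 * I) / e)))"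
proof -
 define n where "n = DIM('a)"
 define k0 where "k0 = (\<lambda>t w. \<integral>\<^sub>+w'. ennreal (G (w + t *\<^sub>R (w' - w))) * indicator B w')"
 define j where "j = (\<lambda>t w. \<integral>\<^sub>+w'. ennreal (G (w + t *\<^sub>R (w' - w)) powr p) * indicator B w')"
 have [measurable]: "(\<lambda>x. k0 (fst x) (snd x)) \<in> borel_measurable (borel \<Otimes>\<^sub>M borel)" unfolding k0_def by measurable
 have [measurable]: "(\<lambda>x. j (fst x) (snd x)) \<in> borel_measurable (borel \<Otimes>\<^sub>M borel)" unfolding j_def by measurable
 have jm[measurable]: "(\<lambda>x. j (f x) (h x)) \<in> borel_measurable M" if "f \<in> borel_measurable M" "h \<in> borel_measurable M" for f h and M :: "'b measure"
  using measurable_compose[OF measurable_Pair[OF that], of "\<lambda>x. j (fst x) (snd x)" borel] by simp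
 have km[measurable]: "(\<lambda>x. k0 (f x) (h x)) \<in> borel_measurable M" if "f \<in> borel_measurable M" "h \<in> borel_measurable M" for f h and M :: "'b measure"
  using measurable_compose[OF measurable_Pair[OF that], of "\<lambda>x. k0 (fst x) (snd x)" borel] by simp
 have Gp: "(\<integral>\<^sub>+w. ennreal (G (t + c *\<^sub>R w) powr p)) \<le> ennreal (1 / \<bar>c\<bar> ^ n * I)" if "c \<noteq> 0" for t c
 proof -
  have "(\<integral>\<^sub>+w. ennreal (G (t + c *\<^sub>R w) powr p)) = ennreal (1 / \<bar>c\<bar> ^ n) * (\<integral>\<^sub>+w. ennreal (G w powr p))"
   using that unfolding n_def by (intro nn_integral_lborel_affine_inverse) auto
  also have "\<dots> \<le> ennreal (1 / \<bar>c\<bar> ^ n) * ennreal I" using I by (intro mult_left_mono) auto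
  finally show ?thesis using I by (simp only: ennreal_mult[symmetric] divide_nonneg_nonneg zero_le_power abs_ge_zero zero_le_one)
 qed
 have j_le: "j t w \<le> ennreal (1 / t ^ n * I)" if "t \<in> {0<..1}" for t w
 proof -
  have "j t w \<le> (\<integral>\<^sub>+w'. ennreal (G ((w - t *\<^sub>R w) + t *\<^sub>R w') powr p))"
   unfolding j_def by (intro nn_integral_mono) (auto simp: indicator_def algebra_simps)
  also have "\<dots> \<le> ennreal (1 / \<bar>t\<bar> ^ n * I)" using that by (intro Gp) auto
  finally show ?thesis using that by simp
 qed
 have half: "1 / s ^ n \<le> 2 ^ n" if "s \<ge> 1/2" for s :: real
  using power_mono[of "1/s" 2 n] that by (simp add: power_one_over divide_simps mult.commute)
 have j_int: "(\<integral>\<^sub>+w. j t w * indicator B w) \<le> ennreal (2 ^ n * b1 * I)" if t: "t \<in> {0<..1}" for t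
 proof -
  have C: "(\<integral>\<^sub>+w. h w * indicator B w) \<le> ennreal (2 ^ n * b1 * I)" if "\<And>w. h w \<le> ennreal (2 ^ n * I)" for h :: "'a => ennreal"
  proof -
   have "(\<integral>\<^sub>+w. h w * indicator B w) \<le> (\<integral>\<^sub>+w. ennreal (2 ^ n * I) * indicator B w)"
    using that by (intro nn_integral_mono mult_right_mono) auto
   also have "\<dots> = ennreal (2 ^ n * I) * emeasure lborel B" by (subst nn_integral_cmult_indicator) auto
   also have "\<dots> \<le> ennreal (2 ^ n * I) * ennreal b1" using b by (intro mult_left_mono) auto
   finally show ?thesis using I b by (simp add: ennreal_mult[symmetric] mult_ac)
  qed
  \<comment> \<open>The substitution in \<open>w'\<close> costs \<open>t\<^sup>-\<^sup>n\<close>, the one in \<open>w\<close> costs \<open>(1 - t)\<^sup>-\<^sup>n\<close>; one of them is at most \<open>2\<^sup>n\<close>.\<close>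
  show ?thesis
  proof (cases "t \<ge> 1/2")
   case True
   have "j t w \<le> ennreal (2 ^ n * I)" for w
    using order_trans[OF j_le[OF t, of w] ennreal_leI] half[OF True] I by (meson mult_right_mono)
   then show ?thesis by (rule C)
  next
   case False
   have "(\<integral>\<^sub>+w. j t w * indicator B w) =
     (\<integral>\<^sub>+w. (\<integral>\<^sub>+w'. ennreal (G (w + t *\<^sub>R (w' - w)) powr p) * indicator B w' * indicator B w))"
    unfolding j_def by (intro nn_integral_cong nn_integral_multc[symmetric]) measurable
   also have "\<dots> = (\<integral>\<^sub>+w'. (\<integral>\<^sub>+w. ennreal (G (w + t *\<^sub>R (w' - w)) powr p) * indicator B w' * indicator B w))"
    by (rule lborel_pair.Fubini') measurable
   also have "\<dots> \<le> (\<integral>\<^sub>+w'. (\<integral>\<^sub>+w. ennreal (G (t *\<^sub>R w' + (1 - t) *\<^sub>R w) powr p)) * indicator B w')"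
   proof (rule nn_integral_mono)
    fix w'
    have "(\<integral>\<^sub>+w. ennreal (G (w + t *\<^sub>R (w' - w)) powr p) * indicator B w' * indicator B w)
     \<le> (\<integral>\<^sub>+w. ennreal (G (t *\<^sub>R w' + (1 - t) *\<^sub>R w) powr p) * indicator B w')"
     by (intro nn_integral_mono) (auto simp: indicator_def algebra_simps)
    then show "(\<integral>\<^sub>+w. ennreal (G (w + t *\<^sub>R (w' - w)) powr p) * indicator B w' * indicator B w)
     \<le> (\<integral>\<^sub>+w. ennreal (G (t *\<^sub>R w' + (1 - t) *\<^sub>R w) powr p)) * indicator B w'"
     by (subst (asm) nn_integral_multc) auto
   qed
   also have "\<dots> \<le> ennreal (2 ^ n * b1 * I)"
   proof (rule C)
    fix w'
    have "(\<integral>\<^sub>+w. ennreal (G (t *\<^sub>R w' + (1 - t) *\<^sub>R w) powr p)) \<le> ennreal (1 / \<bar>1 - t\<bar> ^ n * I)"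
     using False by (intro Gp) auto
    also have "\<dots> \<le> ennreal (2 ^ n * I)" using half[of "\<bar>1 - t\<bar>"] False I by (intro ennreal_leI mult_right_mono) auto
    finally show "(\<integral>\<^sub>+w. ennreal (G (t *\<^sub>R w' + (1 - t) *\<^sub>R w) powr p)) \<le> ennreal (2 ^ n * I)" .
   qed
   finally show ?thesis .
  qed
 qed
 define c where "c = 2 * b1 powr (1 - 1 / p)"
 have c: "c \<ge> 0" by (simp add: c_def)
 define K where "K = (\<lambda>t w. c * enn2real (j t w) powr (1 / p))"
 have [measurable]: "(\<lambda>x. K (f x) (h x)) \<in> borel_measurable M" if "f \<in> borel_measurable M" "h \<in> borel_measurable M" for f h and M :: "'b measure"
  unfolding K_def using jm[OF that] by measurable
 have j_fin: "j t w = ennreal (enn2real (j t w))" if "t \<in> {0<..1}" for t w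
  using le_less_trans[OF j_le[OF that, of w] ennreal_less_top] by simp
 have k0_le: "k0 t w \<le> ennreal (K t w)" if t: "t \<in> {0<..1}" for t w
 proof -
  let ?M = "density lborel (indicator B) :: 'a measure"
  have "(\<integral>\<^sup>+w'. ennreal (G (w + t *\<^sub>R (w' - w))) \<partial>?M) \<le> ennreal (2 * b1 powr (1 - 1/p) * enn2real (j t w) powr (1/p))"
  proof (rule nn_integral_Holder_bound[OF _ _ _ b(4) p])
   show "emeasure ?M (space ?M) \<le> ennreal b1" using b by (simp add: emeasure_density)
   show "(\<integral>\<^sup>+w'. ennreal (G (w + t *\<^sub>R (w' - w)) powr p) \<partial>?M) \<le> ennreal (enn2real (j t w))"
    using j_fin[OF t, of w] by (subst nn_integral_density_indicator) (auto simp: j_def)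
  qed (use G0 in auto)
  then show ?thesis
   by (subst (asm) nn_integral_density_indicator) (auto simp: k0_def K_def c_def)
 qed
 \<comment> \<open>A finite measure that gives more weight to small \<open>t\<close>; against it the integrand carries the factor \<open>t\<^sup>1\<^sup>-\<^sup>\<beta>\<close>, which damps the singularity at 0.\<close>
 define \<mu> where "\<mu> = density lborel (\<lambda>t::real. ennreal (t powr (\<beta> - 1)) * indicator {0<..1} t)"
 have [measurable_cong]: "sets \<mu> = sets borel" by (simp add: \<mu>_def)
 define J where "J = (\<lambda>w. \<integral>\<^sup>+t. ennreal ((K t w * t powr (1 - \<beta>)) powr q) \<partial>\<mu>)"
 define A where "A = c powr q * I powr (q / p - 1)"
 have A: "A \<ge> 0" by (simp add: A_def)
 have Kq: "(K t w * t powr (1 - \<beta>)) powr q * t powr (\<beta> - 1) \<le> A * t powr (e - 1) * enn2real (j t w)" if t: "t \<in> {0<..1}" for t w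
 proof -
  define x where "x = enn2real (j t w)"
  have x: "0 \<le> x" "x \<le> 1 / t ^ n * I"
   using j_le[OF t, of w] t I unfolding x_def by (auto intro: enn2real_leI)
  have "x powr (q / p) = x powr (q / p - 1) * x"
   using x p q by (cases "x = 0") (auto simp: powr_diff)
  also have "\<dots> \<le> (1 / t ^ n * I) powr (q / p - 1) * x"
   using x p q by (intro mult_right_mono powr_mono2) (auto simp: divide_simps)
  also have "(1 / t ^ n * I) powr (q / p - 1) = (t powr (- real n)) powr (q / p - 1) * I powr (q / p - 1)"
   using t I by (subst powr_mult) (auto simp: powr_minus powr_realpow divide_inverse)
  also have "(t powr (- real n)) powr (q / p - 1) = t powr (- real n * (q / p - 1))" by (simp add: powr_powr)
  finally have X: "x powr (q / p) \<le> t powr (- real n * (q / p - 1)) * I powr (q / p - 1) * x" .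
  have "(K t w * t powr (1 - \<beta>)) powr q * t powr (\<beta> - 1) = c powr q * x powr (q / p) * t powr ((1 - \<beta>) * q + (\<beta> - 1))"
   using c x t p unfolding K_def x_def[symmetric] by (simp add: powr_mult powr_powr powr_add)
  also have "\<dots> \<le> c powr q * (t powr (- real n * (q / p - 1)) * I powr (q / p - 1) * x) * t powr ((1 - \<beta>) * q + (\<beta> - 1))"
   using X by (intro mult_right_mono mult_left_mono) auto
  also have "\<dots> = A * (t powr (- real n * (q / p - 1)) * t powr ((1 - \<beta>) * q + (\<beta> - 1))) * x" by (simp add: A_def mult_ac)
  also have "t powr (- real n * (q / p - 1)) * t powr ((1 - \<beta>) * q + (\<beta> - 1)) = t powr (e - 1)"
   by (simp add: powr_add[symmetric] e n_def algebra_simps)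
  finally show ?thesis by (simp add: x_def)
 qed
 have \<mu>_space: "emeasure \<mu> (space \<mu>) \<le> ennreal (1 / \<beta>)"
  using nn_integral_powr_unit_interval[OF \<beta>] by (simp add: \<mu>_def emeasure_density)
 have Jm[measurable]: "J \<in> borel_measurable borel"
 proof -
  interpret \<mu>: finite_measure \<mu>
   using \<mu>_space by (intro finite_measureI) (auto simp: top_unique)
  show ?thesis unfolding J_def by measurable
 qed
 have J_le: "J w \<le> (\<integral>\<^sub>+t. ennreal (A * t powr (e - 1)) * indicator {0<..1} t * j t w)" for w
 proof -
  have "J w = (\<integral>\<^sub>+t. ennreal (t powr (\<beta> - 1)) * indicator {0<..1} t * ennreal ((K t w * t powr (1 - \<beta>)) powr q))"
   unfolding J_def \<mu>_def by (rule nn_integral_density) measurable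
  also have "\<dots> \<le> (\<integral>\<^sub>+t. ennreal (A * t powr (e - 1)) * indicator {0<..1} t * j t w)"
  proof (rule nn_integral_mono)
   fix t :: real
   show "ennreal (t powr (\<beta> - 1)) * indicator {0<..1} t * ennreal ((K t w * t powr (1 - \<beta>)) powr q)
    \<le> ennreal (A * t powr (e - 1)) * indicator {0<..1} t * j t w"
   proof (cases "t \<in> {0<..1}")
    case True
    have "ennreal (t powr (\<beta> - 1)) * ennreal ((K t w * t powr (1 - \<beta>)) powr q) \<le> ennreal (A * t powr (e - 1) * enn2real (j t w))"
     using Kq[OF True, of w] by (simp add: ennreal_mult[symmetric] mult.commute ennreal_leI)
    also have "\<dots> = ennreal (A * t powr (e - 1)) * j t w"
     using A j_fin[OF True, of w] by (simp add: ennreal_mult)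
    finally show ?thesis using True by simp
   qed simp
  qed
  finally show ?thesis .
 qed
 define J0 where "J0 = A * (2 ^ n * b1 * I) / e"
 have J0: "J0 \<ge> 0" using A b I e by (simp add: J0_def)
 have J_int: "(\<integral>\<^sub>+w. J w * indicator B w) \<le> ennreal J0"
 proof -
  have "(\<integral>\<^sub>+w. J w * indicator B w)
   \<le> (\<integral>\<^sub>+w. (\<integral>\<^sub>+t. ennreal (A * t powr (e - 1)) * indicator {0<..1} t * j t w) * indicator B w)"
   using J_le by (intro nn_integral_mono mult_right_mono) auto
  also have "\<dots> = (\<integral>\<^sub>+w. (\<integral>\<^sub>+t. ennreal (A * t powr (e - 1)) * indicator {0<..1} t * (j t w * indicator B w)))"
   by (subst nn_integral_multc[symmetric]) (auto simp: mult.assoc)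
  also have "\<dots> = (\<integral>\<^sub>+t. (\<integral>\<^sub>+w. ennreal (A * t powr (e - 1)) * indicator {0<..1} t * (j t w * indicator B w)))"
   by (rule lborel_pair.Fubini') measurable
  also have "\<dots> = (\<integral>\<^sub>+t. ennreal (A * t powr (e - 1)) * indicator {0<..1} t * (\<integral>\<^sub>+w. j t w * indicator B w))"
   by (intro nn_integral_cong nn_integral_cmult) measurable
  also have "\<dots> \<le> (\<integral>\<^sub>+t. ennreal (A * (2 ^ n * b1 * I)) * (ennreal (t powr (e - 1)) * indicator {0<..1} t))"
  proof (rule nn_integral_mono)
   fix t :: real
   show "ennreal (A * t powr (e - 1)) * indicator {0<..1} t * (\<integral>\<^sub>+w. j t w * indicator B w)
    \<le> ennreal (A * (2 ^ n * b1 * I)) * (ennreal (t powr (e - 1)) * indicator {0<..1} t)"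
   proof (cases "t \<in> {0<..1}")
    case True
    have "ennreal (A * t powr (e - 1)) * (\<integral>\<^sub>+w. j t w * indicator B w) \<le> ennreal (A * t powr (e - 1)) * ennreal (2 ^ n * b1 * I)"
     using j_int[OF True] by (rule mult_left_mono) simp
    then show ?thesis using True A I b by (simp add: ennreal_mult[symmetric] mult_ac)
   qed simp
  qed
  also have "\<dots> = ennreal (A * (2 ^ n * b1 * I)) * (\<integral>\<^sub>+t. ennreal (t powr (e - 1)) * indicator {0<..1} t)"
   by (rule nn_integral_cmult) measurable
  also have "\<dots> \<le> ennreal (A * (2 ^ n * b1 * I)) * ennreal (1 / e)"
   using nn_integral_powr_unit_interval[OF e(2)] by (rule mult_left_mono) simp
  also have "\<dots> = ennreal J0" using A b I e by (simp add: J0_def ennreal_mult[symmetric])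
  finally show ?thesis .
 qed
 have J_fin: "AE w in lborel. w \<in> B --> J w < \<infinity>"
 proof -
  have "AE w in lborel. J w * indicator B w \<noteq> \<infinity>"
   using J_int by (intro nn_integral_PInf_AE) (auto simp: top_unique)
  then show ?thesis by eventually_elim (auto simp: less_top)
 qed
 define d where "d = \<Lambda> * (2 * (1 / \<beta>) powr (1 - 1 / q)) / b0"
 have d: "d \<ge> 0" using \<Lambda> b by (simp add: d_def)
 have main: "F w powr q \<le> 2 powr q * ((S / b0) powr q + d powr q * enn2real (J w))" if w: "w \<in> B" and Jw: "J w < \<infinity>" for w
 proof -
  have T: "(\<integral>\<^sub>+t. ennreal (K t w) * indicator {0<..1} t) \<le> ennreal (2 * (1/\<beta>) powr (1 - 1/q) * enn2real (J w) powr (1/q))"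
  proof -
   have "(\<integral>\<^sub>+t. ennreal (K t w) * indicator {0<..1} t) =
     (\<integral>\<^sub>+t. ennreal (t powr (\<beta> - 1)) * indicator {0<..1} t * ennreal (K t w * t powr (1 - \<beta>)))"
   proof (rule nn_integral_cong)
    fix t :: real
    have "t powr (\<beta> - 1) * (K t w * t powr (1 - \<beta>)) = K t w" if "t > 0"
     using that powr_add[of t "\<beta> - 1" "1 - \<beta>"] by (simp add: mult_ac)
    then show "ennreal (K t w) * indicator {0<..1} t = ennreal (t powr (\<beta> - 1)) * indicator {0<..1} t * ennreal (K t w * t powr (1 - \<beta>))"
     using c by (auto simp: indicator_def ennreal_mult[symmetric] K_def)
   qed
   also have "\<dots> = (\<integral>\<^sup>+t. ennreal (K t w * t powr (1 - \<beta>)) \<partial>\<mu>)"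
    unfolding \<mu>_def by (rule nn_integral_density[symmetric]) measurable
   also have "\<dots> \<le> ennreal (2 * (1/\<beta>) powr (1 - 1/q) * enn2real (J w) powr (1/q))"
   proof (rule nn_integral_Holder_bound)
    show "emeasure \<mu> (space \<mu>) \<le> ennreal (1 / \<beta>)" by (rule \<mu>_space)
    show "(\<integral>\<^sup>+t. ennreal ((K t w * t powr (1 - \<beta>)) powr q) \<partial>\<mu>) \<le> ennreal (enn2real (J w))"
     using Jw by (simp add: J_def)
   qed (use p q \<beta> c in \<open>auto simp: K_def\<close>)
   finally show ?thesis .
  qed
  have "ennreal b0 * ennreal (F w) \<le> (\<integral>\<^sub>+w'. ennreal (F w) * indicator B w')"
   using mult_left_mono[OF b(2), of "ennreal (F w)"] by (simp add: nn_integral_cmult_indicator mult.commute)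
  also have "\<dots> \<le> (\<integral>\<^sub>+w'. ennreal (F w') * indicator B w' + ennreal \<Lambda> * (\<integral>\<^sub>+t. ennreal (G (w + t *\<^sub>R (w' - w))) * indicator {0..1} t * indicator B w'))"
   using inc[OF w] by (intro nn_integral_mono) (auto simp: indicator_def)
  also have "\<dots> = (\<integral>\<^sub>+w'. ennreal (F w') * indicator B w')
    + ennreal \<Lambda> * (\<integral>\<^sub>+w'. (\<integral>\<^sub>+t. ennreal (G (w + t *\<^sub>R (w' - w))) * indicator {0..1} t * indicator B w'))"
   by (subst nn_integral_add) (auto intro!: nn_integral_cmult)
  also have "(\<integral>\<^sub>+w'. (\<integral>\<^sub>+t. ennreal (G (w + t *\<^sub>R (w' - w))) * indicator {0..1} t * indicator B w'))
   = (\<integral>\<^sub>+t. (\<integral>\<^sub>+w'. ennreal (G (w + t *\<^sub>R (w' - w))) * indicator {0..1} t * indicator B w'))"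
   by (rule lborel_pair.Fubini') measurable
  also have "\<dots> = (\<integral>\<^sub>+t. k0 t w * indicator {0..1} t)"
   unfolding k0_def by (intro nn_integral_cong, subst nn_integral_multc[symmetric]) (auto simp: mult_ac)
  also have "\<dots> \<le> (\<integral>\<^sub>+t. ennreal (K t w) * indicator {0<..1} t)"
  proof (rule nn_integral_mono_AE)
   show "AE t in lborel. k0 t w * indicator {0..1} t \<le> ennreal (K t w) * indicator {0<..1} t"
    using AE_lborel_singleton[of 0] by eventually_elim (use k0_le[of _ w] in \<open>auto simp: indicator_def\<close>)
  qed
  finally have X: "ennreal b0 * ennreal (F w) \<le> (\<integral>\<^sub>+w'. ennreal (F w') * indicator B w')
   + ennreal \<Lambda> * (\<integral>\<^sub>+t. ennreal (K t w) * indicator {0<..1} t)" by (simp add: add_left_mono mult_left_mono)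
  define R where "R = 2 * (1/\<beta>) powr (1 - 1/q) * enn2real (J w) powr (1/q)"
  have R: "R \<ge> 0" by (simp add: R_def)
  have "ennreal b0 * ennreal (F w) \<le> ennreal S + ennreal \<Lambda> * ennreal R"
   unfolding R_def by (rule order_trans[OF X add_mono[OF S(2) mult_left_mono[OF T zero_le]]])
  then have "ennreal (b0 * F w) \<le> ennreal (S + \<Lambda> * R)"
   using b S \<Lambda> F0[of w] R by (simp add: ennreal_mult ennreal_plus)
  then have "b0 * F w \<le> S + \<Lambda> * (2 * (1/\<beta>) powr (1 - 1/q) * enn2real (J w) powr (1/q))"
   using S(1) \<Lambda> R unfolding R_def[symmetric] by (subst (asm) ennreal_le_iff) auto
  then have "F w \<le> S / b0 + d * enn2real (J w) powr (1/q)"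
   using b by (simp add: d_def field_simps)
  then have "F w powr q \<le> (S / b0 + d * enn2real (J w) powr (1/q)) powr q" using F0 p q by (intro powr_mono2) auto
  also have "\<dots> \<le> 2 powr q * ((S / b0) powr q + (d * enn2real (J w) powr (1/q)) powr q)"
   using S b d p q by (intro powr_sum_le) auto
  also have "(d * enn2real (J w) powr (1/q)) powr q = d powr q * enn2real (J w)"
   using d p q by (simp add: powr_mult powr_powr)
  finally show ?thesis .
 qed
 have "(\<integral>\<^sub>+w. ennreal (F w powr q) * indicator B w)
  \<le> (\<integral>\<^sub>+w. ennreal (2 powr q) * (ennreal ((S / b0) powr q) * indicator B w + ennreal (d powr q) * (J w * indicator B w)))"
 proof (rule nn_integral_mono_AE)
  show "AE w in lborel. ennreal (F w powr q) * indicator B w \<le> ennreal (2 powr q) * (ennreal ((S / b0) powr q) * indicator B w + ennreal (d powr q) * (J w * indicator B w))"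
   using J_fin
  proof eventually_elim
   case (elim w)
   show ?case
   proof (cases "w \<in> B")
    case True
    define x where "x = enn2real (J w)"
    have x: "J w = ennreal x" "x \<ge> 0" using elim True by (auto simp: x_def)
    have "ennreal (2 powr q) * (ennreal ((S / b0) powr q) + ennreal (d powr q) * J w) = ennreal (2 powr q * ((S / b0) powr q + d powr q * enn2real (J w)))"
     unfolding x(1) enn2real_ennreal[OF x(2)] using x(2) by (simp add: ennreal_mult ennreal_plus)
    then show ?thesis using main[OF True] elim True by (simp add: ennreal_leI)
   qed simp
  qed
 qed
 also have "\<dots> = ennreal (2 powr q) * (ennreal ((S / b0) powr q) * emeasure lborel B + ennreal (d powr q) * (\<integral>\<^sub>+w. J w * indicator B w))"
  by (subst nn_integral_cmult, measurable, subst nn_integral_add, measurable, subst nn_integral_cmult, measurable)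
   (simp add: nn_integral_cmult_indicator)
 also have "\<dots> \<le> ennreal (2 powr q) * (ennreal ((S / b0) powr q) * ennreal b1 + ennreal (d powr q) * ennreal J0)"
  using b J_int by (intro mult_left_mono add_mono) auto
 also have "\<dots> = ennreal (2 powr q * ((S / b0) powr q * b1 + d powr q * J0))"
  using b J0 by (simp add: ennreal_mult ennreal_plus)
 finally show ?thesis unfolding d_def J0_def A_def c_def n_def .
qed

section \<open>Sobolev inequality on Lipschitz domains\<close>

text \<open>Riemann sums: on a piece of length \<open>\<eta>\<close> the function \<open>h\<close> varies by at
 most \<open>\<epsilon>\<close>, so both the increment of \<open>f\<close> along the chord and the integral of
 \<open>h\<close> along the piece are governed by one value of \<open>h\<close>.\<close>
lemma increment_along_Lipschitz_curve:
 fixes f h :: "'a::euclidean_space => real" and \<gamma> :: "real => 'a"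
 assumes h: "continuous_on UNIV h" "\<And>z. h z \<ge> 0" and \<gamma>: "L-lipschitz_on {0..1} \<gamma>" and \<rho>: "\<rho> > 0"
  and loc: "\<And>z \<xi>. z \<in> \<gamma> ` {0..1} ==> norm \<xi> \<le> \<rho> ==> ennreal \<bar>f (z + \<xi>) - f z\<bar>
   \<le> ennreal (norm \<xi>) * segment_integral h z \<xi>"
 shows "\<bar>f (\<gamma> 1) - f (\<gamma> 0)\<bar> \<le> L * integral {0..1} (\<lambda>t. h (\<gamma> t))"
proof (rule field_le_epsilon)
 fix \<theta> :: real assume \<theta>: "\<theta> > 0"
 have L: "L \<ge> 0" by (rule lipschitz_on_nonneg[OF \<gamma>])
 define \<epsilon> where "\<epsilon> = \<theta> / (2 * L + 1)"
 have \<epsilon>: "\<epsilon> > 0" "2 * L * \<epsilon> \<le> \<theta>" using \<theta> L by (auto simp: \<epsilon>_def field_simps)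
 have cont: "continuous_on {0..1} \<gamma>" by (rule lipschitz_on_continuous_on[OF \<gamma>])
 have hc: "continuous_on {0..1} (\<lambda>t. h (\<gamma> t))"
  by (rule continuous_on_compose2[OF h(1) cont]) auto
 define K where "K = {x + y | x y. x \<in> \<gamma> ` {0..1} \<and> y \<in> cball (0::'a) 1}"
 have "compact K" unfolding K_def by (intro compact_sums compact_continuous_image cont compact_cball) auto
 then have "uniformly_continuous_on K h"
  by (intro compact_uniformly_continuous continuous_on_subset[OF h(1)]) auto
 then obtain \<delta> where \<delta>: "\<delta> > 0" "\<And>x x'. x \<in> K ==> x' \<in> K ==> dist x' x < \<delta> ==> dist (h x') (h x) < \<epsilon>"
  using \<epsilon>(1) unfolding uniformly_continuous_on_def by metis
 have near: "\<bar>h (\<gamma> s + y) - h (\<gamma> s)\<bar> \<le> \<epsilon>" if "s \<in> {0..1}" "norm y < \<delta>" "norm y \<le> 1" for s y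
 proof -
  have "\<gamma> s \<in> K" using that unfolding K_def by force
  moreover have "\<gamma> s + y \<in> K" using that unfolding K_def by force
  ultimately show ?thesis using \<delta>(2)[of "\<gamma> s" "\<gamma> s + y"] that by (auto simp: dist_norm)
 qed
 define \<eta> where "\<eta> = min \<rho> (min 1 (\<delta> / 2))"
 have \<eta>: "\<eta> > 0" "\<eta> \<le> \<rho>" "\<eta> \<le> 1" "\<eta> < \<delta>" using \<rho> \<delta> by (auto simp: \<eta>_def)
 have step: "\<bar>f (\<gamma> t) - f (\<gamma> s)\<bar> \<le> L * integral {s..t} (\<lambda>t. h (\<gamma> t)) + 2 * L * \<epsilon> * (t - s)"
  if st: "0 \<le> s" "s \<le> t" "t \<le> 1" "L * (t - s) \<le> \<eta>" for s t
 proof -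
  have lip: "norm (\<gamma> x - \<gamma> s) \<le> L * (x - s)" if "x \<in> {s..t}" for x
   using lipschitz_onD[OF \<gamma>, of x s] that st by (auto simp: dist_norm)
  have small: "L * (x - s) \<le> \<eta>" if "x \<in> {s..t}" for x
   using mult_left_mono[of "x - s" "t - s" L] that st L by auto
  define \<xi> where "\<xi> = \<gamma> t - \<gamma> s"
  have \<xi>: "norm \<xi> \<le> L * (t - s)" "norm \<xi> \<le> \<eta>" using lip[of t] st by (auto simp: \<xi>_def)
  have "ennreal \<bar>f (\<gamma> s + \<xi>) - f (\<gamma> s)\<bar> \<le> ennreal (norm \<xi>) * (\<integral>\<^sub>+x. ennreal (h (\<gamma> s + x *\<^sub>R \<xi>)) * indicator {0..1} x)"
   using \<xi> \<eta> st by (intro loc) auto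
  also have "\<dots> \<le> ennreal (norm \<xi>) * (\<integral>\<^sub>+x. ennreal (h (\<gamma> s) + \<epsilon>) * indicator {0..1::real} x)"
  proof (intro mult_left_mono nn_integral_mono)
   fix x :: real
   have "h (\<gamma> s + x *\<^sub>R \<xi>) \<le> h (\<gamma> s) + \<epsilon>" if x: "x \<in> {0..1}"
   proof -
    have "norm (x *\<^sub>R \<xi>) \<le> \<eta>" using x \<xi>(2) mult_mono[of x 1 "norm \<xi>" \<eta>] \<eta> by auto
    then show ?thesis using near[of s "x *\<^sub>R \<xi>"] st \<eta> by auto
   qed
   then show "ennreal (h (\<gamma> s + x *\<^sub>R \<xi>)) * indicator {0..1} x \<le> ennreal (h (\<gamma> s) + \<epsilon>) * indicator {0..1} x"
    by (auto simp: indicator_def ennreal_leI)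
  qed auto
  also have "\<dots> = ennreal (norm \<xi> * (h (\<gamma> s) + \<epsilon>))"
   using h(2)[of "\<gamma> s"] \<epsilon> by (simp add: nn_integral_cmult_indicator ennreal_mult)
  finally have "\<bar>f (\<gamma> t) - f (\<gamma> s)\<bar> \<le> norm \<xi> * (h (\<gamma> s) + \<epsilon>)"
   using h(2)[of "\<gamma> s"] \<epsilon> by (simp add: \<xi>_def)
  also have "\<dots> \<le> (L * (t - s)) * (h (\<gamma> s) + \<epsilon>)" using \<xi> h(2)[of "\<gamma> s"] \<epsilon> by (intro mult_right_mono) auto
  finally have 1: "\<bar>f (\<gamma> t) - f (\<gamma> s)\<bar> \<le> (L * (t - s)) * (h (\<gamma> s) + \<epsilon>)" .
  have "(t - s) * (h (\<gamma> s) - \<epsilon>) = integral {s..t} (\<lambda>x. h (\<gamma> s) - \<epsilon>)" using st by simp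
  also have "\<dots> \<le> integral {s..t} (\<lambda>t. h (\<gamma> t))"
  proof (rule integral_le)
   show "(\<lambda>t. h (\<gamma> t)) integrable_on {s..t}"
    using st by (intro integrable_continuous_interval continuous_on_subset[OF hc]) auto
   fix x assume x: "x \<in> {s..t}"
   have "norm (\<gamma> x - \<gamma> s) \<le> \<eta>" using lip[OF x] small[OF x] by linarith
   then show "h (\<gamma> s) - \<epsilon> \<le> h (\<gamma> x)" using near[of s "\<gamma> x - \<gamma> s"] st \<eta> by auto
  qed auto
  finally have "L * ((t - s) * (h (\<gamma> s) - \<epsilon>)) \<le> L * integral {s..t} (\<lambda>t. h (\<gamma> t))" using L by (rule mult_left_mono)
  with 1 show ?thesis by (simp add: algebra_simps)
 qed
 obtain N :: nat where N: "N > 0" "L / \<eta> \<le> real N"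
  using real_arch_simple[of "max 1 (L / \<eta>)"] by (metis max.bounded_iff not_one_le_zero of_nat_0 gr0I)
 have LN: "L * (1 / real N) \<le> \<eta>" using N \<eta> by (simp add: field_simps)
 have part: "\<bar>f (\<gamma> (i / N)) - f (\<gamma> 0)\<bar> \<le> L * integral {0..i / N} (\<lambda>t. h (\<gamma> t)) + 2 * L * \<epsilon> * (i / N)" if "i \<le> N" for i :: nat
  using that
 proof (induction i)
  case (Suc i)
  have diff: "real (Suc i) / N - real i / N = 1 / N" by (simp add: diff_divide_distrib[symmetric])
  have le: "real i / N \<le> real (Suc i) / N" "real (Suc i) / N \<le> 1" using Suc.prems N by (auto simp: divide_simps)
  have "\<bar>f (\<gamma> (Suc i / N)) - f (\<gamma> (i / N))\<bar> \<le> L * integral {i / N..Suc i / N} (\<lambda>t. h (\<gamma> t)) + 2 * L * \<epsilon> * (Suc i / N - i / N)"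
   using le N LN by (intro step) (simp_all only: diff, auto)
  moreover have "integral {0..i / N} (\<lambda>t. h (\<gamma> t)) + integral {i / N..Suc i / N} (\<lambda>t. h (\<gamma> t)) = integral {0..Suc i / N} (\<lambda>t. h (\<gamma> t))"
   using le by (intro Henstock_Kurzweil_Integration.integral_combine integrable_continuous_interval continuous_on_subset[OF hc]) auto
  then have "L * integral {0..Suc i / N} (\<lambda>t. h (\<gamma> t)) = L * integral {0..i / N} (\<lambda>t. h (\<gamma> t)) + L * integral {i / N..Suc i / N} (\<lambda>t. h (\<gamma> t))"
   by (simp only: distrib_left[symmetric])
  moreover have "2 * L * \<epsilon> * (Suc i / N - i / N) = 2 * L * \<epsilon> * (Suc i / N) - 2 * L * \<epsilon> * (i / N)" by (rule right_diff_distrib)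
  ultimately show ?case using Suc.IH Suc.prems by linarith
 qed simp
 show "\<bar>f (\<gamma> 1) - f (\<gamma> 0)\<bar> \<le> L * integral {0..1} (\<lambda>t. h (\<gamma> t)) + \<theta>"
  using part[of N] N \<epsilon> by simp
qed

text \<open>\<open>f\<close> stands for a nonnegative Sobolev function on \<open>\<Omega>\<close> and
 \<open>g\<close> for a bound on its gradient; both are total functions so that they can be mollified.\<close>
definition sobolev_pair :: "(real^'n::finite) set => real => real => (real^'n => real) => (real^'n => real) => bool" where
 "sobolev_pair \<Omega> p M f g \<longleftrightarrow> integrable lborel f \<and> (\<forall>z. f z \<ge> 0) \<and> integrable lborel g \<and> (\<forall>z. g z \<ge> 0) \<and>
  (\<exists>f0 G. weak_gradient \<Omega> f0 G \<and> (AE z\<in>\<Omega> in lborel. f z = f0 z) \<and> (AE z\<in>\<Omega> in lborel. norm (G z) \<le> g z)) \<and>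
  (\<integral>\<^sub>+z. ennreal (f z)) \<le> ennreal M \<and> (\<integral>\<^sub>+z. ennreal (g z powr p)) \<le> ennreal M"

text \<open>Lipschitz charts do not preserve segments, so the segment bound cannot be pulled back directly. But
 the mollifications of \<open>f\<close> and \<open>g\<close> are continuous and satisfy the increment bound
 pointwise near the compact set \<open>\<phi> ` B\<close>, hence along the images of segments. Their
 compositions with \<open>\<phi>\<close> satisfy the convex inequality, with constants independent of the
 radius, and Fatou's lemma gives the result for \<open>f\<close>.\<close>
lemma higher_integrability_in_chart:
 fixes \<phi> :: "'a::euclidean_space => real^'n::finite"
 assumes dim: "DIM('a) = CARD('n)" and \<Omega>: "open \<Omega>" and p: "p \<ge> 1" and q: "q \<ge> p" and \<beta>: "\<beta> > 0"
  and e: "(1 - \<beta>) * q + \<beta> - CARD('n) * (q / p - 1) > 0" and b: "0 < b0" "0 < b1" and L: "L \<ge> 0" and D: "D \<ge> 0" and M: "M \<ge> 0"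
 obtains C where "\<And>B f g. compact B ==> convex B ==> ennreal b0 \<le> emeasure lborel B ==> emeasure lborel B \<le> ennreal b1 ==>
   (\<And>w w'. w \<in> B ==> w' \<in> B ==> norm (w' - w) \<le> D) ==> L-lipschitz_on B \<phi> ==> L-lipschitz_on (\<phi> ` B) s ==>
   (\<And>w. w \<in> B ==> s (\<phi> w) = w) ==> \<phi> ` B \<subseteq> \<Omega> ==> sobolev_pair \<Omega> p M f g ==>
   (\<integral>\<^sub>+z. ennreal (f z powr q) * indicator (\<phi> ` B) z) \<le> ennreal C"
proof -
 define N where "N = (2 * L * CARD('n)) ^ CARD('n)"
 have N: "N \<ge> 0" using L by (simp add: N_def)
 obtain C0 where C0: "\<And>(B::'a set) F G. B \<in> sets borel ==> ennreal b0 \<le> emeasure lborel B ==> emeasure lborel B \<le> ennreal b1 ==>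
  F \<in> borel_measurable borel ==> (\<And>w. F w \<ge> 0) ==> G \<in> borel_measurable borel ==> (\<And>w. G w \<ge> 0) ==>
  (\<And>w w'. w \<in> B ==> w' \<in> B ==>
   ennreal (F w) \<le> ennreal (F w') + ennreal (L * D) * segment_integral G w (w' - w)) ==>
  (\<integral>\<^sub>+w. ennreal (F w) * indicator B w) \<le> ennreal (N * (2 * M)) ==>
  (\<integral>\<^sub>+w. ennreal (G w powr p)) \<le> ennreal (N * (2 powr p * M)) ==>
  (\<integral>\<^sub>+w. ennreal (F w powr q) * indicator B w) \<le> ennreal C0"
 proof -
  have "(1 - \<beta>) * q + \<beta> - DIM('a) * (q / p - 1) > 0" using e dim by simp
  from Sobolev_bound_of_segment_bound[OF _ b(1) _ _ b(2) _ _ _ _ _ _ _ _ _ _ p q \<beta> refl this, where \<Lambda> = "L * D" and S = "N * (2 * M)" and I = "N * (2 powr p * M)"]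
  show ?thesis using N M L D by (intro that) auto
 qed
 show thesis
 proof (rule that[of "N * C0"])
  fix B :: "'a set" and f g :: "real^'n => real"
  assume B: "compact B" "convex B" "ennreal b0 \<le> emeasure lborel B" "emeasure lborel B \<le> ennreal b1"
   and diam: "\<And>w w'. w \<in> B ==> w' \<in> B ==> norm (w' - w) \<le> D" and \<phi>: "L-lipschitz_on B \<phi>" and s: "L-lipschitz_on (\<phi> ` B) s"
   and inv: "\<And>w. w \<in> B ==> s (\<phi> w) = w" and sub: "\<phi> ` B \<subseteq> \<Omega>" and sp: "sobolev_pair \<Omega> p M f g"
  have [measurable]: "B \<in> sets borel" using B by (simp add: borel_compact)
  have \<phi>c: "continuous_on B \<phi>" by (rule lipschitz_on_continuous_on[OF \<phi>])
  have sc: "continuous_on (\<phi> ` B) s" by (rule lipschitz_on_continuous_on[OF s])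
  have cp: "compact (\<phi> ` B)" using \<phi>c B by (intro compact_continuous_image)
  then have [measurable]: "\<phi> ` B \<in> sets borel" by (simp add: borel_compact)
  have sB: "s ` \<phi> ` B = B" using inv by (force simp: image_image)
  obtain f0 G where sp': "integrable lborel f" "\<And>z. f z \<ge> 0" "integrable lborel g" "\<And>z. g z \<ge> 0"
   "weak_gradient \<Omega> f0 G" "AE z\<in>\<Omega> in lborel. f z = f0 z" "AE z\<in>\<Omega> in lborel. norm (G z) \<le> g z"
   "(\<integral>\<^sub>+z. ennreal (f z)) \<le> ennreal M" "(\<integral>\<^sub>+z. ennreal (g z powr p)) \<le> ennreal M"
   using sp unfolding sobolev_pair_def by blast
  have [measurable]: "f \<in> borel_measurable borel" "g \<in> borel_measurable borel" using sp' by auto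
  obtain \<rho>2 where \<rho>2: "\<rho>2 > 0" "(\<Union>x\<in>\<phi> ` B. cball x \<rho>2) \<subseteq> \<Omega>"
   using compact_subset_open_imp_cball_epsilon_subset[OF cp \<Omega> sub] by metis
  define \<rho> where "\<rho> = \<rho>2 / 2"
  have \<rho>: "\<rho> > 0" using \<rho>2 by (simp add: \<rho>_def)
  have mollified: "(\<integral>\<^sub>+z. ennreal (mollify r f z powr q) * indicator (\<phi> ` B) z) \<le> ennreal (N * C0)"
   if r: "0 < r" "r \<le> \<rho>" for r
  proof -
   have m: "continuous_on UNIV (mollify r f)" "continuous_on UNIV (mollify r g)"
    "\<And>z. mollify r f z \<ge> 0" "\<And>z. mollify r g z \<ge> 0"
    using sp' by (auto intro!: mollify_continuous mollify_nonneg)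
   have [measurable]: "mollify r f \<in> borel_measurable borel" "mollify r g \<in> borel_measurable borel"
    using sp' by (auto intro!: mollify_measurable)
   define F where "F = (\<lambda>w. indicator B w *\<^sub>R mollify r f (\<phi> w))"
   define H where "H = (\<lambda>w. indicator B w *\<^sub>R mollify r g (\<phi> w))"
   have FHm[measurable]: "F \<in> borel_measurable borel" "H \<in> borel_measurable borel"
    unfolding F_def H_def
    by (intro borel_measurable_continuous_on_indicator continuous_on_compose2[OF m(1) \<phi>c] continuous_on_compose2[OF m(2) \<phi>c]; simp)+
   have loc: "ennreal \<bar>mollify r f (z + \<xi>) - mollify r f z\<bar>
     \<le> ennreal (norm \<xi>) * segment_integral (mollify r g) z \<xi>"
    if z: "z \<in> \<phi> ` B" "norm \<xi> \<le> \<rho>" for z \<xi>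
   proof (rule mollify_increment_bound[OF \<Omega> sp'(5,1,6,3,4,7) r(1)])
    fix t :: real assume t: "t \<in> {0..1}"
    show "cball (z + t *\<^sub>R \<xi>) r \<subseteq> \<Omega>"
    proof
     fix y assume "y \<in> cball (z + t *\<^sub>R \<xi>) r"
     moreover have "norm (t *\<^sub>R \<xi>) \<le> \<rho>" using t z mult_mono[of t 1 "norm \<xi>" \<rho>] by auto
     moreover have "dist z y \<le> dist z (z + t *\<^sub>R \<xi>) + dist (z + t *\<^sub>R \<xi>) y" by (rule dist_triangle)
     ultimately have "y \<in> cball z \<rho>2" using r unfolding \<rho>_def by (auto simp: dist_norm)
     then show "y \<in> \<Omega>" using \<rho>2 z by blast
    qed
   qed
   have inc: "ennreal (F w) \<le> ennreal (F w') + ennreal (L * D) * segment_integral H w (w' - w)"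
    if w: "w \<in> B" "w' \<in> B" for w w'
   proof -
    define \<gamma> where "\<gamma> = (\<lambda>t. \<phi> (w + t *\<^sub>R (w' - w)))"
    have in_B: "w + t *\<^sub>R (w' - w) \<in> B" if "t \<in> {0..1}" for t
     using convexD_alt[OF B(2) w, of t] that by (simp add: algebra_simps)
    have \<gamma>: "(L * D)-lipschitz_on {0..1} \<gamma>"
    proof (rule lipschitz_onI)
     fix t t' :: real assume t: "t \<in> {0..1}" "t' \<in> {0..1}"
     have "dist (\<gamma> t) (\<gamma> t') \<le> L * dist (w + t *\<^sub>R (w' - w)) (w + t' *\<^sub>R (w' - w))"
      unfolding \<gamma>_def by (intro lipschitz_onD[OF \<phi>] in_B t)
     also have "dist (w + t *\<^sub>R (w' - w)) (w + t' *\<^sub>R (w' - w)) = dist t t' * norm (w' - w)"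
      by (simp add: dist_norm dist_real_def flip: scaleR_left_diff_distrib)
     also have "L * (dist t t' * norm (w' - w)) \<le> L * (dist t t' * D)" using diam[OF w] L by (intro mult_left_mono) auto
     finally show "dist (\<gamma> t) (\<gamma> t') \<le> L * D * dist t t'" by (simp add: mult_ac)
    qed (use L D in auto)
    have \<gamma>B: "\<gamma> ` {0..1} \<subseteq> \<phi> ` B" using in_B by (auto simp: \<gamma>_def)
    have "\<bar>mollify r f (\<gamma> 1) - mollify r f (\<gamma> 0)\<bar> \<le> L * D * integral {0..1} (\<lambda>t. mollify r g (\<gamma> t))"
     using \<gamma>B by (intro increment_along_Lipschitz_curve[OF m(2,4) \<gamma> \<rho>] loc) auto
    then have "F w \<le> F w' + L * D * integral {0..1} (\<lambda>t. mollify r g (\<gamma> t))"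
     using w by (simp add: F_def \<gamma>_def)
    moreover have "ennreal (integral {0..1} (\<lambda>t. mollify r g (\<gamma> t))) = segment_integral H w (w' - w)"
    proof -
     have c: "continuous_on {0..1} (\<lambda>t. mollify r g (\<gamma> t))"
      by (rule continuous_on_compose2[OF m(2) lipschitz_on_continuous_on[OF \<gamma>]]) auto
     have "((\<lambda>t. mollify r g (\<gamma> t)) has_integral integral {0..1} (\<lambda>t. mollify r g (\<gamma> t))) {0..1}"
      by (intro integrable_integral integrable_continuous_interval c)
     from nn_integral_has_integral_lebesgue[OF _ this] m(4)
     have "(\<integral>\<^sub>+t. ennreal (indicat_real {0..1} t * mollify r g (\<gamma> t))) = ennreal (integral {0..1} (\<lambda>t. mollify r g (\<gamma> t)))" by simp
     moreover have "ennreal (indicat_real {0..1} t * mollify r g (\<gamma> t)) = ennreal (H (w + t *\<^sub>R (w' - w))) * indicator {0..1} t" for t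
      using in_B[of t] by (auto simp: indicator_def H_def \<gamma>_def)
     ultimately show ?thesis by simp
    qed
    moreover have "integral {0..1} (\<lambda>t. mollify r g (\<gamma> t)) \<ge> 0" using m by (intro integral_nonneg) (auto intro!: integrable_continuous_interval continuous_on_compose2[OF m(2) lipschitz_on_continuous_on[OF \<gamma>]])
    moreover have "F w' \<ge> 0" using m by (simp add: F_def)
    ultimately show ?thesis
     using L D ennreal_leI[of "F w" "F w' + L * D * integral {0..1} (\<lambda>t. mollify r g (\<gamma> t))"] by (simp add: ennreal_mult ennreal_plus)
   qed
   have pull: "(\<integral>\<^sub>+w. h (\<phi> w) * indicator B w) \<le> ennreal N * (\<integral>\<^sub>+z. h z)"
    if [measurable]: "h \<in> borel_measurable borel" for h
   proof -
    have "(\<integral>\<^sub>+w. h (\<phi> w) * indicator B w) \<le> ennreal N * (\<integral>\<^sub>+z. h z * indicator (\<phi> ` B) z)"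
     using nn_integral_Lipschitz_pullback_le[OF _ B(1) \<phi>c inv s that] dim by (simp add: N_def)
    also have "\<dots> \<le> ennreal N * (\<integral>\<^sub>+z. h z)"
     by (intro mult_left_mono nn_integral_mono) (auto simp: indicator_def)
    finally show ?thesis .
   qed
   have "(\<integral>\<^sub>+w. ennreal (F w powr q) * indicator B w) \<le> ennreal C0"
   proof (rule C0[OF _ B(3,4) FHm(1) _ FHm(2) _ inc])
    have "(\<integral>\<^sub>+w. ennreal (F w) * indicator B w) = (\<integral>\<^sub>+w. ennreal (mollify r f (\<phi> w)) * indicator B w)"
     by (intro nn_integral_cong) (auto simp: F_def indicator_def)
    also have "\<dots> \<le> ennreal N * (\<integral>\<^sub>+z. ennreal (mollify r f z))" by (rule pull) measurable
    also have "(\<integral>\<^sub>+z. ennreal (mollify r f z)) \<le> ennreal 2 * ennreal M"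
     using order_trans[OF nn_integral_mollify_powr_le[OF sp'(1,2) r(1), of 1] mult_left_mono] sp'(8) by (simp add: m(3) sp'(2))
    finally show "(\<integral>\<^sub>+w. ennreal (F w) * indicator B w) \<le> ennreal (N * (2 * M))"
     using N M by (simp add: ennreal_mult mult_left_mono)
    have "(\<integral>\<^sub>+w. ennreal (H w powr p)) = (\<integral>\<^sub>+w. ennreal (mollify r g (\<phi> w) powr p) * indicator B w)"
     using p by (intro nn_integral_cong) (auto simp: H_def indicator_def)
    also have "\<dots> \<le> ennreal N * (\<integral>\<^sub>+z. ennreal (mollify r g z powr p))" by (rule pull) measurable
    also have "(\<integral>\<^sub>+z. ennreal (mollify r g z powr p)) \<le> ennreal (2 powr p) * ennreal M"
     by (rule order_trans[OF nn_integral_mollify_powr_le[OF sp'(3,4) r(1) p] mult_left_mono[OF sp'(9)]]) simp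
    finally show "(\<integral>\<^sub>+w. ennreal (H w powr p)) \<le> ennreal (N * (2 powr p * M))"
     using N M by (simp add: ennreal_mult mult_left_mono)
   qed (use m in \<open>auto simp: F_def H_def\<close>)
   moreover have "(\<integral>\<^sub>+z. ennreal (F (s z) powr q) * indicator (\<phi> ` B) z) \<le> ennreal N * (\<integral>\<^sub>+w. ennreal (F w powr q) * indicator B w)"
   proof -
    have inv': "\<phi> (s z) = z" if "z \<in> \<phi> ` B" for z using inv that by auto
    have dim': "DIM(real^'n) = DIM('a)" using dim by simp
    have \<phi>': "L-lipschitz_on (s ` \<phi> ` B) \<phi>" using \<phi> by (simp only: sB)
    show ?thesis
     using nn_integral_Lipschitz_pullback_le[OF dim' cp sc inv' \<phi>', of "\<lambda>w. ennreal (F w powr q)"] by (simp add: sB N_def dim)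
   qed
   moreover have "(\<integral>\<^sub>+z. ennreal (mollify r f z powr q) * indicator (\<phi> ` B) z) = (\<integral>\<^sub>+z. ennreal (F (s z) powr q) * indicator (\<phi> ` B) z)"
    using inv by (intro nn_integral_cong) (auto simp: indicator_def F_def)
   ultimately have "(\<integral>\<^sub>+z. ennreal (mollify r f z powr q) * indicator (\<phi> ` B) z) \<le> ennreal N * ennreal C0"
    using mult_left_mono[of "\<integral>\<^sup>+w. ennreal (F w powr q) * indicator B w \<partial>lborel" "ennreal C0" "ennreal N"] by simp
   then show ?thesis using N by (simp add: ennreal_mult')
  qed
  define r0 where "r0 = (\<lambda>k. \<rho> / (real k + 1))"
  have r0: "\<And>k. r0 k > 0" "\<And>k. r0 k \<le> \<rho>" using \<rho> by (auto simp: r0_def field_simps)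
  have "r0 \<longlonglongrightarrow> 0"
   using tendsto_mult_left[OF LIMSEQ_inverse_real_of_nat, of \<rho>] by (simp add: r0_def divide_inverse add.commute)
  from mollify_L1_tendsto[OF sp'(1) r0(1) this]
  have lim: "(\<lambda>k. \<integral>\<^sub>+z. ennreal \<bar>mollify (r0 k) f z - f z\<bar>) \<longlonglongrightarrow> 0" .
  have [measurable]: "mollify (r0 k) f \<in> borel_measurable borel" for k using sp' by (auto intro!: mollify_measurable)
  have em: "(\<lambda>z. ennreal \<bar>mollify (r0 k) f z - f z\<bar>) \<in> borel_measurable lborel" for k by measurable
  obtain \<kappa> :: "nat => nat" where \<kappa>: "strict_mono \<kappa>" "AE z in lborel. (\<lambda>k. ennreal \<bar>mollify (r0 (\<kappa> k)) f z - f z\<bar>) \<longlonglongrightarrow> 0"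
   by (rule nn_integral_tendsto_0_AE_subseq[OF em lim]) (rule that)
  have "(\<integral>\<^sub>+z. ennreal (f z powr q) * indicator (\<phi> ` B) z)
    = (\<integral>\<^sub>+z. liminf (\<lambda>k. ennreal (mollify (r0 (\<kappa> k)) f z powr q) * indicator (\<phi> ` B) z))"
  proof (rule nn_integral_cong_AE)
   show "AE z in lborel. ennreal (f z powr q) * indicator (\<phi> ` B) z = liminf (\<lambda>k. ennreal (mollify (r0 (\<kappa> k)) f z powr q) * indicator (\<phi> ` B) z)"
    using \<kappa>(2)
   proof eventually_elim
    case (elim z)
    have "(\<lambda>k. mollify (r0 (\<kappa> k)) f z - f z) \<longlonglongrightarrow> 0"
     using elim by (subst (asm) ennreal_0[symmetric], subst (asm) tendsto_ennreal_iff) (auto simp: tendsto_rabs_zero_iff)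
    then have "(\<lambda>k. mollify (r0 (\<kappa> k)) f z) \<longlonglongrightarrow> f z" by (simp add: LIM_zero_iff)
    then have "(\<lambda>k. mollify (r0 (\<kappa> k)) f z powr q) \<longlonglongrightarrow> f z powr q"
     using p q sp'(2) by (intro tendsto_powr') (auto simp: mollify_nonneg)
    then have "(\<lambda>k. ennreal (mollify (r0 (\<kappa> k)) f z powr q) * indicator (\<phi> ` B) z) \<longlonglongrightarrow> ennreal (f z powr q) * indicator (\<phi> ` B) z"
     by (cases "z \<in> \<phi> ` B") auto
    then show ?case by (intro lim_imp_Liminf[symmetric]) auto
   qed
  qed
  also have "\<dots> \<le> liminf (\<lambda>k. \<integral>\<^sub>+z. ennreal (mollify (r0 (\<kappa> k)) f z powr q) * indicator (\<phi> ` B) z)"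
   by (rule nn_integral_liminf) measurable
  also have "\<dots> \<le> liminf (\<lambda>k. ennreal (N * C0))" by (intro Liminf_mono always_eventually allI mollified r0)
  also have "\<dots> = ennreal (N * C0)" by (simp add: Liminf_const)
  finally show "(\<integral>\<^sub>+z. ennreal (f z powr q) * indicator (\<phi> ` B) z) \<le> ennreal (N * C0)" .
 qed
qed

definition Sobolev_bounded_on ::
 "(real^'n::finite) set => real => real => real => (real^'n) set => bool" where
 "Sobolev_bounded_on \<Omega> p q M U \<longleftrightarrow> (\<exists>C. \<forall>f g. sobolev_pair \<Omega> p M f g -->
  (\<integral>\<^sub>+z. ennreal (f z powr q) * indicator U z) \<le> ennreal C)"

lemma Sobolev_bounded_on_Union:
 assumes "finite \<U>" "\<And>U. U \<in> \<U> ==> U \<in> sets borel \<and> Sobolev_bounded_on \<Omega> p q M U"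
 shows "Sobolev_bounded_on \<Omega> p q M (\<Union>\<U>)"
 using assms
proof (induction rule: finite_induct)
 case empty
 show ?case by (auto simp: Sobolev_bounded_on_def)
next
 case (insert U \<U>)
 have b[measurable]: "U \<in> sets borel" "\<Union>\<U> \<in> sets borel" using insert by (auto intro!: sets.finite_Union)
 have "Sobolev_bounded_on \<Omega> p q M U" "Sobolev_bounded_on \<Omega> p q M (\<Union>\<U>)" using insert by auto
 then obtain C1 C2 where C: "\<And>f g. sobolev_pair \<Omega> p M f g ==> (\<integral>\<^sub>+z. ennreal (f z powr q) * indicator U z) \<le> ennreal C1"
  "\<And>f g. sobolev_pair \<Omega> p M f g ==> (\<integral>\<^sub>+z. ennreal (f z powr q) * indicator (\<Union>\<U>) z) \<le> ennreal C2"
  unfolding Sobolev_bounded_on_def by blast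
 have "(\<integral>\<^sub>+z. ennreal (f z powr q) * indicator (\<Union>(insert U \<U>)) z) \<le> ennreal (max 0 C1 + max 0 C2)"
  if sp: "sobolev_pair \<Omega> p M f g" for f g
 proof -
  have [measurable]: "f \<in> borel_measurable borel" using sp by (auto simp: sobolev_pair_def)
  have "(\<integral>\<^sub>+z. ennreal (f z powr q) * indicator (\<Union>(insert U \<U>)) z)
   \<le> (\<integral>\<^sub>+z. ennreal (f z powr q) * indicator U z + ennreal (f z powr q) * indicator (\<Union>\<U>) z)"
   by (intro nn_integral_mono) (auto simp: indicator_def)
  also have "\<dots> = (\<integral>\<^sub>+z. ennreal (f z powr q) * indicator U z) + (\<integral>\<^sub>+z. ennreal (f z powr q) * indicator (\<Union>\<U>) z)"
   by (rule nn_integral_add) measurable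
  also have "\<dots> \<le> ennreal (max 0 C1) + ennreal (max 0 C2)"
   by (intro add_mono order_trans[OF C(1)[OF sp]] order_trans[OF C(2)[OF sp]] ennreal_leI) auto
  finally show ?thesis by (simp add: ennreal_plus)
 qed
 then show ?case unfolding Sobolev_bounded_on_def by blast
qed

text \<open>The boxes that fill a chart up to the boundary of \<open>\<Omega>\<close> exhaust it from inside;
 the constant is the same for all of them.\<close>
lemma Sobolev_bounded_on_charts:
 fixes \<phi> :: "'a::euclidean_space => real^'n::finite" and B :: "nat => 'a set"
 assumes dim: "DIM('a) = CARD('n)" and \<Omega>: "open \<Omega>" and p: "p \<ge> 1" and q: "q \<ge> p" and \<beta>: "\<beta> > 0"
  and e: "(1 - \<beta>) * q + \<beta> - CARD('n) * (q / p - 1) > 0" and b: "0 < b0" "0 < b1" and L: "L \<ge> 0" and D: "D \<ge> 0" and M: "M \<ge> 0"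
  and B: "incseq B" "\<And>k. compact (B k)" "\<And>k. convex (B k)" "\<And>k. ennreal b0 \<le> emeasure lborel (B k)" "\<And>k. emeasure lborel (B k) \<le> ennreal b1"
   "\<And>k w w'. w \<in> B k ==> w' \<in> B k ==> norm (w' - w) \<le> D"
  and \<phi>: "\<And>k. L-lipschitz_on (B k) \<phi>" "\<And>k. L-lipschitz_on (\<phi> ` B k) s" "\<And>k w. w \<in> B k ==> s (\<phi> w) = w" "\<And>k. \<phi> ` B k \<subseteq> \<Omega>"
  and U: "U \<subseteq> (\<Union>k. \<phi> ` B k)"
 shows "Sobolev_bounded_on \<Omega> p q M U"
proof (rule higher_integrability_in_chart[OF dim \<Omega> p q \<beta> e b L D M, where \<phi> = \<phi> and s = s])
 fix C assume C: "\<And>(B :: 'a set) f g. compact B ==> convex B ==> ennreal b0 \<le> emeasure lborel B ==> emeasure lborel B \<le> ennreal b1 ==>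
   (\<And>w w'. w \<in> B ==> w' \<in> B ==> norm (w' - w) \<le> D) ==> L-lipschitz_on B \<phi> ==> L-lipschitz_on (\<phi> ` B) s ==>
   (\<And>w. w \<in> B ==> s (\<phi> w) = w) ==> \<phi> ` B \<subseteq> \<Omega> ==> sobolev_pair \<Omega> p M f g ==>
   (\<integral>\<^sub>+z. ennreal (f z powr q) * indicator (\<phi> ` B) z) \<le> ennreal C"
 have "(\<integral>\<^sub>+z. ennreal (f z powr q) * indicator U z) \<le> ennreal C" if sp: "sobolev_pair \<Omega> p M f g" for f g
 proof -
  have [measurable]: "f \<in> borel_measurable borel" using sp by (auto simp: sobolev_pair_def)
  have [measurable]: "\<phi> ` B k \<in> sets borel" for k
   by (intro borel_compact compact_continuous_image lipschitz_on_continuous_on[OF \<phi>(1)] B)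
  have inc: "incseq (\<lambda>k. \<phi> ` B k)" using B(1) by (auto simp: incseq_def)
  have "(\<integral>\<^sub>+z. ennreal (f z powr q) * indicator U z) \<le> (\<integral>\<^sub>+z. (SUP k. ennreal (f z powr q) * indicator (\<phi> ` B k) z))"
  proof (rule nn_integral_mono)
   fix z
   show "ennreal (f z powr q) * indicator U z \<le> (SUP k. ennreal (f z powr q) * indicator (\<phi> ` B k) z)"
   proof (cases "z \<in> U")
    case True
    then obtain k where "z \<in> \<phi> ` B k" using U by blast
    then show ?thesis by (intro SUP_upper2[of k]) (auto simp: indicator_def)
   qed simp
  qed
  also have "\<dots> = (SUP k. \<integral>\<^sub>+z. ennreal (f z powr q) * indicator (\<phi> ` B k) z)"
  proof (rule nn_integral_monotone_convergence_SUP)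
   show "incseq (\<lambda>k z. ennreal (f z powr q) * indicator (\<phi> ` B k) z)"
    using incseqD[OF inc] by (auto simp: incseq_def le_fun_def indicator_def)
  qed measurable
  also have "\<dots> \<le> ennreal C" by (intro SUP_least C[OF B(2-6) \<phi> sp])
  finally show ?thesis .
 qed
 then show "Sobolev_bounded_on \<Omega> p q M U" unfolding Sobolev_bounded_on_def by blast
qed

text \<open>As \<open>\<beta>\<close> tends to 0 the expression tends to \<open>q - n (q / p - 1)\<close>, which
 is positive exactly below the Sobolev conjugate.\<close>
lemma below_Sobolev_conjugate:
 fixes p q :: real
 assumes p: "p \<ge> 1" and q: "q \<ge> p" "ereal q < sobolev_conjugate n p"
 obtains \<beta> :: real where "\<beta> > 0" "(1 - \<beta>) * q + \<beta> - n * (q / p - 1) > 0"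
proof (cases "n = 0")
 case True
 show thesis using p q True by (intro that[of "1/2"]) auto
next
 case False
 define E where "E = q - n * (q / p - 1)"
 have E: "E > 0"
 proof (cases "p < n")
  case True
  then have "q < n * p / (n - p)" using q by (simp add: sobolev_conjugate_def)
  then have "q * (n - p) < n * p" using True by (simp add: field_simps)
  then show ?thesis using p by (simp add: E_def field_simps)
 next
  case np: False
  have "n * (q / p) \<le> q" using np p q by (simp add: field_simps)
  moreover have "real n > 0" using False by simp
  ultimately show ?thesis unfolding E_def right_diff_distrib by linarith
 qed
 define \<beta> where "\<beta> = E / (2 * q)"
 have "\<beta> * q = E / 2" using p q by (simp add: \<beta>_def)
 then have "(1 - \<beta>) * q = q - (q - n * (q / p - 1)) / 2" by (simp add: left_diff_distrib E_def)
 moreover have "\<beta> > 0" using E p q by (simp add: \<beta>_def)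
 moreover have "x + \<beta> - y > 0" if "x = q - (q - y) / 2" "\<beta> > 0" "q - y > 0" for x y using that by (simp add: field_simps)
 ultimately show thesis using E[unfolded E_def] by (intro that[of \<beta>])
qed

text \<open>Each point of the compact closure of \<open>\<Omega>\<close> has a neighbourhood on which the
 inequality holds: a ball for inner points, a half box in a chart for boundary points.\<close>
lemma Sobolev_inequality_Lipschitz_domain:
 fixes \<Omega> :: "(real^'n::finite) set"
 assumes dim: "CARD('n) = CARD('m::finite) + 1" and \<Omega>: "bounded_lipschitz_domain TYPE('m) \<Omega>"
  and p: "p \<ge> 1" and q: "q \<ge> p" "ereal q < sobolev_conjugate CARD('n) p" and M: "M \<ge> 0"
 obtains C where "\<And>f g. sobolev_pair \<Omega> p M f g ==> (\<integral>\<^sub>+z. ennreal (f z powr q) * indicator \<Omega> z) \<le> ennreal C"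
proof -
 have op: "open \<Omega>" and bd: "bounded \<Omega>" using \<Omega> by (auto simp: bounded_lipschitz_domain_def)
 obtain \<beta> where \<beta>: "\<beta> > 0" "(1 - \<beta>) * q + \<beta> - CARD('n) * (q / p - 1) > 0"
  by (rule below_Sobolev_conjugate[OF p q]) (rule that)
 have interior: "\<exists>N. open N \<and> x \<in> N \<and> Sobolev_bounded_on \<Omega> p q M (N \<inter> \<Omega>)" if x: "x \<in> \<Omega>" for x
 proof -
  obtain \<rho> where \<rho>: "\<rho> > 0" "cball x \<rho> \<subseteq> \<Omega>" using op x open_contains_cball by blast
  define v where "v = unit_ball_vol (real CARD('n)) * \<rho> ^ CARD('n)"
  have v: "v > 0" "emeasure lborel (cball x \<rho>) = ennreal v" using \<rho> by (auto simp: v_def emeasure_cball)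
  have d: "norm (w' - w) \<le> 2 * \<rho>" if "w \<in> cball x \<rho>" "w' \<in> cball x \<rho>" for w w'
   using dist_triangle[of w' w x] that by (simp add: dist_norm norm_minus_commute dist_commute)
  have "Sobolev_bounded_on \<Omega> p q M (ball x \<rho> \<inter> \<Omega>)"
  proof (rule Sobolev_bounded_on_charts[where B = "\<lambda>_. cball x \<rho>" and \<phi> = "\<lambda>z. z" and s = "\<lambda>z. z", OF _ op p q(1) \<beta> v(1) v(1) zero_le_one _ M])
   show "0 \<le> 2 * \<rho>" using \<rho> by simp
  qed (use \<rho> v d in \<open>auto intro!: lipschitz_onI\<close>)
  then show ?thesis using \<rho> by (intro exI[of _ "ball x \<rho>"]) auto
 qed
 have boundary: "\<exists>N. open N \<and> x \<in> N \<and> Sobolev_bounded_on \<Omega> p q M (N \<inter> \<Omega>)" if x: "x \<in> frontier \<Omega>" for x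
 proof -
  obtain U and V :: "(real^'m) set" and \<phi> \<psi> L where c: "open U" "x \<in> U" "open V" "homeomorphism (V \<times> {-1<..<1::real}) U \<phi> \<psi>"
    "L-lipschitz_on (V \<times> {-1<..<1}) \<phi>" "L-lipschitz_on U \<psi>" "\<phi> ` (V \<times> {-1<..<0}) = U \<inter> \<Omega>" "\<phi> ` (V \<times> {0}) = U \<inter> frontier \<Omega>"
   using \<Omega> x unfolding bounded_lipschitz_domain_def by meson
  have "x \<in> \<phi> ` (V \<times> {0})" using c x by auto
  then obtain a where a: "a \<in> V" "\<phi> (a, 0) = x" by auto
  obtain \<rho> where \<rho>: "\<rho> > 0" "cball a \<rho> \<subseteq> V" using c(3) a open_contains_cball by blast
  have inv: "\<psi> (\<phi> w) = w" if "w \<in> V \<times> {-1<..<1}" for w using homeomorphism_apply1[OF c(4) that] .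
  have im: "\<phi> ` (V \<times> {-1<..<1}) = U" using homeomorphism_image1[OF c(4)] .
  define l where "l = (\<lambda>k. - (1/2) / (real k + 2))"
  have l: "- (1/4) \<le> l k" "l k < 0" for k by (auto simp: l_def field_simps)
  have l_mono: "l i \<le> l k" if "i \<le> k" for i k using that by (auto simp: l_def field_simps)
  define B where "B = (\<lambda>k. cball a \<rho> \<times> {-(1/2)..l k})"
  have l1: "l k < 1" for k using l[of k] by linarith
  have BV: "B k \<subseteq> V \<times> {-1<..<0}" for k
  proof
   fix w assume "w \<in> B k"
   then show "w \<in> V \<times> {-1<..<0}" using \<rho> l[of k] by (auto simp: B_def dest!: subsetD)
  qed
  then have BV': "B k \<subseteq> V \<times> {-1<..<1}" for k by force
  have BU: "\<phi> ` B k \<subseteq> U \<inter> \<Omega>" for k using image_mono[OF BV, of \<phi>] c(7) by blast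
  define v where "v = unit_ball_vol (real CARD('m)) * \<rho> ^ CARD('m)"
  have v: "v > 0" "emeasure lborel (cball a \<rho>) = ennreal v" using \<rho> by (auto simp: v_def emeasure_cball)
  have meas: "emeasure lborel (B k) = ennreal (v * (l k + 1/2))" for k
  proof -
   have "emeasure lborel (B k) = emeasure (lborel \<Otimes>\<^sub>M lborel) (cball a \<rho> \<times> {-(1/2)..l k})" by (simp add: B_def lborel_prod)
   also have "\<dots> = emeasure lborel (cball a \<rho>) * emeasure lborel {-(1/2)..l k}"
    by (rule lborel.emeasure_pair_measure_Times) auto
   also have "\<dots> = ennreal v * ennreal (l k + 1/2)" using l[of k] by (simp add: v)
   finally show ?thesis using v l[of k] by (simp add: ennreal_mult)
  qed
  define N where "N = \<phi> ` (ball a \<rho> \<times> {-(1/2)<..<1/2})"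
  have N_sub: "ball a \<rho> \<times> {-(1/2)<..<1/2} \<subseteq> V \<times> {-1<..<1::real}" using \<rho> by auto
  have "openin (top_of_set U) N"
   unfolding N_def
  proof (rule homeomorphism_imp_open_map[OF c(4)])
   show "openin (top_of_set (V \<times> {-1<..<1})) (ball a \<rho> \<times> {-(1/2)<..<1/2::real})"
    by (intro open_subset N_sub open_Times) auto
  qed
  then have "open N" using c(1) openin_open_eq by blast
  moreover have "x \<in> N" using a \<rho> by (force simp: N_def)
  moreover have "Sobolev_bounded_on \<Omega> p q M (N \<inter> \<Omega>)"
  proof (rule Sobolev_bounded_on_charts[where B = B and \<phi> = \<phi> and s = \<psi>, OF _ op p q(1) \<beta>])
   show "DIM((real^'m) \<times> real) = CARD('n)" using dim by simp
   show "0 < v / 4" "0 < v / 2" using v by auto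
   show "0 \<le> L" by (rule lipschitz_on_nonneg[OF c(5)])
   show "0 \<le> 2 * \<rho> + 1" using \<rho> by simp
   show "0 \<le> M" by (rule M)
   show "incseq B" using l_mono by (fastforce simp: incseq_def B_def)
   show "compact (B k)" "convex (B k)" for k by (auto simp: B_def intro!: compact_Times convex_Times)
   show "ennreal (v / 4) \<le> emeasure lborel (B k)" for k
    using mult_left_mono[of "1/4" "l k + 1/2" v] l[of k] v unfolding meas by (intro ennreal_leI) auto
   show "emeasure lborel (B k) \<le> ennreal (v / 2)" for k
    using mult_left_mono[of "l k + 1/2" "1/2" v] l[of k] v unfolding meas by (intro ennreal_leI) auto
   show "norm (w' - w) \<le> 2 * \<rho> + 1" if w: "w \<in> B k" "w' \<in> B k" for k w w'
   proof -
    obtain y t y' t' where wt: "w = (y, t)" "w' = (y', t')" by (metis surj_pair)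
    have "norm (y' - y) \<le> 2 * \<rho>"
     using dist_triangle[of y' y a] w by (simp add: wt B_def dist_norm norm_minus_commute dist_commute)
    moreover have "norm (t' - t) \<le> 1" using w l[of k] by (auto simp: wt B_def)
    ultimately show ?thesis using norm_Pair_le[of "y' - y" "t' - t"] by (simp add: wt)
   qed
   show "L-lipschitz_on (B k) \<phi>" for k by (rule lipschitz_on_subset[OF c(5) BV'])
   show "L-lipschitz_on (\<phi> ` B k) \<psi>" for k using BU by (intro lipschitz_on_subset[OF c(6)]) auto
   show "\<psi> (\<phi> w) = w" if "w \<in> B k" for k w using inv BV' that by blast
   show "\<phi> ` B k \<subseteq> \<Omega>" for k using BU by auto
   show "N \<inter> \<Omega> \<subseteq> (\<Union>k. \<phi> ` B k)"
   proof
    fix z assume z: "z \<in> N \<inter> \<Omega>"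
    then obtain y t where yt: "z = \<phi> (y, t)" "y \<in> ball a \<rho>" "-(1/2) < t" "t < 1/2" by (auto simp: N_def)
    have "(y, t) \<in> V \<times> {-1<..<1}" using yt by (intro subsetD[OF N_sub]) simp
    then have "z \<in> U" using im yt by auto
    then have "z \<in> \<phi> ` (V \<times> {-1<..<0})" using z c(7) by auto
    then obtain y' t' where yt': "z = \<phi> (y', t')" "y' \<in> V" "-1 < t'" "t' < 0" by auto
    have "(y, t) = (y', t')"
     using inv[of "(y, t)"] inv[of "(y', t')"] \<open>(y, t) \<in> _\<close> yt yt' by auto
    then have t: "t < 0" using yt' by simp
    obtain k where "1 / (- t) < real k" using reals_Archimedean2 by blast
    then have "t \<le> l k" using t by (auto simp: l_def field_simps)
    then have "(y, t) \<in> B k" using yt by (auto simp: B_def)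
    then show "z \<in> (\<Union>k. \<phi> ` B k)" using yt by blast
   qed
  qed
  ultimately show ?thesis by blast
 qed
 have "\<exists>N. open N \<and> x \<in> N \<and> Sobolev_bounded_on \<Omega> p q M (N \<inter> \<Omega>)" if "x \<in> closure \<Omega>" for x
  using that interior boundary closure_Un_frontier[of \<Omega>] by blast
 then obtain N where N: "\<And>x. x \<in> closure \<Omega> ==> open (N x) \<and> x \<in> N x \<and> Sobolev_bounded_on \<Omega> p q M (N x \<inter> \<Omega>)" by metis
 have "compact (closure \<Omega>)" using bd by simp
 then obtain X where X: "X \<subseteq> closure \<Omega>" "finite X" "closure \<Omega> \<subseteq> (\<Union>x\<in>X. N x)"
  using N by (elim compactE_image[where C = "closure \<Omega>" and f = N]) auto
 have "Sobolev_bounded_on \<Omega> p q M (\<Union>((\<lambda>x. N x \<inter> \<Omega>) ` X))"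
  using X N op by (intro Sobolev_bounded_on_Union) auto
 moreover have "(\<Union>((\<lambda>x. N x \<inter> \<Omega>) ` X)) = \<Omega>" using X closure_subset[of \<Omega>] by blast
 ultimately have "\<exists>C. \<forall>f g. sobolev_pair \<Omega> p M f g --> (\<integral>\<^sub>+z. ennreal (f z powr q) * indicator \<Omega> z) \<le> ennreal C"
  unfolding Sobolev_bounded_on_def by simp
 then show thesis using that by blast
qed

section \<open>Membership and convergence in Lebesgue and Sobolev spaces\<close>

lemma finite_measure_lebesgue_on:
 fixes \<Omega> :: "'a::euclidean_space set"
 assumes "bounded \<Omega>" "\<Omega> \<in> sets borel"
 shows "finite_measure (lebesgue_on \<Omega>)"
 using emeasure_bounded_finite[OF assms(1)] assms(2)
 by (intro finite_measureI) (simp add: emeasure_restrict_space)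

lemma Lp_spaceI:
 fixes f :: "real^'n::finite => 'b::euclidean_space"
 assumes [measurable]: "f \<in> borel_measurable (lebesgue_on \<Omega>)" and fin: "(\<integral>\<^sup>+z. ennreal (norm (f z) powr p) \<partial>lebesgue_on \<Omega>) < \<infinity>"
 shows "f \<in> Lp_space p \<Omega>"
proof -
 have "integrable (lebesgue_on \<Omega>) (\<lambda>z. norm (f z) powr p)" using fin by (intro integrableI_bounded) auto
 then show ?thesis using assms(1) by (simp add: Lp_space_def)
qed

lemma Sobolev_uniform_bound:
 fixes \<Omega> :: "(real^'n::finite) set" and f0 g :: "nat => real^'n => real"
 assumes dim: "CARD('n) = CARD('m::finite) + 1" and \<Omega>: "bounded_lipschitz_domain TYPE('m) \<Omega>"
  and p: "p \<ge> 1" and q: "q \<ge> p" "ereal q < sobolev_conjugate CARD('n) p"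
  and f0: "\<And>m. f0 m \<in> Lp_space p \<Omega>" "\<And>m z. f0 m z \<ge> 0" "\<And>m. (LINT z|lebesgue_on \<Omega>. \<bar>f0 m z\<bar> powr p) \<le> K"
  and g: "\<And>m. integrable lborel (g m)" "\<And>m z. g m z \<ge> 0" "\<And>m. (\<integral>\<^sub>+z. ennreal (g m z powr p)) \<le> ennreal K"
  and G: "\<And>m. \<exists>G. weak_gradient \<Omega> (f0 m) G \<and> (AE z\<in>\<Omega> in lborel. norm (G z) \<le> g m z)"
 obtains C where "C \<ge> 0" "\<And>m. (\<integral>\<^sub>+z. ennreal (f0 m z powr q) * indicator \<Omega> z) \<le> ennreal C"
proof -
 have op: "open \<Omega>" and bd: "bounded \<Omega>" using \<Omega> by (auto simp: bounded_lipschitz_domain_def)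
 have b[measurable]: "\<Omega> \<in> sets borel" using op by auto
 have K: "K \<ge> 0" using order_trans[OF integral_nonneg_AE f0(3)[of 0]] by (auto intro!: AE_I2)
 define A where "A = measure lborel \<Omega> + 1"
 have A: "A > 0" "emeasure lborel \<Omega> \<le> ennreal A"
  using emeasure_bounded_finite[OF bd] by (auto simp: A_def emeasure_eq_ennreal_measure less_top intro!: add_nonneg_pos ennreal_leI)
 define S where "S = 2 * A powr (1 - 1/p) * K powr (1/p)"
 have MK: "max S K \<ge> 0" using K by simp
 show thesis
 proof (rule Sobolev_inequality_Lipschitz_domain[OF dim \<Omega> p q MK])
 fix C assume C: "\<And>f g. sobolev_pair \<Omega> p (max S K) f g ==> (\<integral>\<^sub>+z. ennreal (f z powr q) * indicator \<Omega> z) \<le> ennreal C"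
 show thesis
 proof (rule that[of "max 0 C"])
  fix m
  obtain f where f: "f \<in> borel_measurable borel" "\<And>z. z \<notin> \<Omega> ==> f z = 0" "AE z\<in>\<Omega> in lborel. f z = f0 m z"
   "integrable lborel f" "(\<integral>\<^sub>+z. ennreal (\<bar>f z\<bar> powr p)) = ennreal (LINT z|lebesgue_on \<Omega>. \<bar>f0 m z\<bar> powr p)"
   by (rule Lp_space_representative[OF f0(1)[of m] bd op p]) (rule that)
  note f(1)[measurable]
  have ae: "AE z\<in>\<Omega> in lborel. \<bar>f z\<bar> = f0 m z"
   using f(3) by eventually_elim (use f0(2)[of m] in auto)
  have "(\<integral>\<^sub>+z. ennreal \<bar>f z\<bar>) = (\<integral>\<^sub>+z. ennreal \<bar>f z\<bar> * indicator \<Omega> z)"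
   by (intro nn_integral_cong) (use f(2) in \<open>auto simp: indicator_def\<close>)
  also have "\<dots> = (\<integral>\<^sup>+z. ennreal \<bar>f z\<bar> \<partial>density lborel (indicator \<Omega>))"
   by (rule nn_integral_density_indicator[symmetric]) measurable
  also have "\<dots> \<le> ennreal S"
   unfolding S_def
  proof (rule nn_integral_Holder_bound[OF _ _ _ A(1) p _ K])
   show "emeasure (density lborel (indicator \<Omega>)) (space (density lborel (indicator \<Omega>))) \<le> ennreal A"
    using A finite_measure_density_indicator(2)[OF bd b] by simp
   have "(\<integral>\<^sup>+z. ennreal (\<bar>f z\<bar> powr p) \<partial>density lborel (indicator \<Omega>)) \<le> (\<integral>\<^sub>+z. ennreal (\<bar>f z\<bar> powr p))"
    by (subst nn_integral_density_indicator) (auto intro!: nn_integral_mono simp: indicator_def)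
   also note f(5)
   also have "ennreal (LINT z|lebesgue_on \<Omega>. \<bar>f0 m z\<bar> powr p) \<le> ennreal K" by (rule ennreal_leI[OF f0(3)])
   finally show "(\<integral>\<^sup>+z. ennreal (\<bar>f z\<bar> powr p) \<partial>density lborel (indicator \<Omega>)) \<le> ennreal K" .
  qed auto
  finally have "(\<integral>\<^sub>+z. ennreal \<bar>f z\<bar>) \<le> ennreal (max S K)" by (rule order_trans) (simp add: ennreal_leI)
  moreover have "(\<integral>\<^sub>+z. ennreal (g m z powr p)) \<le> ennreal (max S K)" by (rule order_trans[OF g(3)]) (simp add: ennreal_leI)
  ultimately have "sobolev_pair \<Omega> p (max S K) (\<lambda>z. \<bar>f z\<bar>) (g m)"
   unfolding sobolev_pair_def using f(4) g(1,2) G[of m] ae by auto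
  from C[OF this] have "(\<integral>\<^sub>+z. ennreal (\<bar>f z\<bar> powr q) * indicator \<Omega> z) \<le> ennreal (max 0 C)"
   by (rule order_trans) (simp add: ennreal_leI)
  moreover have "(\<integral>\<^sub>+z. ennreal (f0 m z powr q) * indicator \<Omega> z) = (\<integral>\<^sub>+z. ennreal (\<bar>f z\<bar> powr q) * indicator \<Omega> z)"
   by (rule nn_integral_cong_AE) (use ae in eventually_elim, auto simp: indicator_def)
  ultimately show "(\<integral>\<^sub>+z. ennreal (f0 m z powr q) * indicator \<Omega> z) \<le> ennreal (max 0 C)" by simp
 qed simp
 qed
qed

lemma nn_integral_mdist_powr_le:
 assumes \<Omega>: "\<Omega> \<in> sets borel" and m: "(\<lambda>z. mdist X x (u z)) \<in> borel_measurable (lebesgue_on \<Omega>)"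
  and x: "x \<in> mspace X" "y \<in> mspace X" "\<And>z. z \<in> \<Omega> ==> u z \<in> mspace X" and d: "mdist X y x \<le> d" and q: "q \<ge> 0"
 shows "(\<integral>\<^sub>+z. ennreal (mdist X y (u z) powr q) * indicator \<Omega> z) \<le>
  ennreal (2 powr q) * (ennreal (d powr q) * emeasure lborel \<Omega> + (\<integral>\<^sub>+z. ennreal (mdist X x (u z) powr q) * indicator \<Omega> z))"
proof -
 note m[measurable]
 have "(\<integral>\<^sup>+z. ennreal (mdist X y (u z) powr q) \<partial>lebesgue_on \<Omega>) \<le>
   (\<integral>\<^sup>+z. ennreal (2 powr q) * (ennreal (d powr q) + ennreal (mdist X x (u z) powr q)) \<partial>lebesgue_on \<Omega>)"
 proof (rule nn_integral_mono)
  fix z assume "z \<in> space (lebesgue_on \<Omega>)"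
  then have "mdist X y (u z) \<le> d + mdist X x (u z)" using mdist_triangle_of[of y X x "u z"] x d by auto
  then have "mdist X y (u z) powr q \<le> (d + mdist X x (u z)) powr q" using q by (intro powr_mono2) (auto simp: mdist_nonneg_of)
  also have "\<dots> \<le> 2 powr q * (d powr q + mdist X x (u z) powr q)"
   using d order_trans[OF mdist_nonneg_of d] q by (intro powr_sum_le) (auto simp: mdist_nonneg_of)
  finally show "ennreal (mdist X y (u z) powr q) \<le> ennreal (2 powr q) * (ennreal (d powr q) + ennreal (mdist X x (u z) powr q))"
   by (simp add: ennreal_mult[symmetric] ennreal_plus[symmetric] ennreal_leI del: ennreal_plus)
 qed
 also have "\<dots> = ennreal (2 powr q) * (ennreal (d powr q) * emeasure (lebesgue_on \<Omega>) (space (lebesgue_on \<Omega>)) + (\<integral>\<^sup>+z. ennreal (mdist X x (u z) powr q) \<partial>lebesgue_on \<Omega>))"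
  by (subst nn_integral_cmult, measurable, subst nn_integral_add) auto
 also have "emeasure (lebesgue_on \<Omega>) (space (lebesgue_on \<Omega>)) = emeasure lborel \<Omega>"
  using \<Omega> by (simp add: emeasure_restrict_space)
 finally show ?thesis by (simp add: nn_integral_lebesgue_on[OF \<Omega>])
qed

lemma Lp_maps_mdist_Lp_space:
 fixes \<Omega> :: "(real^'n::finite) set"
 assumes u: "u \<in> Lp_maps p \<Omega> X" and \<Omega>: "bounded \<Omega>" "\<Omega> \<in> sets borel" and p: "p \<ge> 0" and y: "y \<in> mspace X"
 shows "(\<lambda>z. mdist X y (u z)) \<in> Lp_space p \<Omega>"
proof (rule Lp_spaceI)
 show "(\<lambda>z. mdist X y (u z)) \<in> borel_measurable (lebesgue_on \<Omega>)" by (rule Lp_maps_mdist_measurable[OF u y])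
 obtain x where x: "x \<in> mspace X" "(\<lambda>z. mdist X x (u z)) \<in> Lp_space p \<Omega>" using u by (auto simp: Lp_maps_def)
 then have "integrable (lebesgue_on \<Omega>) (\<lambda>z. mdist X x (u z) powr p)" by (simp add: Lp_space_def mdist_nonneg_of)
 then have fin: "(\<integral>\<^sup>+z. ennreal (mdist X x (u z) powr p) \<partial>lebesgue_on \<Omega>) < \<infinity>"
  by (simp add: integrable_iff_bounded)
 have "(\<integral>\<^sub>+z. ennreal (mdist X y (u z) powr p) * indicator \<Omega> z) \<le>
  ennreal (2 powr p) * (ennreal (mdist X y x powr p) * emeasure lborel \<Omega> + (\<integral>\<^sub>+z. ennreal (mdist X x (u z) powr p) * indicator \<Omega> z))"
  by (rule nn_integral_mdist_powr_le[OF \<Omega>(2) Lp_maps_mdist_measurable[OF u x(1)] x(1) y Lp_maps_values[OF u] order_refl p])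
 also have "\<dots> < \<infinity>"
  using fin emeasure_bounded_finite[OF \<Omega>(1)] by (simp add: nn_integral_lebesgue_on[OF \<Omega>(2)] ennreal_mult_less_top ennreal_add_less_top less_top)
 finally show "(\<integral>\<^sup>+z. ennreal (norm (mdist X y (u z)) powr p) \<partial>lebesgue_on \<Omega>) < \<infinity>"
  by (simp add: nn_integral_lebesgue_on[OF \<Omega>(2)] mdist_nonneg_of)
qed

text \<open>Fatou's lemma bounds the integral, and the union of sequences that are dense for the \<open>f
 j\<close> is dense for \<open>v\<close>.\<close>
lemma AE_limit_in_Lp_maps:
 fixes f :: "nat => real^'n::finite => 'z"
 assumes f: "\<And>j. f j \<in> Lp_maps p \<Omega> Z" and \<Omega>: "\<Omega> \<in> sets borel" and vZ: "\<And>z. v z \<in> mspace Z"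
  and lim: "AE z\<in>\<Omega> in lborel. (\<lambda>j. mdist Z (f j z) (v z)) \<longlonglongrightarrow> 0"
  and z0: "z0 \<in> mspace Z" and q: "q > 0" and C: "\<And>j. (\<integral>\<^sub>+z. ennreal (mdist Z z0 (f j z) powr q) * indicator \<Omega> z) \<le> ennreal C"
 shows "(\<integral>\<^sub>+z. ennreal (mdist Z z0 (v z) powr q) * indicator \<Omega> z) \<le> ennreal C" "v \<in> Lp_maps q \<Omega> Z"
proof -
 have fm: "f j \<in> lebesgue_on \<Omega> \<rightarrow>\<^sub>M sigma (mspace Z) {U. openin (mtopology_of Z) U}" for j using f[of j] by (simp add: Lp_maps_def)
 have fZ: "f j z \<in> mspace Z" if "z \<in> \<Omega>" for j z using Lp_maps_values[OF f that] .
 have vm: "v \<in> lebesgue_on \<Omega> \<rightarrow>\<^sub>M sigma (mspace Z) {U. openin (mtopology_of Z) U}"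
  by (rule AE_limit_measurable[OF fm \<Omega> fZ vZ lim])
 have [measurable]: "(\<lambda>z. mdist Z z0 (f j z)) \<in> borel_measurable (lebesgue_on \<Omega>)" for j by (rule mdist_measurable[OF fm z0])
 have "(\<integral>\<^sup>+z. ennreal (mdist Z z0 (v z) powr q) \<partial>lebesgue_on \<Omega>) = (\<integral>\<^sup>+z. liminf (\<lambda>j. ennreal (mdist Z z0 (f j z) powr q)) \<partial>lebesgue_on \<Omega>)"
 proof (rule nn_integral_cong_AE, subst AE_lebesgue_on_iff[OF \<Omega>], use lim in eventually_elim, intro impI)
  fix z assume l: "z \<in> \<Omega> --> (\<lambda>j. mdist Z (f j z) (v z)) \<longlonglongrightarrow> 0" and z: "z \<in> \<Omega>"
  have "(\<lambda>j. mdist Z z0 (f j z) - mdist Z z0 (v z)) \<longlonglongrightarrow> 0"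
   by (rule Lim_null_comparison[OF _ l[rule_format, OF z]])
    (use abs_mdist_diff_le[OF z0 fZ[OF z] vZ] in \<open>auto\<close>)
  then have "(\<lambda>j. mdist Z z0 (f j z)) \<longlonglongrightarrow> mdist Z z0 (v z)" by (simp add: LIM_zero_iff)
  then have "(\<lambda>j. ennreal (mdist Z z0 (f j z) powr q)) \<longlonglongrightarrow> ennreal (mdist Z z0 (v z) powr q)"
   using q by (intro tendsto_ennrealI tendsto_powr') (auto simp: mdist_nonneg_of)
  then show "ennreal (mdist Z z0 (v z) powr q) = liminf (\<lambda>j. ennreal (mdist Z z0 (f j z) powr q))"
   by (intro lim_imp_Liminf[symmetric]) auto
 qed
 also have "\<dots> \<le> liminf (\<lambda>j. \<integral>\<^sup>+z. ennreal (mdist Z z0 (f j z) powr q) \<partial>lebesgue_on \<Omega>)"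
  by (rule nn_integral_liminf) measurable
 also have "\<dots> \<le> liminf (\<lambda>j. ennreal C)"
  by (intro Liminf_mono always_eventually allI) (simp add: nn_integral_lebesgue_on[OF \<Omega>] C)
 finally show 1: "(\<integral>\<^sub>+z. ennreal (mdist Z z0 (v z) powr q) * indicator \<Omega> z) \<le> ennreal C"
  by (simp add: nn_integral_lebesgue_on[OF \<Omega>] Liminf_const)
 define D where "D = (\<lambda>j (c :: nat => 'z). (\<forall>i. c i \<in> mspace Z) \<and> (AE z\<in>\<Omega> in lborel. (\<forall>\<epsilon>>0. \<exists>i. mdist Z (c i) (f j z) < \<epsilon>)))"
 have "\<exists>c. D j c" for j
 proof -
  obtain c :: "nat => 'z" where c: "\<And>i. c i \<in> mspace Z" "AE z\<in>\<Omega> in lborel. (\<forall>\<epsilon>>0. \<exists>i. mdist Z (c i) (f j z) < \<epsilon>)"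
   by (rule Lp_maps_dense_sequence[OF f \<Omega>, of j]) (rule that)
  show ?thesis unfolding D_def by (intro exI[of _ c] conjI allI c)
 qed
 then obtain c where "\<And>j. D j (c j)" by metis
 then have c: "\<And>j i. c j i \<in> mspace Z" "\<And>j. AE z\<in>\<Omega> in lborel. (\<forall>\<epsilon>>0. \<exists>i. mdist Z (c j i) (f j z) < \<epsilon>)"
  unfolding D_def by auto
 have "AE z in lborel. \<forall>j. z \<in> \<Omega> --> (\<forall>\<epsilon>>0. \<exists>i. mdist Z (c j i) (f j z) < \<epsilon>)"
  unfolding AE_all_countable using c(2) by blast
 then have d: "AE z\<in>\<Omega> in lborel. (\<forall>\<epsilon>>0. \<exists>i. mdist Z (case_prod c (prod_decode i)) (v z) < \<epsilon>)"
  using lim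
 proof (eventually_elim, intro impI allI)
  fix z and \<epsilon> :: real
  assume a: "\<forall>j. z \<in> \<Omega> --> (\<forall>\<epsilon>>0. \<exists>i. mdist Z (c j i) (f j z) < \<epsilon>)" "z \<in> \<Omega> --> (\<lambda>j. mdist Z (f j z) (v z)) \<longlonglongrightarrow> 0" "z \<in> \<Omega>" "\<epsilon> > 0"
  then have "(\<lambda>j. mdist Z (f j z) (v z)) \<longlonglongrightarrow> 0" by simp
  then have "\<forall>\<^sub>F j in sequentially. mdist Z (f j z) (v z) < \<epsilon> / 2" using a(4) by (intro order_tendstoD) auto
  then obtain j where j: "mdist Z (f j z) (v z) < \<epsilon> / 2" by (auto simp: eventually_sequentially)
  obtain i where i: "mdist Z (c j i) (f j z) < \<epsilon> / 2" using a(1,3) half_gt_zero[OF a(4)] by blast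
  have "mdist Z (c j i) (v z) < \<epsilon>" using mdist_triangle_of[OF c(1)[of j i] fZ[OF a(3), of j] vZ[of z]] i j by linarith
  then show "\<exists>i. mdist Z (case_prod c (prod_decode i)) (v z) < \<epsilon>" by (intro exI[of _ "prod_encode (j, i)"]) simp
 qed
 show "v \<in> Lp_maps q \<Omega> Z"
 proof (rule Lp_mapsI[OF vm \<Omega> vZ _ d z0])
  show "case_prod c (prod_decode i) \<in> mspace Z" for i by (simp add: c split: prod.split)
  show "(\<integral>\<^sub>+z. ennreal (mdist Z z0 (v z) powr q) * indicator \<Omega> z) < \<infinity>" using 1 by (rule le_less_trans) simp
 qed
qed

text \<open>Distance functions are 1-Lipschitz, so \<open>h\<close> is a segment bound for each \<open>mdist Z y
 \<circ> v\<close> with the same \<open>h\<close>.\<close>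
lemma segment_bound_imp_W1p_maps:
 fixes v :: "real^'n::finite => 'z" and h :: "real^'n => real"
 assumes \<Omega>: "open \<Omega>" "bounded \<Omega>" and p: "p \<ge> 1" and v: "v \<in> Lp_maps p \<Omega> Z"
  and h: "h \<in> borel_measurable borel" "\<And>z. h z \<ge> 0" "\<And>z. z \<notin> \<Omega> ==> h z = 0" "(\<integral>\<^sub>+z. ennreal (h z powr p)) < \<infinity>"
  and sb: "segment_bound \<Omega> Z v h"
 shows "v \<in> W1p_maps p \<Omega> Z"
proof -
 note h(1)[measurable]
 have b[measurable]: "\<Omega> \<in> sets borel" using \<Omega> by auto
 have hi: "integrable lborel h" using h by (intro integrable_of_powr_bounded_support[OF h(1) \<Omega>(2) b h(3) p]) auto
 have to_on: "k \<in> borel_measurable (lebesgue_on \<Omega>)" if "k \<in> borel_measurable borel" for k :: "real^'n => 'b::euclidean_space"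
  using that by (intro measurable_restrict_space1 measurable_completion) simp
 have h_le: "(\<integral>\<^sup>+z. ennreal (h z powr p) \<partial>lebesgue_on \<Omega>) < \<infinity>"
  unfolding nn_integral_lebesgue_on[OF b]
  by (rule le_less_trans[OF nn_integral_mono h(4)]) (simp add: indicator_def)
 have hL: "h \<in> Lp_space p \<Omega>" using h_le h(2) by (intro Lp_spaceI to_on) auto
 have "(\<lambda>z. mdist Z y (v z)) \<in> W1p p \<Omega> \<and> (\<exists>G. weak_gradient \<Omega> (\<lambda>z. mdist Z y (v z)) G \<and> (AE z in lebesgue_on \<Omega>. norm (G z) \<le> h z))"
  if y: "y \<in> mspace Z" for y
 proof -
  have f0: "(\<lambda>z. mdist Z y (v z)) \<in> Lp_space p \<Omega>" using p by (intro Lp_maps_mdist_Lp_space[OF v \<Omega>(2) b _ y]) simp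
  then have f0m: "(\<lambda>z. mdist Z y (v z)) \<in> borel_measurable (lebesgue_on \<Omega>)" by (simp add: Lp_space_def)
  obtain f where "f \<in> borel_measurable borel" "\<And>z. z \<notin> \<Omega> ==> f z = 0" and f: "AE z\<in>\<Omega> in lborel. f z = mdist Z y (v z)" "integrable lborel f"
   by (rule Lp_space_representative[OF f0 \<Omega>(2,1) p]) (rule that)
  have "segment_bound \<Omega> euclidean_metric f h"
   unfolding segment_bound_def
  proof
   fix \<xi>
   show "AE z in lborel. closed_segment z (z + \<xi>) \<subseteq> \<Omega> --> ennreal (mdist euclidean_metric (f z) (f (z + \<xi>)))
     \<le> ennreal (norm \<xi>) * segment_integral h z \<xi>"
    using sb[unfolded segment_bound_def, rule_format, of \<xi>] f(1) AE_lborel_translate[OF f(1), of \<xi>]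
   proof (eventually_elim, intro impI)
    fix z assume a: "closed_segment z (z + \<xi>) \<subseteq> \<Omega> --> ennreal (mdist Z (v z) (v (z + \<xi>))) \<le> ennreal (norm \<xi>) * segment_integral h z \<xi>"
     "z \<in> \<Omega> --> f z = mdist Z y (v z)" "z + \<xi> \<in> \<Omega> --> f (z + \<xi>) = mdist Z y (v (z + \<xi>))" "closed_segment z (z + \<xi>) \<subseteq> \<Omega>"
    then have in_\<Omega>: "z \<in> \<Omega>" "z + \<xi> \<in> \<Omega>" by auto
    have le: "mdist euclidean_metric (f z) (f (z + \<xi>)) \<le> mdist Z (v z) (v (z + \<xi>))"
     using a in_\<Omega> abs_mdist_diff_le[OF y Lp_maps_values[OF v in_\<Omega>(1)] Lp_maps_values[OF v in_\<Omega>(2)]] by (simp add: dist_real_def)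
    show "ennreal (mdist euclidean_metric (f z) (f (z + \<xi>))) \<le> ennreal (norm \<xi>) * segment_integral h z \<xi>"
     by (rule order_trans[OF ennreal_leI[OF le] a(1)[rule_format, OF a(4)]])
   qed
  qed
  then obtain G where G: "G \<in> borel_measurable borel" "weak_gradient \<Omega> (\<lambda>z. mdist Z y (v z)) G" "AE z\<in>\<Omega> in lborel. norm (G z) \<le> h z"
   by (rule segment_bound_imp_weak_gradient[OF \<Omega> f(2) f0m f(1) hi h(2)]) (rule that)
  have Gh: "AE z in lebesgue_on \<Omega>. norm (G z) \<le> h z" using G(3) by (subst AE_lebesgue_on_iff[OF b])
  have "(\<integral>\<^sup>+z. ennreal (norm (G z) powr p) \<partial>lebesgue_on \<Omega>) \<le> (\<integral>\<^sup>+z. ennreal (h z powr p) \<partial>lebesgue_on \<Omega>)"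
   by (rule nn_integral_mono_AE) (use Gh in eventually_elim, use p in \<open>auto intro!: ennreal_leI powr_mono2\<close>)
  then have "G \<in> Lp_space p \<Omega>" using h_le by (intro Lp_spaceI to_on G) (rule le_less_trans)
  with f0 G(2) Gh show ?thesis unfolding W1p_def by blast
 qed
 then have "h \<in> gradient_bounds p \<Omega> Z v" using hL by (simp add: gradient_bounds_def)
 then show ?thesis using v by (auto simp: W1p_maps_def)
qed

text \<open>The distance \<open>mdist Z (f j z) (v z)\<close> is replaced by a measurable function that agrees
 with it almost everywhere.\<close>
lemma AE_limit_Lq_tendsto:
 fixes f :: "nat => real^'n::finite => 'z"
 assumes f: "\<And>j. f j \<in> Lp_maps p \<Omega> Z" and \<Omega>: "bounded \<Omega>" "\<Omega> \<in> sets borel" and v: "v \<in> Lp_maps p \<Omega> Z"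
  and lim: "AE z\<in>\<Omega> in lborel. (\<lambda>j. mdist Z (f j z) (v z)) \<longlonglongrightarrow> 0"
  and z0: "z0 \<in> mspace Z" and q: "0 < q" "q < q'"
  and C: "C \<ge> 0" "\<And>j. (\<integral>\<^sub>+z. ennreal (mdist Z z0 (f j z) powr q') * indicator \<Omega> z) \<le> ennreal C"
   "(\<integral>\<^sub>+z. ennreal (mdist Z z0 (v z) powr q') * indicator \<Omega> z) \<le> ennreal C"
 shows "(\<lambda>j. \<integral>\<^sup>+z. ennreal (mdist Z (f j z) (v z) powr q) \<partial>lebesgue_on \<Omega>) \<longlonglongrightarrow> 0"
proof -
 obtain c :: "nat => 'z" where c: "\<And>i. c i \<in> mspace Z" "AE z\<in>\<Omega> in lborel. (\<forall>\<epsilon>>0. \<exists>i. mdist Z (c i) (v z) < \<epsilon>)"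
  by (rule Lp_maps_dense_sequence[OF v \<Omega>(2)]) (rule that)
 have [measurable]: "(\<lambda>z. mdist Z y (f j z)) \<in> borel_measurable (lebesgue_on \<Omega>)" "(\<lambda>z. mdist Z y (v z)) \<in> borel_measurable (lebesgue_on \<Omega>)"
  if "y \<in> mspace Z" for j y by (rule Lp_maps_mdist_measurable[OF f that], rule Lp_maps_mdist_measurable[OF v that])
 define e where "e = (\<lambda>j z. enn2real (SUP i. ennreal \<bar>mdist Z (c i) (v z) - mdist Z (c i) (f j z)\<bar>))"
 have em: "e j \<in> borel_measurable (lebesgue_on \<Omega>)" for j unfolding e_def using c(1) by measurable
 have e: "AE z in lebesgue_on \<Omega>. \<forall>j. e j z = mdist Z (f j z) (v z)"
 proof (subst AE_lebesgue_on_iff[OF \<Omega>(2)], use c(2) in eventually_elim, intro impI allI)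
  fix z j assume a: "z \<in> \<Omega> --> (\<forall>\<epsilon>>0. \<exists>i. mdist Z (c i) (v z) < \<epsilon>)" "z \<in> \<Omega>"
  have "ennreal (mdist Z (v z) (f j z)) = (SUP i. ennreal \<bar>mdist Z (c i) (v z) - mdist Z (c i) (f j z)\<bar>)"
   using a by (intro mdist_eq_SUP_dense c Lp_maps_values[OF v] Lp_maps_values[OF f]) auto
  then have "e j z = enn2real (ennreal (mdist Z (v z) (f j z)))" by (simp only: e_def)
  then show "e j z = mdist Z (f j z) (v z)" by (simp add: mdist_nonneg_of mdist_commute_of)
 qed
 have "(\<lambda>j. \<integral>\<^sup>+z. ennreal (e j z powr q) \<partial>lebesgue_on \<Omega>) \<longlonglongrightarrow> 0"
 proof (rule AE_tendsto_bounded_imp_Lq_tendsto[OF finite_measure_lebesgue_on[OF \<Omega>] em _ _ q])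
  show "e j z \<ge> 0" for j z by (simp add: e_def)
  have "AE z in lebesgue_on \<Omega>. (\<lambda>j. mdist Z (f j z) (v z)) \<longlonglongrightarrow> 0" using lim by (subst AE_lebesgue_on_iff[OF \<Omega>(2)])
  with e show "AE z in lebesgue_on \<Omega>. (\<lambda>j. e j z) \<longlonglongrightarrow> 0" by eventually_elim simp
  fix j
  have "(\<integral>\<^sup>+z. ennreal (e j z powr q') \<partial>lebesgue_on \<Omega>)
   \<le> (\<integral>\<^sup>+z. ennreal (2 powr q') * (ennreal (mdist Z z0 (f j z) powr q') + ennreal (mdist Z z0 (v z) powr q')) \<partial>lebesgue_on \<Omega>)"
  proof (rule nn_integral_mono_AE, use e AE_space in eventually_elim)
   fix z assume a: "\<forall>j. e j z = mdist Z (f j z) (v z)" "z \<in> space (lebesgue_on \<Omega>)"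
   then have z: "z \<in> \<Omega>" by simp
   have "mdist Z (f j z) (v z) \<le> mdist Z z0 (f j z) + mdist Z z0 (v z)"
    using mdist_triangle_of[OF Lp_maps_values[OF f z] z0 Lp_maps_values[OF v z], of j] by (simp add: mdist_commute_of)
   then have "e j z powr q' \<le> (mdist Z z0 (f j z) + mdist Z z0 (v z)) powr q'"
    using a q by (intro powr_mono2) (auto simp: mdist_nonneg_of)
   also have "\<dots> \<le> 2 powr q' * (mdist Z z0 (f j z) powr q' + mdist Z z0 (v z) powr q')"
    using q by (intro powr_sum_le) (auto simp: mdist_nonneg_of)
   finally show "ennreal (e j z powr q') \<le> ennreal (2 powr q') * (ennreal (mdist Z z0 (f j z) powr q') + ennreal (mdist Z z0 (v z) powr q'))"
    by (simp add: ennreal_mult[symmetric] ennreal_plus[symmetric] ennreal_leI del: ennreal_plus)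
  qed
  also have "\<dots> = ennreal (2 powr q') * ((\<integral>\<^sup>+z. ennreal (mdist Z z0 (f j z) powr q') \<partial>lebesgue_on \<Omega>) + (\<integral>\<^sup>+z. ennreal (mdist Z z0 (v z) powr q') \<partial>lebesgue_on \<Omega>))"
  proof -
   have "(\<lambda>z. ennreal (mdist Z z0 (f j z) powr q')) \<in> borel_measurable (lebesgue_on \<Omega>)" "(\<lambda>z. ennreal (mdist Z z0 (v z) powr q')) \<in> borel_measurable (lebesgue_on \<Omega>)"
    using Lp_maps_mdist_measurable[OF f z0] Lp_maps_mdist_measurable[OF v z0] by measurable
   then show ?thesis by (subst nn_integral_cmult) (auto simp: nn_integral_add)
  qed
  also have "\<dots> \<le> ennreal (2 powr q') * (ennreal C + ennreal C)"
   using C(2)[of j] C(3) by (intro mult_left_mono add_mono) (simp_all add: nn_integral_lebesgue_on[OF \<Omega>(2)])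
  finally show "(\<integral>\<^sup>+z. ennreal (e j z powr q') \<partial>lebesgue_on \<Omega>) \<le> ennreal (2 powr q' * (C + C))"
   using C(1) by (simp add: ennreal_mult[symmetric] ennreal_plus[symmetric] del: ennreal_plus)
 qed
 moreover have "(\<integral>\<^sup>+z. ennreal (e j z powr q) \<partial>lebesgue_on \<Omega>) = (\<integral>\<^sup>+z. ennreal (mdist Z (f j z) (v z) powr q) \<partial>lebesgue_on \<Omega>)" for j
  by (rule nn_integral_cong_AE, use e in eventually_elim) simp
 ultimately show ?thesis by simp
qed

section \<open>The compactness theorem\<close>

lemma Lp_maps_mono:
 fixes \<Omega> :: "(real^'n::finite) set"
 assumes u: "u \<in> Lp_maps q' \<Omega> X" and \<Omega>: "bounded \<Omega>" "\<Omega> \<in> sets borel" and q: "0 \<le> q" "q \<le> q'"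
 shows "u \<in> Lp_maps q \<Omega> X"
proof -
 obtain x where x: "x \<in> mspace X" "(\<lambda>z. mdist X x (u z)) \<in> Lp_space q' \<Omega>" using u by (auto simp: Lp_maps_def)
 then have m[measurable]: "(\<lambda>z. mdist X x (u z)) \<in> borel_measurable (lebesgue_on \<Omega>)"
  and i: "integrable (lebesgue_on \<Omega>) (\<lambda>z. mdist X x (u z) powr q')" by (auto simp: Lp_space_def mdist_nonneg_of)
 interpret finite_measure "lebesgue_on \<Omega>" by (rule finite_measure_lebesgue_on[OF \<Omega>])
 have "integrable (lebesgue_on \<Omega>) (\<lambda>z. mdist X x (u z) powr q)"
 proof (rule Bochner_Integration.integrable_bound[OF Bochner_Integration.integrable_add[OF integrable_const[of 1] i]])
  have "mdist X x (u z) powr q \<le> 1 + mdist X x (u z) powr q'" for z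
  proof (cases "mdist X x (u z) \<le> 1")
   case True
   then have "mdist X x (u z) powr q \<le> 1 powr q" using q by (intro powr_mono2) (auto simp: mdist_nonneg_of)
   then show ?thesis by (simp add: add_increasing2)
  next
   case False
   then have "mdist X x (u z) powr q \<le> mdist X x (u z) powr q'" by (intro powr_mono q) simp
   then show ?thesis by linarith
  qed
  then show "AE z in lebesgue_on \<Omega>. norm (mdist X x (u z) powr q) \<le> norm (1 + mdist X x (u z) powr q')" by auto
 qed measurable
 then have "(\<lambda>z. mdist X x (u z)) \<in> Lp_space q \<Omega>" using m by (simp add: Lp_space_def mdist_nonneg_of)
 then show ?thesis using u x(1) by (auto simp: Lp_maps_def)
qed

lemma isometric_embedding_compose_Lp_maps:
 fixes \<Omega> :: "(real^'n::finite) set"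
 assumes \<phi>: "isometric_embedding X Z \<phi>" and u: "u \<in> Lp_maps p \<Omega> X" and \<Omega>: "\<Omega> \<in> sets borel"
  and z0: "z0 \<in> mspace Z" "(\<integral>\<^sub>+z. ennreal (mdist Z z0 (\<phi> (u z)) powr q) * indicator \<Omega> z) < \<infinity>"
 shows "\<phi> \<circ> u \<in> Lp_maps q \<Omega> Z"
proof -
 have uX: "u z \<in> mspace X" if "z \<in> \<Omega>" for z using Lp_maps_values[OF u that] .
 obtain c :: "nat => 'a" where c: "\<And>i. c i \<in> mspace X" "AE z\<in>\<Omega> in lborel. (\<forall>\<epsilon>>0. \<exists>i. mdist X (c i) (u z) < \<epsilon>)"
  by (rule Lp_maps_dense_sequence[OF u \<Omega>]) (rule that)
 show ?thesis
 proof (rule Lp_mapsI[OF _ \<Omega> _ _ _ z0(1), where c = "\<lambda>i. \<phi> (c i)"])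
  show "\<phi> \<circ> u \<in> lebesgue_on \<Omega> \<rightarrow>\<^sub>M sigma (mspace Z) {U. openin (mtopology_of Z) U}"
   using u uX by (intro isometric_embedding_measurable[OF \<phi>]) (auto simp: Lp_maps_def)
  show "AE z\<in>\<Omega> in lborel. (\<forall>\<epsilon>>0. \<exists>i. mdist Z (\<phi> (c i)) ((\<phi> \<circ> u) z) < \<epsilon>)"
   using c(2) by eventually_elim (use c(1) uX \<phi> in \<open>auto simp: isometric_embedding_def\<close>)
 qed (use \<phi> uX c(1) z0(2) in \<open>auto simp: isometric_embedding_def\<close>)
qed

lemma exponent_below_Sobolev_conjugate:
 assumes "p > 0" "n > 0"
 shows "ereal p < sobolev_conjugate n p"
proof (cases "p < n")
 case True
 have "p * (n - p) < n * p" using assms by (simp add: algebra_simps)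
 then have "p < n * p / (n - p)" using True by (simp add: pos_less_divide_eq)
 then show ?thesis using True by (simp add: sobolev_conjugate_def)
qed (simp add: sobolev_conjugate_def)

text \<open>By Fatou's lemma the lower limit is integrable, hence finite almost everywhere.\<close>
lemma infinitely_often_bounded_point:
 fixes h :: "nat => 'a => real"
 assumes h: "\<And>j. h j \<in> borel_measurable M" "\<And>j. (\<integral>\<^sup>+z. ennreal (h j z) \<partial>M) \<le> ennreal A"
 shows "AE z in M. \<exists>H. infinite {j. h j z < H}"
proof -
 note h(1)[measurable]
 have "(\<integral>\<^sup>+z. liminf (\<lambda>j. ennreal (h j z)) \<partial>M) \<le> liminf (\<lambda>j. \<integral>\<^sup>+z. ennreal (h j z) \<partial>M)" by (rule nn_integral_liminf) measurable
 also have "\<dots> \<le> liminf (\<lambda>j. ennreal A)" by (intro Liminf_mono always_eventually allI h(2))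
 also have "\<dots> < \<infinity>" by (simp add: Liminf_const)
 finally have "AE z in M. liminf (\<lambda>j. ennreal (h j z)) \<noteq> \<infinity>" by (intro nn_integral_PInf_AE) auto
 then show ?thesis
 proof eventually_elim
  case (elim z)
  define l where "l = enn2real (liminf (\<lambda>j. ennreal (h j z)))"
  have l: "liminf (\<lambda>j. ennreal (h j z)) = ennreal l" "l \<ge> 0" using elim by (auto simp: l_def less_top)
  have "infinite {j. h j z < l + 1}"
  proof
   assume "finite {j. h j z < l + 1}"
   then obtain N where "\<And>j. h j z < l + 1 ==> j < N" by (auto simp: finite_nat_set_iff_bounded)
   then have "\<forall>\<^sub>F j in sequentially. ennreal (l + 1) \<le> ennreal (h j z)"
    by (intro eventually_sequentiallyI[of N] ennreal_leI) (meson not_less)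
   then have "ennreal (l + 1) \<le> liminf (\<lambda>j. ennreal (h j z))" by (rule Liminf_bounded)
   then show False using l by simp
  qed
  then show ?case by blast
 qed
qed

theorem theorem1p5:
  fixes \<Omega> :: "(real^'n::finite) set"
    and X :: "'x metric"
    and u :: "nat \<Rightarrow> real^'n \<Rightarrow> 'x"
    and p :: real
  assumes "CARD('n) \<ge> 2"
    and "CARD('n) = CARD('m::finite) + 1"
    and "mcomplete_of X"
    and "bounded_lipschitz_domain TYPE('m) \<Omega>"
    and "p > 1"
    and "bounded_W1p_seq p \<Omega> X u"
  shows "\<exists>(r :: nat \<Rightarrow> nat) (Z :: 'x target metric) (\<phi> :: nat \<Rightarrow> 'x \<Rightarrow> 'x target) v.
    strict_mono r \<and> mcomplete_of Z \<and>
    (\<forall>m. isometric_embedding X Z (\<phi> m)) \<and>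
    v \<in> W1p_maps p \<Omega> Z \<and>
    (\<forall>q::real. 1 \<le> q \<and> ereal q < sobolev_conjugate CARD('n) p \<longrightarrow>
       converges_in_Lq q \<Omega> Z (\<lambda>m. \<phi> m \<circ> u (r m)) v)"
proof -
 note dom = assms(4)
 have op: "open \<Omega>" and bd: "bounded \<Omega>" and ne: "\<Omega> \<noteq> {}" using dom by (auto simp: bounded_lipschitz_domain_def)
 have b[measurable]: "\<Omega> \<in> sets borel" using op by auto
 have p: "p > 1" "p \<ge> 1" "p \<ge> 0" using assms(5) by auto
 have fin_\<Omega>: "emeasure lborel \<Omega> < \<infinity>" using emeasure_bounded_finite[OF bd] .
 have not_null: "\<Omega> \<notin> null_sets lborel"
 proof
  assume "\<Omega> \<in> null_sets lborel"
  then have "\<Omega> \<in> null_sets lebesgue" by (rule null_sets_completionI)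
  then show False using open_not_negligible[OF op ne] by (simp add: negligible_iff_null_sets)
 qed
 obtain x0 K where x0: "x0 \<in> mspace X"
  and K: "\<And>m. (LINT z|lebesgue_on \<Omega>. mdist X x0 (u m z) powr p) + reshetnyak_energy p \<Omega> X (u m) \<le> K"
  using assms(6) unfolding bounded_W1p_seq_def bdd_above_def by blast
 have u: "u m \<in> Lp_maps p \<Omega> X" "gradient_bounds p \<Omega> X (u m) \<noteq> {}" for m
  using assms(6) by (auto simp: bounded_W1p_seq_def W1p_maps_def)
 have uX: "u m z \<in> mspace X" if "z \<in> \<Omega>" for m z using Lp_maps_values[OF u(1) that] .
 have um[measurable]: "(\<lambda>z. mdist X x0 (u m z)) \<in> borel_measurable (lebesgue_on \<Omega>)" for m by (rule Lp_maps_mdist_measurable[OF u(1) x0])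
 have uL: "(\<lambda>z. mdist X x0 (u m z)) \<in> Lp_space p \<Omega>" for m by (rule Lp_maps_mdist_Lp_space[OF u(1) bd b p(3) x0])
 have pos: "0 \<le> (LINT z|lebesgue_on \<Omega>. mdist X x0 (u m z) powr p)" "0 \<le> reshetnyak_energy p \<Omega> X (u m)" for m
  unfolding reshetnyak_energy_def using u(2)[of m] by (auto intro!: integral_nonneg_AE cINF_greatest)
 define K' where "K' = K + 1"
 have K': "K' \<ge> 0" "(LINT z|lebesgue_on \<Omega>. mdist X x0 (u m z) powr p) \<le> K'" "reshetnyak_energy p \<Omega> X (u m) < K'" for m
  using K[of m] pos[of m] unfolding K'_def by linarith+
 define P where "P = (\<lambda>m g. g \<in> borel_measurable borel \<and> (\<forall>z. g z \<ge> 0) \<and> (\<forall>z. z \<notin> \<Omega> --> g z = 0) \<and> integrable lborel g \<and>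
  (\<integral>\<^sub>+z. ennreal (g z powr p)) \<le> ennreal K' \<and> segment_bound \<Omega> X (u m) g \<and>
  (\<exists>G. weak_gradient \<Omega> (\<lambda>z. mdist X x0 (u m z)) G \<and> (AE z\<in>\<Omega> in lborel. norm (G z) \<le> g z)))"
 have "\<exists>g. P m g" for m
 proof -
  obtain g0 where g0: "g0 \<in> gradient_bounds p \<Omega> X (u m)" "(LINT z|lebesgue_on \<Omega>. \<bar>g0 z\<bar> powr p) < K'"
   using cInf_lessD[OF _ K'(3)[of m, unfolded reshetnyak_energy_def]] u(2)[of m] by auto
  obtain g where g: "g \<in> borel_measurable borel" "\<And>z. g z \<ge> 0" "\<And>z. z \<notin> \<Omega> ==> g z = 0" "integrable lborel g"
   "(\<integral>\<^sub>+z. ennreal (g z powr p)) = ennreal (LINT z|lebesgue_on \<Omega>. \<bar>g0 z\<bar> powr p)" "segment_bound \<Omega> X (u m) g"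
   "\<And>x. x \<in> mspace X ==> \<exists>G. weak_gradient \<Omega> (\<lambda>z. mdist X x (u m z)) G \<and> (AE z\<in>\<Omega> in lborel. norm (G z) \<le> g z)"
   by (rule W1p_maps_segment_bound[OF bd op p(2) u(1) g0(1)]) (rule that)
  then have "P m g" unfolding P_def using g0(2) x0 by (auto intro!: ennreal_leI)
  then show ?thesis by (rule exI[of _ g])
 qed
 then obtain g where "\<And>m. P m (g m)" by metis
 then have g: "g m \<in> borel_measurable borel" "\<And>z. g m z \<ge> 0" "\<And>z. z \<notin> \<Omega> ==> g m z = 0" "integrable lborel (g m)"
   "(\<integral>\<^sub>+z. ennreal (g m z powr p)) \<le> ennreal K'" "segment_bound \<Omega> X (u m) (g m)"
   "\<exists>G. weak_gradient \<Omega> (\<lambda>z. mdist X x0 (u m z)) G \<and> (AE z\<in>\<Omega> in lborel. norm (G z) \<le> g m z)" for m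
  unfolding P_def by blast+
 note g(1)[measurable]
 define A0 where "A0 = measure lborel \<Omega> + 1"
 have e\<Omega>: "emeasure (lebesgue_on \<Omega>) (space (lebesgue_on \<Omega>)) = emeasure lborel \<Omega>" by (simp add: emeasure_restrict_space)
 have A0: "A0 > 0" "emeasure (lebesgue_on \<Omega>) (space (lebesgue_on \<Omega>)) \<le> ennreal A0"
  using fin_\<Omega> unfolding e\<Omega>
  by (auto simp: A0_def emeasure_eq_ennreal_measure less_top intro!: add_nonneg_pos ennreal_leI)
 define A where "A = 2 * A0 powr (1 - 1/p) * K' powr (1/p)"
 have A: "A \<ge> 0" by (simp add: A_def)
 have gA: "(\<integral>\<^sub>+z. ennreal (g m z) * indicator \<Omega> z) \<le> ennreal A" for m
  unfolding A_def nn_integral_lebesgue_on[OF b, symmetric]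
 proof (rule nn_integral_Holder_bound[OF _ g(2) A0(2,1) p(2) _ K'(1)])
  show "g m \<in> borel_measurable (lebesgue_on \<Omega>)" using g(1) by (intro measurable_restrict_space1 measurable_completion) simp
  show "(\<integral>\<^sup>+z. ennreal (g m z powr p) \<partial>lebesgue_on \<Omega>) \<le> ennreal K'"
   unfolding nn_integral_lebesgue_on[OF b]
   by (rule order_trans[OF nn_integral_mono g(5)[of m]]) (simp add: indicator_def)
 qed
 have uA: "(\<integral>\<^sup>+z. ennreal (mdist X x0 (u m z)) \<partial>lebesgue_on \<Omega>) \<le> ennreal A" for m
  unfolding A_def
 proof (rule nn_integral_Holder_bound[OF um mdist_nonneg_of A0(2,1) p(2) _ K'(1)])
  have "integrable (lebesgue_on \<Omega>) (\<lambda>z. mdist X x0 (u m z) powr p)" using uL[of m] by (simp add: Lp_space_def mdist_nonneg_of)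
  then have "(\<integral>\<^sup>+z. ennreal (mdist X x0 (u m z) powr p) \<partial>lebesgue_on \<Omega>) = ennreal (LINT z|lebesgue_on \<Omega>. mdist X x0 (u m z) powr p)"
   by (rule nn_integral_eq_integral) auto
  then show "(\<integral>\<^sup>+z. ennreal (mdist X x0 (u m z) powr p) \<partial>lebesgue_on \<Omega>) \<le> ennreal K'" using K'(2)[of m] by (simp add: ennreal_leI)
 qed
 obtain r0 :: "nat => nat" and G0 :: "nat => (real^'n) set" and B :: real
  where r0: "strict_mono r0" and G0: "\<And>j. G0 j \<in> sets borel" "\<And>j. G0 j \<subseteq> \<Omega>" "\<And>j. emeasure lborel (\<Omega> - G0 j) \<le> ennreal (B * (1/2) ^ j)"
   "\<And>j z w. z \<in> G0 j ==> w \<in> G0 j ==> \<bar>mdist X (u (r0 j) z) (u (r0 j) w) - mdist X (u (r0 (Suc j)) z) (u (r0 (Suc j)) w)\<bar> \<le> 5 * (1/2) ^ j"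
  by (rule subsequence_almost_isometric[OF op bd u(1) g(6) g(1) A gA x0 uA[unfolded nn_integral_lebesgue_on[OF b]]]) (rule that)
 \<comment> \<open>From \<open>J\<close> on the sets \<open>G0 j\<close> have positive measure; the gluing needs them to be nonempty.\<close>
 obtain J where J: "\<And>j. j \<ge> J ==> ennreal (B * (1/2) ^ j) < emeasure lborel \<Omega>"
 proof -
  have "(\<lambda>j. ennreal (B * (1/2) ^ j)) \<longlonglongrightarrow> ennreal (B * 0)" by (intro tendsto_ennrealI tendsto_mult tendsto_const LIMSEQ_power_zero) auto
  moreover have "0 < emeasure lborel \<Omega>" using not_null b by (auto simp: null_sets_def zero_less_iff_neq_zero)
  ultimately have "\<forall>\<^sub>F j in sequentially. ennreal (B * (1/2) ^ j) < emeasure lborel \<Omega>" by (intro order_tendstoD(2)) auto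
  then show thesis using that by (auto simp: eventually_sequentially)
 qed
 define r1 where "r1 = (\<lambda>j. r0 (j + J))"
 define G where "G = (\<lambda>j. G0 (j + J))"
 have Gne: "G j \<noteq> {}" for j using J[of "j + J"] G0(3)[of "j + J"] by (auto simp: G_def)
 have almost: "\<bar>mdist X (u (r1 j) z) (u (r1 j) w) - mdist X (u (r1 (Suc j)) z) (u (r1 (Suc j)) w)\<bar> \<le> 2 * (5/2 * (1/2) ^ j)"
  if "z \<in> G j" "w \<in> G j" for j z w
 proof -
  have "(1/2::real) ^ (j + J) \<le> (1/2) ^ j" by (rule power_decreasing) auto
  moreover have "\<bar>mdist X (u (r1 j) z) (u (r1 j) w) - mdist X (u (r1 (Suc j)) z) (u (r1 (Suc j)) w)\<bar> \<le> 5 * (1/2) ^ (j + J)"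
   using G0(4)[of z "j + J" w] that by (simp add: r1_def G_def)
  ultimately show ?thesis by linarith
 qed
 have aX: "u (r1 j) z \<in> mspace X" "u (r1 (Suc j)) z \<in> mspace X" if "z \<in> G j" for j z using that G0(2) uX by (auto simp: G_def)
 have "\<exists>(Z :: 'x target metric) \<phi>. mcomplete_of Z \<and> (\<forall>j. isometric_embedding X Z (\<phi> j)) \<and>
   (\<forall>j. \<forall>z\<in>G j. mdist Z (\<phi> j (u (r1 j) z)) (\<phi> (Suc j) (u (r1 (Suc j)) z)) \<le> 5/2 * (1/2) ^ j)"
 proof (rule glue_chain_of_copies[where \<epsilon> = "\<lambda>j. 5/2 * (1/2) ^ j" and G = G and a = "\<lambda>j. u (r1 j)" and X = X])
  fix Z :: "'x target metric" and \<phi>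
  assume "mcomplete_of Z" "\<And>j. isometric_embedding X Z (\<phi> j)"
   "\<And>j z. z \<in> G j ==> mdist Z (\<phi> j (u (r1 j) z)) (\<phi> (Suc j) (u (r1 (Suc j)) z)) \<le> 5/2 * (1/2) ^ j"
  then show ?thesis by (intro exI[of _ Z] exI[of _ \<phi>] conjI allI ballI)
 qed (use Gne aX almost in simp_all)
 then obtain Z :: "'x target metric" and \<phi> :: "nat => 'x => 'x target" where Z: "mcomplete_of Z"
  and \<phi>: "\<And>j. isometric_embedding X Z (\<phi> j)"
  and close: "\<And>j z. z \<in> G j ==> mdist Z (\<phi> j (u (r1 j) z)) (\<phi> (Suc j) (u (r1 (Suc j)) z)) \<le> 5/2 * (1/2) ^ j"
  by blast
 have \<phi>Z: "\<phi> j x \<in> mspace Z" if "x \<in> mspace X" for j x using \<phi>[of j] that by (auto simp: isometric_embedding_def)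
 have iso: "mdist Z (\<phi> j x) (\<phi> j y) = mdist X x y" if "x \<in> mspace X" "y \<in> mspace X" for j x y
  using \<phi>[of j] that by (auto simp: isometric_embedding_def)
 define z0 where "z0 = \<phi> 0 x0"
 have z0: "z0 \<in> mspace Z" unfolding z0_def by (rule \<phi>Z[OF x0])
 define f where "f = (\<lambda>j. \<phi> j \<circ> u (r1 j))"
 have fZ: "f j z \<in> mspace Z" if "z \<in> \<Omega>" for j z using \<phi>Z[OF uX[OF that]] by (simp add: f_def)
 obtain v where vZ: "\<And>z. v z \<in> mspace Z" and lim: "AE z\<in>\<Omega> in lborel. (\<lambda>j. mdist Z (f j z) (v z)) \<longlonglongrightarrow> 0"
 proof (rule AE_limit_exists[OF Z z0 fZ _ b, where G = G and B = "B * (1/2) ^ J" and c = "5/2"])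
  show "G j \<in> sets borel" for j by (simp add: G_def G0)
  show "emeasure lborel (\<Omega> - G j) \<le> ennreal (B * (1/2) ^ J * (1/2) ^ j)" for j
   using G0(3)[of "j + J"] by (simp add: G_def power_add mult_ac)
  show "mdist Z (f j z) (f (Suc j) z) \<le> 5/2 * (1/2) ^ j" if "z \<in> G j" for j z using close[OF that] by (simp add: f_def)
 qed (use that in auto)
 \<comment> \<open>The base points \<open>\<phi> j x0\<close> could escape to infinity in \<open>Z\<close>. They stay bounded along a subsequence: at a point where \<open>f j\<close> converges and \<open>u (r1 j)\<close> is infinitely often within a fixed distance of \<open>x0\<close>, the limit \<open>v\<close> is at bounded distance from \<open>\<phi> j x0\<close>.\<close>
 obtain s :: "nat => nat" and c where s: "strict_mono s" "\<And>j. mdist Z z0 (\<phi> (s j) x0) \<le> c"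
 proof -
  have "AE z in lebesgue_on \<Omega>. \<exists>H. infinite {j. mdist X x0 (u (r1 j) z) < H}"
   by (rule infinitely_often_bounded_point[OF um uA])
  then have "AE z\<in>\<Omega> in lborel. (\<exists>H. infinite {j. mdist X x0 (u (r1 j) z) < H})" by (simp add: AE_lebesgue_on_iff[OF b])
  with lim have ae: "AE z\<in>\<Omega> in lborel. (\<lambda>j. mdist Z (f j z) (v z)) \<longlonglongrightarrow> 0 \<and> (\<exists>H. infinite {j. mdist X x0 (u (r1 j) z) < H})"
   by eventually_elim blast
  have "\<not> (AE z in lborel. z \<notin> \<Omega>)" using not_null b by (simp add: AE_iff_null_sets[symmetric])
  moreover have "AE z in lborel. z \<notin> \<Omega>"
   if no: "\<not> (\<exists>z\<in>\<Omega>. (\<lambda>j. mdist Z (f j z) (v z)) \<longlonglongrightarrow> 0 \<and> (\<exists>H. infinite {j. mdist X x0 (u (r1 j) z) < H}))"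
   using ae by eventually_elim (use no in blast)
  ultimately obtain z1 where z1: "z1 \<in> \<Omega>" "(\<lambda>j. mdist Z (f j z1) (v z1)) \<longlonglongrightarrow> 0" "\<exists>H. infinite {j. mdist X x0 (u (r1 j) z1) < H}"
   by blast
  obtain H where H: "infinite {j. mdist X x0 (u (r1 j) z1) < H}" using z1(3) by blast
  obtain D where D: "\<And>j. \<bar>mdist Z (f j z1) (v z1)\<bar> \<le> D"
   using convergent_imp_Bseq[OF convergentI[OF z1(2)]] by (auto simp: Bseq_def)
  show thesis
  proof (rule that[of "enumerate {j. mdist X x0 (u (r1 j) z1) < H}" "mdist Z z0 (v z1) + D + H"])
   show "strict_mono (enumerate {j. mdist X x0 (u (r1 j) z1) < H})" by (rule strict_mono_enumerate[OF H])
   fix i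
   define j where "j = enumerate {j. mdist X x0 (u (r1 j) z1) < H} i"
   have "mdist X x0 (u (r1 j) z1) < H" using enumerate_in_set[OF H, of i] by (simp add: j_def)
   then have "mdist Z (f j z1) (\<phi> j x0) < H" using iso[OF x0 uX[OF z1(1)], of j "r1 j"] by (simp add: f_def mdist_commute_of)
   moreover have "mdist Z (v z1) (f j z1) \<le> D" using D[of j] by (simp add: mdist_commute_of)
   ultimately show "mdist Z z0 (\<phi> j x0) \<le> mdist Z z0 (v z1) + D + H"
    using mdist_triangle_of[OF z0 vZ[of z1] \<phi>Z[OF x0, of j]] mdist_triangle_of[OF vZ[of z1] fZ[OF z1(1), of j] \<phi>Z[OF x0, of j]] by linarith
  qed
 qed
 define r where "r = (\<lambda>j. r1 (s j))"
 define F where "F = (\<lambda>j. \<phi> (s j) \<circ> u (r j))"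
 have F_f: "F j = f (s j)" for j by (simp add: F_def f_def r_def)
 have r: "strict_mono r" using r0 s(1) by (auto simp: r_def r1_def strict_mono_def)
 have FZ: "F j z \<in> mspace Z" if "z \<in> \<Omega>" for j z using fZ[OF that] by (simp add: F_f)
 have Flim: "AE z\<in>\<Omega> in lborel. (\<lambda>j. mdist Z (F j z) (v z)) \<longlonglongrightarrow> 0"
  using lim by eventually_elim (use LIMSEQ_subseq_LIMSEQ[OF _ s(1)] in \<open>auto simp: F_f o_def\<close>)
 have higher: "\<exists>C\<ge>0. (\<forall>j. F j \<in> Lp_maps q \<Omega> Z) \<and> (\<forall>j. (\<integral>\<^sub>+z. ennreal (mdist Z z0 (F j z) powr q) * indicator \<Omega> z) \<le> ennreal C)"
  if q: "q \<ge> p" "ereal q < sobolev_conjugate CARD('n) p" for q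
 proof -
  have K'abs: "(LINT z|lebesgue_on \<Omega>. \<bar>mdist X x0 (u m z)\<bar> powr p) \<le> K'" for m using K'(2)[of m] by (simp add: mdist_nonneg_of)
  obtain C where C: "C \<ge> 0" "\<And>m. (\<integral>\<^sub>+z. ennreal (mdist X x0 (u m z) powr q) * indicator \<Omega> z) \<le> ennreal C"
   by (rule Sobolev_uniform_bound[OF assms(2) dom p(2) q uL mdist_nonneg_of K'abs g(4,2,5,7)]) (rule that)
  define C' where "C' = 2 powr q * (c powr q * A0 + C)"
  have bound: "(\<integral>\<^sub>+z. ennreal (mdist Z z0 (F j z) powr q) * indicator \<Omega> z) \<le> ennreal C'" for j
  proof -
   have m: "(\<lambda>z. mdist Z (\<phi> (s j) x0) (F j z)) \<in> borel_measurable (lebesgue_on \<Omega>)"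
    by (rule measurable_cong[THEN iffD2, OF _ um[of "r j"]]) (simp add: F_def iso x0 uX)
   have eq: "(\<integral>\<^sub>+z. ennreal (mdist Z (\<phi> (s j) x0) (F j z) powr q) * indicator \<Omega> z) = (\<integral>\<^sub>+z. ennreal (mdist X x0 (u (r j) z) powr q) * indicator \<Omega> z)"
    by (intro nn_integral_cong) (auto simp: F_def iso x0 uX indicator_def)
   have "(\<integral>\<^sub>+z. ennreal (mdist Z z0 (F j z) powr q) * indicator \<Omega> z) \<le>
    ennreal (2 powr q) * (ennreal (c powr q) * emeasure lborel \<Omega> + (\<integral>\<^sub>+z. ennreal (mdist Z (\<phi> (s j) x0) (F j z) powr q) * indicator \<Omega> z))"
    using q p by (intro nn_integral_mdist_powr_le[OF b m \<phi>Z[OF x0] z0 FZ s(2)]) auto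
   also have "\<dots> \<le> ennreal (2 powr q) * (ennreal (c powr q) * ennreal A0 + ennreal C)"
    unfolding eq using C(2)[of "r j"] A0(2)[unfolded e\<Omega>] by (intro mult_left_mono add_mono) auto
   also have "\<dots> = ennreal C'" using A0 C(1) by (simp add: C'_def ennreal_mult ennreal_plus)
   finally show ?thesis .
  qed
  moreover have "F j \<in> Lp_maps q \<Omega> Z" for j
   unfolding F_def
   by (rule isometric_embedding_compose_Lp_maps[OF \<phi> u(1) b z0]) (use le_less_trans[OF bound[of j] ennreal_less_top] in \<open>simp add: F_def\<close>)
  moreover have "C' \<ge> 0" using A0 C(1) by (simp add: C'_def)
  ultimately show ?thesis by blast
 qed
 have pn: "ereal p < sobolev_conjugate CARD('n) p" using p assms(1) by (intro exponent_below_Sobolev_conjugate) auto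
 have vp: "v \<in> Lp_maps p \<Omega> Z"
 proof -
  obtain C where C: "\<And>j. F j \<in> Lp_maps p \<Omega> Z" "\<And>j. (\<integral>\<^sub>+z. ennreal (mdist Z z0 (F j z) powr p) * indicator \<Omega> z) \<le> ennreal C"
   using higher[OF order_refl pn] by blast
  show ?thesis by (rule AE_limit_in_Lp_maps(2)[OF C(1) b vZ Flim z0 _ C(2)]) (use p in simp)
 qed
 have sbF: "segment_bound \<Omega> Z (F j) (g (r j))" for j
  unfolding segment_bound_def
 proof
  fix \<xi>
  show "AE z in lborel. closed_segment z (z + \<xi>) \<subseteq> \<Omega> --> ennreal (mdist Z (F j z) (F j (z + \<xi>)))
    \<le> ennreal (norm \<xi>) * segment_integral (g (r j)) z \<xi>"
   using g(6)[of "r j", unfolded segment_bound_def, rule_format, of \<xi>]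
  proof (eventually_elim, intro impI)
   fix z assume a: "closed_segment z (z + \<xi>) \<subseteq> \<Omega> --> ennreal (mdist X (u (r j) z) (u (r j) (z + \<xi>)))
    \<le> ennreal (norm \<xi>) * segment_integral (g (r j)) z \<xi>" "closed_segment z (z + \<xi>) \<subseteq> \<Omega>"
   then have "z \<in> \<Omega>" "z + \<xi> \<in> \<Omega>" by auto
   with a show "ennreal (mdist Z (F j z) (F j (z + \<xi>))) \<le> ennreal (norm \<xi>) * segment_integral (g (r j)) z \<xi>"
    by (simp add: F_def iso uX)
  qed
 qed
 obtain h where "h \<in> borel_measurable borel" "\<And>z. h z \<ge> 0" "\<And>z. z \<notin> \<Omega> ==> h z = 0"
  "(\<integral>\<^sub>+z. ennreal (h z powr p)) < \<infinity>" "segment_bound \<Omega> Z v h"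
  by (rule segment_bound_limit[OF op bd p(1) FZ vZ Flim sbF g(1) g(2) g(3) K'(1) g(5)]) (assumption, assumption, rule that)
 then have vW: "v \<in> W1p_maps p \<Omega> Z" by (rule segment_bound_imp_W1p_maps[OF op bd p(2) vp])
 have conv: "converges_in_Lq q \<Omega> Z F v" if q: "1 \<le> q" "ereal q < sobolev_conjugate CARD('n) p" for q
 proof -
  have "ereal (max p q) < sobolev_conjugate CARD('n) p" using q pn by (simp add: max_def)
  \<comment> \<open>Room above \<open>q\<close> for the higher power, and at least \<open>p\<close> because the Sobolev inequality is stated for such exponents.\<close>
  then obtain q' where q': "ereal (max p q) < ereal q'" "ereal q' < sobolev_conjugate CARD('n) p" using ereal_dense2 by blast
  then have q'': "q' \<ge> p" "q' > q" "q' > 0" "q \<ge> 0" using p q by auto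
  obtain C where C: "C \<ge> 0" "\<And>j. F j \<in> Lp_maps q' \<Omega> Z" "\<And>j. (\<integral>\<^sub>+z. ennreal (mdist Z z0 (F j z) powr q') * indicator \<Omega> z) \<le> ennreal C"
   using higher[OF q''(1) q'(2)] by blast
  note v = AE_limit_in_Lp_maps[OF C(2) b vZ Flim z0 q''(3) C(3)]
  have "(\<lambda>j. \<integral>\<^sup>+z. ennreal (mdist Z (F j z) (v z) powr q) \<partial>lebesgue_on \<Omega>) \<longlonglongrightarrow> 0"
   using q by (intro AE_limit_Lq_tendsto[OF C(2) bd b v(2) Flim z0 _ q''(2) C(1,3) v(1)]) simp
  moreover have "F j \<in> Lp_maps q \<Omega> Z" for j using q'' by (intro Lp_maps_mono[OF C(2) bd b]) auto
  moreover have "v \<in> Lp_maps q \<Omega> Z" using q'' by (intro Lp_maps_mono[OF v(2) bd b]) auto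
  ultimately show ?thesis unfolding converges_in_Lq_def by blast
 qed
 show ?thesis
  using r Z \<phi> vW conv unfolding F_def by (intro exI[of _ r] exI[of _ Z] exI[of _ "\<lambda>m. \<phi> (s m)"] exI[of _ v]) blast
qed

end
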